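(* Let $G=(V,E)$ be a locally finite $2$-connected graph, and let $F,D\subseteq E$. (i) If every end of $G$ has vertex-degree at least $3$ and $F$ is orthogonal to all the minimal nonzero elements of the topological cycle space $\mathcal{C}_{\mathrm{top}}(G)$, namely the topological circuits of $G$, then $F\in\mathcal{C}_{\mathrm{top}}(G)^\perp$. (ii) If every end of $G$ has vertex-degree at least $3$ and $F$ is orthogonal to all the minimal nonzero elements of the algebraic cycle space $\mathcal{C}_{\mathrm{alg}}(G)$, namely the finite circuits and the edge sets of double rays in $G$, then $F\in\mathcal{C}_{\mathrm{alg}}(G)^\perp$. (iii) If $G$ is $3$-padded at infinity and $D$ is orthogonal to all the minimal nonzero elements of the cut space $\mathcal{B}(G)$, namely the bonds of $G$, then $D\in\mathcal{B}(G)^\perp$.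
   Context: The edge space $\mathcal{E}(G)$ is the $\mathbb{F}_2$-vector space of all (possibly infinite) subsets of $E$, with symmetric difference as addition. Two sets of edges are orthogonal if their intersection is finite and of even cardinality; for a subspace $\mathcal{F}$, $\mathcal{F}^\perp$ is the set of edge sets orthogonal to every element of $\mathcal{F}$. $|G|$ denotes the Freudenthal compactification of $G$. A circuit (topological circuit) is the edge set of a circle, i.e. a subspace of $|G|$ homeomorphic to $S^1$; finite circuits are edge sets of finite cycles. $\mathcal{C}_{\mathrm{top}}(G)$ is the set of all sums of thin families of circuits (families in which every edge lies in only finitely many members). $\mathcal{C}_{\mathrm{alg}}(G)$ is the set of edge sets inducing even degree at every vertex. A cut is the set of edges between the two classes of a partition of $V$; $\mathcal{B}(G)$ is the set of all cuts; a bond is a minimal nonempty cut. The vertex-degree of an end $\omega$ is the maximum number of vertex-disjoint rays in $\omega$. For a finite $S\subseteq V$, $C(S,\omega)$ is the unique component of $G-S$ containing a ray of $\omega$; a neighbourhood of $\omega$ (as a set of vertices) is a vertex set containing all vertices of $C(S,\omega)$ for some finite $S\subseteq V$. A $k$-fan from a vertex $u$ to a vertex set (or ray) $Y$ is a subdivided $k$-star with centre $u$ and all $k$ leaves in $Y$. An end $\omega$ is $k$-padded if for every ray $R\in\omega$ there is a neighbourhood $U$ of $\omega$ such that for every vertex $u\in U$ there is a $k$-fan from $u$ to $R$ in $G$. $G$ is $k$-padded at infinity if every end of $G$ is $k$-padded. *)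

theory Defs
  imports "HOL-Analysis.Analysis" "HOL-Library.Extended_Nat"
begin

section \<open>Graphs\<close>

text \<open>A graph is given by its vertex set \<open>V\<close> and its edge set \<open>E\<close>, the edges being
  two-element subsets of \<open>V\<close>.\<close>

definition simple_graph :: "'v set \<Rightarrow> 'v set set \<Rightarrow> bool" where
  "simple_graph V E \<longleftrightarrow> (\<forall>e\<in>E. e \<subseteq> V \<and> card e = 2)"

definition locally_finite_graph :: "'v set \<Rightarrow> 'v set set \<Rightarrow> bool" where
  "locally_finite_graph V E \<longleftrightarrow> (\<forall>v\<in>V. finite {e\<in>E. v \<in> e})"

definition adj_in :: "'v set set \<Rightarrow> 'v set \<Rightarrow> ('v \<times> 'v) set" where
  "adj_in E X = {(x, y). x \<in> X \<and> y \<in> X \<and> {x, y} \<in> E}"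

text \<open>Connectedness and components (as vertex sets) of the subgraph induced on \<open>X\<close>.\<close>

definition graph_connected :: "'v set set \<Rightarrow> 'v set \<Rightarrow> bool" where
  "graph_connected E X \<longleftrightarrow> X \<noteq> {} \<and> (\<forall>x\<in>X. \<forall>y\<in>X. (x, y) \<in> (adj_in E X)\<^sup>*)"

definition graph_components :: "'v set set \<Rightarrow> 'v set \<Rightarrow> 'v set set" where
  "graph_components E X = {(adj_in E X)\<^sup>* `` {x} | x. x \<in> X}"

definition k_connected :: "nat \<Rightarrow> 'v set \<Rightarrow> 'v set set \<Rightarrow> bool" where
  "k_connected k V E \<longleftrightarrow>
     (infinite V \<or> card V > k) \<and>
     (\<forall>S. S \<subseteq> V \<and> finite S \<and> card S < k \<longrightarrow> graph_connected E (V - S))"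

definition graph_path :: "'v set \<Rightarrow> 'v set set \<Rightarrow> 'v list \<Rightarrow> bool" where
  "graph_path V E p \<longleftrightarrow>
     p \<noteq> [] \<and> distinct p \<and> set p \<subseteq> V \<and> (\<forall>i. Suc i < length p \<longrightarrow> {p ! i, p ! Suc i} \<in> E)"

definition cycle_edges :: "'v list \<Rightarrow> 'v set set" where
  "cycle_edges p = {{p ! i, p ! (Suc i mod length p)} | i. i < length p}"

definition finite_circuits :: "'v set set \<Rightarrow> 'v set set set" where
  "finite_circuits E = {cycle_edges p | p. distinct p \<and> length p \<ge> 3 \<and> cycle_edges p \<subseteq> E}"

definition double_ray_edges :: "(int \<Rightarrow> 'v) \<Rightarrow> 'v set set" where
  "double_ray_edges d = {{d i, d (i + 1)} | i. True}"

definition double_ray_edge_sets :: "'v set set \<Rightarrow> 'v set set set" where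
  "double_ray_edge_sets E = {double_ray_edges d | d. inj d \<and> double_ray_edges d \<subseteq> E}"


section \<open>Rays and ends\<close>

text \<open>A ray is identified with the sequence of its vertices, an end with the set of its rays.\<close>

definition ray :: "'v set set \<Rightarrow> (nat \<Rightarrow> 'v) \<Rightarrow> bool" where
  "ray E R \<longleftrightarrow> inj R \<and> (\<forall>i. {R i, R (Suc i)} \<in> E)"

definition ray_equiv :: "'v set \<Rightarrow> 'v set set \<Rightarrow> ((nat \<Rightarrow> 'v) \<times> (nat \<Rightarrow> 'v)) set" where
  "ray_equiv V E = {(R, R'). ray E R \<and> ray E R' \<and>
     (\<forall>S. S \<subseteq> V \<and> finite S \<longrightarrow>
        (\<exists>C\<in>graph_components E (V - S). \<exists>n. R ` {n..} \<subseteq> C \<and> R' ` {n..} \<subseteq> C))}"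

definition ends :: "'v set \<Rightarrow> 'v set set \<Rightarrow> (nat \<Rightarrow> 'v) set set" where
  "ends V E = {R. ray E R} // ray_equiv V E"

definition end_vertex_degree :: "(nat \<Rightarrow> 'v) set \<Rightarrow> enat" where
  "end_vertex_degree \<omega> =
     (SUP \<R> \<in> {\<R>. \<R> \<subseteq> \<omega> \<and> finite \<R> \<and> pairwise (\<lambda>R R'. range R \<inter> range R' = {}) \<R>}.
        enat (card \<R>))"

definition end_comp :: "'v set \<Rightarrow> 'v set set \<Rightarrow> 'v set \<Rightarrow> (nat \<Rightarrow> 'v) set \<Rightarrow> 'v set" where
  "end_comp V E S \<omega> = (THE C. C \<in> graph_components E (V - S) \<and> (\<exists>R\<in>\<omega>. range R \<subseteq> C))"

definition end_nbhd :: "'v set \<Rightarrow> 'v set set \<Rightarrow> (nat \<Rightarrow> 'v) set \<Rightarrow> 'v set \<Rightarrow> bool" where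
  "end_nbhd V E \<omega> U \<longleftrightarrow> U \<subseteq> V \<and> (\<exists>S. S \<subseteq> V \<and> finite S \<and> end_comp V E S \<omega> \<subseteq> U)"

text \<open>A subdivided \<open>k\<close>-star with centre \<open>u\<close> is given by its \<open>k\<close> non-trivial
  paths from \<open>u\<close> to the leaves. Only the leaves have to lie in \<open>Y\<close>; the paths may
  also meet \<open>Y\<close> elsewhere, and \<open>u\<close> itself may lie in \<open>Y\<close>.\<close>

definition k_fan :: "'v set \<Rightarrow> 'v set set \<Rightarrow> nat \<Rightarrow> 'v \<Rightarrow> 'v set \<Rightarrow> 'v list set \<Rightarrow> bool" where
  "k_fan V E k u Y \<P> \<longleftrightarrow>
     finite \<P> \<and> card \<P> = k \<and>
     (\<forall>p\<in>\<P>. graph_path V E p \<and> length p \<ge> 2 \<and> hd p = u \<and> last p \<in> Y) \<and>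
     pairwise (\<lambda>p q. set p \<inter> set q = {u}) \<P>"

definition k_padded_end :: "'v set \<Rightarrow> 'v set set \<Rightarrow> nat \<Rightarrow> (nat \<Rightarrow> 'v) set \<Rightarrow> bool" where
  "k_padded_end V E k \<omega> \<longleftrightarrow>
     (\<forall>R\<in>\<omega>. \<exists>U. end_nbhd V E \<omega> U \<and> (\<forall>u\<in>U. \<exists>\<P>. k_fan V E k u (range R) \<P>))"

definition k_padded_at_infinity :: "'v set \<Rightarrow> 'v set set \<Rightarrow> nat \<Rightarrow> bool" where
  "k_padded_at_infinity V E k \<longleftrightarrow> (\<forall>\<omega>\<in>ends V E. k_padded_end V E k \<omega>)"


section \<open>The Freudenthal compactification\<close>

text \<open>Points of the 1-complex of the graph are given by their barycentric coordinates:
  \<open>on_edge x y t\<close> is the point of the edge \<open>{x, y}\<close> at distance \<open>t\<close> from \<open>x\<close>, and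
  \<open>on_edge x y t = on_edge y x (1 - t)\<close>.\<close>

datatype 'v fpoint = Complex_Pt "'v \<Rightarrow> real" | End_Pt "(nat \<Rightarrow> 'v) set"

definition vertex_pt :: "'v \<Rightarrow> 'v fpoint" where
  "vertex_pt x = Complex_Pt (\<lambda>v. if v = x then 1 else 0)"

definition on_edge :: "'v \<Rightarrow> 'v \<Rightarrow> real \<Rightarrow> 'v fpoint" where
  "on_edge x y t = Complex_Pt (\<lambda>v. if v = x then 1 - t else if v = y then t else 0)"

definition closed_edge :: "'v set \<Rightarrow> 'v fpoint set" where
  "closed_edge e = {on_edge x y t | x y t. e = {x, y} \<and> x \<noteq> y \<and> 0 \<le> t \<and> t \<le> 1}"

definition open_edge_interval :: "'v \<Rightarrow> 'v \<Rightarrow> real \<Rightarrow> real \<Rightarrow> 'v fpoint set" where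
  "open_edge_interval x y a b = {on_edge x y t | t. a < t \<and> t < b}"

text \<open>Union of half-open intervals at \<open>x\<close>, one on every edge at \<open>x\<close>.\<close>

definition vertex_star :: "'v set set \<Rightarrow> 'v \<Rightarrow> ('v \<Rightarrow> real) \<Rightarrow> 'v fpoint set" where
  "vertex_star E x \<delta> =
     insert (vertex_pt x) {on_edge x y t | y t. {x, y} \<in> E \<and> 0 \<le> t \<and> t < \<delta> y}"

text \<open>The component \<open>C(S,\<omega>)\<close> with its edges, together with the ends \<open>\<omega>'\<close> such that
  \<open>C(S,\<omega>') = C(S,\<omega>)\<close> and the inner points of edges between \<open>S\<close> and \<open>C(S,\<omega>)\<close> at distance
  less than \<open>\<epsilon>\<close> from their endvertex in \<open>C(S,\<omega>)\<close>.\<close>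

definition end_hat :: "'v set \<Rightarrow> 'v set set \<Rightarrow> 'v set \<Rightarrow> (nat \<Rightarrow> 'v) set \<Rightarrow> real \<Rightarrow> 'v fpoint set" where
  "end_hat V E S \<omega> \<epsilon> = (let C = end_comp V E S \<omega> in
     vertex_pt ` C
     \<union> {on_edge x y t | x y t. {x, y} \<in> E \<and> x \<in> C \<and> y \<in> C \<and> 0 < t \<and> t < 1}
     \<union> {on_edge x y t | x y t. {x, y} \<in> E \<and> x \<in> C \<and> y \<in> S \<and> 0 < t \<and> t < \<epsilon>}
     \<union> End_Pt ` {\<omega>' \<in> ends V E. end_comp V E S \<omega>' = C})"

definition freudenthal :: "'v set \<Rightarrow> 'v set set \<Rightarrow> 'v fpoint topology" where
  "freudenthal V E = topology_generated_by
     ({open_edge_interval x y a b | x y a b. {x, y} \<in> E \<and> 0 \<le> a \<and> a < b \<and> b \<le> 1}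
      \<union> {vertex_star E x \<delta> | x \<delta>. x \<in> V \<and> (\<forall>y. 0 < \<delta> y \<and> \<delta> y \<le> 1)}
      \<union> {end_hat V E S \<omega> \<epsilon> | S \<omega> \<epsilon>. S \<subseteq> V \<and> finite S \<and> \<omega> \<in> ends V E \<and> 0 < \<epsilon> \<and> \<epsilon> \<le> 1})"

definition is_circle :: "'v set \<Rightarrow> 'v set set \<Rightarrow> 'v fpoint set \<Rightarrow> bool" where
  "is_circle V E X \<longleftrightarrow>
     X \<subseteq> topspace (freudenthal V E) \<and>
     subtopology (freudenthal V E) X homeomorphic_space top_of_set (sphere (0::complex) 1)"

definition topological_circuits :: "'v set \<Rightarrow> 'v set set \<Rightarrow> 'v set set set" where
  "topological_circuits V E = {{e\<in>E. closed_edge e \<subseteq> X} | X. is_circle V E X}"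


section \<open>Subspaces of the edge space\<close>

definition edge_orthogonal :: "'v set set \<Rightarrow> 'v set set \<Rightarrow> bool" where
  "edge_orthogonal A B \<longleftrightarrow> finite (A \<inter> B) \<and> even (card (A \<inter> B))"

definition edge_perp :: "'v set set \<Rightarrow> 'v set set set \<Rightarrow> 'v set set set" where
  "edge_perp E \<F> = {A. A \<subseteq> E \<and> (\<forall>B\<in>\<F>. edge_orthogonal A B)}"

definition minimal_nonzero :: "'v set set set \<Rightarrow> 'v set set set" where
  "minimal_nonzero \<F> = {A\<in>\<F>. A \<noteq> {} \<and> (\<forall>B\<in>\<F>. B \<noteq> {} \<and> B \<subseteq> A \<longrightarrow> B = A)}"

definition thin_family :: "'v set set \<Rightarrow> 'i set \<Rightarrow> ('i \<Rightarrow> 'v set set) \<Rightarrow> bool" where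
  "thin_family E I A \<longleftrightarrow> (\<forall>e\<in>E. finite {i\<in>I. e \<in> A i})"

definition thin_sum :: "'v set set \<Rightarrow> 'i set \<Rightarrow> ('i \<Rightarrow> 'v set set) \<Rightarrow> 'v set set" where
  "thin_sum E I A = {e\<in>E. odd (card {i\<in>I. e \<in> A i})}"

text \<open>Families may have repeated members. Every member of a family of circuits is non-empty,
  and in a thin family each edge lies in only finitely many members, so the index set of any
  thin family of circuits embeds into \<open>E \<times> nat\<close>; hence it is no restriction to take the
  indices from this type.\<close>

definition top_cycle_space :: "'v set \<Rightarrow> 'v set set \<Rightarrow> 'v set set set" where
  "top_cycle_space V E = {thin_sum E I A | (I :: ('v set \<times> nat) set) A.
     (\<forall>i\<in>I. A i \<in> topological_circuits V E) \<and> thin_family E I A}"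

definition alg_cycle_space :: "'v set \<Rightarrow> 'v set set \<Rightarrow> 'v set set set" where
  "alg_cycle_space V E = {A. A \<subseteq> E \<and> (\<forall>v\<in>V. finite {e\<in>A. v \<in> e} \<and> even (card {e\<in>A. v \<in> e}))}"

text \<open>A class of the bipartition may be empty, so that the empty set, the zero of the cut space,
  is a cut.\<close>

definition cut_space :: "'v set \<Rightarrow> 'v set set \<Rightarrow> 'v set set set" where
  "cut_space V E = {{e\<in>E. \<exists>x\<in>X. \<exists>y\<in>V - X. e = {x, y}} | X. X \<subseteq> V}"

definition bonds :: "'v set \<Rightarrow> 'v set set \<Rightarrow> 'v set set set" where
  "bonds V E = {B\<in>cut_space V E. B \<noteq> {} \<and> \<not> (\<exists>B'\<in>cut_space V E. B' \<noteq> {} \<and> B' \<subset> B)}"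

end

theory Submission
  imports Defs
begin

text \<open>
  A finite edge set that is orthogonal to the minimal elements of one of the three spaces is
  orthogonal to the whole space by a parity count, so the point is to show that \<open>F\<close> and \<open>D\<close> are
  finite.

  If \<open>F\<close> is infinite and all ends have degree at least three, then Menger's theorem yields, far out
  in some end, disjoint paths that let two disjoint rays zigzag through infinitely many edges of
  \<open>F\<close>; joined together they form a double ray with both tails in the same end, which is at once
  a minimal element of the algebraic cycle space and a topological circuit.

  If \<open>D\<close> is infinite, then 3-paddedness allows one to grow two disjoint connected sets step by step,
  each step adding an edge of \<open>D\<close> between them; a bond separating them meets \<open>D\<close> infinitely often.

  Topological circuits are treated through finite cuts: they are exactly the minimal non-empty edge
  sets that meet every finite cut evenly. Given such a set \<open>C\<close> and one of its edges \<open>e\<close>, every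
  other edge \<open>f\<close> lies together with \<open>e\<close> in a finite cut that meets \<open>C\<close> in \<open>{e, f}\<close> only. These
  cuts are nested along \<open>C\<close>, and a weighted sum of their characteristic functions is a homeomorphism
  of the closure of \<open>C\<close> without \<open>e\<close> onto an interval. Conversely, deleting two inner
  edge points of a circle disconnects it, which gives the two-edge cuts for a circle.
\<close>

text \<open>The number three has two sources. A path through an edge of \<open>F\<close> supplied by
  Menger's theorem ends on two of three disjoint rays, possibly twice on the same one. Some pair
  occurs arbitrarily far out, so the zigzag occupies at most two rays, and the remaining one becomes
  the other half of the double ray in the same end. For bonds, three disjoint paths lead from a
  \<open>D\<close>-connected set to a ray \<open>T\<close>. The first and the last visit of the
  other ray \<open>P\<close> to these paths lie on at most two of them, so one path is left for
  reaching \<open>T\<close>.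

  Two-connectedness and paddedness speak about the whole graph, whereas every step must avoid the
  finite set built so far. The obstacle is to keep the bounds on separators after deleting such a
  set. This works close enough to an end, by looking at the common part of infinitely many small
  separators; the same device takes Menger's theorem from finite to infinite graphs.

  The topology enters through one continuous function per finite cut, so that circles can be treated
  by parity and nesting of cuts.\<close>

section \<open>Connectivity and components inside a vertex set\<close>

definition conn :: "'v set set => 'v set => 'v => 'v => bool" where
 "conn E X x y \<longleftrightarrow> x \<in> X & (x, y) \<in> (adj_in E X)\<^sup>*"

lemma conn_refl: "x \<in> X ==> conn E X x x"
 by (simp add: conn_def)

lemma conn_left: "conn E X x y ==> x \<in> X"
 by (simp add: conn_def)

lemma conn_right: "conn E X x y ==> y \<in> X"
 unfolding conn_def by (metis (no_types, lifting) adj_in_def case_prodD mem_Collect_eq rtrancl.cases)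

lemma conn_edge: "{x, y} \<in> E ==> x \<in> X ==> y \<in> X ==> conn E X x y"
 by (auto simp: conn_def adj_in_def)

lemma conn_trans: "conn E X x y ==> conn E X y z ==> conn E X x z"
 unfolding conn_def by (meson rtrancl_trans)

lemma conn_step: "conn E X x y ==> {y, z} \<in> E ==> z \<in> X ==> conn E X x z"
 by (meson conn_edge conn_right conn_trans)

lemma conn_induct [consumes 1, case_names refl step]:
 assumes "conn E X x y" "x \<in> X ==> P x"
  and "!!y z. conn E X x y ==> {y, z} \<in> E ==> y \<in> X ==> z \<in> X ==> P y ==> P z"
 shows "P y"
proof -
 have x: "x \<in> X" and r: "(x, y) \<in> (adj_in E X)\<^sup>*" using assms(1) by (auto simp: conn_def)
 show ?thesis using r
 proof (induction rule: rtrancl_induct)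
  case base then show ?case using assms(2) x by simp
 next
  case (step y z)
  then show ?case using assms(3)[of y z] x by (auto simp: conn_def adj_in_def)
 qed
qed

lemma conn_mono: "conn E X x y ==> E \<subseteq> E' ==> X \<subseteq> X' ==> conn E' X' x y"
 by (induction rule: conn_induct) (auto intro: conn_refl conn_step)

lemma conn_sym: "conn E X x y ==> conn E X y x"
proof (induction rule: conn_induct)
 case (step y z)
 then show ?case by (metis conn_edge conn_trans insert_commute)
qed (rule conn_refl)

text \<open>Cut the walk at its first vertex in \<open>S\<close>: unless that vertex is
  \<open>a\<close>, its predecessor \<open>t\<close> is reached without meeting \<open>S\<close>.
  Neighbours of separators are found in this way below.\<close>

lemma conn_hit:
 assumes "conn E X a b"
 shows "conn E (X - S) a b \<or> (\<exists>s\<in>S. conn E X a s & (a = s \<or> (\<exists>t. conn E (X - S) a t & {t, s} \<in> E)))"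
 using assms
proof (induction rule: conn_induct)
 case refl then show ?case by (auto intro: conn_refl)
next
 case (step y z)
 then show ?case by (cases "z \<in> S") (auto intro: conn_step)
qed

text \<open>Only the parts before the first and after the last use of the new edge matter, whatever
  the walk does in between. This drives the induction over edges in
  \<open>menger_finite\<close>.\<close>

lemma conn_insert_edge:
 assumes "conn (insert {x, y} H) X a b"
 shows "conn H X a b \<or> (conn H X a x & conn H X y b) \<or> (conn H X a y & conn H X x b)"
 using assms
proof (induction rule: conn_induct)
 case refl then show ?case by (auto intro: conn_refl)
next
 case (step b c)
 show ?case
 proof (cases "{b, c} \<in> H")
  case True with step show ?thesis by (meson conn_step)
 next
  case False
  then have "(b = x & c = y) \<or> (b = y & c = x)" using step(2) by (auto simp: doubleton_eq_iff)
  then show ?thesis using step conn_refl by metis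
 qed
qed

lemma conn_restrict_edges:
 assumes "conn {e\<in>E. e \<subseteq> W} X a b" "a \<in> W"
 shows "conn E (W Int X) a b"
 using assms(1) by (induction rule: conn_induct) (auto intro: conn_refl conn_step simp: assms(2))

lemma conn_restrict_edges': "conn E (W Int X) a b ==> conn {e\<in>E. e \<subseteq> W} X a b"
 by (induction rule: conn_induct) (auto intro: conn_refl conn_step)

lemma graph_connected_iff: "graph_connected E X \<longleftrightarrow> X ~= {} & (\<forall>x\<in>X. \<forall>y\<in>X. conn E X x y)"
 by (auto simp: graph_connected_def conn_def)

lemma graph_connectedI:
 assumes "x \<in> X" "!!y. y \<in> X ==> conn E X x y"
 shows "graph_connected E X"
 unfolding graph_connected_iff using assms by (meson conn_sym conn_trans empty_iff)

lemma graph_connectedD: "graph_connected E X ==> x \<in> X ==> y \<in> X ==> X \<subseteq> Y ==> conn E Y x y"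
 by (meson conn_mono graph_connected_iff order_refl)

lemma graph_connected_ne: "graph_connected E X ==> X ~= {}"
 by (simp add: graph_connected_def)

lemma graph_connected_singleton [simp]: "graph_connected E {x}"
 by (rule graph_connectedI) (auto intro: conn_refl)

lemma graph_connected_Un:
 assumes "graph_connected E X" "graph_connected E Y" "X Int Y ~= {}"
 shows "graph_connected E (X Un Y)"
proof -
 obtain z where z: "z \<in> X" "z \<in> Y" using assms(3) by auto
 show ?thesis
  by (rule graph_connectedI[of z]) (use z assms(1,2) in \<open>auto intro: graph_connectedD\<close>)
qed

lemma graph_connected_Un_edge:
 assumes "graph_connected E X" "graph_connected E Y" "x \<in> X" "y \<in> Y" "{x, y} \<in> E"
 shows "graph_connected E (X Un Y)"
proof (rule graph_connectedI[of x])
 show "x \<in> X Un Y" using assms by auto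
 fix z assume z: "z \<in> X Un Y"
 have "conn E (X Un Y) x y" using assms by (auto intro: conn_edge)
 then show "conn E (X Un Y) x z" using z assms
  by (metis Un_iff conn_trans graph_connectedD Un_upper1 Un_upper2)
qed

lemma graph_connected_UN_chain:
 assumes "!!n::nat. graph_connected E (X n)" "!!n. X n \<subseteq> X (Suc n)"
 shows "graph_connected E (\<Union>n. X n)"
proof -
 obtain x where x: "x \<in> X 0" using assms(1)[of 0] by (auto simp: graph_connected_def)
 have m: "X m \<subseteq> X n" if "m \<le> n" for m n using that assms(2) by (rule lift_Suc_mono_le[rotated])
 show ?thesis
 proof (rule graph_connectedI[of x])
  fix y assume "y \<in> (\<Union>n. X n)"
  then obtain n where "y \<in> X n" by auto
  then show "conn E (\<Union>n. X n) x y" using graph_connectedD[OF assms(1)[of n], of x y "\<Union>n. X n"] x m[of 0 n] by auto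
 qed (use x in auto)
qed

text \<open>Connectedness in the form in which it is mostly applied: a set closed under the edges of
  \<open>X\<close> swallows \<open>X\<close> as soon as it meets it. Contradictions arise from a
  \<open>Q\<close> of this kind that misses a known vertex.\<close>

lemma graph_connected_subset_side:
 assumes "graph_connected E X" "!!u v. {u, v} \<in> E ==> u \<in> X ==> v \<in> X ==> u \<in> Q ==> v \<in> Q"
  and "x \<in> X" "x \<in> Q"
 shows "X \<subseteq> Q"
proof
 fix y assume "y \<in> X"
 then have "conn E X x y" using graph_connectedD[OF assms(1,3)] by blast
 then show "y \<in> Q"
  by (induction rule: conn_induct) (use assms(2,4) in \<open>blast+\<close>)
qed

lemma graph_components_iff: "C \<in> graph_components E X \<longleftrightarrow> (\<exists>x\<in>X. C = {y. conn E X x y})"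
 unfolding graph_components_def conn_def by auto

lemma component_connected:
 assumes "C \<in> graph_components E X" shows "graph_connected E C"
proof -
 obtain x where x: "x \<in> X" "C = {y. conn E X x y}" using assms by (auto simp: graph_components_iff)
 have "conn E C x y" if "conn E X x y" for y
  using that by (induction rule: conn_induct)
   (auto simp: x conn_refl intro: conn_step)
 then show ?thesis using x by (intro graph_connectedI[of x]) (auto intro: conn_refl)
qed

lemma component_subset: "C \<in> graph_components E X ==> C \<subseteq> X"
 by (auto simp: graph_components_iff dest: conn_right)

lemma component_closed: "C \<in> graph_components E X ==> u \<in> C ==> conn E X u v ==> v \<in> C"
 by (auto simp: graph_components_iff dest: conn_trans)

lemma component_eq: "C \<in> graph_components E X ==> x \<in> C ==> C = {y. conn E X x y}"
 by (auto simp: graph_components_iff dest: conn_trans conn_sym)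

lemma component_unique:
 "C \<in> graph_components E X ==> C' \<in> graph_components E X ==> x \<in> C ==> x \<in> C' ==> C = C'"
 by (metis component_eq)

lemma component_absorbs:
 assumes "C \<in> graph_components E X" "graph_connected E Y" "Y \<subseteq> X" "C Int Y ~= {}"
 shows "Y \<subseteq> C"
 using assms component_closed graph_connectedD by (metis disjoint_iff subsetI)

lemma component_of: "x \<in> X ==> {y. conn E X x y} \<in> graph_components E X"
 by (auto simp: graph_components_iff)

subsection \<open>Paths\<close>

text \<open>The notion of \<open>graph_path\<close> without the vertex set.
  \<open>successively\<close> splits along append, which suits the many concatenations of paths
  below.\<close>

definition gpath :: "'v set set => 'v list => bool" where
 "gpath E p \<longleftrightarrow> p ~= [] & distinct p & successively (%x y. {x, y} \<in> E) p"

lemma gpath_single [simp]: "gpath E [x]" by (simp add: gpath_def)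

lemma gpath_mono: "gpath E p ==> E \<subseteq> E' ==> gpath E' p"
 unfolding gpath_def by (auto elim: successively_mono)

lemma gpath_rev: "gpath E p ==> gpath E (rev p)"
 by (auto simp: gpath_def insert_commute)

lemma gpath_append:
 assumes "gpath E p" "gpath E q" "set p Int set q = {}" "{last p, hd q} \<in> E"
 shows "gpath E (p @ q)"
 using assms by (auto simp: gpath_def successively_append_iff)

lemma gpath_append_iff:
 "p ~= [] ==> q ~= [] ==> gpath E (p @ q) \<longleftrightarrow> gpath E p & gpath E q & set p Int set q = {} & {last p, hd q} \<in> E"
 by (auto simp: gpath_def successively_append_iff)

lemma gpath_connected: "gpath E p ==> graph_connected E (set p)"
proof (induction p)
 case (Cons a p)
 show ?case
 proof (cases "p = []")
  case False
  then have "gpath E p" "{a, hd p} \<in> E" using Cons.prems by (auto simp: gpath_def successively_Cons)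
  then have "graph_connected E ({a} Un set p)"
   using Cons.IH False by (intro graph_connected_Un_edge[where x=a and y="hd p"]) auto
  then show ?thesis by simp
 qed simp
qed (simp add: gpath_def)

lemma gpath_butlast: "gpath E p ==> butlast p ~= [] ==> gpath E (butlast p)"
 by (metis append_butlast_last_id butlast.simps(1) gpath_append_iff not_Cons_self2)

lemma gpath_butlast_set: "gpath E p ==> set (butlast p) = set p - {last p}"
 by (cases p rule: rev_cases) (auto simp: gpath_def)

lemma gpath_tl: "gpath E p ==> tl p ~= [] ==> gpath E (tl p)"
 by (cases p) (auto simp: gpath_def successively_Cons)

lemma conn_imp_gpath:
 assumes "conn E X x y"
 obtains p where "gpath E p" "hd p = x" "last p = y" "set p \<subseteq> X"
proof -
 have "\<exists>p. gpath E p & hd p = x & last p = y & set p \<subseteq> X"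
  using assms
 proof (induction rule: conn_induct)
  case refl then show ?case by (intro exI[of _ "[x]"]) auto
 next
  case (step y z)
  then obtain p where p: "gpath E p" "hd p = x" "last p = y" "set p \<subseteq> X" by auto
  show ?case
  proof (cases "z \<in> set p")
   case True
   then obtain a b where ab: "p = a @ z # b" by (meson split_list)
   have "gpath E (a @ [z])"
    using p(1) unfolding ab gpath_def by (auto simp: successively_append_iff)
   moreover have "hd (a @ [z]) = x" using p(2) ab by (cases a) auto
   ultimately show ?thesis using p(4) ab by (intro exI[of _ "a @ [z]"]) auto
  next
   case False
   then have "gpath E (p @ [z])" using p step by (intro gpath_append) auto
   then show ?thesis using p step
    by (intro exI[of _ "p @ [z]"]) (auto simp: gpath_def)
  qed
 qed
 then show ?thesis using that by auto
qed

lemma gpath_conn: "gpath E p ==> u \<in> set p ==> v \<in> set p ==> set p \<subseteq> X ==> conn E X u v"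
 using gpath_connected graph_connectedD by metis

text \<open>The \<open>A\<close>-\<open>B\<close> paths of Menger's theorem; a single vertex of
  \<open>A Int B\<close> counts as one.\<close>

definition ABpath :: "'v set set => 'v set => 'v set => 'v list => bool" where
 "ABpath E A B p \<longleftrightarrow> gpath E p & set p Int A = {hd p} & set p Int B = {last p}"

lemma ABpathD:
 assumes "ABpath E A B p"
 shows "gpath E p" "p ~= []" "hd p \<in> A" "last p \<in> B" "set p Int A = {hd p}" "set p Int B = {last p}"
 using assms by (auto simp: ABpath_def gpath_def)

lemma ABpath_shrink:
 assumes "gpath E p" "hd p \<in> A" "last p \<in> B"
 obtains q where "ABpath E A B q" "set q \<subseteq> set p"
proof -
 define P where "P = (%q. gpath E q & hd q \<in> A & last q \<in> B & set q \<subseteq> set p)"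
 \<comment> \<open>A shortest path does: a later vertex in \<open>A\<close> or an earlier one in
   \<open>B\<close> would allow a piece to be cut off.\<close>
 define q where "q = (ARG_MIN length q. P q)"
 have "P p" using assms by (auto simp: P_def)
 then have q: "P q" and min: "!!r. P r ==> length q \<le> length r"
  unfolding q_def using arg_min_nat_lemma[of P p length] by auto
 have ne: "q ~= []" using q by (auto simp: P_def gpath_def)
 have A: "v = hd q" if v: "v \<in> set q" "v \<in> A" for v
 proof (rule ccontr)
  assume n: "v ~= hd q"
  obtain a b where ab: "q = a @ v # b" using v by (meson split_list)
  then have "a ~= []" using n by auto
  moreover have "P (v # b)" using q v \<open>a ~= []\<close>
   unfolding P_def ab by (auto simp: gpath_append_iff)
  ultimately show False using min ab by fastforce
 qed
 have B: "v = last q" if v: "v \<in> set q" "v \<in> B" for v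
 proof (rule ccontr)
  assume n: "v ~= last q"
  obtain a b where ab: "q = a @ v # b" using v by (meson split_list)
  then have b: "b ~= []" using n by auto
  have "gpath E ((a @ [v]) @ b)" using q ab by (auto simp: P_def)
  then have "gpath E (a @ [v])" using b by (subst (asm) gpath_append_iff) auto
  moreover have "hd (a @ [v]) \<in> A" using q ab by (cases a) (auto simp: P_def)
  ultimately have "P (a @ [v])" using q v unfolding P_def ab by auto
  then show False using min b ab by fastforce
 qed
 have "ABpath E A B q" using q A B ne unfolding ABpath_def P_def by auto
 then show ?thesis using that q by (auto simp: P_def)
qed

lemma conn_imp_ABpath:
 assumes "conn E X a b" "a \<in> A" "b \<in> B"
 obtains p where "ABpath E A B p" "set p \<subseteq> X"
proof -
 obtain p where "gpath E p" "hd p = a" "last p = b" "set p \<subseteq> X" using conn_imp_gpath[OF assms(1)] .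
 then show ?thesis using ABpath_shrink[of E p A B] assms that by (metis order_trans)
qed

text \<open>Join a fixed root to every member of \<open>F\<close> by a path inside \<open>X\<close>;
  the union of these finitely many paths is connected.\<close>

lemma finite_connected_superset:
 assumes "graph_connected E X" "finite F" "F \<subseteq> X"
 obtains K where "finite K" "graph_connected E K" "F \<subseteq> K" "K \<subseteq> X"
proof -
 obtain r where r: "r \<in> X" using assms(1) by (auto simp: graph_connected_def)
 have "\<exists>p. gpath E p & hd p = r & last p = x & set p \<subseteq> X" if "x \<in> X" for x
  using conn_imp_gpath graph_connectedD[OF assms(1) r that order_refl] by metis
 then obtain p where p: "!!x. x \<in> X ==> gpath E (p x) & hd (p x) = r & last (p x) = x & set (p x) \<subseteq> X"
  by metis
 define K where "K = insert r (\<Union>x\<in>F. set (p x))"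
 have "graph_connected E K"
 proof (rule graph_connectedI[of r])
  fix y assume "y \<in> K"
  then consider "y = r" | x where "x \<in> F" "y \<in> set (p x)" by (auto simp: K_def)
  then show "conn E K r y"
  proof cases
   case 1 then show ?thesis by (simp add: conn_refl K_def)
  next
   case 2
   then show ?thesis using gpath_conn[of E "p x" r y K] p[of x] assms(3)
    by (metis (no_types, lifting) K_def UN_upper gpath_def hd_in_set subset_iff subset_insertI2)
  qed
 qed (simp add: K_def)
 moreover have "F \<subseteq> K"
 proof
  fix x assume "x \<in> F"
  then have "x \<in> set (p x)" using p[of x] assms(3) by (metis gpath_def last_in_set subsetD)
  then show "x \<in> K" using \<open>x \<in> F\<close> by (auto simp: K_def)
 qed
 moreover have "K \<subseteq> X" using p assms(3) r unfolding K_def by blast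
 moreover have "finite K" using assms(2) by (simp add: K_def)
 ultimately show ?thesis using that by blast
qed

subsection \<open>Menger's theorem\<close>

definition linked :: "nat => 'v set set => 'v set => 'v set => bool" where
 "linked k E A B \<longleftrightarrow> (\<exists>f. (\<forall>i<k. ABpath E A B (f i)) &
  (\<forall>i<k. \<forall>j<k. i ~= j --> set (f i) Int set (f j) = {}))"

lemma linkedI:
 assumes "!!i. i < k ==> gpath E (f i) & hd (f i) \<in> A & last (f i) \<in> B"
  and "!!i j. i < k ==> j < k ==> i ~= j ==> set (f i) Int set (f j) = {}"
 shows "linked k E A B"
proof -
 have "\<exists>q. ABpath E A B q & set q \<subseteq> set (f i)" if "i < k" for i
  using ABpath_shrink assms(1)[OF that] by metis
 then obtain g where g: "!!i. i < k ==> ABpath E A B (g i) & set (g i) \<subseteq> set (f i)" by metis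
 have "set (g i) Int set (g j) = {}" if "i < k" "j < k" "i ~= j" for i j
  using g[OF that(1)] g[OF that(2)] assms(2)[OF that] by auto
 then show ?thesis unfolding linked_def using g by (intro exI[of _ g]) simp
qed

lemma gpath_conn_avoid_last:
 assumes "gpath E p" "set p Int Z \<subseteq> {last p}" "u \<in> set p" "u \<notin> Z"
 shows "conn E (-Z) (hd p) u"
proof -
 obtain a b where ab: "p = a @ u # b" using assms(3) by (meson split_list)
 have 1: "gpath E (a @ [u])" using assms(1) unfolding ab gpath_def by (auto simp: successively_append_iff)
 have 2: "hd (a @ [u]) = hd p" using ab by (cases a) auto
 have "set (a @ [u]) \<subseteq> - Z"
 proof
  fix w assume w: "w \<in> set (a @ [u])"
  have "last p = last (u # b)" "distinct p" using ab assms(1) by (auto simp: gpath_def)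
  then have "last p \<notin> set a" using ab last_in_set[of "u # b"] by (metis disjoint_iff distinct_append list.distinct(1))
  then show "w \<in> -Z" using w assms(2,4) ab by auto
 qed
 then show ?thesis using gpath_conn[OF 1, of "hd (a @ [u])" u "-Z"] 2 hd_in_set[of "a @ [u]"] by auto
qed

lemma gpath_conn_avoid_hd:
 assumes "gpath E p" "set p Int Z \<subseteq> {hd p}" "u \<in> set p" "u \<notin> Z"
 shows "conn E (-Z) u (last p)"
proof -
 have "conn E (-Z) (hd (rev p)) u"
  by (rule gpath_conn_avoid_last[OF gpath_rev]) (use assms in \<open>auto simp: last_rev\<close>)
 then show ?thesis by (simp add: hd_rev conn_sym)
qed

text \<open>Goering's induction over the edges. If deleting \<open>e\<close> destroys the
  hypothesis, a set \<open>S\<close> of \<open>k - 1\<close> vertices separates \<open>A\<close>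
  from \<open>B\<close> in \<open>H\<close>, with one end \<open>x\<close> of \<open>e\<close> on
  the side of \<open>A\<close> and the other end \<open>y\<close> on the side of \<open>B\<close>.
  The induction hypothesis gives \<open>k\<close> paths from \<open>A\<close> to
  \<open>insert x S\<close> and \<open>k\<close> paths from \<open>insert y S\<close> to
  \<open>B\<close>, which fit together along \<open>S\<close> and \<open>e\<close>.\<close>

lemma menger_finite:
 assumes "finite E" "\<forall>e\<in>E. card e = 2"
  and "!!T. finite T ==> card T < k ==> \<exists>a\<in>A. \<exists>b\<in>B. conn E (-T) a b"
 shows "linked k E A B"
 using assms
proof (induction E arbitrary: A B rule: finite_induct)
 case empty
 have eq: "a = b" if "conn {} X a b" for a b :: 'a and X using that by (induction rule: conn_induct) auto
 \<comment> \<open>Without edges all connections are trivial, so \<open>A Int B\<close> itself is a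
   separator and has at least \<open>k\<close> elements.\<close>
 have "\<exists>Z\<subseteq>A Int B. finite Z & card Z = k"
 proof (cases "finite (A Int B)")
  case True
  have "k \<le> card (A Int B)"
  proof (rule ccontr)
   assume "~ ?thesis"
   then obtain a b where "a \<in> A" "b \<in> B" "conn {} (-(A Int B)) a b" using empty(2)[OF True] by auto
   then show False using eq conn_left by fastforce
  qed
  then show ?thesis using obtain_subset_with_card_n by metis
 next
  case False
  then show ?thesis using infinite_arbitrarily_large by metis
 qed
 then obtain Z where Z: "Z \<subseteq> A Int B" "finite Z" "card Z = k" by auto
 then obtain g where g: "bij_betw g {..<k} Z" using ex_bij_betw_nat_finite[of Z] by (auto simp: lessThan_atLeast0)
 show ?case
 proof (rule linkedI[of _ _ "%i. [g i]"])
  fix i assume "i < k"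
  then have "g i \<in> Z" using g by (auto simp: bij_betw_def)
  then show "gpath {} [g i] & hd [g i] \<in> A & last [g i] \<in> B" using Z by auto
 next
  fix i j assume "i < k" "j < k" "i ~= j"
  then show "set [g i] Int set [g j] = {}" using g by (auto simp: bij_betw_def inj_on_def)
 qed
next
 case (insert e H)
 have H2: "\<forall>e\<in>H. card e = 2" using insert.prems by auto
 show ?case
 proof (cases "\<forall>T. finite T & card T < k --> (\<exists>a\<in>A. \<exists>b\<in>B. conn H (-T) a b)")
  case True
  then have "linked k H A B" using insert.IH[OF H2] by auto
  then show ?thesis unfolding linked_def ABpath_def by (meson gpath_mono subset_insertI)
 next
  case False
  then obtain S where S: "finite S" "card S < k" and sep: "!!a b. a \<in> A ==> b \<in> B ==> ~ conn H (-S) a b" by auto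
  obtain a0 b0 where ab: "a0 \<in> A" "b0 \<in> B" "conn (insert e H) (-S) a0 b0"
   using insert.prems(2)[OF S] by auto
  obtain x0 y0 where e0: "e = {x0, y0}" "x0 ~= y0" using insert.prems(1) by (auto simp: card_2_iff)
  have "\<exists>x y. e = {x, y} & x ~= y & conn H (-S) a0 x & conn H (-S) y b0"
  proof -
   have "(conn H (-S) a0 x0 & conn H (-S) y0 b0) \<or> (conn H (-S) a0 y0 & conn H (-S) x0 b0)"
    using conn_insert_edge[of x0 y0 H "-S" a0 b0] ab sep e0 by auto
   then show ?thesis using e0 by (metis insert_commute)
  qed
  then obtain x y where e: "e = {x, y}" "x ~= y" and ax: "conn H (-S) a0 x" and yb: "conn H (-S) y b0" by auto
  have nS: "x \<notin> S" "y \<notin> S" using ax yb conn_right conn_left by fastforce+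
  \<comment> \<open>Otherwise \<open>insert x S\<close> would be a separator of the whole graph with
    fewer than \<open>k\<close> vertices, because every use of \<open>e\<close> passes through
    \<open>x\<close>.\<close>
  have k: "card S + 1 = k"
  proof (rule ccontr)
   assume "card S + 1 ~= k"
   then have "card (insert x S) < k" "finite (insert x S)" using S nS by auto
   then obtain a b where c: "a \<in> A" "b \<in> B" "conn (insert e H) (- insert x S) a b" using insert.prems(2) by meson
   have "conn H (- insert x S) a b" using c(3)
   proof (induction rule: conn_induct)
    case (step u v)
    then have "{u, v} \<in> H" using e by (auto simp: doubleton_eq_iff)
    then show ?case using step by (meson conn_step)
   qed (rule conn_refl)
   then show False using sep c conn_mono[of H "- insert x S" a b H "- S"] by auto
  qed
  \<comment> \<open>Fewer than \<open>k\<close> vertices do not separate \<open>A\<close> from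
    \<open>B\<close> in the whole graph. The connection that they leave reaches \<open>x\<close> or
    meets \<open>S\<close>, since both \<open>y\<close> and \<open>B\<close> lie beyond
    \<open>S\<close>.\<close>
  have "\<exists>a\<in>A. \<exists>s\<in>insert x S. conn H (-T) a s" if T: "finite T" "card T < k" for T
  proof -
   obtain a b where c: "a \<in> A" "b \<in> B" "conn (insert {x, y} H) (-T) a b" using insert.prems(2)[OF T] e by auto
   consider "conn H (-T) a b" | "conn H (-T) a x" | "conn H (-T) a y" using conn_insert_edge[OF c(3)] by auto
   then show ?thesis
   proof cases
    case 1
    have "~ conn H (-T-S) a b" using sep[OF c(1,2)] conn_mono[of H "-T-S" a b H "-S"] by auto
    then show ?thesis using conn_hit[OF 1, of S] c by auto
   next
    case 3
    have "~ conn H (-T-S) a y"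
    proof
     assume "conn H (-T-S) a y"
     then have "conn H (-S) a y" using conn_mono[of H "-T-S" a y H "-S"] by blast
     then show False using sep[OF c(1) ab(2)] yb conn_trans by metis
    qed
    then show ?thesis using conn_hit[OF 3, of S] c by auto
   qed (use c in auto)
  qed
  then have "linked k H A (insert x S)" by (intro insert.IH H2)
  then obtain f where f: "!!i. i < k ==> ABpath H A (insert x S) (f i)"
   and fd: "!!i j. i < k ==> j < k ==> i ~= j ==> set (f i) Int set (f j) = {}" unfolding linked_def by blast
  have "\<exists>s\<in>insert y S. \<exists>b\<in>B. conn H (-T) s b" if T: "finite T" "card T < k" for T
  proof -
   obtain a b where c: "a \<in> A" "b \<in> B" "conn (insert {x, y} H) (-T) a b" using insert.prems(2)[OF T] e by auto
   consider "conn H (-T) a b" | "conn H (-T) y b" | "conn H (-T) x b" using conn_insert_edge[OF c(3)] by auto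
   then show ?thesis
   proof cases
    case 1
    have "~ conn H (-T-S) b a"
    proof
     assume "conn H (-T-S) b a"
     then have "conn H (-S) b a" using conn_mono[of H "-T-S" b a H "-S"] by auto
     then show False using sep[OF c(1,2)] conn_sym[of H "-S" b a] by simp
    qed
    then obtain s where "s \<in> S" "conn H (-T) b s" using conn_hit[OF conn_sym[OF 1], of S] by auto
    then show ?thesis using c(2) conn_sym[of H "-T" b s] by auto
   next
    case 3
    have "~ conn H (-T-S) b x"
    proof
     assume "conn H (-T-S) b x"
     then have "conn H (-S) b x" using conn_mono[of H "-T-S" b x H "-S"] by auto
     then show False using sep[OF ab(1) c(2)] conn_trans[OF ax conn_sym[of H "-S" b x]] by simp
    qed
    then obtain s where "s \<in> S" "conn H (-T) b s" using conn_hit[OF conn_sym[OF 3], of S] by auto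
    then show ?thesis using c(2) conn_sym[of H "-T" b s] by auto
   qed (use c in auto)
  qed
  then have "linked k H (insert y S) B" by (intro insert.IH H2)
  then obtain g where g: "!!i. i < k ==> ABpath H (insert y S) B (g i)"
   and gd: "!!i j. i < k ==> j < k ==> i ~= j ==> set (g i) Int set (g j) = {}" unfolding linked_def by blast
  \<comment> \<open>The \<open>k\<close> disjoint paths start at different vertices of a set of size
    \<open>k\<close>, so every vertex of that set is a start.\<close>
  have "inj_on (%i. hd (g i)) {..<k}"
  proof (rule inj_onI)
   fix i j assume "i \<in> {..<k}" "j \<in> {..<k}" "hd (g i) = hd (g j)"
   then show "i = j" using gd[of i j] ABpathD(2)[OF g[of i]] ABpathD(2)[OF g[of j]]
    by (metis disjoint_iff hd_in_set lessThan_iff)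
  qed
  then have "card ((%i. hd (g i)) ` {..<k}) = k" by (simp add: card_image)
  moreover have "(%i. hd (g i)) ` {..<k} \<subseteq> insert y S" using ABpathD(3)[OF g] by auto
  moreover have "card (insert y S) = k" "finite (insert y S)" using S nS k by auto
  ultimately have "(%i. hd (g i)) ` {..<k} = insert y S" by (metis card_subset_eq)
  then have "\<forall>s\<in>insert y S. \<exists>j<k. hd (g j) = s" by (metis (no_types, lifting) imageE lessThan_iff)
  then obtain J where J: "!!s. s \<in> insert y S ==> J s < k & hd (g (J s)) = s" by metis
  \<comment> \<open>A common vertex outside \<open>S\<close> would join \<open>A\<close> to
    \<open>B\<close> in \<open>H\<close> without meeting \<open>S\<close>.\<close>
  have cross: "u \<in> S & u = last (f i) & u = hd (g j)" if ij: "i < k" "j < k" and u: "u \<in> set (f i)" "u \<in> set (g j)" for i j u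
  proof -
   note F = ABpathD[OF f[OF ij(1)]] and G = ABpathD[OF g[OF ij(2)]]
   have "u \<in> S"
   proof (rule ccontr)
    assume n: "u \<notin> S"
    have "conn H (-S) (hd (f i)) u" by (rule gpath_conn_avoid_last) (use F n u in auto)
    moreover have "conn H (-S) u (last (g j))" by (rule gpath_conn_avoid_hd) (use G n u in auto)
    ultimately show False using sep F G by (meson conn_trans)
   qed
   then show ?thesis using F G u by auto
  qed
  \<comment> \<open>A path ending at \<open>x\<close> continues across \<open>e\<close> to
    \<open>y\<close>; every other one continues from the vertex of \<open>S\<close> where it
    ends.\<close>
  define s' where "s' = (%i. if last (f i) = x then y else last (f i))"
  have s': "s' i \<in> insert y S" if "i < k" for i using ABpathD(4)[OF f[OF that]] by (auto simp: s'_def)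
  define h where "h = (%i. if last (f i) = x then f i @ g (J y) else f i @ tl (g (J (s' i))))"
  have hsub: "set (h i) \<subseteq> set (f i) Un set (g (J (s' i)))" for i
  proof -
   have "set (tl l) \<subseteq> set l" for l :: "'a list" by (cases l) auto
   then show ?thesis by (cases "last (f i) = x") (auto simp: h_def s'_def)
  qed
  have inj: "s' i ~= s' j" if "i < k" "j < k" "i ~= j" for i j
  proof -
   have "last (f i) ~= last (f j)" using fd[OF that] ABpathD(2)[OF f[OF that(1)]] ABpathD(2)[OF f[OF that(2)]]
    by (metis disjoint_iff last_in_set)
   moreover have "last (f i) ~= y" "last (f j) ~= y" using ABpathD(4)[OF f[OF that(1)]] ABpathD(4)[OF f[OF that(2)]] nS e by auto
   ultimately show ?thesis by (auto simp: s'_def)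
  qed
  show ?thesis
  proof (rule linkedI[of _ _ h])
   fix i assume i: "i < k"
   note F = ABpathD[OF f[OF i]]
   have Js: "J (s' i) < k" "hd (g (J (s' i))) = s' i" using J s'[OF i] by auto
   note G = ABpathD[OF g[OF Js(1)]]
   show "gpath (insert e H) (h i) & hd (h i) \<in> A & last (h i) \<in> B"
   proof (cases "last (f i) = x")
    case True
    have "set (f i) Int set (g (J y)) = {}" using cross[OF i Js(1)] True nS by (auto simp: s'_def)
    then have "gpath (insert e H) (f i @ g (J y))"
     using F G True Js e by (intro gpath_append) (auto intro: gpath_mono simp: s'_def)
    then show ?thesis using F G True by (simp add: h_def s'_def)
   next
    case False
    then have s: "s' i = last (f i)" by (simp add: s'_def)
    let ?q = "g (J (s' i))"
    show ?thesis
    proof (cases "tl ?q = []")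
     case True
     then have "?q = [s' i]" using Js G by (metis hd_Cons_tl)
     then show ?thesis using F G False s by (auto simp: h_def intro: gpath_mono)
    next
     case t: False
     have qq: "?q = s' i # tl ?q" using Js G by (metis hd_Cons_tl)
     then have d: "s' i \<notin> set (tl ?q)" "{s' i, hd (tl ?q)} \<in> H" using G(1) t
      unfolding gpath_def by (metis distinct.simps(2), metis successively_Cons)
     have "set (f i) Int set (tl ?q) = {}"
     proof (rule ccontr)
      assume "~ ?thesis"
      then obtain u where u: "u \<in> set (f i)" "u \<in> set (tl ?q)" by auto
      then have "u = last (f i)" using cross[OF i Js(1), of u] qq by (metis list.set_intros(2))
      then show False using d u s by simp
     qed
     then have "gpath (insert e H) (f i @ tl ?q)"
      using F G d s gpath_tl[OF G(1) t] by (intro gpath_append) (auto intro: gpath_mono)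
     moreover have "last (f i @ tl ?q) = last ?q" using t qq by (metis last_ConsR last_append)
     ultimately show ?thesis using F G False by (simp add: h_def)
    qed
   qed
  next
   fix i j assume ij: "i < k" "j < k" "i ~= j"
   have J2: "J (s' i) < k" "J (s' j) < k" "hd (g (J (s' i))) = s' i" "hd (g (J (s' j))) = s' j" using J s' ij by auto
   then have Jn: "J (s' i) ~= J (s' j)" using inj[OF ij] by metis
   have y: "last (f i) ~= y" if "i < k" for i using ABpathD(4)[OF f[OF that]] nS e by auto
   have 1: "set (f i) Int set (g (J (s' j))) = {}"
   proof (rule ccontr)
    assume "~ ?thesis"
    then obtain u where u: "u \<in> set (f i)" "u \<in> set (g (J (s' j)))" by auto
    then have "u \<in> S" "u = last (f i)" "u = s' j" using cross[OF ij(1) J2(2)] J2(4) by auto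
    then have "s' i = u" using nS by (auto simp: s'_def)
    then show False using inj[OF ij] \<open>u = s' j\<close> by simp
   qed
   have 2: "set (f j) Int set (g (J (s' i))) = {}"
   proof (rule ccontr)
    assume "~ ?thesis"
    then obtain u where u: "u \<in> set (f j)" "u \<in> set (g (J (s' i)))" by auto
    then have "u \<in> S" "u = last (f j)" "u = s' i" using cross[OF ij(2) J2(1)] J2(3) by auto
    then have "s' j = u" using nS by (auto simp: s'_def)
    then show False using inj[OF ij] \<open>u = s' i\<close> by simp
   qed
   show "set (h i) Int set (h j) = {}"
    using hsub[of i] hsub[of j] 1 2 fd[OF ij] gd[OF J2(1,2) Jn] by blast
  qed
 qed
qed

text \<open>Take a finite \<open>K\<close> of largest size among those contained in infinitely many
  of the sets; the bound \<open>k\<close> makes the maximum exist. Every further point lies together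
  with \<open>K\<close> in only finitely many \<open>T i\<close>, so a finite set disjoint from
  \<open>K\<close> misses almost all \<open>T i\<close> that contain \<open>K\<close>.\<close>

lemma bounded_sets_kernel:
 fixes T :: "nat => 'a set"
 assumes "!!i. finite (T i) & card (T i) < k"
 obtains K where "finite K" "infinite {i. K \<subseteq> T i}" "!!t. t \<notin> K ==> finite {i. insert t K \<subseteq> T i}"
proof -
 define P where "P = (%K. finite K & infinite {i. K \<subseteq> T i})"
 have "P {}" by (simp add: P_def)
 moreover have "card K < k" if "P K" for K
 proof -
  have "{i. K \<subseteq> T i} ~= {}" using that unfolding P_def by (metis finite.emptyI)
  then obtain i where "K \<subseteq> T i" by auto
  then show ?thesis using assms[of i] by (meson card_mono le_less_trans)
 qed
 ultimately obtain K where K: "P K" "!!L. P L ==> card L \<le> card K"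
  using ex_has_greatest_nat[of P "{}" card k] by (metis less_imp_le)
 show ?thesis
 proof (rule that[of K])
  fix t assume t: "t \<notin> K"
  show "finite {i. insert t K \<subseteq> T i}"
  proof (rule ccontr)
   assume "~ ?thesis"
   then have "P (insert t K)" using K(1) by (auto simp: P_def)
   then show False using K(2)[of "insert t K"] t K(1) by (auto simp: P_def)
  qed
 qed (use K in \<open>auto simp: P_def\<close>)
qed

lemma kernel_avoids:
 assumes "!!i. finite (T i)" "infinite {i. K \<subseteq> T i}" "!!t. t \<notin> K ==> finite {i. insert t K \<subseteq> T i}"
  and "finite P" "P Int K = {}" "infinite I" "I \<subseteq> {i. K \<subseteq> T i}"
 obtains i where "i \<in> I" "P Int T i = {}"
proof -
 have "finite (\<Union>t\<in>P. {i. insert t K \<subseteq> T i})"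
 proof (rule finite_UN_I[OF assms(4)])
  fix t assume "t \<in> P"
  then have "t \<notin> K" using assms(5) by blast
  then show "finite {i. insert t K \<subseteq> T i}" by (rule assms(3))
 qed
 then have "infinite (I - (\<Union>t\<in>P. {i. insert t K \<subseteq> T i}))" using assms(6) by simp
 then have "I - (\<Union>t\<in>P. {i. insert t K \<subseteq> T i}) ~= {}" by (rule infinite_imp_nonempty)
 then obtain i where i: "i \<in> I" "i \<notin> (\<Union>t\<in>P. {i. insert t K \<subseteq> T i})" by blast
 have K: "K \<subseteq> T i" using i(1) assms(7) by auto
 have "P Int T i = {}"
 proof (rule ccontr)
  assume "P Int T i ~= {}"
  then obtain t where "t \<in> P" "t \<in> T i" by auto
  then show False using i(2) K by auto
 qed
 then show ?thesis by (rule that[OF i(1)])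
qed

text \<open>Compactness. If every finite part \<open>E'\<close> of the graph has a small separator
  \<open>T E'\<close>, each stage receives a path of the whole graph that avoids the separator of
  that stage. By \<open>kernel_avoids\<close>, a path from an early stage also misses the separator
  of some later stage, although that stage contains all its edges.\<close>

theorem menger:
 assumes "\<forall>e\<in>E. card e = 2"
  and "!!T. finite T ==> card T < k ==> \<exists>a\<in>A. \<exists>b\<in>B. conn E (-T) a b"
 shows "linked k E A B"
proof (rule ccontr)
 assume nl: "~ linked k E A B"
 have "\<exists>T. finite T & card T < k & ~ (\<exists>a\<in>A. \<exists>b\<in>B. conn E' (-T) a b)" if "finite E'" "E' \<subseteq> E" for E'
 proof (rule ccontr)
  assume "~ ?thesis"
  then have "linked k E' A B" using menger_finite[of E' k A B] assms(1) that by blast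
  then show False using nl that(2) unfolding linked_def ABpath_def by (meson gpath_mono)
 qed
 then obtain T where T: "!!E'. finite E' ==> E' \<subseteq> E ==>
   finite (T E') & card (T E') < k & ~ (\<exists>a\<in>A. \<exists>b\<in>B. conn E' (-T E') a b)" by metis
 have "\<exists>a b p. a \<in> A & b \<in> B & gpath E p & hd p = a & last p = b & set p Int S = {}" if S: "finite S" "card S < k" for S
 proof -
  obtain a b where "a \<in> A" "b \<in> B" and c: "conn E (-S) a b" using assms(2)[OF S] by auto
  then show ?thesis using conn_imp_gpath[OF c] by (metis disjoint_eq_subset_Compl)
 qed
 then obtain p where p: "!!S. finite S ==> card S < k ==> gpath E (p S) & hd (p S) \<in> A & last (p S) \<in> B & set (p S) Int S = {}"
  by metis
 define pe where "pe = (%S. {e\<in>E. e \<subseteq> set (p S)})"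
 have pe: "finite (pe S)" for S
  by (rule finite_subset[of _ "Pow (set (p S))"]) (auto simp: pe_def)
 \<comment> \<open>Every stage adds the edges spanned by a path that avoids the current
   separator.\<close>
 define EE where "EE = (%n. ((%E'. E' Un pe (T E')) ^^ n) {})"
 have EE: "finite (EE n) & EE n \<subseteq> E" for n
  unfolding EE_def by (induction n) (use pe in \<open>auto simp: pe_def\<close>)
 have EEmono: "EE m \<subseteq> EE n" if "m \<le> n" for m n
  by (rule lift_Suc_mono_le[OF _ that]) (auto simp: EE_def)
 define TT where "TT = (%n. T (EE n))"
 have TT: "finite (TT n) & card (TT n) < k" for n using T EE by (auto simp: TT_def)
 obtain K where K: "finite K" "infinite {i. K \<subseteq> TT i}" "!!t. t \<notin> K ==> finite {i. insert t K \<subseteq> TT i}"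
  using bounded_sets_kernel[of TT k] TT by metis
 obtain i where i: "K \<subseteq> TT i" using K(2) by (metis (mono_tags, lifting) empty_Collect_eq finite.emptyI)
 have pi: "gpath E (p (TT i))" "hd (p (TT i)) \<in> A" "last (p (TT i)) \<in> B" "set (p (TT i)) Int TT i = {}" using p TT by auto
 have "infinite ({i. K \<subseteq> TT i} - {..i})" using K(2) by simp
 then obtain j where "j \<in> {i. K \<subseteq> TT i} - {..i}" and j2: "set (p (TT i)) Int TT j = {}"
  by (rule kernel_avoids[of TT K "set (p (TT i))" "{i. K \<subseteq> TT i} - {..i}", rotated 5])
   (use TT K i pi(4) in auto)
 then have j: "j > i" "set (p (TT i)) Int TT j = {}" by auto
 have "gpath (EE j) (p (TT i))"
 proof -
  have "pe (TT i) \<subseteq> EE (Suc i)" by (auto simp: EE_def TT_def)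
  then have sub: "pe (TT i) \<subseteq> EE j" using EEmono[of "Suc i" j] j by auto
  have "successively (%x y. {x, y} \<in> EE j) (p (TT i))"
   using pi(1) sub unfolding gpath_def successively_conv_nth pe_def by auto
  then show ?thesis using pi(1) by (simp add: gpath_def)
 qed
 then have "conn (EE j) (- TT j) (hd (p (TT i))) (last (p (TT i)))"
  by (rule gpath_conn) (use j(2) pi(1) in \<open>auto simp: gpath_def\<close>)
 then show False using T[of "EE j"] EE pi by (auto simp: TT_def)
qed

lemma gpath_conn_hd_last: "gpath E p ==> set p \<subseteq> X ==> conn E X (hd p) (last p)"
 by (rule gpath_conn) (auto simp: gpath_def)

subsection \<open>Rays\<close>

text \<open>The star-comb lemma, with local finiteness excluding the star. The distance from
  \<open>r\<close> grows by one along \<open>R\<close>, and \<open>R\<close> stays at vertices with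
  infinitely many descendants in \<open>U\<close>. Past the distances that occur in a finite set
  \<open>S\<close>, descending paths avoid \<open>S\<close>.\<close>

lemma star_comb:
 assumes con: "graph_connected E K" and r: "r \<in> K"
  and lf: "!!x. x \<in> K ==> finite {y\<in>K. {x, y} \<in> E}"
  and U: "U \<subseteq> K" "infinite U"
 obtains R where "ray E R" "R 0 = r" "range R \<subseteq> K"
  "!!S. finite S ==> \<exists>n. (\<forall>m\<ge>n. R m \<notin> S) & infinite {u\<in>U. conn E (K - S) (R n) u}"
proof -
 define A where "A = adj_in E K"
 define d where "d = (%y. LEAST n. (r, y) \<in> A ^^ n)"
 have ex: "\<exists>n. (r, y) \<in> A ^^ n" if "y \<in> K" for y
  using graph_connectedD[OF con r that order_refl] unfolding conn_def A_def by (simp add: rtrancl_power)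
 have dI: "(r, y) \<in> A ^^ d y" if "y \<in> K" for y unfolding d_def using ex[OF that] by (rule LeastI_ex)
 have dle: "d y \<le> n" if "(r, y) \<in> A ^^ n" for y n unfolding d_def using that by (rule Least_le)
 have d0: "d r = 0" using dle[of r 0] by simp
 \<comment> \<open>Edges that increase the distance from \<open>r\<close> by one. A vertex may have
   several parents; no spanning tree is chosen.\<close>
 define ch where "ch = {(x, y). (x, y) \<in> A & d y = Suc (d x)}"
 define desc where "desc = (%x. {y. (x, y) \<in> ch\<^sup>*})"
 have AK: "(x, y) \<in> A ==> x \<in> K & y \<in> K & {x, y} \<in> E" for x y by (auto simp: A_def adj_in_def)
 have all: "y \<in> desc r" if "y \<in> K" "d y = n" for y n
  using that
 proof (induction n arbitrary: y)
  case 0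
  then have "(r, y) \<in> A ^^ 0" using dI[of y] by simp
  then show ?case by (simp add: desc_def)
 next
  case (Suc n)
  then have "(r, y) \<in> A ^^ Suc n" using dI[of y] by simp
  then obtain x where x: "(r, x) \<in> A ^^ n" "(x, y) \<in> A" by (auto elim: relpow_Suc_E)
  have "d x \<le> n" by (rule dle[OF x(1)])
  moreover have "d y \<le> Suc (d x)"
   by (rule dle) (use dI[of x] AK[OF x(2)] x(2) in auto)
  ultimately have "d x = n" using Suc.prems(2) by simp
  then have "x \<in> desc r" "(x, y) \<in> ch" using Suc AK[OF x(2)] x(2) by (auto simp: ch_def)
  then show ?case by (auto simp: desc_def)
 qed
 have step: "\<exists>y. (y \<in> K & infinite (desc y Int U)) & (x, y) \<in> ch" if x: "x \<in> K" "infinite (desc x Int U)" for x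
 proof (rule ccontr)
  assume n: "~ ?thesis"
  have "desc x Int U \<subseteq> insert x (\<Union>y\<in>{y. (x, y) \<in> ch}. desc y Int U)"
   by (auto simp: desc_def elim: converse_rtranclE)
  moreover have "finite (\<Union>y\<in>{y. (x, y) \<in> ch}. desc y Int U)"
  proof (rule finite_UN_I)
   show "finite {y. (x, y) \<in> ch}"
    by (rule finite_subset[OF _ lf[OF x(1)]]) (auto simp: ch_def dest: AK)
   show "finite (desc y Int U)" if "y \<in> {y. (x, y) \<in> ch}" for y
    using n that AK[of x y] by (auto simp: ch_def)
  qed
  ultimately have "finite (desc x Int U)" by (meson finite_insert finite_subset)
  then show False using x(2) by simp
 qed
 have "desc r Int U = U" using all[OF _ refl] U(1) by blast
 then have 0: "infinite (desc r Int U)" using U(2) by simp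
 have "\<exists>R. \<forall>n. ((R n \<in> K & infinite (desc (R n) Int U)) & (n = 0 --> R n = r)) & (R n, R (Suc n)) \<in> ch"
  by (rule dependent_nat_choice) (use step r 0 in auto)
 then obtain R where R0: "R 0 = r" and R: "!!n. R n \<in> K" "!!n. infinite (desc (R n) Int U)" "!!n. (R n, R (Suc n)) \<in> ch"
  by auto
 have dR: "d (R n) = n" for n by (induction n) (use R(3) in \<open>auto simp: R0 d0 ch_def\<close>)
 have "inj R" by (rule inj_on_inverseI[where g=d]) (rule dR)
 moreover have "{R i, R (Suc i)} \<in> E" for i using R(3)[of i] AK by (auto simp: ch_def)
 ultimately have "ray E R" by (simp add: ray_def)
 moreover have "\<exists>n. (\<forall>m\<ge>n. R m \<notin> S) & infinite {u\<in>U. conn E (K - S) (R n) u}" if S: "finite S" for S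
 proof -
  \<comment> \<open>\<open>n\<close> exceeds the distance of every vertex of \<open>S\<close>, and
    along descending paths from \<open>R n\<close> the distance never drops below
    \<open>n\<close>.\<close>
  obtain n where n: "!!s. s \<in> S ==> d s < n"
   using finite_imageI[OF S, of d] unfolding finite_nat_set_iff_bounded by blast
  have avoid: "R m \<notin> S" if "m \<ge> n" for m using n[of "R m"] dR that by auto
  have "conn E (K - S) (R n) u & d u \<ge> n" if "(R n, u) \<in> ch\<^sup>*" for u
   using that
  proof (induction rule: rtrancl_induct)
   case base then show ?case using R avoid[of n] dR by (auto intro: conn_refl)
  next
   case (step y z)
   then have z: "d z > n" "z \<in> K" "{y, z} \<in> E" using AK[of y z] by (auto simp: ch_def)
   then have "z \<in> K - S" using n by fastforce
   then show ?case using step.IH z by (auto intro: conn_step)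
  qed
  then have "desc (R n) Int U \<subseteq> {u\<in>U. conn E (K - S) (R n) u}" by (auto simp: desc_def)
  then show ?thesis using avoid R(2)[of n] finite_subset by blast
 qed
 ultimately show ?thesis using that R0 R(1) by blast
qed

lemma ray_tail: "ray E R ==> ray E (%i. R (n + i))"
 by (auto simp: ray_def intro!: injI dest: injD)

lemma ray_avoids:
 assumes "ray E R" "finite S"
 obtains n where "!!m. m \<ge> n ==> R m \<notin> S"
proof -
 have "finite (R -` S)" using assms by (intro finite_vimageI) (auto simp: ray_def)
 then obtain n where "\<forall>m\<in>R -` S. m < n" by (meson finite_nat_set_iff_bounded)
 then have "R m \<notin> S" if "m \<ge> n" for m using that by (meson leD vimageI)
 then show ?thesis by (rule that)
qed

lemma ray_segment_connected:
 assumes "!!i. i \<ge> a ==> {R i, R (Suc i)} \<in> E" "a \<le> b"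
 shows "graph_connected E (R ` {a..b})"
 using assms(2)
proof (induction b rule: dec_induct)
 case base then show ?case by simp
next
 case (step n)
 have "R ` {a..Suc n} = R ` {a..n} Un {R (Suc n)}" using step by (auto simp: atLeastAtMostSuc_conv)
 moreover have "graph_connected E (R ` {a..n} Un {R (Suc n)})"
  by (rule graph_connected_Un_edge[where x="R n" and y="R (Suc n)"]) (use step assms(1) in auto)
 ultimately show ?case by simp
qed

lemma ray_tail_connected:
 assumes "ray E R" shows "graph_connected E (R ` {a..})"
proof (rule graph_connectedI[of "R a"])
 fix y assume "y \<in> R ` {a..}"
 then obtain b where b: "b \<ge> a" "y = R b" by auto
 have "graph_connected E (R ` {a..b})" by (rule ray_segment_connected) (use assms b in \<open>auto simp: ray_def\<close>)
 then show "conn E (R ` {a..}) (R a) y" by (rule graph_connectedD) (use b in auto)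
qed auto

lemma ray_seg_gpath:
 assumes "ray E R" "a \<le> b"
 shows "gpath E (map R [a..<Suc b])" "hd (map R [a..<Suc b]) = R a" "last (map R [a..<Suc b]) = R b"
  "set (map R [a..<Suc b]) = R ` {a..b}"
proof -
 have "inj R" using assms(1) by (simp add: ray_def)
 then have "distinct (map R [a..<Suc b])"
  by (simp add: distinct_map inj_on_subset[OF _ subset_UNIV] del: upt_Suc)
 moreover have "successively (%x y. {x, y} \<in> E) (map R [a..<Suc b])"
  using assms by (auto simp: ray_def successively_conv_nth simp del: upt_Suc)
 ultimately show "gpath E (map R [a..<Suc b])" using assms(2) by (simp add: gpath_def)
 show "hd (map R [a..<Suc b]) = R a" using assms(2) by (simp add: hd_map del: upt_Suc)
 show "last (map R [a..<Suc b]) = R b" using assms(2) by (simp add: last_map)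
 show "set (map R [a..<Suc b]) = R ` {a..b}"
  by (simp only: set_map set_upt atLeastLessThanSuc_atLeastAtMost)
qed

section \<open>Ends of a locally finite 2-connected graph\<close>

locale lfgraph =
 fixes V :: "'v set" and E :: "'v set set"
 assumes simple: "simple_graph V E" and locfin: "locally_finite_graph V E" and two_conn: "k_connected 2 V E"
begin

lemma edgeD: assumes "{x, y} \<in> E" shows "x \<in> V & y \<in> V & x ~= y"
proof -
 have "{x, y} \<subseteq> V & card {x, y} = 2" using simple assms unfolding simple_graph_def by (rule bspec)
 then show ?thesis by (cases "x = y") auto
qed

lemma edge_ex: assumes "e \<in> E" obtains x y where "e = {x, y}" "x ~= y" "x \<in> V" "y \<in> V"
proof -
 have "e \<subseteq> V & card e = 2" using simple assms unfolding simple_graph_def by (rule bspec)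
 then show ?thesis using that by (auto simp: card_2_iff)
qed

lemma edge_card: "e \<in> E ==> card e = 2" using simple by (simp add: simple_graph_def)

lemma finite_star: "v \<in> V ==> finite {e\<in>E. v \<in> e}"
 using locfin by (simp add: locally_finite_graph_def)

lemma finite_nbrs: "x \<in> V ==> finite {y. {x, y} \<in> E}"
proof -
 assume x: "x \<in> V"
 have "finite (\<Union>{e\<in>E. x \<in> e})" using finite_star[OF x] edge_card
  by (intro finite_Union) (auto simp: card_ge_0_finite)
 then show ?thesis by (rule finite_subset[rotated]) auto
qed

definition nbrs :: "'v set => 'v set" where "nbrs S = {y. \<exists>x\<in>S. {x, y} \<in> E}"

lemma finite_nbrs_set: "finite S ==> finite (nbrs S)"
proof -
 assume S: "finite S"
 have "nbrs S = (\<Union>x\<in>S Int V. {y. {x, y} \<in> E})" by (auto simp: nbrs_def dest: edgeD)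
 then show ?thesis using S finite_nbrs by auto
qed

lemma V_connected: "graph_connected E V"
 using two_conn by (simp add: k_connected_def) (metis Diff_empty card.empty empty_subsetI finite.emptyI zero_less_numeral)

lemma V_delete_connected: "graph_connected E (V - {t})"
proof (cases "t \<in> V")
 case True
 have "card {t} < 2" by simp
 then show ?thesis using two_conn True unfolding k_connected_def by (metis empty_subsetI finite.emptyI finite.insertI insert_subset)
qed (use V_connected in auto)

lemma ray_V: "ray E R ==> R i \<in> V"
 by (meson edgeD ray_def)

lemma tail_in_component:
 assumes "ray E R" "finite S"
 obtains C n where "C \<in> graph_components E (V - S)" "R ` {n..} \<subseteq> C"
proof -
 obtain n where n: "!!m. m \<ge> n ==> R m \<notin> S" using ray_avoids[OF assms] by metis
 let ?C = "{y. conn E (V - S) (R n) y}"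
 have "?C \<in> graph_components E (V - S)" using n[of n] ray_V[OF assms(1)] by (intro component_of) auto
 moreover have "R ` {n..} \<subseteq> ?C"
 proof
  fix y assume y: "y \<in> R ` {n..}"
  have "R ` {n..} \<subseteq> V - S" using n ray_V[OF assms(1)] by auto
  then show "y \<in> ?C" using graph_connectedD[OF ray_tail_connected[OF assms(1), of n], of "R n" y "V - S"] y by auto
 qed
 ultimately show ?thesis by (rule that)
qed

lemma ray_equivI:
 assumes "ray E R" "ray E R'"
  and "!!S. S \<subseteq> V ==> finite S ==> \<exists>C\<in>graph_components E (V - S). \<exists>n. R ` {n..} \<subseteq> C & R' ` {n..} \<subseteq> C"
 shows "(R, R') \<in> ray_equiv V E"
 using assms unfolding ray_equiv_def by simp

lemma ray_equivD:
 assumes "(R, R') \<in> ray_equiv V E" shows "ray E R" "ray E R'"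
 using assms unfolding ray_equiv_def by simp_all

lemma ray_equivE:
 assumes "(R, R') \<in> ray_equiv V E" "S \<subseteq> V" "finite S"
 obtains C n where "C \<in> graph_components E (V - S)" "R ` {n..} \<subseteq> C" "R' ` {n..} \<subseteq> C"
proof -
 have "\<exists>C\<in>graph_components E (V - S). \<exists>n. R ` {n..} \<subseteq> C & R' ` {n..} \<subseteq> C"
  using assms unfolding ray_equiv_def by simp
 then show ?thesis by (elim bexE exE conjE) (rule that)
qed

lemma equiv_refl: "ray E R ==> (R, R) \<in> ray_equiv V E"
proof (rule ray_equivI)
 fix S :: "'v set" assume a: "ray E R" "finite S"
 show "\<exists>C\<in>graph_components E (V - S). \<exists>n. R ` {n..} \<subseteq> C & R ` {n..} \<subseteq> C"
  by (rule tail_in_component[OF a]) blast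
qed

lemma equiv_sym: "(R, R') \<in> ray_equiv V E ==> (R', R) \<in> ray_equiv V E"
proof (rule ray_equivI)
 fix S assume a: "(R, R') \<in> ray_equiv V E" "S \<subseteq> V" "finite S"
 obtain C n where "C \<in> graph_components E (V - S)" "R ` {n..} \<subseteq> C" "R' ` {n..} \<subseteq> C"
  using ray_equivE[OF a] .
 then show "\<exists>C\<in>graph_components E (V - S). \<exists>n. R' ` {n..} \<subseteq> C & R ` {n..} \<subseteq> C"
  by (intro bexI exI conjI)
qed (erule ray_equivD)+

lemma tails_mono: "R ` {n..} \<subseteq> C ==> n \<le> m ==> R ` {m..} \<subseteq> C" for m n :: nat
 by (rule order_trans[OF image_mono]) (simp_all add: atLeast_subset_iff)

lemma equiv_trans:
 assumes "(R, R') \<in> ray_equiv V E" "(R', R'') \<in> ray_equiv V E"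
 shows "(R, R'') \<in> ray_equiv V E"
proof -
 have "\<exists>C\<in>graph_components E (V - S). \<exists>n. R ` {n..} \<subseteq> C & R'' ` {n..} \<subseteq> C" if S: "S \<subseteq> V" "finite S" for S
 proof -
  obtain C n where C: "C \<in> graph_components E (V - S)" "R ` {n..} \<subseteq> C" "R' ` {n..} \<subseteq> C"
   using ray_equivE[OF assms(1) S] .
  obtain C' n' where C': "C' \<in> graph_components E (V - S)" "R' ` {n'..} \<subseteq> C'" "R'' ` {n'..} \<subseteq> C'"
   using ray_equivE[OF assms(2) S] .
  have "R' (max n n') \<in> C" "R' (max n n') \<in> C'" using C(3) C'(2) by auto
  then have "C = C'" using component_unique[OF C(1) C'(1)] by auto
  then have "R ` {max n n'..} \<subseteq> C & R'' ` {max n n'..} \<subseteq> C"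
   using tails_mono[OF C(2)] tails_mono[OF C'(3)] by simp
  then show ?thesis by (intro bexI[OF _ C(1)] exI)
 qed
 then show ?thesis by (intro ray_equivI ray_equivD(1)[OF assms(1)] ray_equivD(2)[OF assms(2)])
qed

lemma equiv_ray: "equiv {R. ray E R} (ray_equiv V E)"
proof (rule equivI)
 show "ray_equiv V E \<subseteq> {R. ray E R} \<times> {R. ray E R}" by (auto simp: ray_equiv_def)
 show "refl_on {R. ray E R} (ray_equiv V E)" by (auto simp: refl_on_def equiv_refl)
 show "sym (ray_equiv V E)" by (auto simp: sym_def equiv_sym)
 show "trans (ray_equiv V E)" by (auto simp: trans_def intro: equiv_trans)
qed

text \<open>Only finitely many common vertices precede the tails that lie in components of
  \<open>V - S\<close>; a later one puts both tails into the same component.\<close>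

lemma equivI_common:
 assumes "ray E R" "ray E R'" "infinite (range R Int range R')"
 shows "(R, R') \<in> ray_equiv V E"
proof -
 have "\<exists>C\<in>graph_components E (V - S). \<exists>n. R ` {n..} \<subseteq> C & R' ` {n..} \<subseteq> C" if S: "S \<subseteq> V" "finite S" for S
 proof -
  obtain C n where C: "C \<in> graph_components E (V - S)" "R ` {n..} \<subseteq> C" using tail_in_component[OF assms(1) S(2)] .
  obtain C' n' where C': "C' \<in> graph_components E (V - S)" "R' ` {n'..} \<subseteq> C'" using tail_in_component[OF assms(2) S(2)] .
  have "infinite (range R Int range R' - (R ` {..<n} Un R' ` {..<n'}))" using assms(3) by simp
  then have "range R Int range R' - (R ` {..<n} Un R' ` {..<n'}) ~= {}" by (rule infinite_imp_nonempty)
  then obtain v where "v \<in> range R Int range R' - (R ` {..<n} Un R' ` {..<n'})" by (meson ex_in_conv)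
  then have v0: "v \<in> range R" "v \<in> range R'" "v \<notin> R ` {..<n}" "v \<notin> R' ` {..<n'}"
   by (simp_all only: Diff_iff Int_iff Un_iff de_Morgan_disj not_False_eq_True)
  obtain i where i: "v = R i" using v0(1) by (rule rangeE)
  obtain j where j: "v = R' j" using v0(2) by (rule rangeE)
  have "i \<ge> n" "j \<ge> n'" using v0(3,4) unfolding i[symmetric] using i j by (metis imageI lessThan_iff not_le)+
  then have "v \<in> C" "v \<in> C'" using C(2) C'(2) i j by (metis atLeast_iff imageI subsetD)+
  then have "C = C'" using component_unique[OF C(1) C'(1)] by auto
  then have "R ` {max n n'..} \<subseteq> C & R' ` {max n n'..} \<subseteq> C"
   using tails_mono[OF C(2)] tails_mono[OF C'(2)] by simp
  then show ?thesis by (intro bexI[OF _ C(1)] exI)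
 qed
 then show ?thesis by (intro ray_equivI assms)
qed

lemma ends_ray: "om \<in> ends V E ==> R \<in> om ==> ray E R"
 unfolding ends_def using equiv_ray by (metis in_quotient_imp_subset mem_Collect_eq subsetD)

lemma ends_equiv: "om \<in> ends V E ==> R \<in> om ==> R' \<in> om ==> (R, R') \<in> ray_equiv V E"
 unfolding ends_def using equiv_ray quotient_eq_iff by metis

lemma ends_closed: "om \<in> ends V E ==> R \<in> om ==> (R, R') \<in> ray_equiv V E ==> R' \<in> om"
 unfolding ends_def by (rule in_quotient_imp_closed[OF equiv_ray])

lemma ends_nonempty: "om \<in> ends V E ==> \<exists>R. R \<in> om"
 unfolding ends_def using equiv_ray in_quotient_imp_non_empty by fastforce

lemma ray_end:
 assumes "ray E R" obtains om where "om \<in> ends V E" "R \<in> om"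
 using that[of "ray_equiv V E `` {R}"] assms equiv_refl unfolding ends_def by (auto intro: quotientI)

lemma ends_eq: "om \<in> ends V E ==> om' \<in> ends V E ==> R \<in> om ==> R' \<in> om' ==> (R, R') \<in> ray_equiv V E ==> om = om'"
 unfolding ends_def using equiv_ray by (meson quotient_eqI)

lemma end_common:
 assumes "om \<in> ends V E" "R \<in> om" "ray E R'" "infinite (range R Int range R')"
 shows "R' \<in> om"
 using assms ends_closed equivI_common ends_ray by metis

lemma end_tail: "om \<in> ends V E ==> R \<in> om ==> (%i. R (n + i)) \<in> om"
proof (rule end_common)
 assume a: "om \<in> ends V E" "R \<in> om"
 have r: "ray E (%i. R (n + i))" using ends_ray[OF a] by (rule ray_tail)
 then show "ray E (%i. R (n + i))" .
 have "range R Int range (%i. R (n + i)) = range (%i. R (n + i))" by auto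
 then show "infinite (range R Int range (%i. R (n + i)))" using r unfolding ray_def using range_inj_infinite by metis
qed

text \<open>Justifies the definite description: two components that contain rays of the end both
  coincide with the component that contains tails of these two rays.\<close>

lemma end_comp:
 assumes w: "om \<in> ends V E" and S: "finite S" "S \<subseteq> V"
 shows end_comp_component: "end_comp V E S om \<in> graph_components E (V - S)"
  and end_comp_tail: "R \<in> om ==> \<exists>n. R ` {n..} \<subseteq> end_comp V E S om"
proof -
 define P where "P = (%C. C \<in> graph_components E (V - S) & (\<exists>R\<in>om. range R \<subseteq> C))"
 obtain R0 where R0: "R0 \<in> om" using ends_nonempty[OF w] by auto
 obtain C n where C: "C \<in> graph_components E (V - S)" "R0 ` {n..} \<subseteq> C" using tail_in_component[OF ends_ray[OF w R0] S(1)] .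
 have "range (%i. R0 (n + i)) \<subseteq> C" using C(2) by auto
 then have PC: "P C" using C(1) end_tail[OF w R0] by (auto simp: P_def)
 have uniq: "C' = C''" if PP: "P C'" "P C''" for C' C''
 proof -
  obtain R R' where r: "R \<in> om" "range R \<subseteq> C'" "R' \<in> om" "range R' \<subseteq> C''" using PP unfolding P_def by (elim conjE bexE)
  obtain D n where D: "D \<in> graph_components E (V - S)" "R ` {n..} \<subseteq> D" "R' ` {n..} \<subseteq> D"
   using ray_equivE[OF ends_equiv[OF w r(1,3)] S(2,1)] .
  have mem: "R n \<in> C'" "R' n \<in> C''" "R n \<in> D" "R' n \<in> D"
   using subsetD[OF r(2), of "R n"] subsetD[OF r(4), of "R' n"] subsetD[OF D(2), of "R n"] subsetD[OF D(3), of "R' n"] by auto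
  have comps: "C' \<in> graph_components E (V - S)" "C'' \<in> graph_components E (V - S)" using PP by (simp_all add: P_def)
  show ?thesis using component_unique[OF comps(1) D(1) mem(1,3)] component_unique[OF comps(2) D(1) mem(2,4)] by simp
 qed
 have eq: "end_comp V E S om = C"
  unfolding end_comp_def P_def[symmetric] by (rule the_equality[of P, OF PC]) (rule uniq[OF _ PC])
 show "end_comp V E S om \<in> graph_components E (V - S)" using eq C by simp
 show "\<exists>n. R ` {n..} \<subseteq> end_comp V E S om" if R: "R \<in> om"
 proof -
  obtain C' n where C': "C' \<in> graph_components E (V - S)" "R ` {n..} \<subseteq> C'" using tail_in_component[OF ends_ray[OF w R] S(1)] .
  have "range (%i. R (n + i)) \<subseteq> C'" using C'(2) by auto
  then have "P C'" using C'(1) end_tail[OF w R] unfolding P_def by blast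
  then have "C' = C" by (rule uniq[OF _ PC])
  then show ?thesis using C'(2) eq by (intro exI) simp
 qed
qed

lemma end_compI:
 assumes "om \<in> ends V E" "finite S" "S \<subseteq> V" "R \<in> om" "!!m. m \<ge> n ==> R m \<notin> S" "conn E (V - S) (R n) u"
 shows "u \<in> end_comp V E S om"
proof -
 obtain m where m: "R ` {m..} \<subseteq> end_comp V E S om" using end_comp_tail[OF assms(1-4)] by auto
 have r: "ray E R" using assms ends_ray by blast
 have "R ` {n..} \<subseteq> V - S" using assms(5) ray_V[OF r] by auto
 then have "conn E (V - S) (R (max m n)) (R n)" using ray_tail_connected[OF r, of n] by (intro graph_connectedD[of E "R ` {n..}"]) auto
 then show ?thesis using component_closed[OF end_comp_component[OF assms(1-3)], of "R (max m n)"] conn_trans[OF _ assms(6), of "R (max m n)"] subsetD[OF m, of "R (max m n)"] by auto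
qed

lemma end_comp_conn:
 assumes "om \<in> ends V E" "finite S" "S \<subseteq> V" "u \<in> end_comp V E S om" "v \<in> end_comp V E S om"
 shows "conn E (V - S) u v"
 by (rule graph_connectedD[OF component_connected[OF end_comp_component[OF assms(1-3)]] assms(4,5)
   component_subset[OF end_comp_component[OF assms(1-3)]]])

lemma end_comp_subset: "om \<in> ends V E ==> finite S ==> S \<subseteq> V ==> end_comp V E S om \<subseteq> V - S"
 using end_comp_component component_subset by metis

lemma end_comp_closed:
 assumes "om \<in> ends V E" "finite S" "S \<subseteq> V" "u \<in> end_comp V E S om" "{u, v} \<in> E" "v \<notin> S"
 shows "v \<in> end_comp V E S om"
 using component_closed[OF end_comp_component[OF assms(1-3)] assms(4)] conn_edge[OF assms(5)] assms(4,6)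
  end_comp_subset[OF assms(1-3)] edgeD[OF assms(5)] by blast

lemma end_comp_mono:
 assumes "om \<in> ends V E" "finite S'" "S \<subseteq> S'" "S' \<subseteq> V"
 shows "end_comp V E S' om \<subseteq> end_comp V E S om"
proof -
 have S: "finite S" "S \<subseteq> V" using assms finite_subset by auto
 obtain R where R: "R \<in> om" using ends_nonempty[OF assms(1)] by auto
 obtain n where n: "R ` {n..} \<subseteq> end_comp V E S om" using end_comp_tail[OF assms(1) S R] by auto
 obtain m where m: "R ` {m..} \<subseteq> end_comp V E S' om" using end_comp_tail[OF assms(1,2,4) R] by auto
 have "R (max n m) \<in> end_comp V E S om Int end_comp V E S' om" using n m by auto
 then show ?thesis
  using component_absorbs[OF end_comp_component[OF assms(1) S] component_connected[OF end_comp_component[OF assms(1,2,4)]]]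
   end_comp_subset[OF assms(1,2,4)] assms(3) by blast
qed

text \<open>The separators \<open>T\<close> of a sequence of counterexamples converging to the end have a largest
  common part \<open>K\<close> shared by infinitely many of them; then already \<open>S \<union> K\<close> separates
  infinitely many of the \<open>u\<close> from the end.\<close>

lemma localize:
 assumes w: "om \<in> ends V E" and R: "R \<in> om" and S0: "finite S0" "S0 \<subseteq> V" and S: "finite S" "S \<subseteq> V"
  and hyp: "!!u T. u \<in> end_comp V E S0 om ==> finite T ==> card T < k ==> u \<notin> T ==> \<exists>n. conn E (V - T) u (R n)"
 obtains S1 where "finite S1" "S \<subseteq> S1" "S1 \<subseteq> V"
  "!!u T. u \<in> end_comp V E S1 om ==> finite T ==> card T < k ==> u \<notin> T ==> \<exists>n. conn E (V - S - T) u (R n)"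
proof (rule ccontr)
 assume neg: "~ thesis"
 note pos = that
 have "\<exists>u T. u \<in> end_comp V E S1 om & finite T & card T < k & u \<notin> T & (\<forall>n. ~ conn E (V - S - T) u (R n))"
  if "finite S1" "S \<subseteq> S1" "S1 \<subseteq> V" for S1
  using neg pos[OF that] by blast
 then obtain u0 T0 where uT: "!!S1. finite S1 ==> S \<subseteq> S1 ==> S1 \<subseteq> V ==>
   u0 S1 \<in> end_comp V E S1 om & finite (T0 S1) & card (T0 S1) < k & u0 S1 \<notin> T0 S1 & (\<forall>n. ~ conn E (V - S - T0 S1) (u0 S1) (R n))"
  by metis
 \<comment> \<open>Each separator is put into the next finite set, so that later points
   \<open>u n\<close> lie beyond all earlier separators.\<close>
 define SS where "SS = (%n. ((%S1. S1 Un (T0 S1 Int V)) ^^ n) (S Un S0))"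
 have SS: "finite (SS n) & S Un S0 \<subseteq> SS n & SS n \<subseteq> V" for n
 proof (induction n)
  case 0 then show ?case using S S0 by (simp add: SS_def)
 next
  case (Suc n)
  have "SS (Suc n) = SS n Un (T0 (SS n) Int V)" by (simp add: SS_def)
  then show ?case using Suc uT[of "SS n"] by auto
 qed
 have SSmono: "SS m \<subseteq> SS n" if "m \<le> n" for m n
  by (rule lift_Suc_mono_le[OF _ that]) (auto simp: SS_def)
 define u where "u = (%n. u0 (SS n))"
 define T where "T = (%n. T0 (SS n) Int V)"
 have u: "u n \<in> end_comp V E (SS n) om" for n using uT[of "SS n"] SS[of n] by (auto simp: u_def)
 have T: "finite (T n) & card (T n) < k" and uTn: "u n \<notin> T n" for n
  using uT[of "SS n"] SS[of n] card_mono[of "T0 (SS n)" "T n"] by (auto simp: u_def T_def)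
 have nc: "~ conn E (V - S - T n) (u n) (R m)" for n m
 proof -
  have "V - S - T n = V - S - T0 (SS n)" by (auto simp: T_def)
  then show ?thesis using uT[of "SS n"] SS[of n] by (auto simp: u_def)
 qed
 have TSS: "T n \<subseteq> SS (Suc n)" for n by (auto simp: T_def SS_def)
 \<comment> \<open>\<open>T n\<close> alone does not cut \<open>u n\<close> off from
   \<open>R\<close>, but together with \<open>S\<close> it does. So a connection enters
   \<open>S\<close>, and it does so from a neighbour of \<open>S\<close>. Local finiteness leaves
   finitely many neighbours, hence infinitely many \<open>n\<close> share one.\<close>
 have "\<exists>t. t \<in> nbrs S & conn E (V - S - T n) (u n) t" for n
 proof -
  have "u n \<in> end_comp V E S0 om" using u[of n] end_comp_mono[OF w, of "SS n" S0] SS[of n] by auto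
  then obtain m where c: "conn E (V - T n) (u n) (R m)" using hyp[of "u n" "T n"] T[of n] uTn[of n] by auto
  have "u n \<notin> S" using u[of n] end_comp_subset[OF w, of "SS n"] SS[of n] by auto
  have eq: "V - T n - S = V - S - T n" by auto
  obtain s t where "s \<in> S" "conn E (V - S - T n) (u n) t" "{t, s} \<in> E"
   using conn_hit[OF c, of S] nc[of n m] \<open>u n \<notin> S\<close> unfolding eq by auto
  then have "t \<in> nbrs S" unfolding nbrs_def by (metis (mono_tags, lifting) insert_commute mem_Collect_eq)
  then show ?thesis using \<open>conn E (V - S - T n) (u n) t\<close> by blast
 qed
 then obtain t where t: "!!n. t n \<in> nbrs S & conn E (V - S - T n) (u n) (t n)" by metis
 obtain K where K: "finite K" "infinite {i. K \<subseteq> T i}" "!!t. t \<notin> K ==> finite {i. insert t K \<subseteq> T i}"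
  by (rule bounded_sets_kernel[of T k]) (use T in auto)
 have "finite (t ` {i. K \<subseteq> T i})" by (rule finite_subset[OF _ finite_nbrs_set[OF S(1)]]) (use t in auto)
 then obtain i0 where i0: "infinite {i \<in> {i. K \<subseteq> T i}. t i = t i0}" using pigeonhole_infinite[OF K(2)] by blast
 define I where "I = {i. K \<subseteq> T i & t i = t i0}"
 have I: "infinite I" "I \<subseteq> {i. K \<subseteq> T i}" using i0 by (auto simp: I_def)
 \<comment> \<open>A path from the common neighbour to \<open>R\<close> outside
   \<open>S Un K\<close> is finite and would miss some \<open>T i\<close>, thereby joining
   \<open>u i\<close> to \<open>R\<close>.\<close>
 have "~ conn E (V - S - K) (t i0) (R n)" for n
 proof
  assume c: "conn E (V - S - K) (t i0) (R n)"
  obtain p where p: "gpath E p" "hd p = t i0" "last p = R n" "set p \<subseteq> V - S - K" using conn_imp_gpath[OF c] .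
  obtain i where i: "i \<in> I" "set p Int T i = {}"
   by (rule kernel_avoids[of T K "set p" I]) (use T K I p in auto)
  have "conn E (V - S - T i) (t i0) (R n)" using gpath_conn_hd_last[OF p(1), of "V - S - T i"] p(2-4) i(2) by auto
  moreover have "t i = t i0" using i(1) by (simp add: I_def)
  ultimately show False using conn_trans[of E "V - S - T i" "u i" "t i0" "R n"] t[of i] nc[of i n] by simp
 qed
 note no = this
 obtain i where i: "i \<in> I" using infinite_imp_nonempty[OF I(1)] by blast
 obtain j where j: "j \<in> I" "j > i" using I(1) by (meson infinite_nat_iff_unbounded)
 \<comment> \<open>For a late \<open>j\<close>, \<open>K\<close> lies in \<open>SS j\<close>, so
   \<open>u j\<close> lies in the component of the end beyond \<open>S Un K\<close>. Outside
   \<open>S Un K\<close> it is thus joined to \<open>R\<close>, but it is also joined to the common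
   neighbour.\<close>
 have KS: "K \<subseteq> SS j" using i I(2) TSS[of i] SSmono[of "Suc i" j] j(2) by auto
 have fin: "finite (S Un K)" "S Un K \<subseteq> V" using S K(1) KS SS[of j] by auto
 have "S Un K \<subseteq> SS j" using KS SS[of j] by auto
 then have uj: "u j \<in> end_comp V E (S Un K) om" using u[of j] end_comp_mono[OF w, of "SS j" "S Un K"] SS[of j] by auto
 obtain n where "R ` {n..} \<subseteq> end_comp V E (S Un K) om" using end_comp_tail[OF w fin R] by auto
 then have "conn E (V - (S Un K)) (u j) (R n)" using end_comp_conn[OF w fin uj] by auto
 moreover have "conn E (V - (S Un K)) (u j) (t i0)"
  using t[of j] j(1) conn_mono[of E "V - S - T j" "u j" "t j" E "V - (S Un K)"] by (auto simp: I_def)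
 moreover have "V - (S Un K) = V - S - K" by auto
 ultimately show False using no[of n] conn_trans[OF conn_sym[of E "V - S - K" "u j" "t i0"]] by auto
qed

end

lemma even_card_sym_diff:
 assumes "finite A" "finite B"
 shows "even (card ((A - B) Un (B - A))) \<longleftrightarrow> (even (card A) \<longleftrightarrow> even (card B))"
proof -
 have "card ((A - B) Un (B - A)) = card (A - B) + card (B - A)"
  using assms by (intro card_Un_disjoint) auto
 moreover have "card A = card (A - B) + card (A Int B)"
  using card_Un_disjoint[of "A - B" "A Int B"] assms by (auto simp: Un_Diff_Int)
 moreover have "card B = card (B - A) + card (B Int A)"
  using card_Un_disjoint[of "B - A" "B Int A"] assms by (auto simp: Un_Diff_Int)
 moreover have "card (B Int A) = card (A Int B)" by (simp add: Int_commute)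
 ultimately show ?thesis by presburger
qed

subsection \<open>Cycles and double rays as periodic sequences\<close>

definition seq_edges :: "(int => 'v) => 'v set set" where
 "seq_edges d = {{d i, d (i + 1)} | i. True}"

text \<open>Covers injective sequences, that is, double rays, as well as periodic ones that run
  around a cycle of length at least three. Parity and minimality are thus proved once for
  both.\<close>

definition locally_inj :: "(int => 'v) => bool" where
 "locally_inj d \<longleftrightarrow> (\<forall>i j. d i = d j --> d (i + 1) = d (j + 1) & d (i - 1) = d (j - 1)) &
  (\<forall>i. d i ~= d (i + 1) & d (i - 1) ~= d (i + 1))"

lemma seq_edges_at:
 assumes "locally_inj d"
 shows "{e\<in>seq_edges d. d i \<in> e} = {{d (i - 1), d i}, {d i, d (i + 1)}}"
  and "{d (i - 1), d i} ~= {d i, d (i + 1)}"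
proof -
 have eq: "d i = d j ==> d (i + 1) = d (j + 1) & d (i - 1) = d (j - 1)" for i j using assms unfolding locally_inj_def by metis
 have ne: "d i ~= d (i + 1)" "d (i - 1) ~= d (i + 1)" for i using assms unfolding locally_inj_def by metis+
 show "{e\<in>seq_edges d. d i \<in> e} = {{d (i - 1), d i}, {d i, d (i + 1)}}"
 proof (intro equalityI subsetI)
  fix e assume "e \<in> {e\<in>seq_edges d. d i \<in> e}"
  then obtain j where e: "e = {d j, d (j + 1)}" and "d i = d j \<or> d i = d (j + 1)" by (auto simp: seq_edges_def)
  then show "e \<in> {{d (i - 1), d i}, {d i, d (i + 1)}}" using eq[of i j] eq[of i "j + 1"] by auto
 next
  fix e assume "e \<in> {{d (i - 1), d i}, {d i, d (i + 1)}}"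
  then consider "e = {d (i - 1), d (i - 1 + 1)}" | "e = {d i, d (i + 1)}" by auto
  then show "e \<in> {e\<in>seq_edges d. d i \<in> e}" unfolding seq_edges_def by cases auto
 qed
 show "{d (i - 1), d i} ~= {d i, d (i + 1)}" using ne[of i] by (auto simp: doubleton_eq_iff)
qed

lemma seq_edges_even:
 assumes "locally_inj d" shows "finite {e\<in>seq_edges d. v \<in> e}" "even (card {e\<in>seq_edges d. v \<in> e})"
proof -
 have "finite {e\<in>seq_edges d. v \<in> e} & even (card {e\<in>seq_edges d. v \<in> e})"
 proof (cases "\<exists>i. v = d i")
  case True
  then obtain i where "v = d i" by auto
  then show ?thesis using seq_edges_at[OF assms, of i] by simp
 next
  case False
  then have e: "{e\<in>seq_edges d. v \<in> e} = {}" by (auto simp: seq_edges_def)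
  show ?thesis unfolding e by simp
 qed
 then show "finite {e\<in>seq_edges d. v \<in> e}" "even (card {e\<in>seq_edges d. v \<in> e})" by auto
qed

text \<open>Even degree at \<open>d (i + 1)\<close> forces the edges before and after this vertex to
  be both in \<open>B\<close> or both outside, and this propagates in both directions.\<close>

lemma seq_edges_minimal:
 assumes d: "locally_inj d" and B: "B \<subseteq> seq_edges d" "B ~= {}" and ev: "!!i. even (card {e\<in>B. d i \<in> e})"
 shows "B = seq_edges d"
proof -
 let ?e = "%i. {d i, d (i + 1)}"
 have step: "?e i \<in> B \<longleftrightarrow> ?e (i + 1) \<in> B" for i
 proof -
  have at: "{e\<in>seq_edges d. d (i + 1) \<in> e} = {?e i, ?e (i + 1)}" "?e i ~= ?e (i + 1)"
   using seq_edges_at[OF d, of "i + 1"] by (simp_all add: add.assoc)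
  have "{e\<in>B. d (i + 1) \<in> e} = {?e i, ?e (i + 1)} Int B" using at(1) B(1) by auto
  then have "even (card ({?e i, ?e (i + 1)} Int B))" using ev[of "i + 1"] by simp
  then show ?thesis using at(2) by (cases "?e i \<in> B"; cases "?e (i + 1) \<in> B") auto
 qed
 obtain k where k: "?e k \<in> B" using B by (auto simp: seq_edges_def)
 have "?e i \<in> B" for i
 proof (induction i rule: int_induct[where k=k])
  case base then show ?case by (rule k)
 next
  case (step1 i) then show ?case using step by blast
 next
  case (step2 i) then show ?case using step[of "i - 1"] by simp
 qed
 then show ?thesis using B(1) by (auto simp: seq_edges_def)
qed

lemma double_ray_seq: "double_ray_edges d = seq_edges d" "inj d ==> locally_inj d"
 by (auto simp: double_ray_edges_def seq_edges_def locally_inj_def inj_eq)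

text \<open>The cycle is unrolled by reducing indices modulo its length; length at least three keeps
  the two neighbours of a vertex distinct.\<close>

lemma cycle_seq:
 assumes "distinct p" "length p \<ge> 3"
 obtains d where "cycle_edges p = seq_edges d" "locally_inj d" "range d = set p"
proof -
 let ?L = "int (length p)"
 define d where "d = (%i. p ! nat (i mod ?L))"
 have L: "?L \<ge> 3" using assms(2) by simp
 have lt: "nat (i mod ?L) < length p" for i
  using L pos_mod_sign[of ?L i] pos_mod_bound[of ?L i] by linarith
 have deq: "d i = d j \<longleftrightarrow> i mod ?L = j mod ?L" for i j
 proof -
  have "d i = d j \<longleftrightarrow> nat (i mod ?L) = nat (j mod ?L)" unfolding d_def by (rule nth_eq_iff_index_eq[OF assms(1) lt lt])
  also have "\<dots> \<longleftrightarrow> i mod ?L = j mod ?L" using L pos_mod_sign[of ?L i] pos_mod_sign[of ?L j] by (intro eq_nat_nat_iff) linarith+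
  finally show ?thesis .
 qed
 have dn: "d (int i) = p ! i" if "i < length p" for i using that by (simp add: d_def)
 have succ: "d (int i + 1) = p ! (Suc i mod length p)" for i
 proof -
  have "(int i + 1) mod ?L = int (Suc i mod length p)" by (simp add: zmod_int add.commute)
  then show ?thesis by (simp add: d_def)
 qed
 have "cycle_edges p = seq_edges d"
 proof (intro equalityI subsetI)
  fix e assume "e \<in> cycle_edges p"
  then obtain i where "i < length p" "e = {p ! i, p ! (Suc i mod length p)}" by (auto simp: cycle_edges_def)
  then have "e = {d (int i), d (int i + 1)}" using dn succ by simp
  then show "e \<in> seq_edges d" by (auto simp: seq_edges_def)
 next
  fix e assume "e \<in> seq_edges d"
  then obtain i where e: "e = {d i, d (i + 1)}" by (auto simp: seq_edges_def)
  let ?i = "nat (i mod ?L)"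
  have "0 \<le> i mod ?L" by (rule pos_mod_sign) (use L in linarith)
  then have ii: "int ?i = i mod ?L" by (rule nat_0_le)
  have dd: "d i = d (int ?i)" "d (i + 1) = d (int ?i + 1)" unfolding ii deq by (simp_all add: mod_add_left_eq)
  have "e = {p ! ?i, p ! (Suc ?i mod length p)}" unfolding e dd dn[OF lt] succ ..
  then show "e \<in> cycle_edges p" using lt[of i] by (auto simp: cycle_edges_def)
 qed
 moreover have "locally_inj d"
 proof -
  have "d i ~= d (i + 1) & d (i - 1) ~= d (i + 1)" for i
  proof -
   have "~ ?L dvd 1" "~ ?L dvd 2" using L zdvd_imp_le[of ?L 1] zdvd_imp_le[of ?L 2] by auto
   
   moreover have "i - (i + 1) = - 1" "i - 1 - (i + 1) = - 2" by simp_all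
   ultimately show ?thesis unfolding deq mod_eq_dvd_iff by (simp only: dvd_minus_iff not_False_eq_True simp_thms)
  qed
  moreover have "d (i + 1) = d (j + 1) & d (i - 1) = d (j - 1)" if "d i = d j" for i j
   using that unfolding deq mod_eq_dvd_iff by simp
  ultimately show ?thesis unfolding locally_inj_def by blast
 qed
 moreover have "range d = set p"
 proof (intro equalityI subsetI)
  fix v assume "v \<in> range d"
  then show "v \<in> set p" using lt by (auto simp: d_def)
 next
  fix v assume "v \<in> set p"
  then obtain i where "i < length p" "v = p ! i" by (auto simp: in_set_conv_nth)
  then show "v \<in> range d" using dn[of i] by (metis rangeI)
 qed
 ultimately show ?thesis by (rule that)
qed

text \<open>\<open>R' n\<close> receives the index \<open>-(n + 1)\<close>, so the edge joining the
  two starts lies between the indices \<open>-1\<close> and \<open>0\<close>.\<close>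

lemma double_ray_of_rays:
 assumes "ray E R" "ray E R'" "range R Int range R' = {}" "{R 0, R' 0} \<in> E"
 defines "d \<equiv> %i::int. if i \<ge> 0 then R (nat i) else R' (nat (- i - 1))"
 shows "inj d" "double_ray_edges d \<subseteq> E" "!!n. d (int n) = R n" "!!n. d (- int (Suc n)) = R' n" "{R 0, R' 0} \<in> double_ray_edges d"
proof -
 have i: "inj R" "inj R'" and e: "!!i. {R i, R (Suc i)} \<in> E" "!!i. {R' i, R' (Suc i)} \<in> E" using assms by (auto simp: ray_def)
 show "inj d"
 proof (rule injI)
  fix x y assume "d x = d y"
  moreover have "R a ~= R' b" for a b using assms(3) by auto
  ultimately show "x = y" using i by (auto simp: d_def inj_eq split: if_splits dest: not_sym)
 qed
 have "{d i, d (i + 1)} \<in> E" for i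
 proof -
  consider "i \<ge> 0" | "i = -1" | "i < -1" by linarith
  then show ?thesis
  proof cases
   case 1
   then have "nat (i + 1) = Suc (nat i)" by simp
   then show ?thesis using 1 e(1)[of "nat i"] by (simp add: d_def)
  next
   case 2 then show ?thesis using assms(4) by (simp add: d_def insert_commute)
  next
   case 3
   then have "nat (- i - 1) = Suc (nat (- (i + 1) - 1))" by simp
   then show ?thesis using 3 e(2)[of "nat (- (i + 1) - 1)"] by (simp add: d_def insert_commute)
  qed
 qed
 then show "double_ray_edges d \<subseteq> E" by (auto simp: double_ray_edges_def)
 show "d (int n) = R n" for n by (simp add: d_def)
 show "d (- int (Suc n)) = R' n" for n by (simp add: d_def)
 have "{R 0, R' 0} = {d (-1), d (-1 + 1)}" by (simp add: d_def insert_commute)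
 then show "{R 0, R' 0} \<in> double_ray_edges d" unfolding double_ray_edges_def by blast
qed

lemma double_ray_edge_sets_mono: "C \<subseteq> E ==> double_ray_edge_sets C \<subseteq> double_ray_edge_sets E"
 by (auto simp: double_ray_edge_sets_def)

lemma finite_circuits_mono: "C \<subseteq> E ==> finite_circuits C \<subseteq> finite_circuits E"
 by (auto simp: finite_circuits_def)

lemma circuit_or_ray_seq:
 assumes "Z \<in> finite_circuits C Un double_ray_edge_sets C"
 obtains d where "Z = seq_edges d" "locally_inj d" "Z \<subseteq> C"
proof (cases "Z \<in> finite_circuits C")
 case True
 then obtain p where p: "Z = cycle_edges p" "distinct p" "length p \<ge> 3" "Z \<subseteq> C" by (auto simp: finite_circuits_def)
 obtain d where "cycle_edges p = seq_edges d" "locally_inj d" using cycle_seq[OF p(2,3)] .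
 then show ?thesis using that p by simp
next
 case False
 then obtain d where "Z = double_ray_edges d" "inj d" "Z \<subseteq> C" using assms by (auto simp: double_ray_edge_sets_def)
 then show ?thesis using that double_ray_seq by metis
qed

context lfgraph
begin

subsection \<open>Cuts\<close>

definition bd :: "'v set => 'v set set" where
 "bd Q = {e\<in>E. \<exists>x\<in>Q. \<exists>y\<in>V - Q. e = {x, y}}"

lemma bd_iff: assumes "{x, y} \<in> E" shows "{x, y} \<in> bd Q \<longleftrightarrow> (x \<in> Q \<longleftrightarrow> y \<notin> Q)"
 using assms edgeD[OF assms] by (auto simp: bd_def doubleton_eq_iff)

lemma bd_subset: "bd Q \<subseteq> E" by (auto simp: bd_def)

lemma bd_cases: assumes "e \<in> bd Q" obtains x y where "e = {x, y}" "x \<in> Q" "y \<in> V - Q" "{x, y} \<in> E"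
 using assms by (auto simp: bd_def)

lemma bd_sym_diff: "bd ((Q - Q') Un (Q' - Q)) = (bd Q - bd Q') Un (bd Q' - bd Q)"
proof (rule set_eqI)
 fix e
 show "e \<in> bd ((Q - Q') Un (Q' - Q)) \<longleftrightarrow> e \<in> (bd Q - bd Q') Un (bd Q' - bd Q)"
 proof (cases "e \<in> E")
  case True
  obtain x y where e: "e = {x, y}" using edge_ex[OF True] by metis
  show ?thesis using True unfolding e by (auto simp: bd_iff)
 next
  case False then show ?thesis using bd_subset by blast
 qed
qed

lemma bd_star: "v \<in> V ==> bd {v} = {e\<in>E. v \<in> e}"
proof (rule set_eqI)
 fix e assume v: "v \<in> V"
 show "e \<in> bd {v} \<longleftrightarrow> e \<in> {e\<in>E. v \<in> e}"
 proof (cases "e \<in> E")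
  case True
  obtain x y where e: "e = {x, y}" "x ~= y" using edge_ex[OF True] by metis
  show ?thesis using True unfolding e(1) using e(2) by (auto simp: bd_iff)
 qed (use bd_subset in auto)
qed

lemma finite_touch: "finite K ==> finite {e\<in>E. e Int K ~= {}}"
proof -
 assume K: "finite K"
 have "{e\<in>E. e Int K ~= {}} \<subseteq> (\<Union>v\<in>K Int V. {e\<in>E. v \<in> e})"
 proof
  fix e assume "e \<in> {e\<in>E. e Int K ~= {}}"
  then obtain v where v: "e \<in> E" "v \<in> e" "v \<in> K" by blast
  obtain x y where xy: "e = {x, y}" "x ~= y" "x \<in> V" "y \<in> V" using edge_ex[OF v(1)] .
  then have "v \<in> V" using v(2) by auto
  then show "e \<in> (\<Union>v\<in>K Int V. {e\<in>E. v \<in> e})" using v by blast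
 qed
 then show ?thesis using K finite_star by (meson IntD2 finite_Int finite_UN_I finite_subset)
qed

lemma finite_bd: "finite K ==> finite (bd K)"
 by (rule finite_subset[OF _ finite_touch]) (auto simp: bd_def)

lemma bd_union: "bd (A Un B) \<subseteq> bd A Un bd B"
 by (auto simp: bd_def)

lemma bd_compl: "bd (V - Q) = bd Q"
proof (rule set_eqI)
 fix e
 show "e \<in> bd (V - Q) \<longleftrightarrow> e \<in> bd Q"
 proof (cases "e \<in> E")
  case True
  obtain x y where e: "e = {x, y}" "x \<in> V" "y \<in> V" using edge_ex[OF True] by metis
  show ?thesis using True e(2,3) unfolding e(1) by (auto simp: bd_iff)
 qed (use bd_subset in auto)
qed

text \<open>The cut of a finite set is the sum of the stars of its vertices and inherits their
  parity.\<close>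

lemma even_cut_of_even_degrees:
 assumes "finite K" "K \<subseteq> V" "C \<subseteq> E" "!!v. v \<in> K ==> even (card {e\<in>C. v \<in> e})"
 shows "even (card (C Int bd K))"
 using assms(1,2,4)
proof (induction K rule: finite_induct)
 case empty
 have "bd {} = {}" by (simp add: bd_def)
 then show ?case by simp
next
 case (insert v K)
 have v: "v \<in> V" using insert by simp
 have eq: "insert v K = ({v} - K) Un (K - {v})" using insert by auto
 have "C Int bd (insert v K) = (C Int bd {v} - C Int bd K) Un (C Int bd K - C Int bd {v})"
  unfolding eq bd_sym_diff by blast
 moreover have "C Int bd {v} = {e\<in>C. v \<in> e}" using assms(3) bd_star[OF v] by auto
 then have "even (card (C Int bd {v}))" using insert.prems by simp
 moreover have "even (card (C Int bd K))" using insert by simp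
 moreover have "finite (C Int bd {v})" "finite (C Int bd K)" using finite_bd insert(1) by simp_all
 ultimately show ?case by (simp add: even_card_sym_diff)
qed

subsection \<open>The algebraic cycle space\<close>

lemma alg_iff: "C \<in> alg_cycle_space V E \<longleftrightarrow> C \<subseteq> E & (\<forall>v\<in>V. even (card {e\<in>C. v \<in> e}))"
proof -
 have "finite {e\<in>C. v \<in> e}" if "C \<subseteq> E" "v \<in> V" for v
  by (rule finite_subset[OF _ finite_star[OF that(2)]]) (use that in auto)
 then show ?thesis by (auto simp: alg_cycle_space_def)
qed

lemma alg_diff:
 assumes "C \<in> alg_cycle_space V E" "Z \<in> alg_cycle_space V E" "Z \<subseteq> C"
 shows "C - Z \<in> alg_cycle_space V E"
proof -
 have "even (card {e\<in>C - Z. v \<in> e})" if v: "v \<in> V" for v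
 proof -
  have "finite {e\<in>C. v \<in> e}" using assms v by (auto simp: alg_cycle_space_def)
  moreover have "{e\<in>C - Z. v \<in> e} = {e\<in>C. v \<in> e} - {e\<in>Z. v \<in> e}" by auto
  moreover have "{e\<in>Z. v \<in> e} \<subseteq> {e\<in>C. v \<in> e}" using assms(3) by auto
  ultimately have "card {e\<in>C - Z. v \<in> e} = card {e\<in>C. v \<in> e} - card {e\<in>Z. v \<in> e}"
   by (metis card_Diff_subset finite_subset)
  then show ?thesis using assms v by (auto simp: alg_iff)
 qed
 moreover have "C - Z \<subseteq> E" using assms(1) unfolding alg_iff by blast
 ultimately show ?thesis unfolding alg_iff by simp
qed

lemma seq_alg: "locally_inj d ==> seq_edges d \<subseteq> E ==> seq_edges d \<in> alg_cycle_space V E"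
 using seq_edges_even[of d] by (auto simp: alg_iff)

text \<open>Koenig's lemma, as the case of \<open>star_comb\<close> in which \<open>U\<close> is the
  whole component.\<close>

lemma ray_in_component:
 assumes C: "C \<subseteq> E" and x: "x \<in> V" and inf: "infinite {y. conn C V x y}"
 obtains R where "ray C R" "R 0 = x" "!!n. conn C V x (R n)"
proof -
 define K where "K = {y. conn C V x y}"
 have K: "K \<in> graph_components C V" using component_of[OF x] by (simp add: K_def)
 have 1: "graph_connected C K" using component_connected[OF K] .
 have 2: "finite {z\<in>K. {y, z} \<in> C}" if "y \<in> K" for y
 proof (rule finite_subset)
  show "{z\<in>K. {y, z} \<in> C} \<subseteq> {z. {y, z} \<in> E}" using C by auto
  show "finite {z. {y, z} \<in> E}" by (rule finite_nbrs) (use component_subset[OF K] that in auto)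
 qed
 have 3: "x \<in> K" using x by (simp add: K_def conn_refl)
 obtain R where "ray C R" "R 0 = x" "range R \<subseteq> K"
  by (rule star_comb[OF 1 3 2 order_refl]) (use inf in \<open>auto simp: K_def\<close>)
 then show ?thesis using that[of R] by (auto simp: K_def)
qed

text \<open>If \<open>C - {e}\<close> still joins the ends of \<open>e\<close>, a path closes to a
  cycle. Otherwise the components of \<open>C - {e}\<close> at both ends are infinite, and a ray in
  each of them forms a double ray with \<open>e\<close>.\<close>

lemma alg_edge:
 assumes C: "C \<in> alg_cycle_space V E" and e: "e \<in> C"
 obtains Z where "e \<in> Z" "Z \<in> finite_circuits C Un double_ray_edge_sets C"
proof -
 have CE: "C \<subseteq> E" using C by (simp add: alg_iff)
 obtain x y where xy: "e = {x, y}" "x ~= y" "x \<in> V" "y \<in> V" using edge_ex[OF subsetD[OF CE e]] .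
 define C' where "C' = C - {e}"
 have C'E: "C' \<subseteq> E" using CE by (auto simp: C'_def)
 show ?thesis
 proof (cases "conn C' V x y")
  case True
  obtain p where p: "gpath C' p" "hd p = x" "last p = y" "set p \<subseteq> V" using conn_imp_gpath[OF True] .
  let ?L = "length p"
  have ne: "p ~= []" and dist: "distinct p" and st: "!!i. Suc i < ?L ==> {p ! i, p ! Suc i} \<in> C'"
   using p(1) by (auto simp: gpath_def successively_conv_nth)
  have ends: "p ! 0 = x" "p ! (?L - 1) = y" using p ne by (auto simp: hd_conv_nth last_conv_nth)
  have "?L ~= 0" "?L ~= 1" using ne ends xy by auto
  moreover have "?L ~= 2"
  proof
   assume L: "?L = 2"
   then have "{x, y} \<in> C'" using st[of 0] ends by simp
   then show False using xy by (simp add: C'_def)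
  qed
  ultimately have L: "?L \<ge> 3" by linarith
  have "cycle_edges p \<subseteq> C"
  proof
   fix f assume "f \<in> cycle_edges p"
   then obtain i where i: "i < ?L" "f = {p ! i, p ! (Suc i mod ?L)}" by (auto simp: cycle_edges_def)
   show "f \<in> C"
   proof (cases "Suc i < ?L")
    case True then show ?thesis using st[of i] i by (simp add: C'_def)
   next
    case False
    then have "Suc i = ?L" using i by simp
    then have "i = ?L - 1" "Suc i mod ?L = 0" by auto
    then have "f = e" using i ends xy(1) by (simp add: insert_commute)
    then show ?thesis using e by simp
   qed
  qed
  moreover have "e \<in> cycle_edges p"
  proof -
   have "Suc (?L - 1) = ?L" using L by simp
   then have "Suc (?L - 1) mod ?L = 0" "?L - 1 < ?L" by simp_all
   then show ?thesis unfolding cycle_edges_def using ends xy(1) by (metis (mono_tags, lifting) insert_commute mem_Collect_eq)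
  qed
  ultimately show ?thesis using dist L that[of "cycle_edges p"] by (auto simp: finite_circuits_def)
 next
  case False
  have inf: "infinite {z. conn C' V u z}" if uv: "e = {u, v}" "u \<in> V" "~ conn C' V u v" for u v
  proof
   let ?K = "{z. conn C' V u z}"
   assume fin: "finite ?K"
   have KV: "?K \<subseteq> V" by (auto dest: conn_right)
   \<comment> \<open>A finite component would have a cut that meets \<open>C\<close> in
     \<open>e\<close> alone, against the even degrees.\<close>
   have "C Int bd ?K = {e}"
   proof (intro equalityI subsetI)
    fix f assume "f \<in> C Int bd ?K"
    then have f: "f \<in> C" "f \<in> bd ?K" by auto
    obtain a b where ab: "f = {a, b}" "a \<in> ?K" "b \<in> V - ?K" using f(2) by (rule bd_cases)
    show "f \<in> {e}"
    proof (rule ccontr)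
     assume "f \<notin> {e}"
     then have "{a, b} \<in> C'" using f ab by (simp add: C'_def)
     then have "conn C' V u b" using ab by (auto intro: conn_step)
     then show False using ab by simp
    qed
   next
    fix f assume f: "f \<in> {e}"
    have "u \<in> ?K" "v \<notin> ?K" using uv by (simp_all add: conn_refl)
    then have "{u, v} \<in> bd ?K" using bd_iff[of u v ?K] uv(1) e CE by auto
    then show "f \<in> C Int bd ?K" using f e uv by simp
   qed
   moreover have "even (card (C Int bd ?K))"
    by (rule even_cut_of_even_degrees[OF fin KV CE]) (use C KV in \<open>auto simp: alg_iff\<close>)
   ultimately show False by simp
  qed
  have F': "~ conn C' V y x" using False conn_sym[of C' V y x] by blast
  obtain R where R: "ray C' R" "R 0 = x" "!!n. conn C' V x (R n)"
   using ray_in_component[OF C'E xy(3) inf[OF xy(1,3) False]] by metis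
  obtain R' where R': "ray C' R'" "R' 0 = y" "!!n. conn C' V y (R' n)"
   using ray_in_component[OF C'E xy(4) inf[OF _ xy(4) F']] xy(1) by (metis insert_commute)
  have rr: "ray C R" "ray C R'" using R(1) R'(1) by (auto simp: ray_def C'_def)
  have disj: "range R Int range R' = {}"
  proof (rule ccontr)
   assume "range R Int range R' ~= {}"
   then obtain n m where "R n = R' m" by auto
   then have "conn C' V x y" using conn_trans[OF R(3)[of n], of y] conn_sym[OF R'(3)[of m]] by simp
   then show False using False by simp
  qed
  have ee: "{R 0, R' 0} \<in> C" using R R' xy e by simp
  show ?thesis using double_ray_of_rays[OF rr disj ee] xy(1) R(2) R'(2)
   by (intro that) (auto simp: double_ray_edge_sets_def)
 qed
qed

lemma alg_circuit: "Z \<in> finite_circuits E Un double_ray_edge_sets E ==> Z \<in> alg_cycle_space V E"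
 by (rule circuit_or_ray_seq) (auto intro: seq_alg)

lemma minimal_alg: "minimal_nonzero (alg_cycle_space V E) = finite_circuits E Un double_ray_edge_sets E"
proof (intro equalityI subsetI)
 fix C assume "C \<in> minimal_nonzero (alg_cycle_space V E)"
 then have C: "C \<in> alg_cycle_space V E" "C ~= {}" and min: "!!B. B \<in> alg_cycle_space V E ==> B ~= {} ==> B \<subseteq> C ==> B = C"
  by (auto simp: minimal_nonzero_def)
 have CE: "C \<subseteq> E" using C by (simp add: alg_iff)
 obtain e where "e \<in> C" using C by auto
 then obtain Z where Z: "e \<in> Z" "Z \<in> finite_circuits C Un double_ray_edge_sets C" using alg_edge[OF C(1)] by metis
 have Z2: "Z \<in> finite_circuits E Un double_ray_edge_sets E" using Z(2) finite_circuits_mono[OF CE] double_ray_edge_sets_mono[OF CE] by blast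
 have "Z \<subseteq> C" using Z(2) by (rule circuit_or_ray_seq)
 then have "Z = C" using min[of Z] alg_circuit[OF Z2] Z(1) by auto
 then show "C \<in> finite_circuits E Un double_ray_edge_sets E" using Z2 by simp
next
 fix Z assume Z: "Z \<in> finite_circuits E Un double_ray_edge_sets E"
 obtain d where d: "Z = seq_edges d" "locally_inj d" "Z \<subseteq> E" using circuit_or_ray_seq[OF Z] .
 have "B = Z" if B: "B \<in> alg_cycle_space V E" "B ~= {}" "B \<subseteq> Z" for B
 proof -
  have "d i \<in> V" for i
  proof -
   have "{d i, d (i + 1)} \<in> E" using d by (auto simp: seq_edges_def)
   then show ?thesis using edgeD by blast
  qed
  then show ?thesis using seq_edges_minimal[OF d(2), of B] B d(1) by (auto simp: alg_iff)
 qed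
 moreover have "Z ~= {}" using d by (auto simp: seq_edges_def)
 ultimately show "Z \<in> minimal_nonzero (alg_cycle_space V E)" using alg_circuit[OF Z] by (auto simp: minimal_nonzero_def)
qed

text \<open>Peel off a circuit or double ray through an edge of \<open>F Int C\<close>. It meets
  \<open>F\<close> evenly, and the remaining element of the space meets \<open>F\<close> in fewer
  edges.\<close>

lemma finite_orthogonal_alg:
 assumes F: "finite F" and orth: "!!Z. Z \<in> finite_circuits E Un double_ray_edge_sets E ==> edge_orthogonal F Z"
  and C: "C \<in> alg_cycle_space V E"
 shows "edge_orthogonal F C"
 using C
proof (induction "card (F Int C)" arbitrary: C rule: less_induct)
 case less
 show ?case
 proof (cases "F Int C = {}")
  case True then show ?thesis by (simp add: edge_orthogonal_def)
 next
  case False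
  then obtain e where e: "e \<in> F" "e \<in> C" by auto
  obtain Z where Z: "e \<in> Z" "Z \<in> finite_circuits C Un double_ray_edge_sets C" using alg_edge[OF less.prems e(2)] .
  have CE: "C \<subseteq> E" using less.prems by (simp add: alg_iff)
  have Z2: "Z \<in> finite_circuits E Un double_ray_edge_sets E" using Z(2) finite_circuits_mono[OF CE] double_ray_edge_sets_mono[OF CE] by blast
  have ZC: "Z \<subseteq> C" using Z(2) by (rule circuit_or_ray_seq)
  have "F Int (C - Z) \<subset> F Int C" using e Z(1) by auto
  then have "card (F Int (C - Z)) < card (F Int C)" using F by (intro psubset_card_mono) auto
  then have "edge_orthogonal F (C - Z)" using less.hyps alg_diff[OF less.prems alg_circuit[OF Z2] ZC] by blast
  moreover have "edge_orthogonal F Z" by (rule orth[OF Z2])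
  moreover have "card (F Int C) = card (F Int (C - Z)) + card (F Int Z)"
  proof -
   have "F Int C = (F Int (C - Z)) Un (F Int Z)" using ZC by auto
   then show ?thesis using card_Un_disjoint[of "F Int (C - Z)" "F Int Z"] F by auto
  qed
  ultimately show ?thesis using F by (simp add: edge_orthogonal_def)
 qed
qed

end

section \<open>Rays that zigzag through infinitely many given edges\<close>

lemma chain_ray:
 assumes gp: "!!n::nat. gpath E (p n)" and ext: "!!n. \<exists>q. q ~= [] & p (Suc n) = p n @ q"
 obtains R where "ray E R" "!!n i. i < length (p n) ==> R i = p n ! i" "!!n. length (p n) > n"
  "range R = (\<Union>n. set (p n))"
proof -
 have len: "n < length (p n)" for n
 proof (induction n)
  case 0 then show ?case using gp[of 0] by (simp add: gpath_def)
 next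
  case (Suc n)
  obtain q where "q ~= []" "p (Suc n) = p n @ q" using ext by blast
  then show ?case using Suc by (cases q) auto
 qed
 have pre: "\<exists>q. p (m + k) = p m @ q" for m k
 proof (induction k)
  case (Suc k)
  then obtain q where q: "p (m + k) = p m @ q" by auto
  obtain q' where "p (Suc (m + k)) = p (m + k) @ q'" using ext by blast
  then show ?case using q by simp
 qed simp
 have nth: "p (m + k) ! i = p m ! i" if "i < length (p m)" for m k i
  using pre[of m k] that by (auto simp: nth_append)
 define R where "R = (%i. p i ! i)"
 have R: "R i = p n ! i" if "i < length (p n)" for n i
 proof (cases "i \<le> n")
  case True then show ?thesis using nth[OF len, of i "n - i"] by (simp add: R_def)
 next
  case False then show ?thesis using nth[OF that, of "i - n"] by (simp add: R_def)
 qed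
 have "inj R"
 proof (rule linorder_injI)
  fix i j :: nat assume "i < j"
  then have ij: "i < length (p j)" "j < length (p j)" using len[of j] by auto
  have "distinct (p j)" using gp[of j] by (simp add: gpath_def)
  then have "p j ! i ~= p j ! j" using ij \<open>i < j\<close> by (simp add: nth_eq_iff_index_eq)
  then show "R i ~= R j" using R[OF ij(1)] R[OF ij(2)] by simp
 qed
 moreover have "{R i, R (Suc i)} \<in> E" for i
 proof -
  have l: "Suc i < length (p (Suc i))" by (rule len)
  then have "{p (Suc i) ! i, p (Suc i) ! Suc i} \<in> E" using gp[of "Suc i"] by (simp add: gpath_def successively_conv_nth)
  then show ?thesis using R[of i "Suc i"] R[OF l] l by simp
 qed
 ultimately have "ray E R" by (simp add: ray_def)
 moreover have "range R = (\<Union>n. set (p n))"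
 proof (intro equalityI subsetI)
  fix v assume "v \<in> range R"
  then obtain i where "v = R i" by (rule rangeE)
  then have "v \<in> set (p i)" using R[OF len[of i]] nth_mem[OF len[of i]] by simp
  then show "v \<in> (\<Union>n. set (p n))" by (rule UN_I[OF UNIV_I])
 next
  fix v assume "v \<in> (\<Union>n. set (p n))"
  then obtain n where "v \<in> set (p n)" by (rule UN_E)
  then obtain i where "i < length (p n)" "p n ! i = v" unfolding in_set_conv_nth by auto
  then show "v \<in> range R" using R[of i n] by (metis rangeI)
 qed
 ultimately show ?thesis using that R len by blast
qed

lemma ray_prepend:
 assumes w: "gpath E w" and R: "ray E R" and l: "last w = R b" and d: "!!i. i > b ==> R i \<notin> set w"
 defines "R' \<equiv> %i. if i < length w then w ! i else R (b + 1 + (i - length w))"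
 shows "ray E R'" "range R' \<subseteq> set w Un range R" "!!n. R' (length w + n) = R (b + 1 + n)"
proof -
 have ne: "w ~= []" and dist: "distinct w" and st: "!!i. Suc i < length w ==> {w ! i, w ! Suc i} \<in> E"
  using w by (auto simp: gpath_def successively_conv_nth)
 have injR: "inj R" and eR: "!!i. {R i, R (Suc i)} \<in> E" using R by (auto simp: ray_def)
 have "inj R'"
 proof (rule linorder_injI)
  fix i j :: nat assume ij: "i < j"
  consider "j < length w" | "i < length w" "j \<ge> length w" | "i \<ge> length w" using ij by linarith
  then show "R' i ~= R' j"
  proof cases
   case 1 then show ?thesis using ij dist by (simp add: R'_def nth_eq_iff_index_eq)
  next
   case 2
   have "R (b + 1 + (j - length w)) \<notin> set w" by (rule d) simp
   moreover have "w ! i \<in> set w" using 2(1) by simp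
   ultimately have "w ! i ~= R (b + 1 + (j - length w))" by metis
   moreover have "~ j < length w" using 2(2) by simp
   ultimately show ?thesis using 2(1) unfolding R'_def by (simp only: if_True if_False simp_thms)
  next
   case 3
   then show ?thesis using ij injR by (auto simp: R'_def inj_eq)
  qed
 qed
 moreover have "{R' i, R' (Suc i)} \<in> E" for i
 proof -
  consider "Suc i < length w" | "Suc i = length w" | "i \<ge> length w" by linarith
  then show ?thesis
  proof cases
   case 1 then show ?thesis using st[of i] by (simp add: R'_def)
  next
   case 2
   then have "w ! i = R b" using l ne by (simp add: last_conv_nth flip: 2)
   then show ?thesis using 2 eR[of b] by (simp add: R'_def flip: 2)
  next
   case 3
   then have "Suc i - length w = Suc (i - length w)" by simp
   then show ?thesis using 3 eR[of "b + 1 + (i - length w)"] by (simp add: R'_def)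
  qed
 qed
 ultimately show "ray E R'" by (simp add: ray_def)
 show "range R' \<subseteq> set w Un range R" by (auto simp: R'_def)
 show "R' (length w + n) = R (b + 1 + n)" for n by (simp add: R'_def)
qed

text \<open>\<open>A\<close> and \<open>B\<close> may coincide, in which case the path is an ear on
  a single ray. Its inner vertices avoid both rays, so it can be inserted between segments of
  them.\<close>

definition crossing :: "'v set set => 'v set set => (nat => 'v) => (nat => 'v) => 'v list => bool" where
 "crossing E F A B Q \<longleftrightarrow> gpath E Q & length Q \<ge> 2 & hd Q \<in> range A & last Q \<in> range B &
  set Q Int (range A Un range B) = {hd Q, last Q} & (\<exists>i. Suc i < length Q & {Q ! i, Q ! Suc i} \<in> F)"

lemma crossing_rev: assumes "crossing E F A B Q" shows "crossing E F B A (rev Q)"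
proof -
 have Q: "gpath E Q" "length Q \<ge> 2" "hd Q \<in> range A" "last Q \<in> range B"
  "set Q Int (range A Un range B) = {hd Q, last Q}" using assms by (auto simp: crossing_def)
 obtain i where i: "Suc i < length Q" "{Q ! i, Q ! Suc i} \<in> F" using assms by (auto simp: crossing_def)
 let ?j = "length Q - Suc (Suc i)"
 have "Suc ?j < length (rev Q)" using i by simp
 moreover have "rev Q ! ?j = Q ! Suc i" "rev Q ! Suc ?j = Q ! i" using i by (simp_all add: rev_nth Suc_diff_Suc)
 then have "{rev Q ! ?j, rev Q ! Suc ?j} \<in> F" using i(2) by (simp add: insert_commute)
 ultimately have "\<exists>i. Suc i < length (rev Q) & {rev Q ! i, rev Q ! Suc i} \<in> F" by blast
 then show ?thesis unfolding crossing_def using Q gpath_rev[OF Q(1)]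
  by (simp add: hd_rev last_rev Un_commute insert_commute)
qed

text \<open>The invariant is that the path \<open>p\<close> ends on the ray \<open>A\<close> and
  misses the rest of it. Walk along \<open>A\<close> to the start of a crossing chosen far out, then
  follow the crossing to \<open>B\<close>; the rest of \<open>B\<close> is then free again.\<close>

lemma zigzag_step:
 assumes A: "ray E A" and B: "ray E B" and AB: "A = B \<or> range A Int range B = {}"
  and AX: "range A Int X = {}"
  and hyp: "!!S. finite S ==> \<exists>Q. crossing E F A B Q & set Q Int S = {} & set Q Int X = {}"
  and p: "gpath E p" "set p Int X = {}" "last p = A m" "set p Int A ` {m<..} = {}"
 shows "\<exists>q b i. q ~= [] & gpath E (p @ q) & set (p @ q) Int X = {} & last (p @ q) = B b & set (p @ q) Int B ` {b<..} = {} &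
  Suc i < length (p @ q) & length p \<le> Suc i & {(p @ q) ! i, (p @ q) ! Suc i} \<in> F"
proof -
 have injA: "inj A" and injB: "inj B" using A B by (auto simp: ray_def)
 obtain M where M: "!!i. i \<ge> M ==> B i \<notin> set p" using ray_avoids[OF B, of "set p"] by auto
 \<comment> \<open>A crossing that avoids these initial segments starts on \<open>A\<close> beyond
   \<open>A m\<close> and ends on \<open>B\<close> beyond all vertices of \<open>p\<close> on
   \<open>B\<close>.\<close>
 define S where "S = set p Un A ` {..m} Un B ` {..M} Un B ` {..m} Un A ` {..M}"
 have "finite S" by (simp add: S_def)
 then obtain Q0 where Q0: "crossing E F A B Q0" "set Q0 Int S = {}" "set Q0 Int X = {}" using hyp by blast
 \<comment> \<open>On a single ray the crossing is traversed in the direction of the ray; otherwise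
   the segment leading to its start would run through its end.\<close>
 have "\<exists>Q a b. crossing E F A B Q & set Q Int S = {} & set Q Int X = {} & hd Q = A a & last Q = B b & (A = B --> a < b)"
 proof -
  obtain a b where ab: "hd Q0 = A a" "last Q0 = B b" using Q0(1) by (auto simp: crossing_def)
  show ?thesis
  proof (cases "A = B --> a < b")
   case True then show ?thesis using Q0 ab by blast
  next
   case False
   have "hd Q0 ~= last Q0"
   proof -
    have "distinct Q0" "length Q0 \<ge> 2" using Q0(1) by (auto simp: crossing_def gpath_def)
    then show ?thesis by (cases Q0) auto
   qed
   then have "b < a" using False ab by (metis linorder_neqE_nat)
   moreover have "hd (rev Q0) = A b" "last (rev Q0) = B a" using ab False by (simp_all add: hd_rev last_rev)
   moreover have "crossing E F A B (rev Q0)" using crossing_rev[OF Q0(1)] False by simp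
   ultimately show ?thesis using Q0(2,3) by (metis set_rev)
  qed
 qed
 then obtain Q a b where Q: "crossing E F A B Q" "set Q Int S = {}" "set Q Int X = {}" and ab: "hd Q = A a" "last Q = B b"
  and lt: "A = B ==> a < b" by blast
 have gQ: "gpath E Q" and Qne: "Q ~= []" and QAB: "set Q Int (range A Un range B) = {A a, B b}"
  using Q(1) ab by (auto simp: crossing_def gpath_def)
 have aQ: "A a \<in> set Q" "B b \<in> set Q" using Qne ab hd_in_set last_in_set by metis+
 have am: "a > m"
 proof (rule ccontr)
  assume "~ ?thesis"
  then have "A a \<in> S" by (auto simp: S_def)
  then show False using aQ Q(2) by blast
 qed
 have bM: "b > M"
 proof (rule ccontr)
  assume "~ ?thesis"
  then have "B b \<in> S" by (auto simp: S_def)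
  then show False using aQ Q(2) by blast
 qed
 have neq: "A i ~= B b" if "i < a" for i
 proof (cases "A = B")
  case True then show ?thesis using lt[OF True] that injB by (auto simp: inj_eq)
 next
  case False then show ?thesis using AB by (metis disjoint_iff rangeI)
 qed
 \<comment> \<open>Both \<open>A m\<close> and \<open>A a\<close> are left out, as they already
   belong to \<open>p\<close> and to \<open>Q\<close>.\<close>
 define seg where "seg = map A [Suc m..<a]"
 have sset: "set seg = A ` {Suc m..<a}" by (simp add: seg_def)
 have sQ: "set seg Int set Q = {}"
 proof (rule ccontr)
  assume "~ ?thesis"
  then obtain i where i: "i < a" "A i \<in> set Q" unfolding sset by auto
  then have "A i = A a \<or> A i = B b" using QAB by blast
  then show False using neq[OF i(1)] i(1) injA by (auto simp: inj_eq)
 qed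
 have sp: "set p Int set seg = {}" using p(4) unfolding sset by auto
 have pQ: "set p Int set Q = {}" using Q(2) by (auto simp: S_def)
 have edA: "{A i, A (Suc i)} \<in> E" for i using A by (simp add: ray_def)
 have gps: "gpath E (p @ seg) & last (p @ seg) = A (a - 1)"
 proof (cases "seg = []")
  case True
  then have "a - 1 = m" using am by (simp add: seg_def)
  then show ?thesis using True p by simp
 next
  case False
  then have am': "Suc m \<le> a - 1" "Suc (a - 1) = a" by (auto simp: seg_def)
  note sg = ray_seg_gpath[OF A am'(1), unfolded am'(2), folded seg_def]
  have "gpath E (p @ seg)" by (rule gpath_append[OF p(1) sg(1) sp]) (use p(3) sg(2) edA in simp)
  then show ?thesis using sg(3) False by simp
 qed
 have "gpath E ((p @ seg) @ Q)"
 proof (rule gpath_append)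
  show "set (p @ seg) Int set Q = {}" using sQ pQ by auto
  have "Suc (a - 1) = a" using am by simp
  then show "{last (p @ seg), hd Q} \<in> E" using gps ab(1) edA[of "a - 1"] by simp
 qed (use gps gQ in auto)
 then have 1: "gpath E (p @ (seg @ Q))" by simp
 have 2: "set (p @ (seg @ Q)) Int X = {}" using p(2) Q(3) AX unfolding set_append sset by blast
 have 3: "last (p @ (seg @ Q)) = B b" using Qne ab by simp
 have 4: "set (p @ (seg @ Q)) Int B ` {b<..} = {}"
 proof (rule ccontr)
  assume "~ ?thesis"
  then obtain j where j: "j > b" "B j \<in> set p \<or> B j \<in> set seg \<or> B j \<in> set Q" by auto
  have "B j \<notin> set p" using M[of j] j bM by simp
  moreover have "B j ~= A i" if "i \<le> a" for i
  proof (cases "A = B")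
   case True then show ?thesis using lt[OF True] that j injB by (auto simp: inj_eq)
  next
   case False then show ?thesis using AB by (metis disjoint_iff rangeI)
  qed
  note ne = this
  have "B j \<notin> set seg"
  proof
   assume "B j \<in> set seg"
   then obtain i where "i < a" "B j = A i" unfolding sset by auto
   then show False using ne[of i] by simp
  qed
  moreover have "B j \<notin> set Q"
  proof
   assume "B j \<in> set Q"
   then have "B j = A a \<or> B j = B b" using QAB by blast
   then show False using ne[of a] j injB by (auto simp: inj_eq)
  qed
  ultimately show False using j by blast
 qed
 obtain i where i: "Suc i < length Q" "{Q ! i, Q ! Suc i} \<in> F" using Q(1) by (auto simp: crossing_def)
 let ?i = "length (p @ seg) + i"
 have "{(p @ (seg @ Q)) ! ?i, (p @ (seg @ Q)) ! Suc ?i} \<in> F"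
  using i(2) nth_append_length_plus[of "p @ seg" Q i] nth_append_length_plus[of "p @ seg" Q "Suc i"] by simp
 moreover have "Suc ?i < length (p @ (seg @ Q))" "length p \<le> Suc ?i" using i by simp_all
 ultimately show ?thesis using 1 2 3 4 Qne by (intro exI[of _ "seg @ Q"] exI[of _ b] exI[of _ ?i]) simp
qed

text \<open>Steps from \<open>A\<close> to \<open>B\<close> and back alternate, and the flag
  \<open>sw\<close> records the current ray. Each step adds an edge of \<open>F\<close> past the old
  path, and all the finite paths end on one of the two rays, so the limit meets the rays infinitely
  often.\<close>

lemma zigzag:
 assumes A: "ray E A" and B: "ray E B" and AB: "A = B \<or> range A Int range B = {}"
  and X: "range A Int X = {}" "range B Int X = {}"
  and hyp: "!!S. finite S ==> \<exists>Q. crossing E F A B Q & set Q Int S = {} & set Q Int X = {}"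
 obtains Z where "ray E Z" "range Z Int X = {}" "infinite {i. {Z i, Z (Suc i)} \<in> F}" "infinite (range Z Int (range A Un range B))"
proof -
 have hyp': "\<exists>Q. crossing E F B A Q & set Q Int S = {} & set Q Int X = {}" if "finite S" for S
  using hyp[OF that] crossing_rev set_rev by metis
 define cur where "cur = (%sw. if sw then B else A)"
 define Inv where "Inv = (%(p, sw). gpath E p & set p Int X = {} & (\<exists>m. last p = cur sw m & set p Int cur sw ` {m<..} = {}))"
 define St where "St = (%(p, sw::bool) (p', sw'::bool). (\<exists>q i. q ~= [] & p' = p @ q & Suc i < length p' & length p \<le> Suc i & {p' ! i, p' ! Suc i} \<in> F))"
 have step: "\<exists>y. Inv y & St x y" if Ix: "Inv x" for x
 proof -
  obtain p sw where x: "x = (p, sw)" by (cases x)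
  obtain m where p: "gpath E p" "set p Int X = {}" "last p = cur sw m" "set p Int cur sw ` {m<..} = {}"
   using Ix unfolding x Inv_def by auto
  have "\<exists>q b i. q ~= [] & gpath E (p @ q) & set (p @ q) Int X = {} & last (p @ q) = cur (~ sw) b & set (p @ q) Int cur (~ sw) ` {b<..} = {} &
  Suc i < length (p @ q) & length p \<le> Suc i & {(p @ q) ! i, (p @ q) ! Suc i} \<in> F"
  proof (rule zigzag_step[where A="cur sw" and B="cur (~ sw)"])
   show "cur sw = cur (~ sw) \<or> range (cur sw) Int range (cur (~ sw)) = {}" using AB by (auto simp: cur_def)
   show "range (cur sw) Int X = {}" using X by (simp add: cur_def)
   show "\<exists>Q. crossing E F (cur sw) (cur (~ sw)) Q & set Q Int S = {} & set Q Int X = {}" if "finite S" for S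
    using hyp[OF that] hyp'[OF that] by (simp add: cur_def)
  qed (use A B p in \<open>auto simp: cur_def\<close>)
  then obtain q b i where q: "q ~= []" "gpath E (p @ q)" "set (p @ q) Int X = {}" "last (p @ q) = cur (~ sw) b" "set (p @ q) Int cur (~ sw) ` {b<..} = {}"
  "Suc i < length (p @ q)" "length p \<le> Suc i" "{(p @ q) ! i, (p @ q) ! Suc i} \<in> F" by (elim exE conjE)
  have "Inv (p @ q, ~ sw)" unfolding Inv_def prod.case using q(2-5) by blast
  moreover have "St x (p @ q, ~ sw)" unfolding St_def x prod.case using q by blast
  ultimately show ?thesis by blast
 qed
 have "Inv ([A 0], False)" using A X(1) by (auto simp: Inv_def cur_def ray_def inj_eq intro!: exI[of _ 0])
 then have "\<exists>f. \<forall>n. Inv (f n) & St (f n) (f (Suc n))"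
  using dependent_nat_choice[of "%n. Inv" "%n. St"] step by blast
 then obtain f where f: "!!n. Inv (f n)" "!!n. St (f n) (f (Suc n))" by blast
 define p where "p = (%n. fst (f n))"
 have gp: "gpath E (p n)" "set (p n) Int X = {}" "last (p n) \<in> range A Un range B" for n
  using f(1)[of n] by (auto simp: Inv_def p_def cur_def split: prod.splits if_splits)
 have st: "\<exists>q i. q ~= [] & p (Suc n) = p n @ q & Suc i < length (p (Suc n)) & length (p n) \<le> Suc i & {p (Suc n) ! i, p (Suc n) ! Suc i} \<in> F" for n
  using f(2)[of n] by (auto simp: St_def p_def split: prod.splits)
 obtain Z where Z: "ray E Z" "!!n i. i < length (p n) ==> Z i = p n ! i" "!!n. length (p n) > n" "range Z = (\<Union>n. set (p n))"
  by (rule chain_ray[of E p]) (use gp(1) st in blast)+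
 have "range Z Int X = {}" using gp(2) unfolding Z(4) by blast
 moreover have "infinite {i. {Z i, Z (Suc i)} \<in> F}"
  unfolding infinite_nat_iff_unbounded_le
 proof
  fix n
  obtain i where i: "Suc i < length (p (Suc n))" "length (p n) \<le> Suc i" "{p (Suc n) ! i, p (Suc n) ! Suc i} \<in> F" using st[of n] by blast
  have "i \<ge> n" using i(2) Z(3)[of n] by simp
  moreover have "{Z i, Z (Suc i)} \<in> F" using i Z(2)[of i "Suc n"] Z(2)[OF i(1)] by simp
  ultimately show "\<exists>i\<ge>n. i \<in> {i. {Z i, Z (Suc i)} \<in> F}" by blast
 qed
 moreover have "infinite (range Z Int (range A Un range B))"
 proof -
  have "infinite {i. Z i \<in> range A Un range B}"
   unfolding infinite_nat_iff_unbounded_le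
  proof
   fix n
   have l: "length (p n) - 1 < length (p n)" "length (p n) - 1 \<ge> n" using Z(3)[of n] by auto
   have "p n ~= []" using Z(3)[of n] by auto
   then have "Z (length (p n) - 1) = last (p n)" using Z(2)[OF l(1)] by (simp add: last_conv_nth)
   then show "\<exists>i\<ge>n. i \<in> {i. Z i \<in> range A Un range B}" using gp(3)[of n] l(2) by (metis mem_Collect_eq)
  qed
  moreover have "inj_on Z {i. Z i \<in> range A Un range B}" using Z(1) by (auto simp: ray_def intro: inj_on_subset)
  ultimately have "infinite (Z ` {i. Z i \<in> range A Un range B})" using finite_imageD by blast
  moreover have "Z ` {i. Z i \<in> range A Un range B} \<subseteq> range Z Int (range A Un range B)" by blast
  ultimately show ?thesis by (rule infinite_super[rotated])
 qed
 ultimately show ?thesis using that Z(1) by blast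
qed

lemma gpath_restrict:
 assumes "gpath {e\<in>E. e \<subseteq> W} p" "hd p \<in> W" shows "gpath E p" "set p \<subseteq> W"
proof -
 show "gpath E p" by (rule gpath_mono[OF assms(1)]) auto
 show "set p \<subseteq> W"
 proof
  fix v assume "v \<in> set p"
  then have "conn {e\<in>E. e \<subseteq> W} UNIV (hd p) v" by (intro gpath_conn[OF assms(1)]) (use assms(1) in \<open>auto simp: gpath_def\<close>)
  then show "v \<in> W" using conn_right[OF conn_restrict_edges[OF _ assms(2)]] by blast
 qed
qed

text \<open>If every disjoint family had at most two rays, the supremum would be at most two; so
  some actual family has at least three.\<close>

lemma degree_ge3:
 assumes "end_vertex_degree om \<ge> 3"
 obtains R1 R2 R3 where "R1 \<in> om" "R2 \<in> om" "R3 \<in> om" "range R1 Int range R2 = {}" "range R1 Int range R3 = {}" "range R2 Int range R3 = {}"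
proof -
 let ?F = "{\<R>. \<R> \<subseteq> om & finite \<R> & pairwise (%R R'. range R Int range R' = {}) \<R>}"
 have "\<exists>\<R>\<in>?F. card \<R> \<ge> 3"
 proof (rule ccontr)
  assume "~ ?thesis"
  then have "enat (card \<R>) \<le> 2" if "\<R> \<in> ?F" for \<R> using that by (auto simp: numeral_eq_enat not_le)
  then have "end_vertex_degree om \<le> 2" unfolding end_vertex_degree_def by (rule SUP_least)
  then have "(3::enat) \<le> 2" using assms by (rule order_trans[rotated])
  then show False by simp
 qed
 then obtain \<R> where R: "\<R> \<subseteq> om" "pairwise (%R R'. range R Int range R' = {}) \<R>" "card \<R> \<ge> 3" by blast
 obtain T where T: "T \<subseteq> \<R>" "card T = 3" using obtain_subset_with_card_n[OF R(3)] by metis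
 then obtain x y z where "T = {x, y, z}" "x ~= y" "y ~= z" "x ~= z" by (auto simp: card_3_iff)
 then show ?thesis using that[of x y z] T(1) R(1,2) unfolding pairwise_def by blast
qed

context lfgraph
begin

text \<open>Two-connectedness in the form that \<open>localize\<close> takes as its hypothesis for
  \<open>k = 2\<close>.\<close>

lemma conn_V_minus_small:
 assumes "u \<in> V" "u \<notin> T" "finite T" "card T < 2" "ray E R"
 shows "\<exists>n. conn E (V - T) u (R n)"
proof (cases "T = {}")
 case True
 then show ?thesis using graph_connectedD[OF V_connected assms(1) ray_V[OF assms(5), of 0]] by auto
next
 case False
 then have "card T > 0" using assms(3) by (simp add: card_gt_0_iff)
 then have "card T = 1" using assms(4) by linarith
 then obtain t where T: "T = {t}" by (rule card_1_singletonE)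
 have "R 0 ~= R 1" using assms(5) by (simp add: ray_def inj_eq)
 then have "\<exists>n. R n ~= t" by metis
 then obtain n where "R n ~= t" ..
 then have "R n \<in> V - {t}" using ray_V[OF assms(5)] by simp
 then show ?thesis using graph_connectedD[OF V_delete_connected, of u t "R n"] assms(1,2) T by auto
qed

text \<open>Choose an edge of \<open>F\<close> so far out that no single vertex cuts its ends off
  from \<open>R1\<close> outside \<open>S\<close>. Menger's theorem for \<open>k = 2\<close> gives
  disjoint paths from the two ends to \<open>U\<close>, and the edge joins them to one path.\<close>

lemma local_crossing:
 assumes w: "om \<in> ends V E" and R1: "R1 \<in> om" "range R1 \<subseteq> U" and F: "F \<subseteq> E"
  and lim: "!!S. finite S ==> S \<subseteq> V ==> infinite (\<Union>F Int end_comp V E S om)" and S: "finite S"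
 shows "\<exists>Q. gpath E Q & length Q \<ge> 2 & set Q Int U = {hd Q, last Q} & (\<exists>i. Suc i < length Q & {Q ! i, Q ! Suc i} \<in> F) & set Q Int S = {}"
proof -
 define S' where "S' = S Int V"
 have S': "finite S'" "S' \<subseteq> V" using S by (auto simp: S'_def)
 have r1: "ray E R1" using ends_ray[OF w R1(1)] .
 obtain S1 where S1: "finite S1" "S' \<subseteq> S1" "S1 \<subseteq> V"
  and loc: "!!u T. u \<in> end_comp V E S1 om ==> finite T ==> card T < 2 ==> u \<notin> T ==> \<exists>n. conn E (V - S' - T) u (R1 n)"
 proof (rule localize[OF w R1(1) _ _ S', of "{}" 2])
  show "\<exists>n. conn E (V - T) u (R1 n)" if "u \<in> end_comp V E {} om" "finite T" "card T < 2" "u \<notin> T" for u T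
   using conn_V_minus_small[OF _ that(4,2,3) r1] that(1) end_comp_subset[OF w, of "{}"] by auto
 qed auto
 \<comment> \<open>Avoiding the neighbours of \<open>S1\<close> ensures that the other end of the
   edge lies in the same component.\<close>
 have "infinite (\<Union>F Int end_comp V E S1 om - nbrs S1)" using lim[OF S1(1,3)] finite_nbrs_set[OF S1(1)] by simp
 then have "\<Union>F Int end_comp V E S1 om - nbrs S1 ~= {}" by (rule infinite_imp_nonempty)
 then obtain u where "u \<in> \<Union>F Int end_comp V E S1 om - nbrs S1" by (meson ex_in_conv)
 then have u: "u \<in> \<Union>F" "u \<in> end_comp V E S1 om" "u \<notin> nbrs S1" by (simp_all only: Diff_iff Int_iff not_False_eq_True)
 obtain f where f: "f \<in> F" "u \<in> f" using u(1) by blast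
 have fE: "f \<in> E" using f F by blast
 obtain x y where xy: "f = {x, y}" "x ~= y" using edge_ex[OF fE] by metis
 define w' where "w' = (if u = x then y else x)"
 have w': "f = {u, w'}" "u ~= w'" using xy f(2) by (auto simp: w'_def)
 have uw: "{u, w'} \<in> E" using fE w'(1) by simp
 then have wu: "{w', u} \<in> E" by (simp add: insert_commute)
 have nS1: "w' \<notin> S1"
 proof
  assume "w' \<in> S1"
  then have "u \<in> nbrs S1" unfolding nbrs_def using wu by blast
  then show False using u(3) by simp
 qed
 have wC: "w' \<in> end_comp V E S1 om" by (rule end_comp_closed[OF w S1(1,3) u(2) uw nS1])
 define W where "W = V - S'"
 have CW: "end_comp V E S1 om \<subseteq> W" using end_comp_subset[OF w S1(1,3)] S1(2) by (auto simp: W_def)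
 have "linked 2 {e\<in>E. e \<subseteq> W} {u, w'} (U Int W)"
 proof (rule menger)
  show "\<forall>e\<in>{e\<in>E. e \<subseteq> W}. card e = 2" using edge_card by simp
  fix T :: "'v set" assume T: "finite T" "card T < 2"
  have "\<exists>a\<in>{u, w'}. a \<notin> T"
  proof (rule ccontr)
   assume "~ ?thesis"
   then have "{u, w'} \<subseteq> T" by blast
   then have "card {u, w'} \<le> card T" using T(1) by (rule card_mono[rotated])
   then show False using T(2) w'(2) by simp
  qed
  then obtain a where a: "a \<in> {u, w'}" "a \<notin> T" by blast
  then have "a \<in> end_comp V E S1 om" using u(2) wC by blast
  then obtain n where c: "conn E (V - S' - T) a (R1 n)" using loc[OF _ T a(2)] by blast
  have "V - S' - T = W Int - T" by (auto simp: W_def)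
  then have "conn {e\<in>E. e \<subseteq> W} (- T) a (R1 n)" using c conn_restrict_edges' by metis
  moreover have "R1 n \<in> U Int W" using R1(2) conn_right[OF c] by (auto simp: W_def)
  ultimately show "\<exists>a\<in>{u, w'}. \<exists>b\<in>U Int W. conn {e\<in>E. e \<subseteq> W} (- T) a b" using a(1) by blast
 qed
 then obtain g where g: "!!i. i < (2::nat) ==> ABpath {e\<in>E. e \<subseteq> W} {u, w'} (U Int W) (g i)"
  and gd: "!!i j. i < 2 ==> j < 2 ==> i ~= j ==> set (g i) Int set (g j) = {}" unfolding linked_def by blast
 have gg: "ABpath {e\<in>E. e \<subseteq> W} {u, w'} (U Int W) (g 0)" "ABpath {e\<in>E. e \<subseteq> W} {u, w'} (U Int W) (g 1)"
  by (rule g; simp)+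
 note g0 = ABpathD[OF gg(1)] and g1 = ABpathD[OF gg(2)]
 have hW: "hd (g 0) \<in> W" "hd (g 1) \<in> W" using g0(3) g1(3) subsetD[OF CW u(2)] subsetD[OF CW wC] by auto
 note q0 = gpath_restrict[OF g0(1) hW(1)] and q1 = gpath_restrict[OF g1(1) hW(2)]
 have disj: "set (g 0) Int set (g 1) = {}" by (rule gd) auto
 have "hd (g 0) ~= hd (g 1)" using disj hd_in_set[OF g0(2)] hd_in_set[OF g1(2)] by auto
 then have hd: "{hd (g 0), hd (g 1)} = f" using g0(3) g1(3) w'(1) by auto
 define Q where "Q = rev (g 0) @ g 1"
 have ne: "g 0 ~= []" "g 1 ~= []" using g0(2) g1(2) by auto
 have "gpath E Q" unfolding Q_def
  by (rule gpath_append) (use q0(1) q1(1) gpath_rev disj hd fE ne in \<open>auto simp: last_rev\<close>)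
 moreover have "length Q \<ge> 2" using ne by (cases "g 0"; cases "g 1") (auto simp: Q_def)
 moreover have "set Q Int U = {hd Q, last Q}"
 proof -
  have "set (g 0) Int U = {last (g 0)}" using g0(6) q0(2) by auto
  moreover have "set (g 1) Int U = {last (g 1)}" using g1(6) q1(2) by auto
  moreover have "hd Q = last (g 0)" "last Q = last (g 1)" using ne by (auto simp: Q_def hd_rev hd_append)
  ultimately show ?thesis by (auto simp: Q_def)
 qed
 moreover have "\<exists>i. Suc i < length Q & {Q ! i, Q ! Suc i} \<in> F"
 proof -
  let ?i = "length (g 0) - 1"
  have l: "?i < length (rev (g 0))" "Suc ?i = length (rev (g 0))" using ne by (auto simp: Suc_diff_Suc)
  have "Q ! ?i = hd (g 0)" using l ne unfolding Q_def by (simp add: nth_append rev_nth hd_conv_nth)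
  moreover have "Q ! Suc ?i = hd (g 1)" unfolding l(2) Q_def using ne nth_append_length_plus[of "rev (g 0)" "g 1" 0] by (simp add: hd_conv_nth)
  moreover have "Suc ?i < length Q" unfolding l(2) using ne by (simp add: Q_def)
  ultimately show ?thesis using hd f(1) by (intro exI[of _ ?i]) simp
 qed
 moreover have "set Q Int S = {}"
 proof -
  have "set Q \<subseteq> W" using q0(2) q1(2) by (auto simp: Q_def)
  then show ?thesis by (auto simp: W_def S'_def)
 qed
 ultimately show ?thesis by blast
qed

text \<open>A path that meets each ray only once replaces their initial segments; \<open>a\<close>,
  \<open>b\<close> and \<open>c\<close> locate the two tails in the double ray.\<close>

lemma join_rays:
 assumes Z: "ray E Z" and R: "ray E R" and disj: "range Z Int range R = {}"
 obtains d a b c where "inj d" "double_ray_edges d \<subseteq> E" "!!n. d (int n) = Z (a + n)" "!!n. d (- int (Suc (c + n))) = R (b + n)"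
proof -
 have "conn E V (Z 0) (R 0)" using graph_connectedD[OF V_connected ray_V[OF Z] ray_V[OF R]] by blast
 then obtain W where W: "ABpath E (range Z) (range R) W" "set W \<subseteq> V" using conn_imp_ABpath[of E V "Z 0" "R 0" "range Z" "range R"] by blast
 note Wd = ABpathD[OF W(1)]
 obtain a where a: "hd W = Z a" using Wd(3) by blast
 obtain b where b: "last W = R b" using Wd(4) by blast
 have "hd W ~= last W" using Wd(3,4) disj by (metis disjoint_iff)
 then have tl: "tl W ~= []" using Wd(2) by (cases W) auto
 define w where "w = tl W"
 have Ww: "W = Z a # w" using Wd(2) a by (cases W) (auto simp: w_def)
 have wne: "w ~= []" using tl by (simp add: w_def)
 have gw: "gpath E w" "{Z a, hd w} \<in> E" "Z a \<notin> set w" using Wd(1) wne unfolding Ww gpath_def successively_Cons by auto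
 have lw: "last w = R b" using b wne Ww by simp
 have dw: "R i \<notin> set w" if "i > b" for i
 proof
  assume "R i \<in> set w"
  then have "R i \<in> set W Int range R" using Ww by simp
  then have "R i = R b" using Wd(6) b by simp
  then show False using that R by (simp add: ray_def inj_eq)
 qed
 define R' where "R' = (%i. if i < length w then w ! i else R (b + 1 + (i - length w)))"
 note R' = ray_prepend[OF gw(1) R lw dw, folded R'_def]
 have Z': "ray E (%i. Z (a + i))" by (rule ray_tail[OF Z])
 have wZ: "set w Int range Z = {}" using Wd(5) gw(3) a unfolding Ww by auto
 have dj: "range (%i. Z (a + i)) Int range R' = {}" using R'(2) wZ disj by blast
 have ee: "{Z (a + 0), R' 0} \<in> E" using gw(2) wne by (simp add: R'_def hd_conv_nth)
 note dr = double_ray_of_rays[OF Z' R'(1) dj ee]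
 show ?thesis
 proof (rule that[OF dr(1,2)])
  show "(if 0 \<le> int n then Z (a + nat (int n)) else R' (nat (- int n - 1))) = Z (a + n)" for n by simp
  show "(if 0 \<le> - int (Suc (length w + n)) then Z (a + nat (- int (Suc (length w + n)))) else R' (nat (- (- int (Suc (length w + n))) - 1))) = R ((b + 1) + n)" for n
  proof -
   have "nat (- (- int (Suc (length w + n))) - 1) = length w + n" "~ 0 \<le> - int (Suc (length w + n))" by simp_all
   moreover have "R' (length w + n) = R (b + 1 + n)" by (simp add: R'_def)
   ultimately show ?thesis by (simp only: if_False)
  qed
 qed
qed

lemma infinite_set_double_ray:
 assumes F: "F \<subseteq> E" "infinite F" and deg: "!!om. om \<in> ends V E ==> end_vertex_degree om \<ge> 3"
 obtains d where "inj d" "double_ray_edges d \<subseteq> E" "infinite (F Int double_ray_edges d)"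
  "((%n. d (int n)), (%n. d (- int n))) \<in> ray_equiv V E"
proof -
 have UV: "\<Union>F \<subseteq> V" using F(1) simple by (auto simp: simple_graph_def)
 have infU: "infinite (\<Union>F)"
 proof
  assume "finite (\<Union>F)"
  then have "finite (Pow (\<Union>F))" by simp
  then have "finite F" by (rule finite_subset[rotated]) blast
  then show False using F(2) by simp
 qed
 have VE: "V ~= {}" using graph_connected_ne[OF V_connected] .
 then obtain r where r: "r \<in> V" by blast
 \<comment> \<open>Ends of edges of \<open>F\<close> accumulate at the end of this ray: for every
   finite \<open>S\<close>, infinitely many of them lie in its component.\<close>
 obtain R where R: "ray E R" and comb: "!!S. finite S ==> \<exists>n. (\<forall>m\<ge>n. R m \<notin> S) & infinite {u\<in>\<Union>F. conn E (V - S) (R n) u}"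
 proof (rule star_comb[OF V_connected r _ UV infU])
  show "finite {y\<in>V. {x, y} \<in> E}" if "x \<in> V" for x
   by (rule finite_subset[OF _ finite_nbrs[OF that]]) auto
 qed auto
 obtain om where w: "om \<in> ends V E" "R \<in> om" using ray_end[OF R] .
 have lim: "infinite (\<Union>F Int end_comp V E S om)" if S: "finite S" "S \<subseteq> V" for S
 proof -
  obtain n where n: "\<forall>m\<ge>n. R m \<notin> S" "infinite {u\<in>\<Union>F. conn E (V - S) (R n) u}" using comb[OF S(1)] by blast
  have "{u\<in>\<Union>F. conn E (V - S) (R n) u} \<subseteq> \<Union>F Int end_comp V E S om"
  proof
   fix u assume "u \<in> {u\<in>\<Union>F. conn E (V - S) (R n) u}"
   then show "u \<in> \<Union>F Int end_comp V E S om" using end_compI[OF w(1) S w(2), of n u] n(1) by simp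
  qed
  then show ?thesis using n(2) by (rule infinite_super)
 qed
 obtain R1 R2 R3 where Rs: "R1 \<in> om" "R2 \<in> om" "R3 \<in> om" "range R1 Int range R2 = {}" "range R1 Int range R3 = {}" "range R2 Int range R3 = {}"
  using degree_ge3[OF deg[OF w(1)]] .
 define r where "r = (%j::nat. if j = 0 then R1 else if j = 1 then R2 else R3)"
 have rw: "r j \<in> om" for j using Rs by (simp add: r_def)
 have rray: "ray E (r j)" for j using ends_ray[OF w(1) rw] .
 have rdisj: "range (r j) Int range (r k) = {}" if "j < 3" "k < 3" "j ~= k" for j k
  using that Rs(4-6) by (auto simp: r_def numeral_3_eq_3 less_Suc_eq)
 define U where "U = range (r 0) Un range (r 1) Un range (r 2)"
 have rU: "range (r j) \<subseteq> U" for j by (auto simp: U_def r_def)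
 define P where "P = (%S j k. \<exists>Q. gpath E Q & length Q \<ge> 2 & set Q Int U = {hd Q, last Q} & (\<exists>i. Suc i < length Q & {Q ! i, Q ! Suc i} \<in> F) & set Q Int S = {}
  & hd Q \<in> range (r j) & last Q \<in> range (r k))"
 \<comment> \<open>Each failing pair is defeated by a finite set, and the union of these nine sets
   would defeat all pairs at once, against \<open>local_crossing\<close>.\<close>
 have "\<exists>j<3. \<exists>k<3. \<forall>S. finite S --> P S j k"
 proof (rule ccontr)
  assume "~ ?thesis"
  then have "\<forall>j k. \<exists>S. j < 3 & k < 3 --> finite S & ~ P S j k" by blast
  then obtain S where S: "!!j k. j < 3 ==> k < 3 ==> finite (S j k) & ~ P (S j k) j k" by metis
  define SS where "SS = (\<Union>j<3. \<Union>k<3. S j k)"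
  have "finite SS" using S by (auto simp: SS_def)
  then obtain Q where Q: "gpath E Q" "length Q \<ge> 2" "set Q Int U = {hd Q, last Q}" "\<exists>i. Suc i < length Q & {Q ! i, Q ! Suc i} \<in> F" "set Q Int SS = {}"
   using local_crossing[OF w(1) rw rU F(1) lim, of SS] by blast
  have "\<exists>j<3. v \<in> range (r j)" if "v \<in> U" for v
  proof -
   have "v \<in> range (r 0) \<or> v \<in> range (r 1) \<or> v \<in> range (r 2)" using that by (simp add: U_def)
   moreover have "(0::nat) < 3" "(1::nat) < 3" "(2::nat) < 3" by simp_all
   ultimately show ?thesis by metis
  qed
  moreover have "hd Q \<in> U" "last Q \<in> U" using Q(3) by blast+
  ultimately obtain j k where jk: "j < 3" "k < 3" "hd Q \<in> range (r j)" "last Q \<in> range (r k)" by metis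
  have "S j k \<subseteq> SS" using jk by (auto simp: SS_def)
  then have "set Q Int S j k = {}" using Q(5) by blast
  then have "P (S j k) j k" using Q jk unfolding P_def by blast
  then show False using S[OF jk(1,2)] by blast
 qed
 then obtain j k where jk: "j < 3" "k < 3" and PS: "!!S. finite S ==> P S j k" by blast
 \<comment> \<open>The third ray is disjoint from the crossings, because these meet \<open>U\<close>
   only in their ends. It is kept for the other half of the double ray.\<close>
 have "\<exists>l<3. l ~= j & l ~= k" using jk by presburger
 then obtain l where l: "l < 3" "l ~= j" "l ~= k" by blast
 have jl: "range (r j) Int range (r l) = {}" "range (r k) Int range (r l) = {}" using rdisj l jk by metis+
 obtain Z where Z: "ray E Z" "range Z Int range (r l) = {}" "infinite {i. {Z i, Z (Suc i)} \<in> F}" "infinite (range Z Int (range (r j) Un range (r k)))"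
 proof (rule zigzag[OF rray rray _ jl])
  show "r j = r k \<or> range (r j) Int range (r k) = {}" using rdisj[OF jk] by (cases "j = k") auto
  fix S :: "'v set" assume "finite S"
  then obtain Q where Q: "gpath E Q" "length Q \<ge> 2" "set Q Int U = {hd Q, last Q}" "\<exists>i. Suc i < length Q & {Q ! i, Q ! Suc i} \<in> F" "set Q Int S = {}"
   "hd Q \<in> range (r j)" "last Q \<in> range (r k)" using PS unfolding P_def by blast
  have "Q ~= []" using Q(1) by (simp add: gpath_def)
  then have "hd Q \<in> set Q" "last Q \<in> set Q" by simp_all
  note hl = this
  have inU: "v = hd Q \<or> v = last Q" if "v \<in> set Q" "v \<in> U" for v
  proof -
   have "v \<in> set Q Int U" using that by (rule IntI)
   then show ?thesis unfolding Q(3) by simp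
  qed
  have "set Q Int (range (r j) Un range (r k)) = {hd Q, last Q}"
  proof (intro equalityI subsetI)
   fix v assume "v \<in> set Q Int (range (r j) Un range (r k))"
   then have "v \<in> set Q" "v \<in> U" using subsetD[OF rU[of j]] subsetD[OF rU[of k]] by (simp, metis IntD2 UnE)
   then show "v \<in> {hd Q, last Q}" using inU by simp
  next
   fix v assume "v \<in> {hd Q, last Q}"
   then show "v \<in> set Q Int (range (r j) Un range (r k))" using hl Q(6,7) by (metis IntI UnI1 UnI2 insertE singletonD)
  qed
  moreover have "set Q Int range (r l) = {}"
  proof (rule ccontr)
   assume "set Q Int range (r l) ~= {}"
   then obtain v where "v \<in> set Q" "v \<in> range (r l)" by (meson disjoint_iff)
   moreover from this have "v = hd Q \<or> v = last Q" using inU subsetD[OF rU[of l]] by metis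
   ultimately show False using Q(6,7) jl by (metis disjoint_iff)
  qed
  ultimately show "\<exists>Q. crossing E F (r j) (r k) Q & set Q Int S = {} & set Q Int range (r l) = {}"
   using Q(1,2,4,5,6,7) unfolding crossing_def by metis
 qed
 have Zw: "Z \<in> om"
 proof -
  have "infinite (range (r j) Int range Z) \<or> infinite (range (r k) Int range Z)"
   using Z(4) by (simp add: Int_Un_distrib Int_commute)
  then show ?thesis using end_common[OF w(1) rw Z(1)] by blast
 qed
 obtain d a b c where d: "inj d" "double_ray_edges d \<subseteq> E" "!!n. d (int n) = Z (a + n)" "!!n. d (- int (Suc (c + n))) = r l (b + n)"
  using join_rays[OF Z(1) rray Z(2)] by metis
 have "infinite (F Int double_ray_edges d)"
 proof -
  have injZ: "inj Z" using Z(1) by (simp add: ray_def)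
  have inj: "inj_on (%i. {Z i, Z (Suc i)}) ({i. {Z i, Z (Suc i)} \<in> F} - {..<a})"
   by (rule inj_onI) (auto simp: doubleton_eq_iff inj_eq[OF injZ])
  have "infinite ({i. {Z i, Z (Suc i)} \<in> F} - {..<a})" using Z(3) by simp
  then have "infinite ((%i. {Z i, Z (Suc i)}) ` ({i. {Z i, Z (Suc i)} \<in> F} - {..<a}))" using finite_imageD[OF _ inj] by blast
  moreover have "(%i. {Z i, Z (Suc i)}) ` ({i. {Z i, Z (Suc i)} \<in> F} - {..<a}) \<subseteq> F Int double_ray_edges d"
  proof
   fix e assume "e \<in> (%i. {Z i, Z (Suc i)}) ` ({i. {Z i, Z (Suc i)} \<in> F} - {..<a})"
   then obtain i where i0: "e = {Z i, Z (Suc i)}" "i \<in> {i. {Z i, Z (Suc i)} \<in> F} - {..<a}" by (rule imageE)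
   then have i: "e = {Z i, Z (Suc i)}" "e \<in> F" "i \<ge> a" by simp_all
   have "{d (int (i - a)), d (int (i - a) + 1)} = e"
    using i d(3)[of "i - a"] d(3)[of "Suc (i - a)"] by (simp add: add.commute)
   then have "e \<in> double_ray_edges d" unfolding double_ray_edges_def by blast
   then show "e \<in> F Int double_ray_edges d" using i(2) by blast
  qed
  ultimately show ?thesis by (rule infinite_super[rotated])
 qed
 moreover have "((%n. d (int n)), (%n. d (- int n))) \<in> ray_equiv V E"
 proof (rule ends_equiv[OF w(1)])
  show "(%n. d (int n)) \<in> om" unfolding d(3) by (rule end_tail[OF w(1) Zw])
  have edge: "{d i, d (i + 1)} \<in> E" for i using d(2) unfolding double_ray_edges_def by blast
  have rn: "ray E (%n. d (- int n))"
  proof -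
   have "inj (%n. d (- int n))" using d(1) by (auto intro!: injI dest: injD)
   moreover have "{d (- int i), d (- int (Suc i))} \<in> E" for i using edge[of "- int (Suc i)"] by (simp add: insert_commute)
   ultimately show ?thesis by (simp add: ray_def)
  qed
  have "range (%n. r l (b + n)) \<subseteq> range (r l) Int range (%n. d (- int n))"
  proof
   fix v assume "v \<in> range (%n. r l (b + n))"
   then obtain n where "v = r l (b + n)" by blast
   then have "v = r l (b + n)" "v = d (- int (Suc (c + n)))" using d(4)[of n] by simp_all
   then show "v \<in> range (r l) Int range (%n. d (- int n))" by blast
  qed
  moreover have "infinite (range (%n. r l (b + n)))" using ray_tail[OF rray[of l], of b] by (intro range_inj_infinite) (simp add: ray_def)
  ultimately have "infinite (range (r l) Int range (%n. d (- int n)))" by (rule infinite_super)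
  then show "(%n. d (- int n)) \<in> om" by (rule end_common[OF w(1) rw rn])
 qed
 ultimately show ?thesis using that d(1,2) by blast
qed

subsection \<open>Bonds\<close>

lemma cut_space_bd: "cut_space V E = {bd X | X. X \<subseteq> V}"
 by (simp add: cut_space_def bd_def)

text \<open>A vertex outside \<open>X\<close> and \<open>Y\<close> lies in another component of
  \<open>V - X\<close>, from which \<open>X\<close> is reached without meeting
  \<open>Y\<close>.\<close>

lemma component_compl_connected:
 assumes X: "X \<subseteq> V" "graph_connected E X" and Y: "Y \<in> graph_components E (V - X)"
 shows "graph_connected E (V - Y)"
proof -
 obtain x where x: "x \<in> X" using graph_connected_ne[OF X(2)] by auto
 have YX: "Y \<subseteq> V - X" using component_subset[OF Y] .
 have XY: "X \<subseteq> V - Y" using X(1) YX by auto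
 have "conn E (V - Y) x y" if y: "y \<in> V - Y" for y
 proof (cases "y \<in> X")
  case True then show ?thesis using graph_connectedD[OF X(2) x _ XY] by blast
 next
  case False
  have c: "conn E V y x" using graph_connectedD[OF V_connected, of y x V] y x X(1) by auto
  have "~ conn E (V - X) y x" using conn_right[of E "V - X" y x] x by auto
  then obtain s t where st: "s \<in> X" "conn E (V - X) y t" "{t, s} \<in> E"
   using conn_hit[OF c, of X] False by auto
  have "~ conn E (V - X) y z" if "z \<in> Y" for z
   using component_closed[OF Y that conn_sym[of E "V - X" y z]] y by auto
  then have "conn E (V - X - Y) y t" using conn_hit[OF st(2), of Y] by auto
  then have "conn E (V - Y) y t" by (rule conn_mono) auto
  then have "conn E (V - Y) y s" using st(1,3) XY by (auto intro: conn_step)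
  moreover have "conn E (V - Y) s x" by (rule graph_connectedD[OF X(2) st(1) x XY])
  ultimately show ?thesis using conn_sym[OF conn_trans] by metis
 qed
 then show ?thesis using x XY by (intro graph_connectedI[of x]) auto
qed

text \<open>A cut contained in \<open>bd Y\<close> has no edge inside \<open>Y\<close> or inside
  \<open>V - Y\<close>. Each of these connected sets lies on one side of it, which leaves only the
  empty cut and \<open>bd Y\<close>.\<close>

lemma bond_of_sides:
 assumes Y: "Y \<subseteq> V" "graph_connected E Y" "graph_connected E (V - Y)"
 shows "bd Y \<in> bonds V E"
proof -
 obtain y where y: "y \<in> Y" using graph_connected_ne[OF Y(2)] by auto
 obtain x where x: "x \<in> V - Y" using graph_connected_ne[OF Y(3)] by auto
 have side: "bd Z = bd Y" if Z: "Z \<subseteq> V" "bd Z ~= {}" "bd Z \<subseteq> bd Y" for Z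
 proof -
  have e1: "v \<in> Z" if "{u, v} \<in> E" "u \<in> C" "v \<in> C" "u \<in> Z" "C = Y \<or> C = V - Y" for u v C
  proof (rule ccontr)
   assume "v \<notin> Z"
   then have "{u, v} \<in> bd Y" using bd_iff[OF that(1)] that(4) Z(3) by auto
   then show False using bd_iff[OF that(1), of Y] that edgeD[OF that(1)] by auto
  qed
  have dich: "C \<subseteq> Z \<or> C Int Z = {}" if "C = Y \<or> C = V - Y" for C
  proof (cases "C Int Z = {}")
   case False
   then obtain c where c: "c \<in> C" "c \<in> Z" by auto
   have "graph_connected E C" using that Y by auto
   then have "C \<subseteq> Z" by (rule graph_connected_subset_side[OF _ _ c]) (use e1 that in blast)
   then show ?thesis by simp
  qed simp
  have "Z = {} \<or> Z = Y \<or> Z = V - Y \<or> Z = V" using dich[of Y] dich[of "V - Y"] Z(1) Y(1) by auto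
  moreover have "bd {} = {}" "bd V = {}" by (auto simp: bd_def)
  ultimately show ?thesis using Z(2) bd_compl by auto
 qed
 have "bd Y ~= {}"
 proof
  assume e: "bd Y = {}"
  have "V \<subseteq> Y"
  proof (rule graph_connected_subset_side[OF V_connected])
   show "v \<in> Y" if "{u, v} \<in> E" "u \<in> Y" for u v using bd_iff[OF that(1), of Y] that e by auto
  qed (use y Y(1) in auto)
  then show False using x by auto
 qed
 moreover have "bd Y \<in> cut_space V E" using Y(1) by (auto simp: cut_space_bd)
 moreover have False if "B \<in> cut_space V E" "B ~= {}" "B \<subset> bd Y" for B
 proof -
  obtain Z where "B = bd Z" "Z \<subseteq> V" using \<open>B \<in> cut_space V E\<close> by (auto simp: cut_space_bd)
  then show False using side[of Z] that by auto
 qed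
 ultimately show ?thesis unfolding bonds_def by auto
qed

lemma bond_of_component:
 assumes "X \<subseteq> V" "graph_connected E X" "Y \<in> graph_components E (V - X)"
 shows "bd Y \<in> bonds V E"
 using bond_of_sides[OF _ component_connected[OF assms(3)] component_compl_connected[OF assms]] component_subset[OF assms(3)] by blast

text \<open>Two-connectedness keeps the graph connected after deleting \<open>v\<close>.
  Orthogonality to bonds therefore yields even degrees at all vertices.\<close>

lemma star_bond: assumes "v \<in> V" shows "{e\<in>E. v \<in> e} \<in> bonds V E"
 using bond_of_sides[of "{v}"] V_delete_connected[of v] bd_star[OF assms] assms by simp

lemma minimal_cut: "minimal_nonzero (cut_space V E) = bonds V E"
 unfolding minimal_nonzero_def bonds_def by auto

subsection \<open>Two disjoint rays in every end\<close>

text \<open>The ray from \<open>star_comb\<close> reaches infinitely many vertices of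
  \<open>U\<close> past any finite \<open>S\<close>. All but finitely many of these attach to
  \<open>R\<close> beyond a given vertex, so the two rays have tails in the same component.\<close>

lemma connected_set_ray:
 assumes w: "om \<in> ends V E" "R \<in> om" and X: "X \<subseteq> V" "graph_connected E X"
  and U: "U \<subseteq> X" "infinite U" "!!u. u \<in> U ==> \<exists>j. u = R j \<or> {R j, u} \<in> E"
 obtains R1 where "R1 \<in> om" "range R1 \<subseteq> X"
proof -
 have r: "ray E R" using ends_ray[OF w] .
 obtain x where x: "x \<in> X" using graph_connected_ne[OF X(2)] by auto
 have lf: "finite {y\<in>X. {z, y} \<in> E}" if "z \<in> X" for z
  by (rule finite_subset[OF _ finite_nbrs[of z]]) (use that X(1) in auto)
 obtain R1 where R1: "ray E R1" "range R1 \<subseteq> X"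
  and comb: "!!S. finite S ==> \<exists>n. (\<forall>m\<ge>n. R1 m \<notin> S) & infinite {u\<in>U. conn E (X - S) (R1 n) u}"
  by (rule star_comb[OF X(2) x lf U(1,2)]) auto
 have "(R, R1) \<in> ray_equiv V E"
 proof (rule ray_equivI[OF r R1(1)])
  fix S assume S: "S \<subseteq> V" "finite S"
  obtain C n0 where C: "C \<in> graph_components E (V - S)" "R ` {n0..} \<subseteq> C" using tail_in_component[OF r S(2)] .
  obtain n where n: "!!m. m \<ge> n ==> R1 m \<notin> S" "infinite {u\<in>U. conn E (X - S) (R1 n) u}" using comb[OF S(2)] by auto
  have "finite (R ` {..<n0} Un nbrs (R ` {..<n0}))" using finite_nbrs_set by simp
  then have "infinite ({u\<in>U. conn E (X - S) (R1 n) u} - (R ` {..<n0} Un nbrs (R ` {..<n0})))" using n(2) by simp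
  then have "{u\<in>U. conn E (X - S) (R1 n) u} - (R ` {..<n0} Un nbrs (R ` {..<n0})) ~= {}" by (rule infinite_imp_nonempty)
  then obtain u where "u \<in> {u\<in>U. conn E (X - S) (R1 n) u} - (R ` {..<n0} Un nbrs (R ` {..<n0}))" by (meson ex_in_conv)
  then have u: "u \<in> U" "conn E (X - S) (R1 n) u" "u \<notin> R ` {..<n0}" "u \<notin> nbrs (R ` {..<n0})" by simp_all
  obtain j where j: "u = R j \<or> {R j, u} \<in> E" using U(3)[OF u(1)] by auto
  have "j \<ge> n0"
  proof (rule ccontr)
   assume "~ ?thesis"
   then have "R j \<in> R ` {..<n0}" by simp
   then show False using u(3,4) j unfolding nbrs_def by (metis (mono_tags, lifting) mem_Collect_eq)
  qed
  then have Rj: "R j \<in> C" using C(2) by (metis atLeast_iff imageI subsetD)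
  have uX: "u \<in> V - S" using conn_right[OF u(2)] X(1) by auto
  have "conn E (V - S) (R j) u" using j
  proof
   assume "{R j, u} \<in> E"
   then show ?thesis using component_subset[OF C(1)] Rj uX by (auto intro: conn_edge)
  qed (use uX in \<open>auto intro: conn_refl\<close>)
  moreover have "conn E (V - S) (R1 n) u" by (rule conn_mono[OF u(2)]) (use X(1) in auto)
  ultimately have "conn E (V - S) (R j) (R1 n)" using conn_trans conn_sym by metis
  then have "R1 n \<in> C" by (rule component_closed[OF C(1) Rj])
  moreover have "R1 ` {n..} \<subseteq> V - S" using n(1) R1(2) X(1) by auto
  ultimately have R1C: "R1 ` {n..} \<subseteq> C"
   using component_absorbs[OF C(1) ray_tail_connected[OF R1(1), of n]] by auto
  then have "R ` {max n n0..} \<subseteq> C & R1 ` {max n n0..} \<subseteq> C" using tails_mono[OF C(2)] tails_mono[OF R1C] by simp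
  then show "\<exists>C\<in>graph_components E (V - S). \<exists>n. R ` {n..} \<subseteq> C & R1 ` {n..} \<subseteq> C" by (intro bexI[OF _ C(1)] exI)
 qed
 then have "R1 \<in> om" using ends_closed[OF w] by blast
 then show ?thesis using that R1(2) by blast
qed

text \<open>If every component of \<open>G - R\<close> has only finitely many neighbours on \<open>R\<close>, let \<open>g n\<close> be the
  farthest vertex of \<open>R\<close> reachable by a chord or through such a component from the first \<open>n\<close>
  vertices. Greedily chosen ears overlap, and the even and the odd ones yield disjoint connected
  sets.\<close>

lemma two_disjoint_rays:
 assumes w: "om \<in> ends V E"
 obtains R1 R2 where "R1 \<in> om" "R2 \<in> om" "range R1 Int range R2 = {}"
proof -
 obtain R where R: "R \<in> om" using ends_nonempty[OF w] by auto
 have r: "ray E R" using ends_ray[OF w R] .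
 have injR: "inj R" and eR: "!!i. {R i, R (Suc i)} \<in> E" using r by (auto simp: ray_def)
 have RV: "R i \<in> V" for i using ray_V[OF r] .
 define \<K> where "\<K> = graph_components E (V - range R)"
 define N where "N = (%K. {j. \<exists>u\<in>K. {u, R j} \<in> E})"
 have KV: "K \<subseteq> V - range R" "graph_connected E K" if "K \<in> \<K>" for K
  using component_subset[of K E "V - range R"] component_connected[of K E "V - range R"] that unfolding \<K>_def by simp_all
 have Kdisj: "K = K'" if "K \<in> \<K>" "K' \<in> \<K>" "u \<in> K" "u \<in> K'" for K K' u
  using that component_unique unfolding \<K>_def by metis
 have Kcl: "v \<in> K" if "K \<in> \<K>" "u \<in> K" "{u, v} \<in> E" "v \<notin> range R" for K u v
 proof -
  have "conn E (V - range R) u v" using KV(1)[OF that(1)] that edgeD[OF that(3)] by (auto intro: conn_edge)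
  then show ?thesis using component_closed[of K E "V - range R" u v] that by (simp add: \<K>_def)
 qed
 show ?thesis
 proof (cases "\<exists>K\<in>\<K>. infinite (N K)")
  \<comment> \<open>A component with infinitely many neighbours on \<open>R\<close> contains a ray
    of the end, and that ray is disjoint from \<open>R\<close>.\<close>
  case True
  then obtain K where K: "K \<in> \<K>" "infinite (N K)" by auto
  define U where "U = {u\<in>K. \<exists>j. {R j, u} \<in> E}"
  have "infinite U"
  proof
   assume "finite U"
   then have "finite (R -` nbrs U)" using finite_vimageI[OF finite_nbrs_set injR] by blast
   moreover have "N K \<subseteq> R -` nbrs U"
   proof
    fix j assume "j \<in> N K"
    then obtain u where u: "u \<in> K" "{u, R j} \<in> E" by (auto simp: N_def)
    then have "{R j, u} \<in> E" by (simp add: insert_commute)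
    then have "u \<in> U" using u by (auto simp: U_def)
    then show "j \<in> R -` nbrs U" using u(2) by (auto simp: nbrs_def)
   qed
   ultimately show False using K(2) finite_subset by blast
  qed
  moreover have "U \<subseteq> K" by (auto simp: U_def)
  moreover have "\<exists>j. u = R j \<or> {R j, u} \<in> E" if "u \<in> U" for u using that by (auto simp: U_def)
  moreover have "K \<subseteq> V" using KV(1)[OF K(1)] by auto
  ultimately obtain R2 where "R2 \<in> om" "range R2 \<subseteq> K"
   using connected_set_ray[OF w R _ KV(2)[OF K(1)], of U] by metis
  then show ?thesis using that[OF R, of R2] KV(1)[OF K(1)] by auto
 next
  case False
  define J where "J = (%i j. {R i, R j} \<in> E \<or> (\<exists>K\<in>\<K>. i \<in> N K & j \<in> N K))"
  \<comment> \<open>The first vertices of \<open>R\<close> have finitely many neighbours, and in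
    this case each component has finitely many neighbours on \<open>R\<close>.\<close>
  have fin: "finite {j. \<exists>i\<le>n. J i j}" for n
  proof -
   define \<K>' where "\<K>' = (%u. {y. conn E (V - range R) u y}) ` nbrs (R ` {..n})"
   have "finite \<K>'" unfolding \<K>'_def using finite_nbrs_set by simp
   moreover have "{j. \<exists>i\<le>n. J i j} \<subseteq> R -` nbrs (R ` {..n}) Un (\<Union>K\<in>\<K>' Int \<K>. N K)"
   proof
    fix j assume "j \<in> {j. \<exists>i\<le>n. J i j}"
    then obtain i where i: "i \<le> n" "J i j" by auto
    show "j \<in> R -` nbrs (R ` {..n}) Un (\<Union>K\<in>\<K>' Int \<K>. N K)"
    proof (cases "{R i, R j} \<in> E")
     case True then show ?thesis using i(1) by (auto simp: nbrs_def)
    next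
     case False
     then obtain K where K: "K \<in> \<K>" "i \<in> N K" "j \<in> N K" using i(2) by (auto simp: J_def)
     obtain u where u: "u \<in> K" "{u, R i} \<in> E" using K(2) by (auto simp: N_def)
     have "{R i, u} \<in> E" using u(2) by (simp add: insert_commute)
     then have "u \<in> nbrs (R ` {..n})" using i(1) by (auto simp: nbrs_def)
     moreover have "K = {y. conn E (V - range R) u y}" using component_eq[of K E "V - range R" u] K(1) u(1) by (simp add: \<K>_def)
     ultimately have "K \<in> \<K>'" by (auto simp: \<K>'_def)
     then show ?thesis using K by auto
    qed
   qed
   moreover have "finite (R -` nbrs (R ` {..n}))" using finite_vimageI[OF finite_nbrs_set injR] by simp
   moreover have "finite (\<Union>K\<in>\<K>' Int \<K>. N K)" using \<open>finite \<K>'\<close> False by auto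
   ultimately show ?thesis by (meson finite_UnI finite_subset)
  qed
  \<comment> \<open>Otherwise \<open>R (Suc n)\<close> would separate the earlier vertices of
    \<open>R\<close>, together with the components attached to them, from the later ones, against
    two-connectedness.\<close>
  have over: "\<exists>i\<le>n. \<exists>j. J i j & j \<ge> n + 2" for n
  proof (rule ccontr)
   assume neg: "~ ?thesis"
   have J': "j \<le> Suc n" if "i \<le> n" "J i j" for i j using neg that by (metis Suc_eq_plus1 add_2_eq_Suc' not_less_eq_eq)
   define Q where "Q = R ` {..n} Un (\<Union>K\<in>{K\<in>\<K>. \<exists>i\<le>n. i \<in> N K}. K)"
   have "V - {R (Suc n)} \<subseteq> Q"
   proof (rule graph_connected_subset_side[OF V_delete_connected])
    show "R 0 \<in> V - {R (Suc n)}" "R 0 \<in> Q" using RV injR by (auto simp: Q_def inj_eq)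
    fix x y assume xy: "{x, y} \<in> E" "y \<in> V - {R (Suc n)}" "x \<in> Q"
    have yx: "{y, x} \<in> E" using xy(1) by (simp add: insert_commute)
    have yQ: "y \<in> Q" if "i \<le> n" "J i j" "y = R j" for i j
    proof -
     have "j ~= Suc n" using xy(2) that(3) by auto
     then have "j \<le> n" using J'[OF that(1,2)] by simp
     then show ?thesis using that(3) by (auto simp: Q_def)
    qed
    consider i where "i \<le> n" "x = R i" | K i where "K \<in> \<K>" "i \<le> n" "i \<in> N K" "x \<in> K" using xy(3) by (auto simp: Q_def)
    then show "y \<in> Q"
    proof cases
     case 1
     show ?thesis
     proof (cases "y \<in> range R")
      case True
      then obtain j where "y = R j" by auto
      then show ?thesis using yQ[OF 1(1), of j] xy(1) 1(2) by (auto simp: J_def)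
     next
      case False
      then have yv: "y \<in> V - range R" using xy(2) by auto
      let ?K = "{z. conn E (V - range R) y z}"
      have K: "?K \<in> \<K>" unfolding \<K>_def by (rule component_of[OF yv])
      have yK: "y \<in> ?K" using yv by (simp add: conn_refl)
      then have "i \<in> N ?K" using yx 1(2) unfolding N_def by blast
      then show ?thesis using K yK 1(1) unfolding Q_def by blast
     qed
    next
     case 2
     show ?thesis
     proof (cases "y \<in> range R")
      case True
      then obtain j where j: "y = R j" by auto
      then have "j \<in> N K" using xy(1) 2(4) by (auto simp: N_def)
      then have "J i j" using 2 by (auto simp: J_def)
      then show ?thesis using yQ[OF 2(2) _ j] by blast
     next
      case False
      then have "y \<in> K" using Kcl[OF 2(1,4) xy(1)] by blast
      then show ?thesis using 2 unfolding Q_def by blast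
     qed
    qed
   qed
   moreover have "R (n + 2) \<in> V - {R (Suc n)}" using RV injR by (simp add: inj_eq)
   moreover have "R (n + 2) \<notin> Q" using injR KV(1) by (auto simp: Q_def inj_eq)
   ultimately show False by blast
  qed
  define g where "g = (%n. Max {j. \<exists>i\<le>n. J i j})"
  have gmem: "\<exists>i\<le>n. J i (g n)" for n
  proof -
   have "{j. \<exists>i\<le>n. J i j} ~= {}" using over[of n] by auto
   then have "g n \<in> {j. \<exists>i\<le>n. J i j}" unfolding g_def using Max_in[OF fin] by blast
   then show ?thesis by simp
  qed
  have gmax: "j \<le> g n" if "i \<le> n" "J i j" for i j n unfolding g_def by (rule Max_ge[OF fin]) (use that in auto)
  have gge: "g n \<ge> n + 2" for n using over[of n] gmax by (meson order_trans)
  obtain al where al: "!!n. al n \<le> n & J (al n) (g n)" using gmem by metis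
  \<comment> \<open>The next ear has to start before the end \<open>b k\<close> of the current one,
    so \<open>b k - 1\<close> is the last position allowed for its start.\<close>
  define c where "c = (%k::nat. ((%m. g m - 1) ^^ k) 0)"
  define a where "a = (%k. al (c k))"
  define b where "b = (%k. g (c k))"
  have cS: "c (Suc k) = b k - 1" for k by (simp add: c_def b_def)
  have Jab: "J (a k) (b k)" "a k \<le> c k" for k using al[of "c k"] by (auto simp: a_def b_def)
  have bb: "b k < b (Suc k)" for k using gge[of "c (Suc k)"] cS[of k] by (simp add: b_def)
  have bmono: "b k < b l" if "k < l" for k l using that bb by (rule lift_Suc_mono_less[rotated])
  have aS: "a (Suc k) < b k" for k
   using Jab(2)[of "Suc k"] cS[of k] gge[of "c k"] by (simp add: b_def)
  have cl: "b l \<le> b k" if "a l \<le> c k" for k l using gmax[OF that Jab(1)] by (simp add: b_def)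
  \<comment> \<open>An ear chosen at step \<open>k + 2\<close> that started before
    \<open>b k\<close> would have been available at step \<open>k + 1\<close>, against the choice of
    a farthest end there.\<close>
  have a2: "b k \<le> a (k + 2)" for k
  proof (rule ccontr)
   assume "~ ?thesis"
   then have "a (k + 2) \<le> c (Suc k)" using cS[of k] by simp
   then have "b (k + 2) \<le> b (Suc k)" by (rule cl)
   then show False using bmono[of "Suc k" "k + 2"] by simp
  qed
  have "\<exists>Ear. ({R (a k), R (b k)} \<in> E & Ear = {}) \<or> (Ear \<in> \<K> & a k \<in> N Ear & b k \<in> N Ear)" for k
   using Jab(1)[of k] by (auto simp: J_def)
  then obtain Ear where Ear: "!!k. ({R (a k), R (b k)} \<in> E & Ear k = {}) \<or> (Ear k \<in> \<K> & a k \<in> N (Ear k) & b k \<in> N (Ear k))"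
   by metis
  have EarR: "Ear k \<subseteq> V - range R" for k using Ear[of k] KV(1) by auto
  have EarD: "Ear k Int Ear l = {}" if "k < l" for k l
  proof (rule ccontr)
   assume "~ ?thesis"
   then obtain u where u: "u \<in> Ear k" "u \<in> Ear l" by auto
   then have K: "Ear k \<in> \<K>" "a k \<in> N (Ear k)" "Ear l \<in> \<K>" "b l \<in> N (Ear l)" using Ear[of k] Ear[of l] by auto
   then have "Ear k = Ear l" using Kdisj u by metis
   then have "J (a k) (b l)" using K unfolding J_def by metis
   then have "b l \<le> b k" using gmax[OF Jab(2)[of k]] by (simp add: b_def)
   then show False using bmono[OF that] by simp
  qed
  \<comment> \<open>These segments link ears of equal parity. They are pairwise disjoint because
    \<open>a (k + 2) < b (k + 1)\<close>.\<close>
  define seg where "seg = (%k. R ` {b k..a (k + 2)})"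
  have segc: "graph_connected E (seg k)" for k unfolding seg_def
   by (rule ray_segment_connected[where E=E and R=R, OF _ a2]) (rule eR)
  have segend: "R (b k) \<in> seg k" "R (a (k + 2)) \<in> seg k" for k using a2[of k] by (auto simp: seg_def)
  have join: "graph_connected E (Y Un (Ear k Un seg k))" if Y: "graph_connected E Y" "R (a k) \<in> Y" for Y k
   using Ear[of k]
  proof
   assume e: "{R (a k), R (b k)} \<in> E & Ear k = {}"
   have "graph_connected E (Y Un seg k)"
    by (rule graph_connected_Un_edge[OF Y(1) segc Y(2) segend(1)]) (use e in simp)
   then show ?thesis using e by simp
  next
   assume e: "Ear k \<in> \<K> & a k \<in> N (Ear k) & b k \<in> N (Ear k)"
   obtain u where u: "u \<in> Ear k" "{u, R (a k)} \<in> E" using e by (auto simp: N_def)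
   obtain v where v: "v \<in> Ear k" "{v, R (b k)} \<in> E" using e by (auto simp: N_def)
   have "graph_connected E (Ear k)" using e KV(2) by blast
   then have 1: "graph_connected E (Ear k Un seg k)" by (rule graph_connected_Un_edge[OF _ segc v(1) segend(1) v(2)])
   have "{R (a k), u} \<in> E" using u(2) by (simp add: insert_commute)
   then show ?thesis by (rule graph_connected_Un_edge[OF Y(1) 1 Y(2), of u, rotated]) (use u(1) in simp)
  qed
  have ray: "\<exists>R1\<in>om. range R1 \<subseteq> (\<Union>n. Ear (2 * n + o1) Un seg (2 * n + o1))" for o1
  proof -
   define X where "X = (%m. seg o1 Un (\<Union>n\<in>{1..m}. Ear (2 * n + o1) Un seg (2 * n + o1)))"
   have XS: "X (Suc m) = X m Un (Ear (2 * Suc m + o1) Un seg (2 * Suc m + o1))" for m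
    by (simp add: X_def atLeastAtMostSuc_conv Un_ac)
   have Xseg: "seg (2 * m + o1) \<subseteq> X m" for m
   proof (cases m)
    case 0 then show ?thesis by (simp add: X_def)
   next
    case (Suc k) then show ?thesis unfolding Suc XS by blast
   qed
   have Xc: "graph_connected E (X m)" for m
   proof (induction m)
    case 0 then show ?case using segc by (simp add: X_def)
   next
    case (Suc m)
    have "R (a (2 * Suc m + o1)) \<in> X m" using segend(2)[of "2 * m + o1"] Xseg[of m] by (auto simp: add.commute)
    then show ?case unfolding XS by (rule join[OF Suc.IH])
   qed
   have Xall: "(\<Union>m. X m) \<subseteq> (\<Union>n. Ear (2 * n + o1) Un seg (2 * n + o1))"
   proof -
    have "seg o1 \<subseteq> (\<Union>n. Ear (2 * n + o1) Un seg (2 * n + o1))" by (rule subset_trans[OF _ UN_upper[of 0]]) auto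
    then show ?thesis unfolding X_def by blast
   qed
   have con: "graph_connected E (\<Union>m. X m)" by (rule graph_connected_UN_chain[OF Xc]) (use XS in auto)
   have "seg k \<subseteq> V" for k using RV by (auto simp: seg_def)
   then have "Ear k Un seg k \<subseteq> V" for k using EarR[of k] by (metis Diff_subset Un_least order_trans)
   then have XV: "(\<Union>m. X m) \<subseteq> V" by (intro order_trans[OF Xall] UN_least)
   define U where "U = (%m. R (b (2 * m + o1))) ` UNIV"
   have "inj (%m. R (b (2 * m + o1)))"
   proof (rule linorder_injI)
    fix m n :: nat assume "m < n"
    then have "b (2 * m + o1) < b (2 * n + o1)" by (intro bmono) simp
    then show "R (b (2 * m + o1)) ~= R (b (2 * n + o1))" using injR by (simp add: inj_eq)
   qed
   then have "infinite U" unfolding U_def by (rule range_inj_infinite)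
   moreover have "U \<subseteq> (\<Union>m. X m)"
   proof
    fix u assume "u \<in> U"
    then obtain m where "u = R (b (2 * m + o1))" by (auto simp: U_def)
    then have "u \<in> X m" using segend(1)[of "2 * m + o1"] Xseg[of m] by blast
    then show "u \<in> (\<Union>m. X m)" by blast
   qed
   moreover have "\<exists>j. u = R j \<or> {R j, u} \<in> E" if "u \<in> U" for u using that by (auto simp: U_def)
   ultimately obtain R1 where "R1 \<in> om" "range R1 \<subseteq> (\<Union>m. X m)"
    using connected_set_ray[OF w R XV con, of U] by metis
   then show ?thesis using Xall by (meson order_trans)
  qed
  obtain R1 where R1: "R1 \<in> om" "range R1 \<subseteq> (\<Union>n. Ear (2 * n + 0) Un seg (2 * n + 0))" using ray[of 0] by auto
  obtain R2 where R2: "R2 \<in> om" "range R2 \<subseteq> (\<Union>n. Ear (2 * n + 1) Un seg (2 * n + 1))" using ray[of 1] by auto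
  have segD: "seg k Int seg l = {}" if "k < l" for k l
  proof (rule ccontr)
   assume "~ ?thesis"
   then obtain i j where ij: "i \<le> a (k + 2)" "b l \<le> j" "R i = R j" by (auto simp: seg_def)
   have "b (Suc k) \<le> b l" using bmono[of "Suc k" l] that by (cases "Suc k = l") auto
   then have "i < j" using ij aS[of "Suc k"] by simp
   then show False using ij(3) injR by (simp add: inj_eq)
  qed
  have D: "(Ear k Un seg k) Int (Ear l Un seg l) = {}" if "k ~= l" for k l
  proof -
   have "Ear k Int Ear l = {}" using EarD[of k l] EarD[of l k] that by (metis Int_commute linorder_neqE_nat)
   moreover have "seg k Int seg l = {}" using segD[of k l] segD[of l k] that by (metis Int_commute linorder_neqE_nat)
   moreover have "Ear k Int seg l = {}" "seg k Int Ear l = {}" using EarR[of k] EarR[of l] by (auto simp: seg_def)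
   ultimately show ?thesis by auto
  qed
  have "range R1 Int range R2 = {}"
  proof (rule ccontr)
   assume "~ ?thesis"
   then obtain v where v: "v \<in> range R1" "v \<in> range R2" by (meson disjoint_iff)
   obtain m where m: "v \<in> Ear (2 * m + 0) Un seg (2 * m + 0)" using subsetD[OF R1(2) v(1)] by auto
   obtain n where n: "v \<in> Ear (2 * n + 1) Un seg (2 * n + 1)" using subsetD[OF R2(2) v(2)] by auto
   have "2 * m + 0 ~= 2 * n + 1" by presburger
   then show False using D m n by (meson disjoint_iff)
  qed
  then show ?thesis using that R1(1) R2(1) by blast
 qed
qed

end

lemma gpath_bl:
 assumes "gpath E p" "v \<in> set p" "v ~= last p"
 shows "graph_connected E (set (butlast p))" "hd p \<in> set (butlast p)" "v \<in> set (butlast p)" "set (butlast p) = set p - {last p}"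
proof -
 show s: "set (butlast p) = set p - {last p}" by (rule gpath_butlast_set[OF assms(1)])
 then show v: "v \<in> set (butlast p)" using assms by simp
 then have ne: "butlast p ~= []" by auto
 show "graph_connected E (set (butlast p))" by (rule gpath_connected[OF gpath_butlast[OF assms(1) ne]])
 have "hd (butlast p) = hd p" using ne by (cases p) auto
 then show "hd p \<in> set (butlast p)" using ne hd_in_set by metis
qed

context lfgraph
begin

subsection \<open>Building infinite bonds\<close>

text \<open>One step of the construction, outside a finite set \<open>S\<close>: two finite connected sets \<open>A\<close> and
  \<open>B\<close> through which the rays \<open>P\<close> and \<open>T\<close> can be rerouted, separating the \<open>D\<close>-connected set \<open>M\<close>.\<close>

definition split_step :: "'v set set => (nat => 'v) => (nat => 'v) => 'v set => bool" where
 "split_step D P T S \<longleftrightarrow> (\<exists>M A B. finite M & finite A & finite B & M \<subseteq> V - S & A \<subseteq> V - S & B \<subseteq> V - S & A Int B = {} &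
  graph_connected D M & A Int M ~= {} & B Int M ~= {} & graph_connected E A & graph_connected E B &
  (\<exists>a a'. P a \<in> A & P a' \<in> A & (\<forall>i. P i \<in> A Un B --> a \<le> i & i \<le> a')) &
  (\<exists>b b'. T b \<in> B & T b' \<in> B & (\<forall>i. T i \<in> A Un B --> b \<le> i & i \<le> b')))"

lemma split_step_sym:
 assumes "split_step D P T S" shows "split_step D T P S"
proof -
 obtain M A B where "finite M & finite A & finite B & M \<subseteq> V - S & A \<subseteq> V - S & B \<subseteq> V - S & A Int B = {} &
  graph_connected D M & A Int M ~= {} & B Int M ~= {} & graph_connected E A & graph_connected E B &
  (\<exists>a a'. P a \<in> A & P a' \<in> A & (\<forall>i. P i \<in> A Un B --> a \<le> i & i \<le> a')) &
  (\<exists>b b'. T b \<in> B & T b' \<in> B & (\<forall>i. T i \<in> A Un B --> b \<le> i & i \<le> b'))"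
  using assms unfolding split_step_def by (elim exE)
 then show ?thesis unfolding split_step_def
  by (intro exI[of _ M] exI[of _ B] exI[of _ A]) (simp add: Int_commute Un_commute)
qed

lemma split_step_mono: "split_step D P T (S Int V) ==> split_step D P T S"
proof -
 have "V - S Int V = V - S" by auto
 then show "split_step D P T (S Int V) ==> split_step D P T S" by (simp add: split_step_def)
qed

text \<open>The limits \<open>X0\<close> and \<open>Y0\<close> of the two growing sets are connected
  and disjoint. Every step leaves a \<open>D\<close>-connected set that meets both, and hence an
  edge of \<open>D\<close> in any cut separating them.\<close>

lemma infinite_bond:
 assumes D: "D \<subseteq> E" and P: "ray E P" and T: "ray E T" and PT: "range P Int range T = {}"
  and steps: "!!S. finite S ==> split_step D P T S"
 obtains B where "B \<in> bonds V E" "infinite (D Int B)"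
proof -
 have injP: "inj P" and injT: "inj T" and eP: "!!i. {P i, P (Suc i)} \<in> E" and eT: "!!i. {T i, T (Suc i)} \<in> E"
  using P T by (auto simp: ray_def)
 have PTn: "P i ~= T j" for i j using PT by (metis disjoint_iff rangeI)
 have PV: "P i \<in> V" and TV: "T i \<in> V" for i using ray_V[OF P] ray_V[OF T] by auto
 \<comment> \<open>\<open>P\<close> leaves \<open>X\<close>, and \<open>T\<close> leaves
   \<open>Y\<close>, at some last vertex, from which the sets are continued along the rays.
   \<open>Z\<close> collects the vertices of the sets \<open>M\<close> already chosen, so that edges
   of \<open>D\<close> from different steps are distinct.\<close>
 define Inv where "Inv = (%(X, Y, Z :: 'v set). finite X & finite Y & finite Z & X \<subseteq> V & Y \<subseteq> V & X Int Y = {} & graph_connected E X & graph_connected E Y &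
   (\<exists>m. P m \<in> X & (\<forall>i>m. P i \<notin> X Un Y)) & (\<exists>m. T m \<in> Y & (\<forall>i>m. T i \<notin> X Un Y)))"
 define St where "St = (%(X, Y, Z) (X', Y', Z'). X \<subseteq> X' & Y \<subseteq> Y' & Z \<subseteq> Z' &
   (\<exists>M. graph_connected D M & M Int Z = {} & M \<subseteq> Z' & M Int X' ~= {} & M Int Y' ~= {}))"
 have step: "\<exists>y. Inv y & St x y" if Ix: "Inv x" for x
 proof -
  obtain X Y Z where x: "x = (X, Y, Z)" by (cases x)
  have fin: "finite X" "finite Y" "finite Z" and XV: "X \<subseteq> V" and YV: "Y \<subseteq> V" and XY: "X Int Y = {}"
   and Xc: "graph_connected E X" and Yc: "graph_connected E Y" using Ix unfolding x Inv_def by auto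
  have "\<exists>m. P m \<in> X & (\<forall>i>m. P i \<notin> X Un Y)" "\<exists>m. T m \<in> Y & (\<forall>i>m. T i \<notin> X Un Y)" using Ix unfolding x Inv_def prod.case by blast+
  then obtain m m' where m: "P m \<in> X" "!!i. i > m ==> P i \<notin> X Un Y" and m': "T m' \<in> Y" "!!i. i > m' ==> T i \<notin> X Un Y" by metis
  define S where "S = X Un Y Un Z Un P ` {..m} Un T ` {..m'}"
  have "finite S" using fin by (simp add: S_def)
  then have "split_step D P T S" by (rule steps)
  then obtain M A B a a' b b' where MAB: "finite M" "finite A" "finite B" "M \<subseteq> V - S" "A \<subseteq> V - S" "B \<subseteq> V - S" "A Int B = {}"
  "graph_connected D M" "A Int M ~= {}" "B Int M ~= {}" and Ac: "graph_connected E A" and Bc: "graph_connected E B"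
  and a: "P a \<in> A" "P a' \<in> A" and ale0: "\<forall>i. P i \<in> A Un B --> a \<le> i & i \<le> a'"
  and b: "T b \<in> B" "T b' \<in> B" and ble0: "\<forall>i. T i \<in> A Un B --> b \<le> i & i \<le> b'"
   unfolding split_step_def by (elim exE conjE)
  have ale: "a \<le> i & i \<le> a'" if "P i \<in> A Un B" for i using ale0 that by blast
  have ble: "b \<le> i & i \<le> b'" if "T i \<in> A Un B" for i using ble0 that by blast
  have PS: "P i \<in> S" if "i \<le> m" for i using that by (auto simp: S_def)
  have TS: "T i \<in> S" if "i \<le> m'" for i using that by (auto simp: S_def)
  have am: "a > m" using PS[of a] a(1) MAB(5) by (meson DiffD2 not_le subsetD)
  have bm: "b > m'" using TS[of b] b(1) MAB(6) by (meson DiffD2 not_le subsetD)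
  have aa: "a \<le> a'" using ale[of a'] a(2) by simp
  have bb: "b \<le> b'" using ble[of b'] b(2) by simp
  have AS: "A Int S = {}" "B Int S = {}" "M Int S = {}" using MAB(4-6) by auto
  have ABXY: "A Int (X Un Y Un Z) = {}" "B Int (X Un Y Un Z) = {}" "M Int Z = {}" using AS by (auto simp: S_def)
  \<comment> \<open>\<open>P\<close> is followed to its first vertex in \<open>A Un B\<close>, which
    lies in \<open>A\<close>. Its last vertex there, \<open>P a'\<close>, also lies in
    \<open>A\<close> and is the new exit.\<close>
  define X' where "X' = X Un P ` {m..a} Un A"
  define Y' where "Y' = Y Un T ` {m'..b} Un B"
  have sP: "v \<in> X \<or> (v = P i & m < i & i \<le> a)" if "v = P i" "i \<in> {m..a}" for v i
   using that m(1) by (cases "i = m") auto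
  have sT: "v \<in> Y \<or> (v = T i & m' < i & i \<le> b)" if "v = T i" "i \<in> {m'..b}" for v i
   using that m'(1) by (cases "i = m'") auto
  have X'alt: "v \<in> X \<or> (\<exists>i. v = P i & m < i & i \<le> a) \<or> v \<in> A" if "v \<in> X'" for v
   using that sP unfolding X'_def by blast
  have Y'alt: "v \<in> Y \<or> (\<exists>i. v = T i & m' < i & i \<le> b) \<or> v \<in> B" if "v \<in> Y'" for v
   using that sT unfolding Y'_def by blast
  have PB: "P i \<notin> B" if "i \<le> a" for i
  proof
   assume i: "P i \<in> B"
   then have "i = a" using ale[of i] that by simp
   then show False using i a(1) MAB(7) by blast
  qed
  have TA: "T i \<notin> A" if "i \<le> b" for i
  proof
   assume i: "T i \<in> A"
   then have "i = b" using ble[of i] that by simp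
   then show False using i b(1) MAB(7) by blast
  qed
  have disj: "X' Int Y' = {}"
  proof (rule ccontr)
   assume "X' Int Y' ~= {}"
   then obtain v where v: "v \<in> X'" "v \<in> Y'" by (meson disjoint_iff)
   show False using X'alt[OF v(1)] Y'alt[OF v(2)] XY ABXY MAB(7) m(2) m'(2) PB TA PTn by (smt (verit) Un_iff disjoint_iff)
  qed
  have segP: "graph_connected E (P ` {m..a})" by (rule ray_segment_connected) (use eP am in auto)
  have segT: "graph_connected E (T ` {m'..b})" by (rule ray_segment_connected) (use eT bm in auto)
  have X'c: "graph_connected E X'" unfolding X'_def
  proof (intro graph_connected_Un Xc segP Ac)
   have "P m \<in> P ` {m..a}" "P a \<in> P ` {m..a}" using am by auto
   then show "X Int P ` {m..a} ~= {}" "(X Un P ` {m..a}) Int A ~= {}" using m(1) a(1) by blast+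
  qed
  have Y'c: "graph_connected E Y'" unfolding Y'_def
  proof (intro graph_connected_Un Yc segT Bc)
   have "T m' \<in> T ` {m'..b}" "T b \<in> T ` {m'..b}" using bm by auto
   then show "Y Int T ` {m'..b} ~= {}" "(Y Un T ` {m'..b}) Int B ~= {}" using m'(1) b(1) by blast+
  qed
  have P': "P i \<notin> X' Un Y'" if i: "i > a'" for i
  proof
   assume "P i \<in> X' Un Y'"
   moreover have "P i \<notin> A Un B" using ale[of i] i by auto
   moreover have "P i \<notin> X Un Y" using m(2)[of i] i aa am by simp
   moreover have "P i ~= P j" if "j \<le> a" for j using that i aa injP by (auto simp: inj_eq)
   ultimately show False using X'alt[of "P i"] Y'alt[of "P i"] PTn by (metis Un_iff)
  qed
  have T': "T i \<notin> X' Un Y'" if i: "i > b'" for i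
  proof
   assume "T i \<in> X' Un Y'"
   moreover have "T i \<notin> A Un B" using ble[of i] i by auto
   moreover have "T i \<notin> X Un Y" using m'(2)[of i] i bb bm by simp
   moreover have "T i ~= T j" if "j \<le> b" for j using that i bb injT by (auto simp: inj_eq)
   ultimately show False using X'alt[of "T i"] Y'alt[of "T i"] PTn by (metis Un_iff)
  qed
  have "finite X'" "finite Y'" "finite (Z Un M)" using fin MAB(1-3) by (auto simp: X'_def Y'_def)
  moreover have "X' \<subseteq> V" "Y' \<subseteq> V" using XV YV MAB(5,6) PV TV by (auto simp: X'_def Y'_def)
  moreover have "P a' \<in> X'" "T b' \<in> Y'" using a(2) b(2) by (auto simp: X'_def Y'_def)
  then have "\<exists>m. P m \<in> X' & (\<forall>i>m. P i \<notin> X' Un Y')" "\<exists>m. T m \<in> Y' & (\<forall>i>m. T i \<notin> X' Un Y')" using P' T' by metis+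
  ultimately have "Inv (X', Y', Z Un M)" unfolding Inv_def prod.case using disj X'c Y'c by simp
  moreover have "St x (X', Y', Z Un M)"
  proof -
   have "M Int X' ~= {}" "M Int Y' ~= {}" using MAB(9,10) by (auto simp: X'_def Y'_def)
   then show ?thesis unfolding x St_def prod.case using MAB(8) ABXY(3)
    by (intro conjI exI[of _ M]) (auto simp: X'_def Y'_def)
  qed
  ultimately show ?thesis by blast
 qed
 have "Inv ({P 0}, {T 0}, {})"
  unfolding Inv_def prod.case using PV TV injP injT PTn PTn[symmetric]
  by (auto simp: inj_eq intro!: exI[of _ 0])
 then have "\<exists>f. \<forall>n. Inv (f n) & St (f n) (f (Suc n))"
  using dependent_nat_choice[of "%n. Inv" "%n. St"] step by blast
 then obtain f where f: "!!n. Inv (f n)" "!!n. St (f n) (f (Suc n))" by blast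
 define X where "X = (%n. fst (f n))"
 define Y where "Y = (%n. fst (snd (f n)))"
 define Z where "Z = (%n. snd (snd (f n)))"
 have fe: "f n = (X n, Y n, Z n)" for n by (simp add: X_def Y_def Z_def)
 have I: "X n \<subseteq> V" "Y n \<subseteq> V" "X n Int Y n = {}" "graph_connected E (X n)" "graph_connected E (Y n)" for n
  using f(1)[of n] unfolding fe Inv_def prod.case by blast+
 have S: "X n \<subseteq> X (Suc n)" "Y n \<subseteq> Y (Suc n)" "Z n \<subseteq> Z (Suc n)"
   "\<exists>M. graph_connected D M & M Int Z n = {} & M \<subseteq> Z (Suc n) & M Int X (Suc n) ~= {} & M Int Y (Suc n) ~= {}" for n
  using f(2)[of n] unfolding fe St_def prod.case by blast+
 have mono: "m \<le> n ==> X m \<subseteq> X n" "m \<le> n ==> Y m \<subseteq> Y n" "m \<le> n ==> Z m \<subseteq> Z n" for m n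
  using lift_Suc_mono_le[of X m n] lift_Suc_mono_le[of Y m n] lift_Suc_mono_le[of Z m n] S(1-3) by blast+
 define X0 where "X0 = (\<Union>n. X n)"
 define Y0 where "Y0 = (\<Union>n. Y n)"
 have X0c: "graph_connected E X0" unfolding X0_def by (rule graph_connected_UN_chain) (rule I(4) S(1))+
 have Y0c: "graph_connected E Y0" unfolding Y0_def by (rule graph_connected_UN_chain) (rule I(5) S(2))+
 have X0V: "X0 \<subseteq> V" "Y0 \<subseteq> V" using I(1,2) by (auto simp: X0_def Y0_def)
 have XY0: "X0 Int Y0 = {}"
 proof (rule ccontr)
  assume "X0 Int Y0 ~= {}"
  then obtain v m n where "v \<in> X m" "v \<in> Y n" by (auto simp: X0_def Y0_def)
  then have "v \<in> X (max m n)" "v \<in> Y (max m n)" using mono(1)[of m "max m n"] mono(2)[of n "max m n"] by auto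
  then show False using I(3)[of "max m n"] by blast
 qed
 obtain y where y: "y \<in> Y0" using graph_connected_ne[OF Y0c] by blast
 have yv: "y \<in> V - X0" using y X0V XY0 by blast
 \<comment> \<open>\<open>Y0\<close> need not be all that is left; the whole component around it has
   a connected complement, so its cut is a bond.\<close>
 define C where "C = {z. conn E (V - X0) y z}"
 have C: "C \<in> graph_components E (V - X0)" unfolding C_def by (rule component_of[OF yv])
 have yC: "y \<in> C" using yv by (simp add: C_def conn_refl)
 have YC: "Y0 \<subseteq> C" by (rule component_absorbs[OF C Y0c]) (use X0V XY0 y yC in auto)
 have bond: "bd C \<in> bonds V E" by (rule bond_of_component[OF X0V(1) X0c C])
 have CX: "C Int X0 = {}" using component_subset[OF C] by blast
 have "\<exists>e. e \<in> D Int bd C & e \<subseteq> Z (Suc n) & e Int Z n = {}" for n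
 proof -
  obtain M where M: "graph_connected D M" "M Int Z n = {}" "M \<subseteq> Z (Suc n)" "M Int X (Suc n) ~= {}" "M Int Y (Suc n) ~= {}"
   using S(4)[of n] by (elim exE conjE)
  \<comment> \<open>\<open>M\<close> meets \<open>Y0\<close> inside \<open>C\<close> and
    \<open>X0\<close> outside, so some edge of \<open>D\<close> within \<open>M\<close> crosses the
    cut.\<close>
  have "\<exists>u v. {u, v} \<in> D & u \<in> M & v \<in> M & u \<in> C & v \<notin> C"
  proof (rule ccontr)
   assume neg: "~ ?thesis"
   obtain z where z: "z \<in> M" "z \<in> Y (Suc n)" using M(5) by blast
   then have zC: "z \<in> C" using YC by (auto simp: Y0_def)
   have "M \<subseteq> C" by (rule graph_connected_subset_side[OF M(1) _ z(1) zC]) (use neg in metis)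
   then show False using M(4) CX by (auto simp: X0_def)
  qed
  then obtain u v where uv: "{u, v} \<in> D" "u \<in> M" "v \<in> M" "u \<in> C" "v \<notin> C" by blast
  have "{u, v} \<in> bd C" using bd_iff[of u v C] uv D by blast
  then show ?thesis using uv M(2,3) by (intro exI[of _ "{u, v}"]) auto
 qed
 then obtain e where e: "!!n. e n \<in> D Int bd C & e n \<subseteq> Z (Suc n) & e n Int Z n = {}" by metis
 have "inj e"
 proof (rule linorder_injI)
  fix m n :: nat assume "m < n"
  then have "e m \<subseteq> Z n" using e[of m] mono(3)[of "Suc m" n] by auto
  moreover have "e n ~= {}" using e[of n] D edge_card by fastforce
  ultimately show "e m ~= e n" using e[of n] by auto
 qed
 then have "infinite (range e)" by (rule range_inj_infinite)
 moreover have "range e \<subseteq> D Int bd C" using e by blast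
 ultimately have "infinite (D Int bd C)" by (rule infinite_super[rotated])
 then show ?thesis using that bond by blast
qed

text \<open>\<open>P\<close> meets the three paths from \<open>M\<close> to \<open>T\<close>. The
  paths with its first and last such vertex, linked by \<open>K\<close>, form the set
  \<open>A\<close> through which \<open>P\<close> is rerouted; a remaining path leads to
  \<open>T\<close> and forms \<open>B\<close>.\<close>

lemma gadget_cross:
 assumes P: "ray E P" and T: "ray E T" and PT: "range P Int range T = {}"
  and f: "!!i. i < (3::nat) ==> gpath E (f i) & set (f i) \<subseteq> V - S & hd (f i) \<in> M & set (f i) Int range T = {last (f i)}"
  and fd: "!!i j. i < 3 ==> j < 3 ==> i ~= j ==> set (f i) Int set (f j) = {}"
  and K: "!!i. i < 3 ==> \<exists>K. finite K & K \<subseteq> V - S & graph_connected E K & K Int set (f i) = {} & K Int range T = {} & (\<forall>j<3. j ~= i --> hd (f j) \<in> K)"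
  and M: "finite M" "M \<subseteq> V - S" "graph_connected D M"
  and hit: "i0 < 3" "P n0 \<in> set (f i0)"
 shows "split_step D P T S"
proof -
 have injP: "inj P" and injT: "inj T" using P T by (auto simp: ray_def)
 define U where "U = (\<Union>i<3. set (f i))"
 define I where "I = {n. P n \<in> U}"
 have "finite (P -` U)" using injP by (intro finite_vimageI) (auto simp: U_def)
 then have fI: "finite I" by (simp add: I_def vimage_def)
 have "n0 \<in> I" using hit by (auto simp: I_def U_def)
 then have Min: "Min I \<in> I" and Max: "Max I \<in> I" using fI Min_in Max_in by blast+
 obtain \<alpha> where al: "\<alpha> < 3" "P (Min I) \<in> set (f \<alpha>)" using Min by (auto simp: I_def U_def)
 obtain \<beta> where be: "\<beta> < 3" "P (Max I) \<in> set (f \<beta>)" using Max by (auto simp: I_def U_def)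
 \<comment> \<open>Two indices at most are taken, so three paths suffice.\<close>
 have "\<exists>\<gamma><3. \<gamma> ~= \<alpha> & \<gamma> ~= \<beta>" using al(1) be(1) by presburger
 then obtain \<gamma> where ga: "\<gamma> < 3" "\<gamma> ~= \<alpha>" "\<gamma> ~= \<beta>" by blast
 have Pl: "P n ~= last (f i)" if "i < 3" for n i using f[OF that] PT by (metis IntD2 disjoint_iff insertI1 rangeI)
 note A1 = gpath_bl[OF conjunct1[OF f[OF al(1)]] al(2) Pl[OF al(1)]]
 note B1 = gpath_bl[OF conjunct1[OF f[OF be(1)]] be(2) Pl[OF be(1)]]
 obtain K where K: "finite K" "K \<subseteq> V - S" "graph_connected E K" "K Int set (f \<gamma>) = {}" "K Int range T = {}" "!!j. j < 3 ==> j ~= \<gamma> ==> hd (f j) \<in> K"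
  using K[OF ga(1)] by blast
 \<comment> \<open>The last vertices are dropped because they lie on \<open>T\<close>. When the
   first and the last vertex lie on the same path, no connecting set is required.\<close>
 define A where "A = set (butlast (f \<alpha>)) Un (if \<alpha> = \<beta> then {} else K Un set (butlast (f \<beta>)))"
 define B where "B = set (f \<gamma>)"
 have sub: "set (butlast (f i)) \<subseteq> set (f i)" for i by (meson in_set_butlastD subsetI)
 have Ac: "graph_connected E A"
 proof (cases "\<alpha> = \<beta>")
  case True then show ?thesis using A1(1) by (simp add: A_def)
 next
  case False
  have "hd (f \<alpha>) \<in> K" "hd (f \<beta>) \<in> K" using K(6) al(1) be(1) ga by auto
  then have "set (butlast (f \<alpha>)) Int (K Un set (butlast (f \<beta>))) ~= {}" "K Int set (butlast (f \<beta>)) ~= {}" using A1(2) B1(2) by blast+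
  then have "graph_connected E (set (butlast (f \<alpha>)) Un (K Un set (butlast (f \<beta>))))" by (intro graph_connected_Un A1(1) K(3) B1(1))
  then show ?thesis using False by (simp add: A_def)
 qed
 have Bc: "graph_connected E B" unfolding B_def using f[OF ga(1)] gpath_connected by blast
 have AB: "A Int B = {}"
 proof -
  have "set (f \<alpha>) Int set (f \<gamma>) = {}" "set (f \<beta>) Int set (f \<gamma>) = {}" using fd al(1) be(1) ga by auto
  then show ?thesis using sub[of \<alpha>] sub[of \<beta>] K(4) unfolding A_def B_def by auto
 qed
 have AT: "A Int range T = {}"
 proof -
  have "set (butlast (f i)) Int range T = {}" if "i < 3" for i
   using gpath_butlast_set[of E "f i"] f[OF that] by blast
  then show ?thesis using al(1) be(1) K(5) unfolding A_def by auto
 qed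
 have AU: "B \<subseteq> U" using ga(1) by (auto simp: B_def U_def)
 \<comment> \<open>\<open>K\<close> may contain further vertices of \<open>P\<close>, so the
   extremes are taken again. A new extreme outside \<open>A\<close> would lie in \<open>B\<close>,
   hence on one of the paths, and would coincide with an old extreme, which lies in
   \<open>A\<close>.\<close>
 define I' where "I' = {n. P n \<in> A Un B}"
 have finAB: "finite A" "finite B" using K(1) by (auto simp: A_def B_def)
 have "finite (P -` (A Un B))" using injP finAB by (intro finite_vimageI) auto
 then have fI': "finite I'" by (simp add: I'_def vimage_def)
 have minA: "P (Min I) \<in> A" "P (Max I) \<in> A" using A1(3) B1(3) by (auto simp: A_def)
 then have mem: "Min I \<in> I'" "Max I \<in> I'" by (auto simp: I'_def)
 have M1: "P (Min I') \<in> A"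
 proof (rule ccontr)
  assume n: "P (Min I') \<notin> A"
  have "Min I' \<in> I'" using Min_in[OF fI'] mem by blast
  then have "Min I' \<in> I" using n AU by (auto simp: I'_def I_def)
  then have "Min I \<le> Min I'" using fI by simp
  moreover have "Min I' \<le> Min I" using fI' mem by simp
  ultimately show False using n minA by simp
 qed
 have M2: "P (Max I') \<in> A"
 proof (rule ccontr)
  assume n: "P (Max I') \<notin> A"
  have "Max I' \<in> I'" using Max_in[OF fI'] mem by blast
  then have "Max I' \<in> I" using n AU by (auto simp: I'_def I_def)
  then have "Max I' \<le> Max I" using fI by simp
  moreover have "Max I \<le> Max I'" using fI' mem by simp
  ultimately show False using n minA by simp
 qed
 have "Min I' \<le> i & i \<le> Max I'" if "P i \<in> A Un B" for i using that fI' by (simp add: I'_def)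
 then have Pc: "\<exists>a a'. P a \<in> A & P a' \<in> A & (\<forall>i. P i \<in> A Un B --> a \<le> i & i \<le> a')" using M1 M2 by blast
 have lastT: "set (f \<gamma>) Int range T = {last (f \<gamma>)}" using f[OF ga(1)] by simp
 then obtain b where b: "last (f \<gamma>) = T b" by blast
 have "b \<le> i & i \<le> b" if "T i \<in> A Un B" for i
 proof -
  have "T i \<in> set (f \<gamma>) Int range T" using that AT by (auto simp: B_def)
  then have "T i = T b" using lastT b by simp
  then show ?thesis using injT by (simp add: inj_eq)
 qed
 moreover have "T b \<in> B" using lastT b by (auto simp: B_def)
 ultimately have Tc: "\<exists>b b'. T b \<in> B & T b' \<in> B & (\<forall>i. T i \<in> A Un B --> b \<le> i & i \<le> b')" by blast
 have "hd (f \<alpha>) \<in> A Int M" using A1(2) f[OF al(1)] by (auto simp: A_def)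
 then have AM: "A Int M ~= {}" by blast
 have "f \<gamma> ~= []" using f[OF ga(1)] by (simp add: gpath_def)
 then have "hd (f \<gamma>) \<in> B Int M" using f[OF ga(1)] by (simp add: B_def)
 then have BM: "B Int M ~= {}" by blast
 have "A \<subseteq> V - S" "B \<subseteq> V - S" using f[OF al(1)] f[OF be(1)] f[OF ga(1)] sub[of \<alpha>] sub[of \<beta>] K(2) unfolding A_def B_def by auto
 then show ?thesis unfolding split_step_def using M finAB AB AM BM Ac Bc Pc Tc by (intro exI[of _ M] exI[of _ A] exI[of _ B] conjI)
qed

text \<open>\<open>P\<close> misses the three paths but reaches \<open>M\<close> without meeting
  \<open>T\<close>. A path from \<open>P\<close> that stops on first meeting \<open>M\<close> or the
  three paths touches at most one of them. \<open>A\<close> is that path, extended to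
  \<open>M\<close> if necessary, and another of the three is \<open>B\<close>.\<close>

lemma gadget_attach:
 assumes P: "ray E P" and T: "ray E T" and PT: "range P Int range T = {}"
  and f: "!!i. i < (3::nat) ==> gpath E (f i) & set (f i) \<subseteq> V - S & hd (f i) \<in> M & set (f i) Int range T = {last (f i)}"
  and fd: "!!i j. i < 3 ==> j < 3 ==> i ~= j ==> set (f i) Int set (f j) = {}"
  and M: "finite M" "M \<subseteq> V - S" "graph_connected D M"
  and nohit: "!!i n. i < 3 ==> P n \<notin> set (f i)"
  and z: "conn E (V - S - range T) (P n) z" "z \<in> M"
 shows "split_step D P T S"
proof -
 have injP: "inj P" and injT: "inj T" using P T by (auto simp: ray_def)
 define U where "U = (\<Union>i<3. set (f i))"
 obtain W where W: "ABpath E (range P) (M Un U) W" "set W \<subseteq> V - S - range T"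
  using conn_imp_ABpath[OF z(1), of "range P" "M Un U"] z(2) by blast
 note Wd = ABpathD[OF W(1)]
 obtain n0 where n0: "hd W = P n0" using Wd(3) by blast
 have "\<exists>\<gamma> A. \<gamma> < 3 & finite A & set W \<subseteq> A & A \<subseteq> V - S - range T & graph_connected E A & A Int set (f \<gamma>) = {} & A Int M ~= {} & A \<subseteq> set W Un U"
 proof (cases "\<exists>\<alpha><3. last W \<in> set (f \<alpha>)")
  case True
  then obtain \<alpha> where al: "\<alpha> < 3" "last W \<in> set (f \<alpha>)" by blast
  have "last W \<notin> range T" using W(2) last_in_set[OF Wd(2)] by blast
  then have "last W ~= last (f \<alpha>)" using f[OF al(1)] by blast
  note A1 = gpath_bl[OF conjunct1[OF f[OF al(1)]] al(2) this]
  obtain \<gamma> where ga: "\<gamma> < 3" "\<gamma> ~= \<alpha>" using al(1) by (metis zero_less_numeral one_less_numeral_iff semiring_norm(77) zero_neq_one)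
  define A where "A = set W Un set (butlast (f \<alpha>))"
  have "set W Int set (butlast (f \<alpha>)) ~= {}" using A1(3) last_in_set[OF Wd(2)] by blast
  then have "graph_connected E A" unfolding A_def by (rule graph_connected_Un[OF gpath_connected[OF Wd(1)] A1(1)])
  moreover have "A Int set (f \<gamma>) = {}"
  proof (rule ccontr)
   assume "A Int set (f \<gamma>) ~= {}"
   then obtain v where v: "v \<in> A" "v \<in> set (f \<gamma>)" by (meson disjoint_iff)
   have d: "set (f \<alpha>) Int set (f \<gamma>) = {}" using fd al ga by auto
   have "v \<notin> set (f \<alpha>)" using d v(2) by blast
   then have "v \<in> set W" using v(1) A1(4) by (auto simp: A_def)
   moreover have "v \<in> U" using v(2) ga by (auto simp: U_def)
   ultimately have "v \<in> set W Int (M Un U)" by blast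
   then have "v = last W" unfolding Wd(6) by simp
   then show False using \<open>v \<notin> set (f \<alpha>)\<close> al(2) by simp
  qed
  moreover have "set (butlast (f \<alpha>)) \<subseteq> V - S - range T" using A1(4) f[OF al(1)] by auto
  then have "A \<subseteq> V - S - range T" using W(2) by (auto simp: A_def)
  moreover have "hd (f \<alpha>) \<in> A Int M" using A1(2) f[OF al(1)] by (auto simp: A_def)
  then have "A Int M ~= {}" by blast
  moreover have "A \<subseteq> set W Un U" using A1(4) al(1) by (auto simp: A_def U_def)
  ultimately show ?thesis using ga(1) by (intro exI[of _ \<gamma>] exI[of _ A]) (auto simp: A_def)
 next
  case False
  have 0: "(0::nat) < 3" by simp
  have "set W Int set (f 0) = {}"
  proof (rule ccontr)
   assume "set W Int set (f 0) ~= {}"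
   then obtain v where v: "v \<in> set W" "v \<in> set (f 0)" by (meson disjoint_iff)
   then have "v \<in> set W Int (M Un U)" using 0 unfolding U_def by blast
   then have "v = last W" unfolding Wd(6) by simp
   then show False using False v(2) 0 by blast
  qed
  moreover have "last W \<in> M" using Wd(4) False by (auto simp: U_def)
  then have "set W Int M ~= {}" using last_in_set[OF Wd(2)] by blast
  ultimately show ?thesis using 0 W(2) gpath_connected[OF Wd(1)] by (intro exI[of _ 0] exI[of _ "set W"]) auto
 qed
 then obtain \<gamma> A where ga: "\<gamma> < 3" and A: "finite A" "set W \<subseteq> A" "A \<subseteq> V - S - range T" "graph_connected E A" "A Int set (f \<gamma>) = {}" "A Int M ~= {}" "A \<subseteq> set W Un U"
  by (elim exE conjE)
 define B where "B = set (f \<gamma>)"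
 have fg: "gpath E (f \<gamma>)" "set (f \<gamma>) \<subseteq> V - S" "hd (f \<gamma>) \<in> M" "set (f \<gamma>) Int range T = {last (f \<gamma>)}" using f[OF ga] by auto
 have PU: "P i \<notin> U" for i using nohit by (auto simp: U_def)
 have "n0 \<le> i & i \<le> n0" if "P i \<in> A Un B" for i
 proof -
  have "B \<subseteq> U" using ga by (auto simp: B_def U_def)
  then have "P i \<in> set W Int range P" using that A(7) PU[of i] by blast
  then have "P i = P n0" unfolding Wd(5) n0 by simp
  then show ?thesis using injP by (simp add: inj_eq)
 qed
 moreover have "P n0 \<in> A" using A(2) hd_in_set[OF Wd(2)] n0 by auto
 ultimately have Pc: "\<exists>a a'. P a \<in> A & P a' \<in> A & (\<forall>i. P i \<in> A Un B --> a \<le> i & i \<le> a')" by blast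
 obtain b where b: "last (f \<gamma>) = T b" using fg(4) by blast
 have "b \<le> i & i \<le> b" if "T i \<in> A Un B" for i
 proof -
  have "T i \<in> set (f \<gamma>) Int range T" using that A(3) by (auto simp: B_def)
  then have "T i = T b" unfolding fg(4) b by simp
  then show ?thesis using injT by (simp add: inj_eq)
 qed
 moreover have "T b \<in> B" using fg(4) b by (auto simp: B_def)
 ultimately have Tc: "\<exists>b b'. T b \<in> B & T b' \<in> B & (\<forall>i. T i \<in> A Un B --> b \<le> i & i \<le> b')" by blast
 have "f \<gamma> ~= []" using fg(1) by (simp add: gpath_def)
 then have "hd (f \<gamma>) \<in> B Int M" using fg(3) by (simp add: B_def)
 then have BM: "B Int M ~= {}" by blast
 have "graph_connected E B" unfolding B_def by (rule gpath_connected[OF fg(1)])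
 moreover have "A \<subseteq> V - S" using A(3) by blast
 moreover have "A Int B = {}" "finite B" "B \<subseteq> V - S" using A(5) fg(2) by (auto simp: B_def)
 ultimately show ?thesis unfolding split_step_def using M A(1,4,6) BM Pc Tc by (intro exI[of _ M] exI[of _ A] exI[of _ B] conjI)
qed

lemma linked_paths:
 assumes MW: "M \<subseteq> W"
  and sep: "\<forall>T0. finite T0 & card T0 < k --> (\<exists>a\<in>M. \<exists>n. conn E (W - T0) a (R n))"
 shows "\<exists>f. (\<forall>i<k. gpath E (f i) & set (f i) \<subseteq> W & hd (f i) \<in> M & set (f i) Int M = {hd (f i)} & set (f i) Int range R = {last (f i)}) &
  (\<forall>i<k. \<forall>j<k. i ~= j --> set (f i) Int set (f j) = {})"
proof -
 have "linked k {e\<in>E. e \<subseteq> W} M (range R Int W)"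
 proof (rule menger)
  show "\<forall>e\<in>{e\<in>E. e \<subseteq> W}. card e = 2" using edge_card by simp
  fix T :: "'v set" assume T: "finite T" "card T < k"
  obtain a n where an: "a \<in> M" "conn E (W - T) a (R n)" using sep T by blast
  have "W - T = W Int - T" by auto
  then have "conn {e\<in>E. e \<subseteq> W} (- T) a (R n)" using conn_restrict_edges'[of E W "- T" a "R n"] an(2) by simp
  moreover have "R n \<in> range R Int W" using conn_right[OF an(2)] by simp
  ultimately show "\<exists>a\<in>M. \<exists>b\<in>range R Int W. conn {e\<in>E. e \<subseteq> W} (- T) a b" using an(1) by (intro bexI)
 qed
 then obtain f where f: "!!i. i < k ==> ABpath {e\<in>E. e \<subseteq> W} M (range R Int W) (f i)"
  and fd: "!!i j. i < k ==> j < k ==> i ~= j ==> set (f i) Int set (f j) = {}" unfolding linked_def by blast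
 have "gpath E (f i) & set (f i) \<subseteq> W & hd (f i) \<in> M & set (f i) Int M = {hd (f i)} & set (f i) Int range R = {last (f i)}" if "i < k" for i
 proof -
  note F = ABpathD[OF f[OF that]]
  have hW: "hd (f i) \<in> W" using F(3) MW by blast
  note G = gpath_restrict[OF F(1) hW]
  have "set (f i) Int range R = set (f i) Int (range R Int W)" using G(2) by blast
  then show ?thesis using F(3,5,6) G by simp
 qed
 then show ?thesis using fd by (intro exI[of _ f]) simp
qed

end

section \<open>Steps supplied by cycles and by rays of \<open>D\<close>\<close>

lemma cycle_gpath:
 assumes "distinct p" "length p \<ge> 3" "cycle_edges p \<subseteq> E"
 shows "gpath E p" "{last p, hd p} \<in> E"
proof -
 have ne: "p ~= []" using assms(2) by auto
 have "{p ! i, p ! Suc i} \<in> E" if "Suc i < length p" for i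
 proof -
  have "Suc i mod length p = Suc i" using that by simp
  then have "{p ! i, p ! Suc i} \<in> cycle_edges p" unfolding cycle_edges_def using that by (metis (mono_tags, lifting) Suc_lessD mem_Collect_eq)
  then show ?thesis using assms(3) by blast
 qed
 then show "gpath E p" using assms(1) ne by (simp add: gpath_def successively_conv_nth)
 let ?i = "length p - 1"
 have "Suc ?i = length p" using ne by simp
 then have "Suc ?i mod length p = 0" "?i < length p" by simp_all
 then have "{p ! ?i, p ! 0} \<in> cycle_edges p" unfolding cycle_edges_def by (metis (mono_tags, lifting) mem_Collect_eq)
 then show "{last p, hd p} \<in> E" using assms(3) ne by (auto simp: last_conv_nth hd_conv_nth)
qed

text \<open>Read cyclically from the successor of \<open>v\<close>, the remaining vertices form a
  path. It serves as the connecting set in \<open>gadget_cross\<close>.\<close>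

lemma cycle_minus_vertex:
 assumes "distinct p" "length p \<ge> 3" "cycle_edges p \<subseteq> E" "v \<in> set p"
 shows "graph_connected E (set p - {v})"
proof -
 note g = cycle_gpath[OF assms(1-3)]
 obtain xs ys where p: "p = xs @ v # ys" using split_list[OF assms(4)] by blast
 have s: "successively (%x y. {x, y} \<in> E) xs" "successively (%x y. {x, y} \<in> E) ys"
  using g(1) unfolding p gpath_def successively_append_iff successively_Cons by auto
 have "{last ys, hd xs} \<in> E" if "ys ~= []" "xs ~= []"
 proof -
  have "last p = last ys" "hd p = hd xs" using that by (auto simp: p)
  then show ?thesis using g(2) by simp
 qed
 then have "successively (%x y. {x, y} \<in> E) (ys @ xs)" unfolding successively_append_iff using s by blast
 moreover have "ys @ xs ~= []" "distinct (ys @ xs)" using assms(1,2) by (auto simp: p)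
 ultimately have "gpath E (ys @ xs)" by (simp add: gpath_def)
 then have "graph_connected E (set (ys @ xs))" by (rule gpath_connected)
 moreover have "set (ys @ xs) = set p - {v}" using assms(1) by (auto simp: p)
 ultimately show ?thesis by simp
qed

context lfgraph
begin

text \<open>The dual form of fans: close to the end, no vertex is cut off from \<open>R\<close> by
  fewer than \<open>k\<close> other vertices. This is the form to which Menger's theorem
  applies.\<close>

definition unseparable :: "nat => (nat => 'v) set => (nat => 'v) => bool" where
 "unseparable k om R \<longleftrightarrow> (\<exists>S0. finite S0 & S0 \<subseteq> V &
  (\<forall>u\<in>end_comp V E S0 om. \<forall>T. finite T & card T < k & u \<notin> T --> (\<exists>n. conn E (V - T) u (R n))))"

lemma localize':
 assumes w: "om \<in> ends V E" "R \<in> om" and u: "unseparable k om R" and S: "finite S" "S \<subseteq> V"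
 obtains S1 where "finite S1" "S \<subseteq> S1" "S1 \<subseteq> V"
  "!!u T. u \<in> end_comp V E S1 om ==> finite T ==> card T < k ==> u \<notin> T ==> \<exists>n. conn E (V - S - T) u (R n)"
proof -
 obtain S0 where "finite S0" "S0 \<subseteq> V" and h: "\<forall>u\<in>end_comp V E S0 om. \<forall>T. finite T & card T < k & u \<notin> T --> (\<exists>n. conn E (V - T) u (R n))"
  using u unfolding unseparable_def by (elim exE conjE)
 then show ?thesis using localize[OF w \<open>finite S0\<close> \<open>S0 \<subseteq> V\<close> S, of k thesis] that by blast
qed

text \<open>The paths of a fan share only the centre, so fewer than \<open>k\<close> vertices other
  than the centre leave one of the \<open>k\<close> paths untouched.\<close>

lemma padded_unseparable:
 assumes pad: "k_padded_end V E k om" and R: "R \<in> om"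
 shows "unseparable k om R"
proof -
 obtain U where U: "end_nbhd V E om U" "!!u. u \<in> U ==> \<exists>\<P>. k_fan V E k u (range R) \<P>"
  using pad R unfolding k_padded_end_def by blast
 obtain S0 where S0: "finite S0" "S0 \<subseteq> V" "end_comp V E S0 om \<subseteq> U" using U(1) unfolding end_nbhd_def by blast
 have "\<exists>n. conn E (V - T) u (R n)" if u: "u \<in> end_comp V E S0 om" and T: "finite T" "card T < k" "u \<notin> T" for u T
 proof -
  obtain \<P> where fan: "k_fan V E k u (range R) \<P>" using U(2) S0(3) u by blast
  have fin: "finite \<P>" "card \<P> = k" using fan by (auto simp: k_fan_def)
  have pp: "graph_path V E p" "hd p = u" "last p \<in> range R" if "p \<in> \<P>" for p using fan that by (auto simp: k_fan_def)
  have pw: "set p Int set q = {u}" if "p \<in> \<P>" "q \<in> \<P>" "p ~= q" for p q using fan that by (auto simp: k_fan_def pairwise_def)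
  have "\<exists>p\<in>\<P>. set p Int T = {}"
  proof (rule ccontr)
   assume "~ ?thesis"
   then have "\<forall>p. \<exists>t. p \<in> \<P> --> t \<in> set p & t \<in> T" by (meson disjoint_iff)
   then obtain t where t: "!!p. p \<in> \<P> ==> t p \<in> set p & t p \<in> T" by metis
   have "inj_on t \<P>"
   proof (rule inj_onI, rule ccontr)
    fix p q assume pq: "p \<in> \<P>" "q \<in> \<P>" "t p = t q" "p ~= q"
    then have "t p \<in> set p Int set q" using t by (metis IntI)
    then have "t p = u" using pw[OF pq(1,2,4)] by simp
    then show False using t[OF pq(1)] T(3) by simp
   qed
   then have "card \<P> \<le> card T" using t T(1) by (intro card_inj_on_le) auto
   then show False using fin T(2) by simp
  qed
  then obtain p where p: "p \<in> \<P>" "set p Int T = {}" by blast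
  have gp: "gpath E p" "set p \<subseteq> V" using pp(1)[OF p(1)] by (auto simp: graph_path_def gpath_def successively_conv_nth)
  then have "conn E (V - T) (hd p) (last p)" using p(2) by (intro gpath_conn_hd_last) auto
  then show ?thesis using pp(2,3)[OF p(1)] by auto
 qed
 then show ?thesis unfolding unseparable_def using S0 by blast
qed

text \<open>Three disjoint paths from the cycle to \<open>T\<close> feed the gadgets. If
  \<open>P\<close> meets one of them, the cycle without the start of a path connects the other two
  starts; otherwise \<open>P\<close> is attached through \<open>z\<close>.\<close>

lemma split_step_cycle:
 assumes P: "ray E P" and T: "ray E T" and PT: "range P Int range T = {}" and S: "S \<subseteq> V"
  and p: "distinct p" "length p \<ge> 3" "cycle_edges p \<subseteq> D" "set p \<subseteq> V - S" and D: "D \<subseteq> E"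
  and sepT: "\<forall>T0. finite T0 & card T0 < 3 --> (\<exists>a\<in>set p. \<exists>n. conn E (V - S - T0) a (T n))"
  and disj: "set p Int range T = {}" and z: "conn E (V - S - range T) (P n) z" "z \<in> set p"
 shows "split_step D P T S"
proof -
 obtain f :: "nat => 'v list" where ff: "\<forall>i<3. gpath E (f i) & set (f i) \<subseteq> V - S & hd (f i) \<in> set p & set (f i) Int set p = {hd (f i)} & set (f i) Int range T = {last (f i)}"
  "\<forall>i<3. \<forall>j<3. i ~= j --> set (f i) Int set (f j) = {}"
  using linked_paths[OF p(4) sepT] by (elim exE conjE)
 have f0: "gpath E (f i) & set (f i) \<subseteq> V - S & hd (f i) \<in> set p & set (f i) Int set p = {hd (f i)} & set (f i) Int range T = {last (f i)}" if "i < 3" for i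
  using ff(1) that by simp
 have fd: "set (f i) Int set (f j) = {}" if "i < 3" "j < 3" "i ~= j" for i j using ff(2) that by simp
 have f: "!!i. i < (3::nat) ==> gpath E (f i) & set (f i) \<subseteq> V - S & hd (f i) \<in> set p & set (f i) Int range T = {last (f i)}" using f0 by simp
 have Mc: "graph_connected D (set p)" by (rule gpath_connected[OF cycle_gpath(1)[OF p(1-3)]])
 have pE: "cycle_edges p \<subseteq> E" using p(3) D by blast
 show ?thesis
 proof (cases "\<exists>i<3. \<exists>n. P n \<in> set (f i)")
  case True
  then obtain i0 n0 where hit: "i0 < 3" "P n0 \<in> set (f i0)" by blast
  have K: "\<exists>K. finite K & K \<subseteq> V - S & graph_connected E K & K Int set (f i) = {} & K Int range T = {} & (\<forall>j<3. j ~= i --> hd (f j) \<in> K)" if i: "i < 3" for i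
  proof (intro exI[of _ "set p - {hd (f i)}"] conjI allI impI)
   show "graph_connected E (set p - {hd (f i)})" by (rule cycle_minus_vertex[OF p(1,2) pE]) (use f[OF i] in simp)
   show "(set p - {hd (f i)}) Int set (f i) = {}" using f0[OF i] by auto
   show "(set p - {hd (f i)}) Int range T = {}" using disj by auto
   show "set p - {hd (f i)} \<subseteq> V - S" using p(4) by auto
   fix j :: nat assume j: "j < 3" "j ~= i"
   have "f i ~= []" "f j ~= []" using f[OF i] f[OF j(1)] by (auto simp: gpath_def)
   then have "hd (f j) ~= hd (f i)" using fd[OF j(1) i j(2)] hd_in_set by (metis disjoint_iff)
   then show "hd (f j) \<in> set p - {hd (f i)}" using f[OF j(1)] by simp
  qed simp
  show ?thesis by (rule gadget_cross[OF P T PT f fd K _ p(4) Mc hit]) auto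
 next
  case False
  then have "P n \<notin> set (f i)" if "i < 3" for i n using that by blast
  then show ?thesis by (intro gadget_attach[OF P T PT f fd _ p(4) Mc _ z]) auto
 qed
qed

text \<open>If \<open>M\<close> already meets both rays, single vertices do for \<open>A\<close> and
  \<open>B\<close>.\<close>

lemma split_step_direct:
 assumes rP: "ray E P" and rT: "ray E T" and PT: "range P Int range T = {}"
  and M: "finite M" "M \<subseteq> V - S" "graph_connected D M" and n: "P n \<in> M" and m: "T m \<in> M"
 shows "split_step D P T S"
proof -
 have inj: "inj P" "inj T" using rP rT by (auto simp: ray_def)
 have ne: "P i ~= T j" for i j using PT by (metis disjoint_iff rangeI)
 have mem: "P n \<in> V - S" "T m \<in> V - S" using n m M(2) by auto
 have inter: "{P n} Int M ~= {}" "{T m} Int M ~= {}" using n m by auto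
 have Pc: "\<exists>a a'. P a \<in> {P n} & P a' \<in> {P n} & (\<forall>i. P i \<in> {P n} Un {T m} --> a \<le> i & i \<le> a')"
  using ne inj by (intro exI[of _ n]) (auto simp: inj_eq)
 have Tc: "\<exists>b b'. T b \<in> {T m} & T b' \<in> {T m} & (\<forall>i. T i \<in> {P n} Un {T m} --> b \<le> i & i \<le> b')"
  using ne[symmetric] inj by (intro exI[of _ m]) (auto simp: inj_eq)
 show ?thesis unfolding split_step_def
  by (intro exI[of _ M] exI[of _ "{P n}"] exI[of _ "{T m}"] conjI Pc Tc inter M)
   (use mem ne in auto)
qed

text \<open>\<open>split_step_cycle\<close> requires that one ray reach the cycle without meeting
  the other, and this holds for one of the two rays whenever the cycle misses at least one of them.
  If the cycle meets both, no paths are required.\<close>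

lemma split_step_cycles:
 assumes w: "om \<in> ends V E" "P \<in> om" "T \<in> om" and PT: "range P Int range T = {}" and D: "D \<subseteq> E"
  and us: "unseparable 3 om P" "unseparable 3 om T"
  and cyc: "!!S. finite S ==> S \<subseteq> V ==> \<exists>p. distinct p & length p \<ge> 3 & cycle_edges p \<subseteq> D & set p \<subseteq> end_comp V E S om"
  and S: "finite S" "S \<subseteq> V"
 shows "split_step D P T S"
proof -
 have rP: "ray E P" and rT: "ray E T" using ends_ray[OF w(1)] w(2,3) by auto
 obtain S1 where S1: "finite S1" "S \<subseteq> S1" "S1 \<subseteq> V"
  and l1: "!!u T0. u \<in> end_comp V E S1 om ==> finite T0 ==> card T0 < 3 ==> u \<notin> T0 ==> \<exists>n. conn E (V - S - T0) u (P n)"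
  using localize'[OF w(1,2) us(1) S] by metis
 obtain S2 where S2: "finite S2" "S \<subseteq> S2" "S2 \<subseteq> V"
  and l2: "!!u T0. u \<in> end_comp V E S2 om ==> finite T0 ==> card T0 < 3 ==> u \<notin> T0 ==> \<exists>n. conn E (V - S - T0) u (T n)"
  using localize'[OF w(1,3) us(2) S] by metis
 have S3: "finite (S1 Un S2)" "S1 Un S2 \<subseteq> V" using S1 S2 by auto
 obtain p where p: "distinct p" "length p \<ge> 3" "cycle_edges p \<subseteq> D" "set p \<subseteq> end_comp V E (S1 Un S2) om" using cyc[OF S3] by blast
 have p1: "set p \<subseteq> end_comp V E S1 om" using p(4) end_comp_mono[OF w(1) S3(1) _ S3(2), of S1] by blast
 have p2: "set p \<subseteq> end_comp V E S2 om" using p(4) end_comp_mono[OF w(1) S3(1) _ S3(2), of S2] by blast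
 have pV: "set p \<subseteq> V - S" using p1 end_comp_subset[OF w(1) S1(1,3)] S1(2) by blast
 \<comment> \<open>A cycle has at least three vertices, so one of them survives the deletion of
   \<open>T0\<close>.\<close>
 have ex: "\<exists>u\<in>set p. u \<notin> T0" if "finite T0" "card T0 < 3" for T0
 proof (rule ccontr)
  assume "~ ?thesis"
  then have "set p \<subseteq> T0" by blast
  then have "card (set p) \<le> card T0" using that(1) by (rule card_mono[rotated])
  then show False using that(2) p(1,2) by (simp add: distinct_card)
 qed
 have sP: "\<forall>T0. finite T0 & card T0 < 3 --> (\<exists>a\<in>set p. \<exists>n. conn E (V - S - T0) a (P n))"
  using ex l1 p1 by (metis subsetD)
 have sT: "\<forall>T0. finite T0 & card T0 < 3 --> (\<exists>a\<in>set p. \<exists>n. conn E (V - S - T0) a (T n))"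
  using ex l2 p2 by (metis subsetD)
 have TP: "range T Int range P = {}" using PT by (simp add: Int_commute)
 note stT = split_step_cycle[OF rP rT PT S(2) p(1-3) pV D sT]
 note stP = split_step_cycle[OF rT rP TP S(2) p(1-3) pV D sP]
 have Mc: "graph_connected D (set p)" by (rule gpath_connected[OF cycle_gpath(1)[OF p(1-3)]])
 show ?thesis
 proof (cases "set p Int range T = {}")
  case True
  show ?thesis
  proof (cases "\<exists>n z. z \<in> set p & conn E (V - S - range T) (P n) z")
   case c: True
   then obtain n z where "conn E (V - S - range T) (P n) z" "z \<in> set p" by blast
   then show ?thesis by (rule stT[OF True])
  next
   case c: False
   have pP: "set p Int range P = {}"
   proof (rule ccontr)
    assume "set p Int range P ~= {}"
    then obtain n where n: "P n \<in> set p" by auto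
    then have "P n \<in> V - S - range T" using pV True by blast
    then show False using c n conn_refl[of "P n" "V - S - range T" E] by blast
   qed
   obtain f :: "nat => 'v list" where ff: "\<forall>i<3. gpath E (f i) & set (f i) \<subseteq> V - S & hd (f i) \<in> set p & set (f i) Int set p = {hd (f i)} & set (f i) Int range P = {last (f i)}"
    "\<forall>i<3. \<forall>j<3. i ~= j --> set (f i) Int set (f j) = {}"
    using linked_paths[OF pV sP] by (elim exE conjE)
   have f0: "gpath E (f i) & set (f i) \<subseteq> V - S & hd (f i) \<in> set p & set (f i) Int set p = {hd (f i)} & set (f i) Int range P = {last (f i)}" if "i < 3" for i
    using ff(1) that by simp
   have g: "gpath E (f 0)" "set (f 0) \<subseteq> V - S" "hd (f 0) \<in> set p" "last (f 0) \<in> range P" "f 0 ~= []" using f0[of 0] by (auto simp: gpath_def)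
   \<comment> \<open>\<open>P\<close> cannot reach the cycle without meeting \<open>T\<close>, so
     this path to \<open>P\<close> meets \<open>T\<close>. Its part up to such a vertex avoids
     \<open>P\<close>, and the roles of the rays can be exchanged.\<close>
   have "~ set (f 0) Int range T = {}"
   proof
    assume "set (f 0) Int range T = {}"
    then have "conn E (V - S - range T) (hd (f 0)) (last (f 0))" by (intro gpath_conn_hd_last[OF g(1)]) (use g(2) in blast)
    then have cc: "conn E (V - S - range T) (last (f 0)) (hd (f 0))" by (rule conn_sym)
    obtain n where "last (f 0) = P n" using g(4) by (rule rangeE)
    then show False using c g(3) cc by metis
   qed
   then obtain m where m: "T m \<in> set (f 0)" by blast
   have Tl: "T m ~= last (f 0)" using g(4) TP by (metis disjoint_iff rangeI)
   have c2: "conn E (V - S - range P) (hd (f 0)) (T m)"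
   proof -
    note bl = gpath_bl[OF g(1) m Tl]
    have "set (butlast (f 0)) \<subseteq> V - S - range P" using bl(4) g(2) f0[of 0] by auto
    then show ?thesis by (rule graph_connectedD[OF bl(1,2,3)])
   qed
   have "split_step D T P S" by (rule stP[OF pP conn_sym[OF c2] g(3)])
   then show ?thesis by (rule split_step_sym)
  qed
 next
  case False
  then obtain m where m: "T m \<in> set p" by auto
  show ?thesis
  proof (cases "set p Int range P = {}")
   case True
   have "T m \<in> V - S - range P" using m pV TP by blast
   then have "split_step D T P S" using stP[OF True conn_refl m] by blast
   then show ?thesis by (rule split_step_sym)
  next
   case F2: False
   then obtain n where n: "P n \<in> set p" by auto
   show ?thesis by (rule split_step_direct[OF rP rT PT _ pV Mc n m]) simp
  qed
 qed
qed

text \<open>A component \<open>K\<close> of the complement of \<open>P\<close> that lies far out is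
  attached to \<open>P\<close> only and is not separated from \<open>T\<close> by two vertices.
  Three paths lead from its neighbours on \<open>P\<close> to \<open>T\<close> outside
  \<open>K\<close>. \<open>M\<close> is a segment of the ray \<open>P\<close> of \<open>D\<close>,
  and \<open>K\<close> links the starts of the paths.\<close>

lemma split_step_ray:
 assumes w: "om \<in> ends V E" "P \<in> om" "T \<in> om" and PT: "range P Int range T = {}" and D: "D \<subseteq> E" "ray D P"
  and us: "unseparable 3 om T"
  and inf: "infinite (graph_components E (V - range P))"
  and S: "finite S" "S \<subseteq> V"
 shows "split_step D P T S"
proof -
 have rP: "ray E P" and rT: "ray E T" using ends_ray[OF w(1)] w(2,3) by auto
 have PV: "P i \<in> V" for i using ray_V[OF rP] .
 obtain S1 where S1: "finite S1" "S \<subseteq> S1" "S1 \<subseteq> V"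
  and loc: "!!u T0. u \<in> end_comp V E S1 om ==> finite T0 ==> card T0 < 3 ==> u \<notin> T0 ==> \<exists>n. conn E (V - S - T0) u (T n)"
  using localize'[OF w(1,3) us S] by metis
 obtain n0 where n0: "!!m. m \<ge> n0 ==> P m \<notin> S1" using ray_avoids[OF rP S1(1)] by metis
 \<comment> \<open>Finitely many components meet this finite set. Avoiding it keeps \<open>K\<close>
   away from \<open>S1\<close>, from the neighbours of an initial segment of \<open>P\<close>, and
   from the component that contains \<open>T\<close>.\<close>
 define Fs where "Fs = S1 Un nbrs (P ` {..<n0}) Un {T 0}"
 have "finite Fs" unfolding Fs_def using S1(1) finite_nbrs_set by simp
 have "\<exists>K\<in>graph_components E (V - range P). K Int Fs = {}"
 proof (rule ccontr)
  assume neg: "~ ?thesis"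
  have "graph_components E (V - range P) \<subseteq> (%u. {y. conn E (V - range P) u y}) ` Fs"
  proof
   fix K assume K: "K \<in> graph_components E (V - range P)"
   then obtain u where u: "u \<in> K" "u \<in> Fs" using neg by blast
   then show "K \<in> (%u. {y. conn E (V - range P) u y}) ` Fs" using component_eq[OF K u(1)] by (intro image_eqI)
  qed
  then show False using inf \<open>finite Fs\<close> finite_surj by blast
 qed
 then obtain K where K: "K \<in> graph_components E (V - range P)" and KF: "K Int Fs = {}" by blast
 have KV: "K \<subseteq> V - range P" by (rule component_subset[OF K])
 have Kc: "graph_connected E K" by (rule component_connected[OF K])
 have KS1: "K Int S1 = {}" using KF by (auto simp: Fs_def)
 have KT: "K Int range T = {}"
 proof (rule ccontr)
  assume n: "K Int range T ~= {}"
  have tc: "graph_connected E (range T)" using ray_tail_connected[OF rT, of 0] by (simp add: atLeast_0)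
  have TV: "range T \<subseteq> V - range P" using ray_V[OF rT] PT by blast
  have "range T \<subseteq> K" by (rule component_absorbs[OF K tc TV n])
  then show False using KF by (auto simp: Fs_def)
 qed
 have Kcl: "v \<in> K" if "x \<in> K" "{x, v} \<in> E" "v \<notin> range P" for x v
 proof -
  have "conn E (V - range P) x v" by (rule conn_edge[OF that(2)]) (use that KV edgeD[OF that(2)] in auto)
  then show ?thesis by (rule component_closed[OF K that(1)])
 qed
 have Nn0: "j \<ge> n0" if "k \<in> K" "{k, P j} \<in> E" for k j
 proof (rule ccontr)
  assume "~ ?thesis"
  then have "P j \<in> P ` {..<n0}" by simp
  moreover have "{P j, k} \<in> E" using that(2) by (simp add: insert_commute)
  ultimately have "k \<in> nbrs (P ` {..<n0})" unfolding nbrs_def by blast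
  then show False using KF that(1) by (auto simp: Fs_def)
 qed
 obtain u where u: "u \<in> K" using graph_connected_ne[OF Kc] by blast
 have "\<exists>k j. k \<in> K & {k, P j} \<in> E"
 proof (rule ccontr)
  assume neg: "~ ?thesis"
  have "V \<subseteq> K"
  proof (rule graph_connected_subset_side[OF V_connected _ _ u])
   show "b \<in> K" if "{a, b} \<in> E" "a \<in> K" for a b using Kcl[OF that(2,1)] neg that by blast
  qed (use KV u in blast)
  then show False using KV PV[of 0] by blast
 qed
 then obtain k j where kj: "k \<in> K" "{k, P j} \<in> E" by blast
 have jn: "j \<ge> n0" by (rule Nn0[OF kj])
 have KVS1: "K \<subseteq> V - S1" using KV KS1 by blast
 have "conn E (V - S1) (P j) k"
 proof (rule conn_edge)
  show "{P j, k} \<in> E" using kj(2) by (simp add: insert_commute)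
 qed (use n0[OF jn] PV KVS1 kj(1) in auto)
 moreover have "conn E (V - S1) k u" by (rule graph_connectedD[OF Kc kj(1) u KVS1])
 ultimately have "conn E (V - S1) (P j) u" by (rule conn_trans)
 then have uC: "u \<in> end_comp V E S1 om" by (intro end_compI[OF w(1) S1(1,3) w(2), of j]) (use n0 jn in auto)
 define N where "N = {P j | j. \<exists>k\<in>K. {k, P j} \<in> E}"
 define W where "W = V - S - K"
 have NP: "\<exists>j\<ge>n0. v = P j & (\<exists>k\<in>K. {k, v} \<in> E)" if "v \<in> N" for v
  using that Nn0 unfolding N_def by blast
 have NW: "N \<subseteq> W"
 proof
  fix v assume "v \<in> N"
  then obtain j where j: "j \<ge> n0" "v = P j" using NP by blast
  then show "v \<in> W" using n0[OF j(1)] S1(2) PV[of j] KV by (auto simp: W_def)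
 qed
 \<comment> \<open>It suffices to join \<open>u\<close> to \<open>T\<close> outside \<open>S\<close>
   and \<open>T0 - K\<close>. The connection, read from \<open>T\<close>, is followed until it first
   enters \<open>K\<close>, which it does from a vertex of \<open>N\<close>.\<close>
 have sep: "\<forall>T0. finite T0 & card T0 < 3 --> (\<exists>a\<in>N. \<exists>n. conn E (W - T0) a (T n))"
 proof (intro allI impI)
  fix T0 :: "'v set" assume "finite T0 & card T0 < 3"
  then have T0: "finite T0" "card T0 < 3" by auto
  have "card (T0 - K) < 3" using card_mono[OF T0(1), of "T0 - K"] T0(2) by auto
  then obtain n where n: "conn E (V - S - (T0 - K)) u (T n)" using loc[OF uC, of "T0 - K"] T0(1) u by auto
  have TnK: "T n \<notin> K" using KT by blast
  have eq: "V - S - (T0 - K) - K = W - T0" by (auto simp: W_def)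
  have nc: "~ conn E (V - S - (T0 - K) - K) (T n) u" using conn_right u by fastforce
  obtain s t where st: "s \<in> K" "conn E (W - T0) (T n) t" "{t, s} \<in> E"
   using conn_hit[OF conn_sym[OF n], of K] nc TnK unfolding eq by blast
  have tK: "t \<notin> K" using conn_right[OF st(2)] by (auto simp: W_def)
  have sK: "{s, t} \<in> E" using st(3) by (simp add: insert_commute)
  then have "t \<in> range P" using Kcl[OF st(1) sK] tK by blast
  then have "t \<in> N" using st(1) sK unfolding N_def by blast
  then show "\<exists>a\<in>N. \<exists>n. conn E (W - T0) a (T n)" using conn_sym[OF st(2)] by (intro bexI exI)
 qed
 obtain f :: "nat => 'v list" where ff: "\<forall>i<3. gpath E (f i) & set (f i) \<subseteq> W & hd (f i) \<in> N & set (f i) Int N = {hd (f i)} & set (f i) Int range T = {last (f i)}"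
  "\<forall>i<3. \<forall>j<3. i ~= j --> set (f i) Int set (f j) = {}"
  using linked_paths[OF NW sep] by (elim exE conjE)
 have f0: "gpath E (f i) & set (f i) \<subseteq> W & hd (f i) \<in> N & set (f i) Int N = {hd (f i)} & set (f i) Int range T = {last (f i)}" if "i < 3" for i
  using ff(1) that by simp
 have fd: "set (f i) Int set (f j) = {}" if "i < 3" "j < 3" "i ~= j" for i j using ff(2) that by simp
 have "\<forall>i. \<exists>j k. i < 3 --> j \<ge> n0 & hd (f i) = P j & k \<in> K & {k, hd (f i)} \<in> E" using f0 NP by meson
 then obtain jj kk where jk: "!!i. i < 3 ==> jj i \<ge> n0 & hd (f i) = P (jj i) & kk i \<in> K & {kk i, hd (f i)} \<in> E" by metis
 define hi where "hi = max n0 (Max (jj ` {..<3}))"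
 have hij: "jj i \<le> hi" if "i < 3" for i
 proof -
  have "jj i \<le> Max (jj ` {..<3})" using that by (intro Max_ge) auto
  then show ?thesis by (simp add: hi_def)
 qed
 define M where "M = P ` {n0..hi}"
 have hM: "hd (f i) \<in> M" if "i < 3" for i using jk[OF that] hij[OF that] by (auto simp: M_def)
 have Mc: "graph_connected D M" unfolding M_def by (rule ray_segment_connected) (use D(2) in \<open>auto simp: ray_def hi_def\<close>)
 have MV: "M \<subseteq> V - S" using n0 S1(2) PV by (auto simp: M_def)
 have f: "gpath E (f i) & set (f i) \<subseteq> V - S & hd (f i) \<in> M & set (f i) Int range T = {last (f i)}" if "i < 3" for i
  using f0[OF that] hM[OF that] by (auto simp: W_def)
 \<comment> \<open>Only a finite connected part of \<open>K\<close> is taken, one that contains a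
   neighbour of each of the three starts.\<close>
 obtain Kf where Kf: "finite Kf" "graph_connected E Kf" "kk ` {..<3} \<subseteq> Kf" "Kf \<subseteq> K"
  using finite_connected_superset[OF Kc, of "kk ` {..<3}"] jk by (metis finite_imageI finite_lessThan image_subsetI lessThan_iff)
 have KfV: "Kf \<subseteq> V - S" using Kf(4) KVS1 S1(2) by blast
 have ex: "\<exists>K. finite K & K \<subseteq> V - S & graph_connected E K & K Int set (f i) = {} & K Int range T = {} & (\<forall>j<3. j ~= i --> hd (f j) \<in> K)" if i: "i < 3" for i
 proof -
  define L where "L = Kf Un (%j. hd (f j)) ` ({..<3} - {i})"
  have "graph_connected E L"
  proof (rule graph_connectedI)
   show k0: "kk 0 \<in> L" using Kf(3) by (auto simp: L_def)
   fix y assume y: "y \<in> L"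
   have kL: "conn E L (kk 0) v" if "v \<in> Kf" for v by (rule graph_connectedD[OF Kf(2) _ that]) (use Kf(3) in \<open>auto simp: L_def\<close>)
   show "conn E L (kk 0) y"
   proof (cases "y \<in> Kf")
    case False
    then obtain j where j: "j < 3" "y = hd (f j)" using y by (auto simp: L_def)
    have "kk j \<in> Kf" using Kf(3) j(1) by auto
    then show ?thesis using conn_step[OF kL, of "kk j" y] jk[OF j(1)] j(2) y by auto
   qed (rule kL)
  qed
  moreover have "L Int set (f i) = {}"
  proof -
   have "Kf Int set (f i) = {}" using f0[OF i] Kf(4) by (auto simp: W_def)
   moreover have "hd (f j) \<notin> set (f i)" if "j < 3" "j ~= i" for j
   proof -
    have "f j ~= []" using f[OF that(1)] by (simp add: gpath_def)
    then show ?thesis using fd[OF that(1) i that(2)] hd_in_set by (metis disjoint_iff)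
   qed
   ultimately show ?thesis by (auto simp: L_def)
  qed
  moreover have "L Int range T = {}"
  proof -
   have hT: "hd (f j) \<notin> range T" if "j < 3" for j using jk[OF that] PT by (metis disjoint_iff rangeI)
   have "(%j. hd (f j)) ` ({..<3} - {i}) Int range T = {}"
   proof (rule ccontr)
    assume "(%j. hd (f j)) ` ({..<3} - {i}) Int range T ~= {}"
    then obtain v where v: "v \<in> (%j. hd (f j)) ` ({..<3} - {i})" "v \<in> range T" by (meson disjoint_iff)
    obtain j where j: "v = hd (f j)" "j \<in> {..<3} - {i}" using v(1) by (rule imageE)
    then show False using hT[of j] v(2) by simp
   qed
   moreover have "Kf Int range T = {}" using Kf(4) KT by blast
   ultimately show ?thesis unfolding L_def Int_Un_distrib2 by simp
  qed
  moreover have "L \<subseteq> V - S" using KfV hM MV by (auto simp: L_def)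
  moreover have "finite L" using Kf(1) by (simp add: L_def)
  moreover have "\<forall>j<3. j ~= i --> hd (f j) \<in> L" by (auto simp: L_def)
  ultimately show ?thesis by (intro exI[of _ L] conjI)
 qed
 \<comment> \<open>The starts of the paths lie on \<open>P\<close> itself, so the case of
   \<open>gadget_cross\<close> is always present.\<close>
 have hit: "(0::nat) < 3" "P (jj 0) \<in> set (f 0)"
 proof -
  have "f 0 ~= []" using f[of 0] by (simp add: gpath_def)
  then show "P (jj 0) \<in> set (f 0)" using jk[of 0] hd_in_set[of "f 0"] by simp
 qed simp
 show ?thesis by (rule gadget_cross[OF rP rT PT f fd ex _ MV Mc hit]) (auto simp: M_def)
qed


subsection \<open>Sets orthogonal to all bonds\<close>

text \<open>Without rays, each edge of \<open>D\<close> lies on a finite cycle in \<open>D\<close>.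
  Deleting a cycle that meets \<open>S\<close> preserves all hypotheses and lowers the finite number
  of edges of \<open>D\<close> at \<open>S\<close>, so a cycle avoiding \<open>S\<close> appears
  eventually.\<close>

lemma cycle_avoiding:
 assumes "D \<in> alg_cycle_space V E" "infinite D" "!!R. ~ ray D R" "finite S"
 shows "\<exists>p. distinct p & length p \<ge> 3 & cycle_edges p \<subseteq> D & set p Int S = {}"
 using assms(1-3)
proof (induction "card {e\<in>D. e Int S ~= {}}" arbitrary: D rule: less_induct)
 case less
 have DE: "D \<subseteq> E" using less.prems(1) by (simp add: alg_iff)
 obtain e where e: "e \<in> D" using infinite_imp_nonempty[OF less.prems(2)] by blast
 obtain Z where Z: "e \<in> Z" "Z \<in> finite_circuits D Un double_ray_edge_sets D" using alg_edge[OF less.prems(1) e] .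
 have "Z \<notin> double_ray_edge_sets D"
 proof
  assume "Z \<in> double_ray_edge_sets D"
  then obtain d where d: "inj d" "double_ray_edges d \<subseteq> D" by (auto simp: double_ray_edge_sets_def)
  have "{d (int i), d (int i + 1)} \<in> D" for i using d(2) unfolding double_ray_edges_def by blast
  moreover have "inj (%n. d (int n))" using d(1) by (auto intro!: injI dest: injD)
  ultimately have "ray D (%n. d (int n))" by (simp add: ray_def add.commute)
  then show False using less.prems(3) by blast
 qed
 then have ZC: "Z \<in> finite_circuits D" using Z(2) by blast
 then obtain p where p: "Z = cycle_edges p" "distinct p" "length p \<ge> 3" "cycle_edges p \<subseteq> D" by (auto simp: finite_circuits_def)
 show ?case
 proof (cases "set p Int S = {}")
  case True then show ?thesis using p by blast
 next
  case False
  then obtain v where v: "v \<in> set p" "v \<in> S" by blast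
  then obtain i where i: "i < length p" "v = p ! i" by (auto simp: in_set_conv_nth)
  define c where "c = {p ! i, p ! (Suc i mod length p)}"
  have cZ: "c \<in> Z" unfolding p(1) cycle_edges_def c_def using i(1) by blast
  have vc: "v \<in> c" using i(2) by (simp add: c_def)
  have Z2: "Z \<in> finite_circuits E Un double_ray_edge_sets E" using ZC finite_circuits_mono[OF DE] by blast
  have "D - Z \<in> alg_cycle_space V E" using alg_diff[OF less.prems(1) alg_circuit[OF Z2]] p by blast
  moreover have "cycle_edges p = (%i. {p ! i, p ! (Suc i mod length p)}) ` {..<length p}" by (auto simp: cycle_edges_def)
  then have "finite Z" using p(1) by simp
  then have "infinite (D - Z)" using less.prems(2) by simp
  moreover have "~ ray (D - Z) R" for R using less.prems(3)[of R] by (auto simp: ray_def)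
  moreover have "card {e\<in>D - Z. e Int S ~= {}} < card {e\<in>D. e Int S ~= {}}"
  proof (rule psubset_card_mono)
   show "finite {e\<in>D. e Int S ~= {}}" by (rule finite_subset[OF _ finite_touch[OF assms(4)]]) (use DE in auto)
   have "c \<in> {e\<in>D. e Int S ~= {}}" using cZ p vc v(2) by auto
   moreover have "c \<notin> {e\<in>D - Z. e Int S ~= {}}" using cZ by simp
   ultimately show "{e\<in>D - Z. e Int S ~= {}} \<subset> {e\<in>D. e Int S ~= {}}" by blast
  qed
  ultimately obtain q where "distinct q" "length q \<ge> 3" "cycle_edges q \<subseteq> D - Z" "set q Int S = {}" using less.hyps[of "D - Z"] by blast
  then show ?thesis by blast
 qed
qed

lemma cycle_V: assumes "cycle_edges p \<subseteq> E" shows "set p \<subseteq> V"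
proof
 fix v assume "v \<in> set p"
 then obtain i where i: "i < length p" "v = p ! i" by (auto simp: in_set_conv_nth)
 have "{p ! i, p ! (Suc i mod length p)} \<in> cycle_edges p" unfolding cycle_edges_def using i(1) by blast
 then have "{p ! i, p ! (Suc i mod length p)} \<in> E" using assms by blast
 then show "v \<in> V" using edgeD i(2) by blast
qed

text \<open>The cycles are chosen disjoint, so a finite set meets only finitely many of them. Their
  first vertices accumulate at an end by \<open>star_comb\<close>; a cycle that avoids
  \<open>S\<close> and starts in the component of that end lies in it entirely.\<close>

lemma cycles_infinite_bond:
 assumes D: "D \<subseteq> E" and us: "!!om R. om \<in> ends V E ==> R \<in> om ==> unseparable 3 om R"
  and cyc: "!!S. finite S ==> \<exists>p. distinct p & length p \<ge> 3 & cycle_edges p \<subseteq> D & set p Int S = {}"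
 obtains B where "B \<in> bonds V E" "infinite (D Int B)"
proof -
 obtain pf where pf: "!!S. finite S ==> distinct (pf S) & length (pf S) \<ge> 3 & cycle_edges (pf S) \<subseteq> D & set (pf S) Int S = {}"
  using cyc by metis
 define SS where "SS = (%n. ((%S. S Un set (pf S)) ^^ n) {})"
 have SSS: "SS (Suc n) = SS n Un set (pf (SS n))" for n by (simp add: SS_def)
 have SSf: "finite (SS n)" for n by (induction n) (simp_all add: SSS, simp add: SS_def)
 define p where "p = (%n. pf (SS n))"
 have p: "distinct (p n)" "length (p n) \<ge> 3" "cycle_edges (p n) \<subseteq> D" "set (p n) Int SS n = {}" for n
  using pf[OF SSf[of n]] by (auto simp: p_def)
 have pne: "p n ~= []" for n using p(2)[of n] by auto
 have mono: "SS m \<subseteq> SS n" if "m \<le> n" for m n by (rule lift_Suc_mono_le[OF _ that]) (simp add: SSS)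
 have later: "set (p m) \<subseteq> SS n" if "m < n" for m n using mono[of "Suc m" n] that by (simp add: SSS p_def)
 have pV: "set (p n) \<subseteq> V" for n by (rule cycle_V) (use p(3)[of n] D in blast)
 have hp: "hd (p n) \<in> set (p n)" for n using pne by simp
 have inj: "inj (%n. hd (p n))"
 proof (rule linorder_injI)
  fix m n :: nat assume "m < n"
  then have "hd (p m) \<in> SS n" using later hp by blast
  then show "hd (p m) ~= hd (p n)" using p(4)[of n] hp[of n] by (metis disjoint_iff)
 qed
 define U where "U = range (%n. hd (p n))"
 have infU: "infinite U" unfolding U_def by (rule range_inj_infinite[OF inj])
 have UV: "U \<subseteq> V" using pV hp by (auto simp: U_def)
 obtain r where r: "r \<in> V" using graph_connected_ne[OF V_connected] by blast
 obtain R where R: "ray E R" and comb: "!!S. finite S ==> \<exists>n. (\<forall>m\<ge>n. R m \<notin> S) & infinite {u\<in>U. conn E (V - S) (R n) u}"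
 proof (rule star_comb[OF V_connected r _ UV infU])
  show "finite {y\<in>V. {x, y} \<in> E}" if "x \<in> V" for x
   by (rule finite_subset[OF _ finite_nbrs[OF that]]) auto
 qed auto
 obtain om where w: "om \<in> ends V E" "R \<in> om" using ray_end[OF R] .
 have cyc2: "\<exists>p. distinct p & length p \<ge> 3 & cycle_edges p \<subseteq> D & set p \<subseteq> end_comp V E S om" if S: "finite S" "S \<subseteq> V" for S
 proof -
  obtain k where k: "\<forall>m\<ge>k. R m \<notin> S" "infinite {u\<in>U. conn E (V - S) (R k) u}" using comb[OF S(1)] by blast
  define I where "I = {n. conn E (V - S) (R k) (hd (p n))}"
  have "{u\<in>U. conn E (V - S) (R k) u} \<subseteq> (%n. hd (p n)) ` I" unfolding U_def I_def by auto
  then have "infinite I" using k(2) finite_surj by blast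
  have fs: "finite {n. s \<in> set (p n)}" for s
  proof (cases "\<exists>n. s \<in> set (p n)")
   case True
   then obtain n1 where n1: "s \<in> set (p n1)" by blast
   have "{n. s \<in> set (p n)} \<subseteq> {..n1}"
   proof
    fix n assume n: "n \<in> {n. s \<in> set (p n)}"
    show "n \<in> {..n1}"
    proof (rule ccontr)
     assume "n \<notin> {..n1}"
     then have "s \<in> SS n" using later[of n1 n] n1 by auto
     then show False using p(4)[of n] n by auto
    qed
   qed
   then show ?thesis by (rule finite_subset) simp
  qed simp
  have "finite (\<Union>s\<in>S. {n. s \<in> set (p n)})" using S(1) fs by (intro finite_UN_I)
  then have "infinite (I - (\<Union>s\<in>S. {n. s \<in> set (p n)}))" using \<open>infinite I\<close> by simp
  then have "I - (\<Union>s\<in>S. {n. s \<in> set (p n)}) ~= {}" by (rule infinite_imp_nonempty)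
  then obtain n where "n \<in> I - (\<Union>s\<in>S. {n. s \<in> set (p n)})" by (meson ex_in_conv)
  then have n: "conn E (V - S) (R k) (hd (p n))" "set (p n) Int S = {}" by (auto simp: I_def)
  have hC: "hd (p n) \<in> end_comp V E S om" by (rule end_compI[OF w(1) S w(2) _ n(1)]) (use k(1) in blast)
  have "graph_connected E (set (p n))" by (rule gpath_connected[OF cycle_gpath(1)[OF p(1,2)]]) (use p(3)[of n] D in blast)
  then have "set (p n) \<subseteq> end_comp V E S om"
   by (rule component_absorbs[OF end_comp_component[OF w(1) S]]) (use pV[of n] n(2) hC hp[of n] in blast)+
  then show ?thesis using p(1,2,3)[of n] by (intro exI[of _ "p n"]) simp
 qed
 obtain P T where PT: "P \<in> om" "T \<in> om" "range P Int range T = {}" using two_disjoint_rays[OF w(1)] .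
 have st: "split_step D P T S" if "finite S" for S
 proof (rule split_step_mono)
  show "split_step D P T (S Int V)"
   by (rule split_step_cycles[OF w(1) PT D us[OF w(1) PT(1)] us[OF w(1) PT(2)] cyc2]) (use that in auto)
 qed
 show ?thesis by (rule infinite_bond[OF D ends_ray[OF w(1) PT(1)] ends_ray[OF w(1) PT(2)] PT(3) st that])
qed

text \<open>If no infinite bond meets \<open>D\<close> infinitely often, then a ray of \<open>D\<close> has a tail with no further
  \<open>D\<close>-edges, and some bond meets \<open>D\<close> exactly in the edge before that tail.\<close>

lemma orthogonal_bonds_finite:
 assumes D: "D \<subseteq> E" and us: "!!om R. om \<in> ends V E ==> R \<in> om ==> unseparable 3 om R"
  and orth: "!!B. B \<in> bonds V E ==> edge_orthogonal D B"
 shows "finite D" "D \<in> alg_cycle_space V E"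
proof -
 have finB: "finite (D Int B)" and evB: "even (card (D Int B))" if "B \<in> bonds V E" for B using orth[OF that] by (auto simp: edge_orthogonal_def)
 have "even (card {e\<in>D. v \<in> e})" if "v \<in> V" for v
 proof -
  have "D Int {e\<in>E. v \<in> e} = {e\<in>D. v \<in> e}" using D by auto
  then show ?thesis using evB[OF star_bond[OF that]] by simp
 qed
 then show alg: "D \<in> alg_cycle_space V E" using D by (simp add: alg_iff)
 show "finite D"
 proof (rule ccontr)
  assume inf: "infinite D"
  have "~ (\<forall>S. finite S --> (\<exists>p. distinct p & length p \<ge> 3 & cycle_edges p \<subseteq> D & set p Int S = {}))"
  proof
   assume c: "\<forall>S. finite S --> (\<exists>p. distinct p & length p \<ge> 3 & cycle_edges p \<subseteq> D & set p Int S = {})"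
   obtain B where "B \<in> bonds V E" "infinite (D Int B)"
    by (rule cycles_infinite_bond[OF D us]) (use c in blast)+
   then show False using finB by blast
  qed
  then obtain S0 where S0: "finite S0" and nocyc: "!!p. distinct p ==> length p \<ge> 3 ==> cycle_edges p \<subseteq> D ==> set p Int S0 ~= {}" by blast
  have "\<exists>R. ray D R"
  proof (rule ccontr)
   assume "~ ?thesis"
   then show False using cycle_avoiding[OF alg inf _ S0] nocyc by blast
  qed
  then obtain R0 where R0: "ray D R0" by blast
  have R0E: "ray E R0" using R0 D by (auto simp: ray_def)
  obtain om where w: "om \<in> ends V E" "R0 \<in> om" using ray_end[OF R0E] .
  obtain R1 R2 where R12: "R1 \<in> om" "R2 \<in> om" "range R1 Int range R2 = {}" using two_disjoint_rays[OF w(1)] .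
  have r12: "ray E R1" "ray E R2" using ends_ray[OF w(1)] R12 by auto
  \<comment> \<open>If the ray \<open>R0\<close> of \<open>D\<close> met two disjoint rays
    infinitely often, its segments far out would serve as the sets \<open>M\<close> for both of
    them.\<close>
  have "~ (infinite (range R0 Int range R1) & infinite (range R0 Int range R2))"
  proof
   assume i: "infinite (range R0 Int range R1) & infinite (range R0 Int range R2)"
   have "split_step D R1 R2 S" if S: "finite S" for S
   proof -
    obtain n0 where n0: "!!m. m \<ge> n0 ==> R0 m \<notin> S" using ray_avoids[OF R0E S] by metis
    have far: "\<exists>i\<ge>n0. \<exists>j. R0 i = Q j" if "infinite (range R0 Int range Q)" for Q
    proof -
     have "infinite (range R0 Int range Q - R0 ` {..<n0})" using that by simp
     then have "range R0 Int range Q - R0 ` {..<n0} ~= {}" by (rule infinite_imp_nonempty)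
     then obtain v where v: "v \<in> range R0 Int range Q - R0 ` {..<n0}" by (meson ex_in_conv)
     then have "v \<in> range R0" "v \<in> range Q" by simp_all
     then obtain i j where ij: "v = R0 i" "v = Q j" by (elim rangeE)
     have "i \<ge> n0" using v ij(1) by (metis DiffD2 imageI lessThan_iff not_le)
     then show ?thesis using ij by metis
    qed
    obtain i i' where i1: "i \<ge> n0" "R0 i = R1 i'" using far[of R1] i by blast
    obtain j j' where j1: "j \<ge> n0" "R0 j = R2 j'" using far[of R2] i by blast
    define M where "M = R0 ` {n0..max i j}"
    have "graph_connected D M" unfolding M_def by (rule ray_segment_connected) (use R0 i1(1) in \<open>auto simp: ray_def\<close>)
    moreover have "M \<subseteq> V - S" using n0 ray_V[OF R0E] by (auto simp: M_def)
    moreover have "R0 i \<in> M" "R0 j \<in> M" using i1(1) j1(1) by (auto simp: M_def)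
    then have "R1 i' \<in> M" "R2 j' \<in> M" using i1(2) j1(2) by simp_all
    moreover have "finite M" by (simp add: M_def)
    ultimately show ?thesis by (intro split_step_direct[OF r12 R12(3)])
   qed
   then obtain B where "B \<in> bonds V E" "infinite (D Int B)" using infinite_bond[OF D r12 R12(3)] by metis
   then show False using finB by blast
  qed
  then obtain T where T: "T \<in> om" "finite (range R0 Int range T)" using R12 by metis
  obtain n1 where n1: "!!m. m \<ge> n1 ==> R0 m \<notin> range R0 Int range T" using ray_avoids[OF R0E T(2)] by metis
  define R where "R = (%i. R0 (n1 + i))"
  have RD: "ray D R" unfolding R_def by (rule ray_tail[OF R0])
  have RE: "ray E R" unfolding R_def by (rule ray_tail[OF R0E])
  have Rw: "R \<in> om" unfolding R_def by (rule end_tail[OF w])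
  have RT: "range R Int range T = {}"
  proof (rule ccontr)
   assume "range R Int range T ~= {}"
   then obtain v where v: "v \<in> range R" "v \<in> range T" by (meson disjoint_iff)
   obtain i where "v = R i" using v(1) by (rule rangeE)
   then show False using n1[of "n1 + i"] v(2) by (simp add: R_def)
  qed
  have injR: "inj R" and eD: "!!i. {R i, R (Suc i)} \<in> D" using RD by (auto simp: ray_def)
  have RV: "R i \<in> V" for i using ray_V[OF RE] .
  have rc: "graph_connected E (range R)" using ray_tail_connected[OF RE, of 0] by (simp add: atLeast_0)
  have rV: "range R \<subseteq> V" using RV by blast
  define \<K> where "\<K> = graph_components E (V - range R)"
  \<comment> \<open>Infinitely many components would make \<open>split_step_ray\<close> applicable
    at every finite set.\<close>
  have finK: "finite \<K>"
  proof (rule ccontr)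
   assume "infinite \<K>"
   then have ik: "infinite (graph_components E (V - range R))" by (simp add: \<K>_def)
   have st: "split_step D R T S" if "finite S" for S
   proof (rule split_step_mono)
    show "split_step D R T (S Int V)" by (rule split_step_ray[OF w(1) Rw T(1) RT D RD us[OF w(1) T(1)] ik]) (use that in auto)
   qed
   obtain B where "B \<in> bonds V E" "infinite (D Int B)" using infinite_bond[OF D RE ends_ray[OF w(1) T(1)] RT st] by metis
   then show False using finB by blast
  qed
  \<comment> \<open>The edges of \<open>D\<close> leaving \<open>R\<close> lie in the cuts of
    finitely many components; these cuts are bonds and meet \<open>D\<close> finitely.\<close>
  define Dx where "Dx = D Int bd (range R)"
  have "finite Dx"
  proof (rule finite_subset)
   show "finite (\<Union>K\<in>\<K>. D Int bd K)"
    by (rule finite_UN_I[OF finK]) (use finB[OF bond_of_component[OF rV rc]] in \<open>simp add: \<K>_def\<close>)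
   show "Dx \<subseteq> (\<Union>K\<in>\<K>. D Int bd K)"
   proof
    fix e assume "e \<in> Dx"
    then have eD: "e \<in> D" and eb: "e \<in> bd (range R)" by (auto simp: Dx_def)
    obtain x y where xy: "e = {x, y}" "x \<in> range R" "y \<in> V - range R" "{x, y} \<in> E" using eb by (rule bd_cases)
    let ?K = "{z. conn E (V - range R) y z}"
    have K: "?K \<in> \<K>" unfolding \<K>_def by (rule component_of[OF xy(3)])
    have "y \<in> ?K" using xy(3) by (simp add: conn_refl)
    moreover have "x \<notin> ?K" using xy(2) conn_right by fastforce
    ultimately have "e \<in> bd ?K" using bd_iff[OF xy(4), of ?K] xy(1) by blast
    then show "e \<in> (\<Union>K\<in>\<K>. D Int bd K)" using K eD by blast
   qed
  qed
  \<comment> \<open>A chord in \<open>D\<close> closes a cycle of \<open>D\<close> with the segment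
    of \<open>R\<close> that it spans; far out such a cycle would miss \<open>S0\<close>.\<close>
  define Ch where "Ch = {{R i, R j} | i j. {R i, R j} \<in> D & Suc i < j}"
  have "finite Ch"
  proof (rule ccontr)
   assume ic: "infinite Ch"
   obtain n0 where n0: "!!m. m \<ge> n0 ==> R m \<notin> S0" using ray_avoids[OF RE S0] by metis
   have "finite {e\<in>E. e Int R ` {..<n0} ~= {}}" by (rule finite_touch) simp
   then have "infinite (Ch - {e\<in>E. e Int R ` {..<n0} ~= {}})" using ic by simp
   then have "Ch - {e\<in>E. e Int R ` {..<n0} ~= {}} ~= {}" by (rule infinite_imp_nonempty)
   then obtain e where "e \<in> Ch - {e\<in>E. e Int R ` {..<n0} ~= {}}" by (meson ex_in_conv)
   then obtain i j where ij: "{R i, R j} \<in> D" "Suc i < j" "{R i, R j} \<notin> {e\<in>E. e Int R ` {..<n0} ~= {}}" unfolding Ch_def by blast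
   have "i \<ge> n0"
   proof (rule ccontr)
    assume "~ ?thesis"
    then have "R i \<in> {R i, R j} Int R ` {..<n0}" by simp
    then show False using ij(1,3) D by blast
   qed
   define p where "p = map R [i..<Suc j]"
   have ij': "i \<le> j" using ij(2) by simp
   note g = ray_seg_gpath[OF RD ij', folded p_def]
   have len: "length p = Suc j - i" by (simp add: p_def del: upt_Suc)
   have nth: "p ! k = R (i + k)" if "k < length p" for k using that by (simp add: p_def del: upt_Suc)
   have "cycle_edges p \<subseteq> D"
   proof
    fix e assume "e \<in> cycle_edges p"
    then obtain k where k: "k < length p" "e = {p ! k, p ! (Suc k mod length p)}" by (auto simp: cycle_edges_def)
    show "e \<in> D"
    proof (cases "Suc k < length p")
     case True
     then have "e = {R (i + k), R (Suc (i + k))}" using k nth[of k] nth[of "Suc k"] by simp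
     then show ?thesis using eD by simp
    next
     case False
     then have kl: "Suc k = length p" using k(1) by simp
     then have "i + k = j" using len ij(2) by simp
     moreover have "Suc k mod length p = 0" using kl by simp
     moreover have "p ! 0 = R (i + 0)" by (rule nth) (use k(1) in linarith)
     ultimately have "e = {R j, R i}" using k(2) nth[OF k(1)] by simp
     then show ?thesis using ij(1) by (simp add: insert_commute)
    qed
   qed
   moreover have "distinct p" using g(1) by (simp add: gpath_def)
   moreover have "length p \<ge> 3" using len ij(2) by simp
   moreover have "set p Int S0 = {}" using g(4) n0 \<open>i \<ge> n0\<close> by auto
   ultimately show False using nocyc by blast
  qed
  have "finite (\<Union>(Dx Un Ch))"
  proof (rule finite_Union)
   show "finite (Dx Un Ch)" using \<open>finite Dx\<close> \<open>finite Ch\<close> by simp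
   fix e assume "e \<in> Dx Un Ch"
   then have "e \<in> E" using D unfolding Dx_def Ch_def by blast
   then have "card e = 2" by (rule edge_card)
   then show "finite e" by (simp add: card_ge_0_finite)
  qed
  then obtain m0 where m0: "!!k. k \<ge> m0 ==> R k \<notin> \<Union>(Dx Un Ch)" using ray_avoids[OF RE] by metis
  \<comment> \<open>The shift by one leaves a vertex \<open>R m0\<close> just before the tail, so
    that the single edge of \<open>D\<close> between the tail and the rest is
    \<open>{R m0, R m}\<close>.\<close>
  define m where "m = Suc m0"
  have mm: "R k \<notin> \<Union>(Dx Un Ch)" if "k \<ge> m" for k using m0[of k] that by (simp add: m_def)
  define X where "X = R ` {m..}"
  have Xc: "graph_connected E X" unfolding X_def by (rule ray_tail_connected[OF RE])
  have XV: "X \<subseteq> V" using RV by (auto simp: X_def)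
  have nX: "R m0 \<notin> X" using injR by (auto simp: X_def m_def inj_eq)
  then have yV: "R m0 \<in> V - X" using RV by simp
  define C where "C = {z. conn E (V - X) (R m0) z}"
  have C: "C \<in> graph_components E (V - X)" unfolding C_def by (rule component_of[OF yV])
  have bond: "bd C \<in> bonds V E" by (rule bond_of_component[OF XV Xc C])
  have yC: "R m0 \<in> C" using yV by (simp add: C_def conn_refl)
  have CX: "C Int X = {}" using component_subset[OF C] by blast
  have "D Int bd C = {{R m0, R m}}"
  proof (intro equalityI subsetI)
   fix e assume "e \<in> D Int bd C"
   then have eD': "e \<in> D" and eb: "e \<in> bd C" by auto
   obtain a b where ab: "e = {a, b}" "a \<in> C" "b \<in> V - C" "{a, b} \<in> E" using eb by (rule bd_cases)
   have "b \<in> X"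
   proof (rule ccontr)
    assume "b \<notin> X"
    then have "conn E (V - X) a b" using ab component_subset[OF C] by (intro conn_edge) auto
    then have "b \<in> C" by (rule component_closed[OF C ab(2)])
    then show False using ab(3) by blast
   qed
   then obtain k where k: "k \<ge> m" "b = R k" by (auto simp: X_def)
   have aX: "a \<notin> X" using ab(2) CX by blast
   have "a \<in> range R"
   proof (rule ccontr)
    assume "a \<notin> range R"
    then have "e \<in> bd (range R)" using bd_iff[OF ab(4), of "range R"] ab(1) k(2) by simp
    then have "e \<in> Dx" using eD' by (simp add: Dx_def)
    then have "R k \<in> \<Union>(Dx Un Ch)" using ab(1) k(2) by blast
    then show False using mm[OF k(1)] by blast
   qed
   then obtain i where i: "a = R i" by blast
   have im: "i < m"
   proof (rule ccontr)
    assume "~ ?thesis"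
    then have "a \<in> X" using i by (simp add: X_def)
    then show False using aX by simp
   qed
   have "~ Suc i < k"
   proof
    assume s: "Suc i < k"
    have "{R i, R k} \<in> D" using eD' ab(1) i k(2) by simp
    then have "e \<in> Ch" using s ab(1) i k(2) unfolding Ch_def by blast
    then have "R k \<in> \<Union>(Dx Un Ch)" using ab(1) k(2) by blast
    then show False using mm[OF k(1)] by blast
   qed
   then have "i = m0" "k = m" using im k(1) by (auto simp: m_def)
   then show "e \<in> {{R m0, R m}}" using ab(1) i k(2) by simp
  next
   fix e assume e: "e \<in> {{R m0, R m}}"
   have eD0: "{R m0, R m} \<in> D" using eD[of m0] by (simp add: m_def)
   have "R m \<notin> C" using CX by (auto simp: X_def)
   then have "{R m0, R m} \<in> bd C" using bd_iff[of "R m0" "R m" C] yC eD0 D by blast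
   then show "e \<in> D Int bd C" using e eD0 by simp
  qed
  then show False using evB[OF bond] by simp
 qed
qed

text \<open>Only the vertices of \<open>X\<close> that lie on edges of \<open>D\<close> affect
  \<open>D Int bd X\<close>. They form a finite set, whose cut is a sum of stars.\<close>

lemma finite_even_orthogonal_cuts:
 assumes "finite D" "D \<in> alg_cycle_space V E"
 shows "D \<in> edge_perp E (cut_space V E)"
proof -
 have DE: "D \<subseteq> E" and ev: "!!v. v \<in> V ==> even (card {e\<in>D. v \<in> e})" using assms(2) by (auto simp: alg_iff)
 have "edge_orthogonal D (bd X)" if X: "X \<subseteq> V" for X
 proof -
  define K where "K = X Int \<Union>D"
  have "finite (\<Union>D)" by (rule finite_Union[OF assms(1)]) (use DE edge_card in \<open>fastforce intro: card_ge_0_finite\<close>)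
  then have "finite K" by (simp add: K_def)
  then have "even (card (D Int bd K))" by (rule even_cut_of_even_degrees) (use X DE ev in \<open>auto simp: K_def\<close>)
  moreover have "D Int bd K = D Int bd X"
  proof (rule set_eqI)
   fix e
   show "e \<in> D Int bd K \<longleftrightarrow> e \<in> D Int bd X"
   proof (cases "e \<in> D")
    case True
    then have eE: "e \<in> E" using DE by blast
    obtain x y where e: "e = {x, y}" using edge_ex[OF eE] by metis
    have "x \<in> \<Union>D" "y \<in> \<Union>D" using True e by auto
    then have "x \<in> K \<longleftrightarrow> x \<in> X" "y \<in> K \<longleftrightarrow> y \<in> X" by (auto simp: K_def)
    then show ?thesis using eE unfolding e by (simp add: bd_iff)
   qed simp
  qed
  ultimately show ?thesis using assms(1) by (simp add: edge_orthogonal_def)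
 qed
 then show ?thesis using DE unfolding edge_perp_def cut_space_bd by auto
qed

end

subsection \<open>Points of the compactification\<close>

lemma on_edge_swap: "x ~= y ==> on_edge x y t = on_edge y x (1 - t)"
 by (auto simp: on_edge_def)

lemma on_edge_0: "x ~= y ==> on_edge x y 0 = vertex_pt x" and on_edge_1: "x ~= y ==> on_edge x y 1 = vertex_pt y"
 by (auto simp: on_edge_def vertex_pt_def)

lemma closed_edge_image: assumes "x ~= y" shows "closed_edge {x, y} = on_edge x y ` {0..1}"
proof (intro equalityI subsetI)
 fix p assume "p \<in> closed_edge {x, y}"
 then obtain u v t where p: "p = on_edge u v t" "{x, y} = {u, v}" "u ~= v" "0 \<le> t" "t \<le> 1" by (auto simp: closed_edge_def)
 consider "x = u" "y = v" | "x = v" "y = u" using p(2,3) by (auto simp: doubleton_eq_iff)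
 then show "p \<in> on_edge x y ` {0..1}"
 proof cases
  case 1 then show ?thesis using p by auto
 next
  case 2
  then have "p = on_edge x y (1 - t)" using p(1) on_edge_swap[OF p(3), of t] by simp
  then show ?thesis using p(4,5) by auto
 qed
next
 fix p assume "p \<in> on_edge x y ` {0..1}"
 then obtain t where "p = on_edge x y t" "0 \<le> t" "t \<le> 1" by auto
 then show "p \<in> closed_edge {x, y}" unfolding closed_edge_def using assms by blast
qed

text \<open>The function that is \<open>0\<close> and \<open>1\<close> on the two sides of the cut given by \<open>Q\<close> and linear on
  its edges.\<close>

definition side :: "'v set => 'v fpoint => real" where
 "side Q p = (case p of Complex_Pt \<phi> => (\<Sum>v\<in>{v\<in>Q. \<phi> v ~= 0}. \<phi> v)
  | End_Pt om => if \<exists>R\<in>om. \<exists>n. R ` {n..} \<subseteq> Q then 1 else 0)"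

lemma side_on_edge:
 assumes "x ~= y"
 shows "side Q (on_edge x y t) = (if x \<in> Q then 1 - t else 0) + (if y \<in> Q then t else 0)"
proof -
 let ?\<phi> = "%v. if v = x then 1 - t else if v = y then t else 0"
 have "side Q (on_edge x y t) = (\<Sum>v\<in>{v\<in>Q. ?\<phi> v ~= 0}. ?\<phi> v)" by (simp add: side_def on_edge_def)
 also have "\<dots> = (\<Sum>v\<in>{x, y} Int Q. ?\<phi> v)" by (rule sum.mono_neutral_left) (auto split: if_splits)
 also have "\<dots> = (if x \<in> Q then 1 - t else 0) + (if y \<in> Q then t else 0)"
  using assms by (cases "x \<in> Q"; cases "y \<in> Q") auto
 finally show ?thesis .
qed

lemma side_vertex: "side Q (vertex_pt x) = (if x \<in> Q then 1 else 0)"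
proof -
 let ?\<phi> = "%v. if v = x then 1 else 0 :: real"
 have "side Q (vertex_pt x) = (\<Sum>v\<in>{v\<in>Q. ?\<phi> v ~= 0}. ?\<phi> v)" by (simp add: side_def vertex_pt_def)
 also have "\<dots> = (\<Sum>v\<in>{x} Int Q. ?\<phi> v)" by (rule sum.mono_neutral_left) (auto split: if_splits)
 finally show ?thesis by simp
qed

lemma side_single: "side {v} (Complex_Pt \<phi>) = \<phi> v"
proof (cases "\<phi> v = 0")
 case True
 then have "{u\<in>{v}. \<phi> u ~= 0} = {}" by auto
 then show ?thesis using True by (simp only: side_def fpoint.case sum.empty)
next
 case False
 then have "{u\<in>{v}. \<phi> u ~= 0} = {v}" by auto
 then show ?thesis by (simp only: side_def fpoint.case) simp
qed

lemma continuous_map_realI: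
 assumes "!!p \<epsilon>. p \<in> topspace X ==> \<epsilon> > 0 ==> \<exists>U. openin X U & p \<in> U & (\<forall>q\<in>U. \<bar>f q - f p\<bar> < \<epsilon>)"
 shows "continuous_map X euclideanreal f"
 unfolding continuous_map_def
proof (intro conjI allI impI)
 fix W :: "real set" assume "openin euclideanreal W"
 then have W: "open W" by simp
 show "openin X {x \<in> topspace X. f x \<in> W}"
 proof (subst openin_subopen, intro ballI)
  fix p assume p: "p \<in> {x \<in> topspace X. f x \<in> W}"
  then obtain \<epsilon> where e: "\<epsilon> > 0" "!!r. \<bar>r - f p\<bar> < \<epsilon> ==> r \<in> W"
   using W unfolding open_real by blast
  obtain U where U: "openin X U" "p \<in> U" "!!q. q \<in> U ==> \<bar>f q - f p\<bar> < \<epsilon>" using assms[of p \<epsilon>] p e(1) by blast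
  have "U \<subseteq> {x \<in> topspace X. f x \<in> W}" using U e(2) openin_subset[OF U(1)] by blast
  then show "\<exists>T. openin X T & p \<in> T & T \<subseteq> {x \<in> topspace X. f x \<in> W}" using U by blast
 qed
qed simp

section \<open>Side functions of finite cuts and the topology\<close>

context lfgraph
begin

abbreviation FG :: "'v fpoint topology" where "FG \<equiv> freudenthal V E"

text \<open>Finiteness of the cut makes \<open>side Q\<close> continuous at the ends: past its
  finitely many edges, every end lies on one side.\<close>

definition cutset :: "'v set => bool" where "cutset Q \<longleftrightarrow> Q \<subseteq> V & finite (bd Q)"

lemma cutset_single: "v \<in> V ==> cutset {v}" using finite_bd[of "{v}"] by (simp add: cutset_def)

lemma cutset_component: assumes "finite S" "C \<in> graph_components E (V - S)" shows "cutset C"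
proof -
 have "bd C \<subseteq> {e\<in>E. e Int S ~= {}}"
 proof
  fix e assume "e \<in> bd C"
  then obtain x y where xy: "e = {x, y}" "x \<in> C" "y \<in> V - C" "{x, y} \<in> E" by (rule bd_cases)
  have "y \<in> S"
  proof (rule ccontr)
   assume "y \<notin> S"
   then have "conn E (V - S) x y" using xy component_subset[OF assms(2)] by (intro conn_edge) auto
   then show False using component_closed[OF assms(2) xy(2)] xy(3) by blast
  qed
  then show "e \<in> {e\<in>E. e Int S ~= {}}" using xy by auto
 qed
 then show ?thesis using finite_touch[OF assms(1)] component_subset[OF assms(2)] finite_subset unfolding cutset_def by blast
qed

lemma open_interval: "{x, y} \<in> E ==> 0 \<le> a ==> a < b ==> b \<le> 1 ==> openin FG (open_edge_interval x y a b)"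
 unfolding freudenthal_def by (rule topology_generated_by_Basis) blast

lemma open_star: "x \<in> V ==> (!!y. 0 < \<delta> y & \<delta> y \<le> 1) ==> openin FG (vertex_star E x \<delta>)"
 unfolding freudenthal_def by (rule topology_generated_by_Basis) blast

lemma open_hat: "S \<subseteq> V ==> finite S ==> om \<in> ends V E ==> 0 < \<epsilon> ==> \<epsilon> \<le> 1 ==> openin FG (end_hat V E S om \<epsilon>)"
 unfolding freudenthal_def by (rule topology_generated_by_Basis) blast

lemma hat_cases:
 assumes "p \<in> end_hat V E S om \<epsilon>"
 obtains (vertex) v where "p = vertex_pt v" "v \<in> end_comp V E S om"
 | (inner) x y t where "p = on_edge x y t" "{x, y} \<in> E" "x \<in> end_comp V E S om" "y \<in> end_comp V E S om" "0 < t" "t < 1"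
 | (outer) x y t where "p = on_edge x y t" "{x, y} \<in> E" "x \<in> end_comp V E S om" "y \<in> S" "0 < t" "t < \<epsilon>"
 | (endpt) om' where "p = End_Pt om'" "om' \<in> ends V E" "end_comp V E S om' = end_comp V E S om"
 using assms unfolding end_hat_def Let_def by blast

lemma star_cases:
 assumes "p \<in> vertex_star E x \<delta>"
 obtains (vertex) "p = vertex_pt x" | (edge) y t where "p = on_edge x y t" "{x, y} \<in> E" "0 < t" "t < \<delta> y"
proof -
 from assms consider "p = vertex_pt x" | y t where "p = on_edge x y t" "{x, y} \<in> E" "0 \<le> t" "t < \<delta> y" unfolding vertex_star_def by blast
 then show ?thesis
 proof cases
  case 1 then show ?thesis by (rule vertex)
 next
  case (2 y t)
  then show ?thesis using vertex edge on_edge_0[of x y] edgeD[OF 2(2)] by (cases "t = 0") auto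
 qed
qed

lemma end_side:
 assumes w: "om \<in> ends V E" and S: "finite S" "S \<subseteq> V"
 shows "end_comp V E S om \<subseteq> Q ==> side Q (End_Pt om) = 1"
  and "end_comp V E S om Int Q = {} ==> side Q (End_Pt om) = 0"
proof -
 assume sub: "end_comp V E S om \<subseteq> Q"
 obtain R where R: "R \<in> om" using ends_nonempty[OF w] by blast
 obtain n where "R ` {n..} \<subseteq> end_comp V E S om" using end_comp_tail[OF w S R] by blast
 then have "R ` {n..} \<subseteq> Q" using sub by (rule order_trans)
 then have "\<exists>R\<in>om. \<exists>n. R ` {n..} \<subseteq> Q" using R by (intro bexI exI)
 then show "side Q (End_Pt om) = 1" by (simp add: side_def)
next
 assume dis: "end_comp V E S om Int Q = {}"
 have "~ R ` {n..} \<subseteq> Q" if R: "R \<in> om" for R n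
 proof
  assume s: "R ` {n..} \<subseteq> Q"
  obtain m where m: "R ` {m..} \<subseteq> end_comp V E S om" using end_comp_tail[OF w S R] by blast
  have "R (max m n) \<in> Q" using subsetD[OF s, of "R (max m n)"] by simp
  moreover have "R (max m n) \<in> end_comp V E S om" using subsetD[OF m, of "R (max m n)"] by simp
  ultimately show False using dis by blast
 qed
 then show "side Q (End_Pt om) = 0" by (simp add: side_def)
qed

text \<open>Let \<open>S\<close> consist of the ends of the cut edges. The component of the end
  avoids \<open>S\<close>, so no edge at it crosses the cut, and it lies on one side together with
  its neighbours.\<close>

lemma end_dichotomy:
 assumes w: "om \<in> ends V E" and Q: "cutset Q"
 obtains S where "finite S" "S \<subseteq> V" "end_comp V E S om \<subseteq> Q" "!!x y. {x, y} \<in> E ==> x \<in> end_comp V E S om ==> y \<in> Q" "side Q (End_Pt om) = 1"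
 | S where "finite S" "S \<subseteq> V" "end_comp V E S om Int Q = {}" "!!x y. {x, y} \<in> E ==> x \<in> end_comp V E S om ==> y \<notin> Q" "side Q (End_Pt om) = 0"
proof -
 define S where "S = \<Union>(bd Q)"
 have "finite e" if "e \<in> bd Q" for e using that bd_subset edge_card by (metis card_ge_0_finite pos2 subsetD)
 then have S: "finite S" unfolding S_def using Q by (auto simp: cutset_def)
 have SV: "S \<subseteq> V" unfolding S_def using bd_subset simple by (auto simp: simple_graph_def)
 have CS: "end_comp V E S om \<subseteq> V - S" by (rule end_comp_subset[OF w S SV])
 have same: "x \<in> Q \<longleftrightarrow> y \<in> Q" if "{x, y} \<in> E" "x \<in> end_comp V E S om" for x y
 proof (rule ccontr)
  assume "~ ?thesis"
  then have "{x, y} \<in> bd Q" using bd_iff[OF that(1)] by blast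
  then have "x \<in> S" by (auto simp: S_def)
  then show False using that(2) CS by blast
 qed
 have con: "graph_connected E (end_comp V E S om)" by (rule component_connected[OF end_comp_component[OF w S SV]])
 show ?thesis
 proof (cases "end_comp V E S om Int Q = {}")
  case True
  show ?thesis
  proof (rule that(2)[OF S SV True])
   show "y \<notin> Q" if "{x, y} \<in> E" "x \<in> end_comp V E S om" for x y using same[OF that] that(2) True by blast
  qed (rule end_side(2)[OF w S SV True])
 next
  case False
  then obtain x where x: "x \<in> end_comp V E S om" "x \<in> Q" by blast
  have sub: "end_comp V E S om \<subseteq> Q" by (rule graph_connected_subset_side[OF con _ x]) (use same in blast)
  show ?thesis
  proof (rule that(1)[OF S SV sub])
   show "y \<in> Q" if "{x, y} \<in> E" "x \<in> end_comp V E S om" for x y using same[OF that] that(2) sub by blast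
  qed (rule end_side(1)[OF w S SV sub])
 qed
qed

lemma topspace_FG:
 "p \<in> topspace FG \<longleftrightarrow> (\<exists>v\<in>V. p = vertex_pt v) \<or> (\<exists>x y t. {x, y} \<in> E & 0 < t & t < 1 & p = on_edge x y t) \<or> (\<exists>om\<in>ends V E. p = End_Pt om)"
  (is "_ \<longleftrightarrow> ?R p")
proof
 assume "p \<in> topspace FG"
 then have "p \<in> \<Union>({open_edge_interval x y a b | x y a b. {x, y} \<in> E & 0 \<le> a & a < b & b \<le> 1}
   Un {vertex_star E x \<delta> | x \<delta>. x \<in> V & (\<forall>y. 0 < \<delta> y & \<delta> y \<le> 1)}
   Un {end_hat V E S om \<epsilon> | S om \<epsilon>. S \<subseteq> V & finite S & om \<in> ends V E & 0 < \<epsilon> & \<epsilon> \<le> 1})"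
  unfolding freudenthal_def topology_generated_by_topspace .
 then obtain B where BB: "B \<in> {open_edge_interval x y a b | x y a b. {x, y} \<in> E & 0 \<le> a & a < b & b \<le> 1}
   Un {vertex_star E x \<delta> | x \<delta>. x \<in> V & (\<forall>y. 0 < \<delta> y & \<delta> y \<le> 1)}
   Un {end_hat V E S om \<epsilon> | S om \<epsilon>. S \<subseteq> V & finite S & om \<in> ends V E & 0 < \<epsilon> & \<epsilon> \<le> 1}" and pB: "p \<in> B"
  by (rule UnionE)
 from BB consider x y a b where "B = open_edge_interval x y a b" "{x, y} \<in> E" "0 \<le> a" "a < b" "b \<le> 1"
  | x \<delta> where "B = vertex_star E x \<delta>" "x \<in> V" "\<forall>y. 0 < \<delta> y & \<delta> y \<le> 1"
  | S om \<epsilon> where "B = end_hat V E S om \<epsilon>" "S \<subseteq> V" "finite S" "om \<in> ends V E" "0 < \<epsilon>" "\<epsilon> \<le> 1" by blast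
 then show "?R p"
 proof cases
  case 1
  then obtain t where "p = on_edge x y t" "a < t" "t < b" using pB by (auto simp: open_edge_interval_def)
  then have "{x, y} \<in> E & 0 < t & t < 1 & p = on_edge x y t" using 1 by auto
  then show ?thesis by blast
 next
  case 2
  have "p \<in> vertex_star E x \<delta>" using pB 2(1) by simp
  then show ?thesis
  proof (cases rule: star_cases)
   case (edge y t)
   have "\<delta> y \<le> 1" using 2(3) by blast
   then have "{x, y} \<in> E & 0 < t & t < 1 & p = on_edge x y t" using edge by auto
   then show ?thesis by blast
  qed (use 2 in blast)
 next
  case 3
  have CV: "end_comp V E S om \<subseteq> V" using end_comp_subset[OF 3(4,3,2)] by blast
  have "p \<in> end_hat V E S om \<epsilon>" using pB 3(1) by simp
  then show ?thesis
  proof (cases rule: hat_cases)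
   case (outer x y t)
   then have "{x, y} \<in> E & 0 < t & t < 1 & p = on_edge x y t" using 3 by auto
   then show ?thesis by blast
  qed (use CV in blast)+
 qed
next
 assume "?R p"
 then consider v where "v \<in> V" "p = vertex_pt v" | x y t where "{x, y} \<in> E" "0 < t" "t < 1" "p = on_edge x y t"
  | om where "om \<in> ends V E" "p = End_Pt om" by blast
 then show "p \<in> topspace FG"
 proof cases
  case 1
  have "openin FG (vertex_star E v (%_. 1))" by (rule open_star[OF 1(1)]) simp
  moreover have "p \<in> vertex_star E v (%_. 1)" using 1(2) by (simp add: vertex_star_def)
  ultimately show ?thesis using openin_subset by blast
 next
  case 2
  have "openin FG (open_edge_interval x y 0 1)" by (rule open_interval[OF 2(1)]) simp_all
  moreover have "p \<in> open_edge_interval x y 0 1" using 2 by (auto simp: open_edge_interval_def)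
  ultimately show ?thesis using openin_subset by blast
 next
  case 3
  have "openin FG (end_hat V E {} om 1)" by (rule open_hat) (use 3 in auto)
  moreover have "p \<in> end_hat V E {} om 1" using 3 by (auto simp: end_hat_def Let_def)
  ultimately show ?thesis using openin_subset by blast
 qed
qed

lemma FG_cases:
 assumes "p \<in> topspace FG"
 obtains (vertex) v where "v \<in> V" "p = vertex_pt v" | (edge) x y t where "{x, y} \<in> E" "0 < t" "t < 1" "p = on_edge x y t"
  | (endpt) om where "om \<in> ends V E" "p = End_Pt om"
 using assms unfolding topspace_FG by blast

lemma side_range: assumes "p \<in> topspace FG" shows "0 \<le> side Q p" "side Q p \<le> 1"
proof -
 have "0 \<le> side Q p & side Q p \<le> 1" using assms
 proof (cases rule: FG_cases)
  case (edge x y t)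
  then show ?thesis using edgeD[OF edge(1)] by (simp add: side_on_edge)
 next
  case (endpt om) then show ?thesis by (simp add: side_def)
 qed (simp add: side_vertex)
 then show "0 \<le> side Q p" "side Q p \<le> 1" by auto
qed

lemma side_mono: assumes "p \<in> topspace FG" "Q \<subseteq> Q'" shows "side Q p \<le> side Q' p"
 using assms(1)
proof (cases rule: FG_cases)
 case (vertex v) then show ?thesis using assms(2) by (auto simp: side_vertex)
next
 case (edge x y t)
 then show ?thesis using edgeD[OF edge(1)] assms(2) by (auto simp: side_on_edge)
next
 case (endpt om)
 have "\<exists>R\<in>om. \<exists>n. R ` {n..} \<subseteq> Q'" if "\<exists>R\<in>om. \<exists>n. R ` {n..} \<subseteq> Q" using that assms(2) by (meson order_trans)
 then show ?thesis using endpt by (simp add: side_def)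
qed

lemma side_disjoint: assumes p: "p \<in> topspace FG" "Q Int Q' = {}" and Q: "cutset Q" "cutset Q'" and 1: "side Q p = 1" "side Q' p = 1" shows False
 using p(1)
proof (cases rule: FG_cases)
 case (vertex v) then show ?thesis using p(2) 1 by (auto simp: side_vertex split: if_splits)
next
 case (edge x y t)
 then show ?thesis using edgeD[OF edge(1)] p(2) 1 by (auto simp: side_on_edge split: if_splits)
next
 case (endpt om)
 have tail: "\<exists>n. R ` {n..} \<subseteq> X" if X: "cutset X" "side X p = 1" "R \<in> om" for X R
  using endpt(1) X(1)
 proof (cases rule: end_dichotomy)
  case (1 S)
  obtain n where "R ` {n..} \<subseteq> end_comp V E S om" using end_comp_tail[OF endpt(1) 1(1,2) X(3)] by blast
  then show ?thesis using 1(3) by (intro exI) (rule order_trans)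
 next
  case (2 S) then show ?thesis using X(2) endpt(2) by simp
 qed
 obtain R where R: "R \<in> om" using ends_nonempty[OF endpt(1)] by blast
 obtain n where n: "R ` {n..} \<subseteq> Q" using tail[OF Q(1) 1(1) R] by blast
 obtain n' where n': "R ` {n'..} \<subseteq> Q'" using tail[OF Q(2) 1(2) R] by blast
 have "R (max n n') \<in> Q" "R (max n n') \<in> Q'" using subsetD[OF n, of "R (max n n')"] subsetD[OF n', of "R (max n n')"] by simp_all
 then show ?thesis using p(2) by blast
qed

text \<open>On edges and around vertices the value changes by at most the change of the edge
  parameter; at an end it is constant on a hat whose component has no cut edge at it.\<close>

lemma side_continuous:
 assumes Q: "cutset Q" shows "continuous_map FG euclideanreal (side Q)"
proof (rule continuous_map_realI)
 fix p :: "'v fpoint" and \<epsilon> :: real assume p: "p \<in> topspace FG" and e: "\<epsilon> > 0"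
 from p show "\<exists>U. openin FG U & p \<in> U & (\<forall>q\<in>U. \<bar>side Q q - side Q p\<bar> < \<epsilon>)"
 proof (cases rule: FG_cases)
  case (vertex v)
  let ?U = "vertex_star E v (%_. min 1 \<epsilon>)"
  have "openin FG ?U" by (rule open_star[OF vertex(1)]) (use e in auto)
  moreover have "p \<in> ?U" using vertex by (simp add: vertex_star_def)
  moreover have "\<bar>side Q q - side Q p\<bar> < \<epsilon>" if "q \<in> ?U" for q using that
  proof (cases rule: star_cases)
   case vertex' : vertex then show ?thesis using vertex e by simp
  next
   case (edge y t)
   have ne: "v ~= y" using edgeD[OF edge(2)] by blast
   have s: "side Q q = (if v \<in> Q then 1 - t else 0) + (if y \<in> Q then t else 0)" "side Q p = (if v \<in> Q then 1 else 0)"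
    unfolding edge(1) vertex(2) by (rule side_on_edge[OF ne], rule side_vertex)
   show ?thesis unfolding s using edge(3,4) e by (auto split: if_splits)
  qed
  ultimately show ?thesis by blast
 next
  case (edge x y t)
  let ?U = "open_edge_interval x y (max 0 (t - \<epsilon>)) (min 1 (t + \<epsilon>))"
  have ne: "x ~= y" using edgeD[OF edge(1)] by blast
  have "openin FG ?U" by (rule open_interval[OF edge(1)]) (use e edge in auto)
  moreover have "p \<in> ?U" using edge e by (auto simp: open_edge_interval_def)
  moreover have "\<bar>side Q q - side Q p\<bar> < \<epsilon>" if "q \<in> ?U" for q
  proof -
   obtain t' where t': "q = on_edge x y t'" "t - \<epsilon> < t'" "t' < t + \<epsilon>" using \<open>q \<in> ?U\<close> by (auto simp: open_edge_interval_def)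
   show ?thesis unfolding t'(1) edge(4) side_on_edge[OF ne] using t'(2,3) e by (auto split: if_splits)
  qed
  ultimately show ?thesis by blast
 next
  case (endpt om)
  have cst: "side Q q = c" if "finite S" "S \<subseteq> V" "!!x y. {x, y} \<in> E ==> x \<in> end_comp V E S om ==> (y \<in> Q) = (c = 1)"
   "!!x. x \<in> end_comp V E S om ==> (x \<in> Q) = (c = 1)" "c = 0 \<or> c = 1" "q \<in> end_hat V E S om 1" for S c q
   using that(6)
  proof (cases rule: hat_cases)
   case (vertex v) then show ?thesis using that(4)[of v] that(5) by (auto simp: side_vertex)
  next
   case (inner x y t)
   then show ?thesis using that(4)[of x] that(4)[of y] that(5) edgeD[OF inner(2)] by (auto simp: side_on_edge)
  next
   case (outer x y t)
   then show ?thesis using that(4)[of x] that(3)[of x y] that(5) edgeD[OF outer(2)] by (auto simp: side_on_edge)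
  next
   case e2: (endpt om')
   show ?thesis
   proof (cases "c = 1")
    case True
    then have "end_comp V E S om' \<subseteq> Q" using that(4) e2(3) by auto
    then show ?thesis using end_side(1)[OF e2(2) that(1,2)] e2(1) True by simp
   next
    case False
    then have "end_comp V E S om' Int Q = {}" using that(4) e2(3) by auto
    then show ?thesis using end_side(2)[OF e2(2) that(1,2)] e2(1) False that(5) by simp
   qed
  qed
  have "\<exists>S c. finite S & S \<subseteq> V & (\<forall>q\<in>end_hat V E S om 1. side Q q = c)"
   using endpt(1) Q
  proof (cases rule: end_dichotomy)
   case (1 S)
   have "side Q q = 1" if "q \<in> end_hat V E S om 1" for q
    by (rule cst[OF 1(1,2) _ _ _ that]) (use 1(3,4) in auto)
   then show ?thesis using 1(1,2) by blast
  next
   case (2 S)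
   have "side Q q = 0" if "q \<in> end_hat V E S om 1" for q
    by (rule cst[OF 2(1,2) _ _ _ that]) (use 2(3,4) in auto)
   then show ?thesis using 2(1,2) by blast
  qed
  then obtain S c where S: "finite S" "S \<subseteq> V" "!!q. q \<in> end_hat V E S om 1 ==> side Q q = c" by blast
  have "openin FG (end_hat V E S om 1)" by (rule open_hat[OF S(2,1) endpt(1)]) simp_all
  moreover have "p \<in> end_hat V E S om 1" using endpt by (auto simp: end_hat_def Let_def)
  ultimately show ?thesis using S(3) e by (intro exI[of _ "end_hat V E S om 1"]) simp
 qed
qed

lemma side_single_pos:
 assumes "p \<in> topspace FG" "side {x} p > 0"
 obtains (vertex) "p = vertex_pt x" | (edge) y t where "{x, y} \<in> E" "0 < t" "t < 1" "p = on_edge x y t"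
 using assms(1)
proof (cases rule: FG_cases)
 case (vertex v)
 then have "v = x" using assms(2) by (auto simp: side_vertex split: if_splits)
 then show ?thesis using vertex that(1) by simp
next
 case e: (edge u v t)
 have ne: "u ~= v" using edgeD[OF e(1)] by blast
 consider "u = x" | "v = x" using assms(2) unfolding e(4) side_on_edge[OF ne] by (auto split: if_splits)
 then show ?thesis
 proof cases
  case 1 then show ?thesis using e that(2) by blast
 next
  case 2
  have "{x, u} \<in> E" using e(1) 2 by (simp add: insert_commute)
  moreover have "p = on_edge x u (1 - t)" using e(4) on_edge_swap[OF ne] 2 by simp
  ultimately show ?thesis using that(2)[of u "1 - t"] e(2,3) by simp
 qed
next
 case (endpt om)
 obtain R n where R: "R \<in> om" "R ` {n..} \<subseteq> {x}" using assms(2) endpt by (auto simp: side_def split: if_splits)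
 have "R n = x" "R (Suc n) = x" using subsetD[OF R(2), of "R n"] subsetD[OF R(2), of "R (Suc n)"] by auto
 moreover have "inj R" using ends_ray[OF endpt(1) R(1)] by (simp add: ray_def)
 ultimately show ?thesis by (metis injD n_not_Suc_n)
qed

end

lemma openin_finite_conj:
 assumes "finite N" "openin X {z \<in> topspace X. A z}" "!!y. y \<in> N ==> openin X {z \<in> topspace X. B y z}"
 shows "openin X {z \<in> topspace X. A z & (\<forall>y\<in>N. B y z)}"
 using assms(1,3)
proof (induction N rule: finite_induct)
 case empty then show ?case using assms(2) by simp
next
 case (insert y N)
 have "openin X ({z \<in> topspace X. A z & (\<forall>y\<in>N. B y z)} Int {z \<in> topspace X. B y z})"
  using insert by (intro openin_Int) auto
 moreover have "{z \<in> topspace X. A z & (\<forall>y\<in>N. B y z)} Int {z \<in> topspace X. B y z} = {z \<in> topspace X. A z & (\<forall>y\<in>insert y N. B y z)}" by auto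
 ultimately show ?case by simp
qed

context lfgraph
begin

text \<open>At distance \<open>t\<close> from the component, a point on an edge towards
  \<open>S\<close> has side value \<open>1 - t\<close>; thus the width \<open>\<epsilon>\<close>
  becomes the threshold \<open>1 - \<epsilon>\<close>.\<close>

lemma hat_eq:
 assumes w: "om \<in> ends V E" and S: "finite S" "S \<subseteq> V" and e: "0 < \<epsilon>" "\<epsilon> \<le> 1"
 shows "end_hat V E S om \<epsilon> = {q \<in> topspace FG. side (end_comp V E S om) q > 1 - \<epsilon>}"
proof (intro equalityI subsetI)
 let ?C = "end_comp V E S om"
 have CS: "?C \<subseteq> V - S" by (rule end_comp_subset[OF w S])
 fix q assume q: "q \<in> end_hat V E S om \<epsilon>"
 have "q \<in> topspace FG" using q openin_subset[OF open_hat[OF S(2,1) w e]] by blast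
 moreover have "side ?C q > 1 - \<epsilon>" using q
 proof (cases rule: hat_cases)
  case (vertex v) then show ?thesis using e by (simp add: side_vertex)
 next
  case (inner x y t) then show ?thesis using e edgeD[OF inner(2)] by (simp add: side_on_edge)
 next
  case (outer x y t)
  have "y \<notin> ?C" using CS outer(4) by blast
  then show ?thesis using outer edgeD[OF outer(2)] by (simp add: side_on_edge)
 next
  case (endpt om')
  then show ?thesis using end_side(1)[OF endpt(2) S, of ?C] e by simp
 qed
 ultimately show "q \<in> {q \<in> topspace FG. side ?C q > 1 - \<epsilon>}" by simp
next
 let ?C = "end_comp V E S om"
 fix q assume "q \<in> {q \<in> topspace FG. side ?C q > 1 - \<epsilon>}"
 then have q: "q \<in> topspace FG" and sq: "side ?C q > 1 - \<epsilon>" by auto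
 have outer: "q \<in> end_hat V E S om \<epsilon>" if "{x, y} \<in> E" "x \<in> ?C" "y \<notin> ?C" "0 < t" "t < \<epsilon>" "q = on_edge x y t" for x y t
 proof -
  have "y \<in> S" using end_comp_closed[OF w S that(2,1)] that(3) by blast
  then show ?thesis unfolding end_hat_def Let_def using that by blast
 qed
 show "q \<in> end_hat V E S om \<epsilon>" using q
 proof (cases rule: FG_cases)
  case (vertex v)
  then have "v \<in> ?C" using sq e by (auto simp: side_vertex split: if_splits)
  then show ?thesis unfolding end_hat_def Let_def using vertex(2) by blast
 next
  case (edge x y t)
  have ne: "x ~= y" using edgeD[OF edge(1)] by blast
  have s: "(if x \<in> ?C then 1 - t else 0) + (if y \<in> ?C then t else 0) > 1 - \<epsilon>" using sq unfolding edge(4) side_on_edge[OF ne] .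
  consider "x \<in> ?C" "y \<in> ?C" | "x \<in> ?C" "y \<notin> ?C" | "x \<notin> ?C" "y \<in> ?C" | "x \<notin> ?C" "y \<notin> ?C" by blast
  then show ?thesis
  proof cases
   case 1 then show ?thesis unfolding end_hat_def Let_def using edge by blast
  next
   case 2 then show ?thesis using outer[OF edge(1) 2 edge(2) _ edge(4)] s by simp
  next
   case 3
   have "{y, x} \<in> E" using edge(1) by (simp add: insert_commute)
   then show ?thesis using outer[of y x "1 - t"] 3 s edge(3,4) on_edge_swap[OF ne] by simp
  next
   case 4 then show ?thesis using s e by simp
  qed
 next
  case (endpt om')
  then obtain R n where R: "R \<in> om'" "R ` {n..} \<subseteq> ?C" using sq e by (auto simp: side_def split: if_splits)
  obtain m where m: "R ` {m..} \<subseteq> end_comp V E S om'" using end_comp_tail[OF endpt(1) S R(1)] by blast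
  have "R (max n m) \<in> ?C" "R (max n m) \<in> end_comp V E S om'" using subsetD[OF R(2), of "R (max n m)"] subsetD[OF m, of "R (max n m)"] by simp_all
  then have "end_comp V E S om' = ?C" using component_unique[OF end_comp_component[OF endpt(1) S] end_comp_component[OF w S]] by blast
  then show ?thesis unfolding end_hat_def Let_def using endpt by blast
 qed
qed

text \<open>Positivity at \<open>x\<close> confines a point to the edges at \<open>x\<close>; the
  coordinate at \<open>y\<close> then selects the edge and the position on it.\<close>

lemma interval_eq:
 assumes "{x, y} \<in> E" "0 \<le> a" "b \<le> 1"
 shows "open_edge_interval x y a b = {q \<in> topspace FG. side {x} q > 0 & side {y} q > a & side {y} q < b}"
proof (intro equalityI subsetI)
 have ne: "x ~= y" using edgeD[OF assms(1)] by blast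
 {
  fix q assume "q \<in> open_edge_interval x y a b"
  then obtain t where t: "q = on_edge x y t" "a < t" "t < b" by (auto simp: open_edge_interval_def)
  have "q \<in> topspace FG" unfolding topspace_FG using t assms by (metis less_le_trans order_le_less_trans)
  then show "q \<in> {q \<in> topspace FG. side {x} q > 0 & side {y} q > a & side {y} q < b}"
   using t assms ne by (simp add: side_on_edge)
 next
  fix q assume "q \<in> {q \<in> topspace FG. side {x} q > 0 & side {y} q > a & side {y} q < b}"
  then have q: "q \<in> topspace FG" "side {x} q > 0" "side {y} q > a" "side {y} q < b" by auto
  from q(1,2) show "q \<in> open_edge_interval x y a b"
  proof (cases rule: side_single_pos)
   case vertex then show ?thesis using q(3) assms(2) ne by (simp add: side_vertex)
  next
   case (edge y' t)
   have ne': "x ~= y'" using edgeD[OF edge(1)] by blast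
   have s: "side {y} q = (if y' = y then t else 0)" unfolding edge(4) side_on_edge[OF ne'] using ne by auto
   have "y' = y" using s q(3) assms(2) by (auto split: if_splits)
   then show ?thesis using s q(3,4) edge(4) by (auto simp: open_edge_interval_def)
  qed
 }
qed

lemma star_eq:
 assumes x: "x \<in> V" and d: "\<forall>y. 0 < \<delta> y & \<delta> y \<le> 1"
 shows "vertex_star E x \<delta> = {q \<in> topspace FG. side {x} q > 0 & (\<forall>y\<in>{y. {x, y} \<in> E}. side {y} q < \<delta> y)}"
proof (intro equalityI subsetI)
 fix q assume q: "q \<in> vertex_star E x \<delta>"
 have d': "0 < \<delta> y & \<delta> y \<le> 1" for y using d by blast
 have "openin FG (vertex_star E x \<delta>)" by (rule open_star[OF x]) (rule d')
 then have T: "q \<in> topspace FG" using q openin_subset by blast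
 have "side {x} q > 0 & (\<forall>y\<in>{y. {x, y} \<in> E}. side {y} q < \<delta> y)" using q
 proof (cases rule: star_cases)
  case vertex
  then show ?thesis using d' edgeD by (auto simp: side_vertex)
 next
  case (edge y t)
  have ne: "x ~= y" using edgeD[OF edge(2)] by blast
  have "t < 1" using edge(4) d'[of y] by linarith
  moreover have "side {y'} q < \<delta> y'" if "{x, y'} \<in> E" for y'
  proof -
   have "x ~= y'" using edgeD[OF that] by blast
   then have "side {y'} q = (if y' = y then t else 0)" unfolding edge(1) side_on_edge[OF ne] by auto
   then show ?thesis using edge(4) d'[of y'] by simp
  qed
  moreover have "side {x} q = 1 - t" unfolding edge(1) side_on_edge[OF ne] using ne by auto
  ultimately show ?thesis by simp
 qed
 then show "q \<in> {q \<in> topspace FG. side {x} q > 0 & (\<forall>y\<in>{y. {x, y} \<in> E}. side {y} q < \<delta> y)}" using T by simp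
next
 fix q assume "q \<in> {q \<in> topspace FG. side {x} q > 0 & (\<forall>y\<in>{y. {x, y} \<in> E}. side {y} q < \<delta> y)}"
 then have q: "q \<in> topspace FG" "side {x} q > 0" and sd: "!!y. {x, y} \<in> E ==> side {y} q < \<delta> y" by auto
 from q show "q \<in> vertex_star E x \<delta>"
 proof (cases rule: side_single_pos)
  case vertex then show ?thesis by (simp add: vertex_star_def)
 next
  case (edge y t)
  have ne: "x ~= y" using edgeD[OF edge(1)] by blast
  have "side {y} q = t" unfolding edge(4) side_on_edge[OF ne] using ne by auto
  then have "t < \<delta> y" using sd[OF edge(1)] by simp
  then show ?thesis unfolding vertex_star_def using edge by (auto intro: less_imp_le)
 qed
qed

text \<open>The topology is the initial one with respect to the side functions of finite cuts.\<close>

lemma continuous_into_FG: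
 assumes sub: "f ` topspace X \<subseteq> topspace FG" and cont: "!!Q. cutset Q ==> continuous_map X euclideanreal (%z. side Q (f z))"
 shows "continuous_map X FG f"
proof -
 let ?S = "{open_edge_interval x y a b | x y a b. {x, y} \<in> E & 0 \<le> a & a < b & b \<le> 1}
   Un {vertex_star E x \<delta> | x \<delta>. x \<in> V & (\<forall>y. 0 < \<delta> y & \<delta> y \<le> 1)}
   Un {end_hat V E S om \<epsilon> | S om \<epsilon>. S \<subseteq> V & finite S & om \<in> ends V E & 0 < \<epsilon> & \<epsilon> \<le> 1}"
 have op: "openin X {z \<in> topspace X. side Q (f z) \<in> W}" if "cutset Q" "open W" for Q W
  using openin_continuous_map_preimage[OF cont[OF that(1)], of W] that(2) by simp
 have gt: "openin X {z \<in> topspace X. side Q (f z) > c}" if "cutset Q" for Q c using op[OF that, of "{c<..}"] by simp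
 have lt: "openin X {z \<in> topspace X. side Q (f z) < c}" if "cutset Q" for Q c using op[OF that, of "{..<c}"] by simp
 have fT: "f z \<in> topspace FG" if "z \<in> topspace X" for z using sub that by blast
 have "continuous_map X (topology_generated_by ?S) f"
 proof (rule continuous_on_generated_topo)
  show "f ` topspace X \<subseteq> \<Union>?S" using sub unfolding freudenthal_def topology_generated_by_topspace .
  fix U assume "U \<in> ?S"
  then consider x y a b where "U = open_edge_interval x y a b" "{x, y} \<in> E" "0 \<le> a" "a < b" "b \<le> 1"
   | x \<delta> where "U = vertex_star E x \<delta>" "x \<in> V" "\<forall>y. 0 < \<delta> y & \<delta> y \<le> 1"
   | S om \<epsilon> where "U = end_hat V E S om \<epsilon>" "S \<subseteq> V" "finite S" "om \<in> ends V E" "0 < \<epsilon>" "\<epsilon> \<le> 1" by blast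
  then show "openin X (f -` U Int topspace X)"
  proof cases
   case 1
   have xy: "cutset {x}" "cutset {y}" using cutset_single edgeD[OF 1(2)] by auto
   have "f -` U Int topspace X = {z \<in> topspace X. side {x} (f z) > 0} Int ({z \<in> topspace X. side {y} (f z) > a} Int {z \<in> topspace X. side {y} (f z) < b})"
    unfolding 1(1) interval_eq[OF 1(2,3,5)] using fT by auto
   then show ?thesis using gt[OF xy(1)] gt[OF xy(2)] lt[OF xy(2)] by (simp add: openin_Int)
  next
   case 2
   have fin: "finite {y. {x, y} \<in> E}" by (rule finite_nbrs[OF 2(2)])
   have "openin X {z \<in> topspace X. side {x} (f z) > 0 & (\<forall>y\<in>{y. {x, y} \<in> E}. side {y} (f z) < \<delta> y)}"
    by (rule openin_finite_conj[OF fin gt lt]) (use cutset_single 2(2) edgeD in auto)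
   moreover have "f -` U Int topspace X = {z \<in> topspace X. side {x} (f z) > 0 & (\<forall>y\<in>{y. {x, y} \<in> E}. side {y} (f z) < \<delta> y)}"
    unfolding 2(1) star_eq[OF 2(2,3)] using fT by auto
   ultimately show ?thesis by simp
  next
   case 3
   have C: "cutset (end_comp V E S om)" by (rule cutset_component[OF 3(3) end_comp_component[OF 3(4,3,2)]])
   have "f -` U Int topspace X = {z \<in> topspace X. side (end_comp V E S om) (f z) > 1 - \<epsilon>}"
    unfolding 3(1) hat_eq[OF 3(4,3,2,5,6)] using fT by auto
   then show ?thesis using gt[OF C] by simp
  qed
 qed
 then show ?thesis unfolding freudenthal_def .
qed

lemma on_edge_topspace: assumes "{x, y} \<in> E" "0 \<le> t" "t \<le> 1" shows "on_edge x y t \<in> topspace FG"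
proof -
 have ne: "x ~= y" and V: "x \<in> V" "y \<in> V" using edgeD[OF assms(1)] by auto
 consider "t = 0" | "t = 1" | "0 < t" "t < 1" using assms by linarith
 then show ?thesis
 proof cases
  case 1 then show ?thesis unfolding topspace_FG using on_edge_0[OF ne] V by auto
 next
  case 2 then show ?thesis unfolding topspace_FG using on_edge_1[OF ne] V by auto
 next
  case 3 then show ?thesis unfolding topspace_FG using assms(1) by blast
 qed
qed

lemma on_edge_continuous: assumes "{x, y} \<in> E" shows "continuous_map (top_of_set {0..1}) FG (on_edge x y)"
proof (rule continuous_into_FG)
 show "on_edge x y ` topspace (top_of_set {0..1}) \<subseteq> topspace FG" using on_edge_topspace[OF assms] by auto
 fix Q
 have ne: "x ~= y" using edgeD[OF assms] by blast
 show "continuous_map (top_of_set {0..1}) euclideanreal (%t. side Q (on_edge x y t))"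
  unfolding side_on_edge[OF ne] by (cases "x \<in> Q"; cases "y \<in> Q") (auto intro!: continuous_intros)
qed

lemma closed_edge_props:
 assumes "e \<in> E" shows "compactin FG (closed_edge e)" "connectedin FG (closed_edge e)" "closed_edge e \<subseteq> topspace FG"
proof -
 obtain x y where xy: "e = {x, y}" "x ~= y" using edge_ex[OF assms] by metis
 have xyE: "{x, y} \<in> E" using assms xy(1) by simp
 note c = on_edge_continuous[OF xyE]
 have eq: "closed_edge e = on_edge x y ` {0..1}" unfolding xy(1) by (rule closed_edge_image[OF xy(2)])
 show comp: "compactin FG (closed_edge e)" unfolding eq by (rule image_compactin[OF _ c]) (simp add: compactin_subtopology)
 show "connectedin FG (closed_edge e)" unfolding eq
  by (rule connectedin_continuous_map_image[OF c]) (simp add: connectedin_subtopology)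
 show "closed_edge e \<subseteq> topspace FG" using compactin_subset_topspace[OF comp] .
qed

text \<open>Points of the complex differ in the coordinate of some vertex, which is also what tells
  them from ends. Two ends are told apart by the component of one of them beyond a suitable
  separator.\<close>

lemma side_separates:
 assumes p: "p \<in> topspace FG" and q: "q \<in> topspace FG" and ne: "p ~= q"
 obtains Q where "cutset Q" "side Q p ~= side Q q"
proof -
 have supp: "v \<in> V" if "Complex_Pt \<phi> \<in> topspace FG" "\<phi> v ~= 0" for \<phi> v
  using that(1)
 proof (cases rule: FG_cases)
  case (vertex u) then show ?thesis using that(2) by (auto simp: vertex_pt_def split: if_splits)
 next
  case (edge x y t) then show ?thesis using that(2) edgeD[OF edge(1)] by (auto simp: on_edge_def split: if_splits)
 qed simp
 have nz: "\<exists>v. \<phi> v ~= 0" if "Complex_Pt \<phi> \<in> topspace FG" for \<phi>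
  using that
 proof (cases rule: FG_cases)
  case (vertex u)
  then have "\<phi> u ~= 0" by (simp add: vertex_pt_def)
  then show ?thesis by blast
 next
  case (edge x y t)
  then have "\<phi> x ~= 0" by (simp add: on_edge_def)
  then show ?thesis by blast
 qed simp
 have e0: "side {v} (End_Pt om) = 0" if "End_Pt om \<in> topspace FG" for v om
 proof (rule ccontr)
  assume "~ ?thesis"
  then have "side {v} (End_Pt om) > 0" using side_range(1)[OF that, of "{v}"] by linarith
  with that show False by (cases rule: side_single_pos) (auto simp: vertex_pt_def on_edge_def)
 qed
 show ?thesis
 proof (cases p)
  case P: (Complex_Pt \<phi>)
  show ?thesis
  proof (cases q)
   case Q: (Complex_Pt \<psi>)
   then have "\<phi> ~= \<psi>" using ne P by auto
   then obtain v where v: "\<phi> v ~= \<psi> v" by auto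
   then have "\<phi> v ~= 0 \<or> \<psi> v ~= 0" by auto
   then have "v \<in> V" using supp p q P Q by auto
   then show ?thesis using that[OF cutset_single] v P Q by (simp add: side_single)
  next
   case Q: (End_Pt om)
   obtain v where v: "\<phi> v ~= 0" using nz p P by blast
   then have "v \<in> V" using supp p P by auto
   then show ?thesis using that[OF cutset_single] v P Q e0[of om v] q by (simp add: side_single)
  qed
 next
  case P: (End_Pt om)
  show ?thesis
  proof (cases q)
   case Q: (Complex_Pt \<psi>)
   obtain v where v: "\<psi> v ~= 0" using nz q Q by blast
   then have "v \<in> V" using supp q Q by auto
   then show ?thesis using that[OF cutset_single] v P Q e0[of om v] p by (simp add: side_single)
  next
   case Q: (End_Pt om')
   have w: "om \<in> ends V E" "om' \<in> ends V E" using p q P Q unfolding topspace_FG by (auto simp: vertex_pt_def on_edge_def)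
   have wne: "om ~= om'" using ne P Q by simp
   obtain R R' where R: "R \<in> om" "R' \<in> om'" using ends_nonempty w by metis
   have rr: "ray E R" "ray E R'" using ends_ray w R by auto
   have "(R, R') \<notin> ray_equiv V E" using ends_eq[OF w R] wne by blast
   then obtain S where S: "S \<subseteq> V" "finite S" and no: "~ (\<exists>C\<in>graph_components E (V - S). \<exists>n. R ` {n..} \<subseteq> C & R' ` {n..} \<subseteq> C)"
    using ray_equivI[OF rr] by metis
   let ?C = "end_comp V E S om" and ?C' = "end_comp V E S om'"
   have C: "?C \<in> graph_components E (V - S)" "?C' \<in> graph_components E (V - S)" using end_comp_component w S by auto
   have "?C ~= ?C'"
   proof
    assume eq: "?C = ?C'"
    obtain n where n: "R ` {n..} \<subseteq> ?C" using end_comp_tail[OF w(1) S(2,1) R(1)] by blast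
    obtain n' where n': "R' ` {n'..} \<subseteq> ?C" using end_comp_tail[OF w(2) S(2,1) R(2)] eq by auto
    have "R ` {max n n'..} \<subseteq> ?C & R' ` {max n n'..} \<subseteq> ?C" using tails_mono[OF n] tails_mono[OF n'] by simp
    then show False using no C(1) by (metis (no_types, lifting))
   qed
   then have "?C' Int ?C = {}" using component_unique[OF C] by blast
   then have "side ?C (End_Pt om') = 0" by (rule end_side(2)[OF w(2) S(2,1)])
   moreover have "side ?C (End_Pt om) = 1" by (rule end_side(1)[OF w(1) S(2,1)]) simp
   ultimately show ?thesis using that[OF cutset_component[OF S(2) C(1)]] P Q by simp
  qed
 qed
qed

section \<open>The compactification is Hausdorff and compact\<close>

lemma FG_Hausdorff: "Hausdorff_space FG"
 unfolding Hausdorff_space_def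
proof (intro allI impI, elim conjE)
 fix p q assume pq: "p \<in> topspace FG" "q \<in> topspace FG" "p ~= q"
 obtain Q where Q: "cutset Q" "side Q p ~= side Q q" using side_separates[OF pq] .
 note c = side_continuous[OF Q(1)]
 obtain A B :: "real set" where AB: "open A" "open B" "side Q p \<in> A" "side Q q \<in> B" "A Int B = {}" using Q(2) hausdorff by metis
 have "openin FG {x \<in> topspace FG. side Q x \<in> A}" "openin FG {x \<in> topspace FG. side Q x \<in> B}"
  using openin_continuous_map_preimage[OF c] AB by auto
 moreover have "disjnt {x \<in> topspace FG. side Q x \<in> A} {x \<in> topspace FG. side Q x \<in> B}" using AB(5) by (auto simp: disjnt_def)
 ultimately show "\<exists>U W. openin FG U & openin FG W & p \<in> U & q \<in> W & disjnt U W" using pq AB(3,4) by blast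
qed

text \<open>The sets where the side function equals \<open>1\<close> lie in the corresponding hats
  for every \<open>\<epsilon>\<close>, so only the separator remains as a parameter. For finite
  intersections the separators are united.\<close>

lemma end_base:
 assumes U: "openin FG U" and w: "om \<in> ends V E" "End_Pt om \<in> U"
 obtains S where "finite S" "S \<subseteq> V" "{q \<in> topspace FG. side (end_comp V E S om) q = 1} \<subseteq> U"
proof -
 let ?c = "%S. {q \<in> topspace FG. side (end_comp V E S om) q = 1}"
 have "End_Pt om \<in> U --> (\<exists>S. finite S & S \<subseteq> V & ?c S \<subseteq> U)"
  using openin_topology_generated_by[OF U[unfolded freudenthal_def]]
 proof (induction rule: generate_topology_on.induct)
  case Empty then show ?case by simp
 next
  case (Int a b)
  show ?case
  proof
   assume "End_Pt om \<in> a Int b"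
   then obtain S1 S2 where S: "finite S1" "S1 \<subseteq> V" "?c S1 \<subseteq> a" "finite S2" "S2 \<subseteq> V" "?c S2 \<subseteq> b" using Int by auto
   have m: "?c (S1 Un S2) \<subseteq> ?c S'" if "S' \<subseteq> S1 Un S2" for S'
   proof
    fix q assume q: "q \<in> ?c (S1 Un S2)"
    have qT: "q \<in> topspace FG" "side (end_comp V E (S1 Un S2) om) q = 1" using q by auto
    have sub: "end_comp V E (S1 Un S2) om \<subseteq> end_comp V E S' om" using end_comp_mono[OF w(1) _ that] S by simp
    have "1 \<le> side (end_comp V E S' om) q" using side_mono[OF qT(1) sub] qT(2) by simp
    then have "side (end_comp V E S' om) q = 1" using side_range(2)[OF qT(1), of "end_comp V E S' om"] by linarith
    then show "q \<in> ?c S'" using qT(1) by simp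
   qed
   have "?c (S1 Un S2) \<subseteq> a Int b" using m[of S1] m[of S2] S(3,6) by blast
   then show "\<exists>S. finite S & S \<subseteq> V & ?c S \<subseteq> a Int b" using S by (intro exI[of _ "S1 Un S2"]) simp
  qed
 next
  case (UN K)
  show ?case
  proof
   assume "End_Pt om \<in> \<Union>K"
   then obtain k where k: "k \<in> K" "End_Pt om \<in> k" by blast
   have "\<exists>S. finite S & S \<subseteq> V & ?c S \<subseteq> k" by (rule mp[OF UN.IH[OF k(1)] k(2)])
   then obtain S where "finite S" "S \<subseteq> V" "?c S \<subseteq> k" by (elim exE conjE)
   then show "\<exists>S. finite S & S \<subseteq> V & ?c S \<subseteq> \<Union>K" using k(1) by (intro exI[of _ S]) blast
  qed
 next
  case (Basis s)
  show ?case
  proof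
   assume e: "End_Pt om \<in> s"
   have nc: "End_Pt om ~= on_edge x y t" "End_Pt om ~= vertex_pt x" for x y t by (simp_all add: on_edge_def vertex_pt_def)
   from Basis consider x y a b where "s = open_edge_interval x y a b"
    | x \<delta> where "s = vertex_star E x \<delta>"
    | S om' \<epsilon> where "s = end_hat V E S om' \<epsilon>" "S \<subseteq> V" "finite S" "om' \<in> ends V E" "0 < \<epsilon>" "\<epsilon> \<le> 1" by blast
   then show "\<exists>S. finite S & S \<subseteq> V & ?c S \<subseteq> s"
   proof cases
    case 1 then show ?thesis using e nc by (auto simp: open_edge_interval_def)
   next
    case 2 then show ?thesis using e nc by (auto simp: vertex_star_def)
   next
    case 3
    have "End_Pt om \<in> end_hat V E S om' \<epsilon>" using e 3(1) by simp
    then have eq: "end_comp V E S om = end_comp V E S om'" by (cases rule: hat_cases) (use nc in auto)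
    have "?c S \<subseteq> s" unfolding 3(1) hat_eq[OF 3(4,3,2,5,6)] eq using 3(5) by auto
    then show ?thesis using 3(2,3) by (intro exI[of _ S]) simp
   qed
  qed
 qed
 then show ?thesis using w(2) that by blast
qed

text \<open>Beyond growing balls \<open>SS n\<close>, components that are not covered by finitely
  many members can be chosen decreasing, since what remains is a finite union of compact edges and
  parts beyond other components. They determine an end, and a member of the cover containing this
  end covers one of them.\<close>

lemma FG_compact: "compact_space FG"
 unfolding compact_space_def compactin_def
proof (intro conjI allI impI)
 fix \<U> assume UU: "(\<forall>U\<in>\<U>. openin FG U) & topspace FG \<subseteq> \<Union>\<U>"
 define cov where "cov = (%A. \<exists>\<F>. finite \<F> & \<F> \<subseteq> \<U> & A \<subseteq> \<Union>\<F>)"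
 have covU: "cov (\<Union>i\<in>I. A i)" if fin: "finite I" "!!i. i \<in> I ==> cov (A i)" for I and A :: "'v set => 'v fpoint set"
 proof -
  have "\<forall>i\<in>I. \<exists>F. finite F & F \<subseteq> \<U> & A i \<subseteq> \<Union>F" using fin(2) unfolding cov_def by (intro ballI)
  from bchoice[OF this] obtain F where F: "\<forall>i\<in>I. finite (F i) & F i \<subseteq> \<U> & A i \<subseteq> \<Union>(F i)" by (elim exE)
  have 1: "finite (\<Union>i\<in>I. F i)" by (rule finite_UN_I[OF fin(1)]) (use F in simp)
  have 2: "(\<Union>i\<in>I. F i) \<subseteq> \<U>" by (rule UN_least) (use F in simp)
  have 3: "(\<Union>i\<in>I. A i) \<subseteq> \<Union>(\<Union>i\<in>I. F i)"
  proof (rule UN_least)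
   fix i assume i: "i \<in> I"
   have "A i \<subseteq> \<Union>(F i)" using F i by simp
   also have "\<dots> \<subseteq> \<Union>(\<Union>i\<in>I. F i)" by (rule Union_mono) (rule UN_upper[OF i])
   finally show "A i \<subseteq> \<Union>(\<Union>i\<in>I. F i)" .
  qed
  show ?thesis unfolding cov_def by (intro exI[of _ "\<Union>i\<in>I. F i"] conjI 1 2 3)
 qed
 have covUn: "cov (A Un B)" if AB: "cov A" "cov B" for A B
 proof -
  obtain F where F: "finite F" "F \<subseteq> \<U>" "A \<subseteq> \<Union>F" using AB(1) unfolding cov_def by (elim exE conjE)
  obtain G where G: "finite G" "G \<subseteq> \<U>" "B \<subseteq> \<Union>G" using AB(2) unfolding cov_def by (elim exE conjE)
  show ?thesis unfolding cov_def using F G by (intro exI[of _ "F Un G"]) auto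
 qed
 have covsub: "cov A" if "cov B" "A \<subseteq> B" for A B
 proof -
  from that(1) obtain F where F: "finite F" "F \<subseteq> \<U>" "B \<subseteq> \<Union>F" unfolding cov_def by (elim exE conjE)
  show ?thesis unfolding cov_def by (intro exI[of _ F] conjI F(1,2) subset_trans[OF that(2) F(3)])
 qed
 \<comment> \<open>The component with its inner edges and its ends, described as the set where its
   side function is \<open>1\<close>.\<close>
 define fat where "fat = (%C. {q \<in> topspace FG. side C q = 1})"
 have cove: "cov (\<Union>e\<in>{e\<in>E. e Int S ~= {}}. closed_edge e)" if "finite S" for S
 proof (rule covU[OF finite_touch[OF that]])
  fix e assume "e \<in> {e\<in>E. e Int S ~= {}}"
  then have "compactin FG (closed_edge e)" "closed_edge e \<subseteq> topspace FG" using closed_edge_props by auto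
  then have "\<exists>\<F>. finite \<F> & \<F> \<subseteq> \<U> & closed_edge e \<subseteq> \<Union>\<F>" unfolding compactin_def
   using UU subset_trans[of "closed_edge e" "topspace FG" "\<Union>\<U>"] by simp
  then show "cov (closed_edge e)" by (simp add: cov_def)
 qed
 have comps: "finite (graph_components E (V - S))" if S: "finite S" "S ~= {}" "S \<subseteq> V" for S
 proof (rule finite_subset)
  show "finite ((%u. {y. conn E (V - S) u y}) ` nbrs S)" using finite_nbrs_set[OF S(1)] by simp
  show "graph_components E (V - S) \<subseteq> (%u. {y. conn E (V - S) u y}) ` nbrs S"
  proof
   fix C assume C: "C \<in> graph_components E (V - S)"
   have "\<exists>s u. s \<in> S & u \<in> C & {s, u} \<in> E"
   proof (rule ccontr)
    assume neg: "~ ?thesis"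
    obtain c where c: "c \<in> C" using graph_connected_ne[OF component_connected[OF C]] by blast
    have "V \<subseteq> C"
    proof (rule graph_connected_subset_side[OF V_connected _ _ c])
     show "c \<in> V" using c component_subset[OF C] by blast
     fix a b assume ab: "{a, b} \<in> E" "a \<in> V" "b \<in> V" "a \<in> C"
     have "{b, a} \<in> E" using ab(1) by (simp add: insert_commute)
     then have "b \<notin> S" using neg ab(4) by blast
     then have "conn E (V - S) a b" using ab component_subset[OF C] by (intro conn_edge) auto
     then show "b \<in> C" by (rule component_closed[OF C ab(4)])
    qed
    then show False using S(2,3) component_subset[OF C] by blast
   qed
   then obtain s u where su: "s \<in> S" "u \<in> C" "{s, u} \<in> E" by blast
   then have "u \<in> nbrs S" by (auto simp: nbrs_def)
   then show "C \<in> (%u. {y. conn E (V - S) u y}) ` nbrs S" using component_eq[OF C su(2)] by (intro image_eqI)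
  qed
 qed
 have decomp: "topspace FG \<subseteq> (\<Union>e\<in>{e\<in>E. e Int S ~= {}}. closed_edge e) Un (\<Union>C\<in>graph_components E (V - S). fat C)" if S: "finite S" "S \<subseteq> V" for S
 proof
  fix q assume q: "q \<in> topspace FG"
  then show "q \<in> (\<Union>e\<in>{e\<in>E. e Int S ~= {}}. closed_edge e) Un (\<Union>C\<in>graph_components E (V - S). fat C)"
  proof (cases rule: FG_cases)
   case (vertex v)
   show ?thesis
   proof (cases "v \<in> S")
    case True
    have "\<exists>y. {v, y} \<in> E"
    proof (rule ccontr)
     assume neg: "~ ?thesis"
     have "V \<subseteq> {v}" by (rule graph_connected_subset_side[OF V_connected _ vertex(1)]) (use neg in auto)
     then have "V - {v} = {}" by blast
     then show False using graph_connected_ne[OF V_delete_connected[of v]] by blast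
    qed
    then obtain y where y: "{v, y} \<in> E" by blast
    have ne: "v ~= y" using edgeD[OF y] by blast
    have "q \<in> closed_edge {v, y}" unfolding closed_edge_image[OF ne] vertex(2) on_edge_0[OF ne, symmetric] by simp
    moreover have "{v, y} Int S ~= {}" using True by blast
    ultimately show ?thesis using y by blast
   next
    case False
    then have v: "v \<in> V - S" using vertex(1) by blast
    have "v \<in> {y. conn E (V - S) v y}" using v by (simp add: conn_refl)
    then have "q \<in> fat {y. conn E (V - S) v y}" using q vertex(2) by (simp add: fat_def side_vertex)
    then show ?thesis using component_of[OF v, of E] by blast
   qed
  next
   case (edge x y t)
   have ne: "x ~= y" and V: "x \<in> V" "y \<in> V" using edgeD[OF edge(1)] by auto
   show ?thesis
   proof (cases "{x, y} Int S = {}")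
    case False
    have "q \<in> closed_edge {x, y}" unfolding closed_edge_image[OF ne] using edge by auto
    then show ?thesis using edge(1) False by blast
   next
    case True
    then have x: "x \<in> V - S" and y: "y \<in> V - S" using V by auto
    have "x \<in> {y. conn E (V - S) x y}" "y \<in> {y. conn E (V - S) x y}" using x conn_edge[OF edge(1) x y] by (simp_all add: conn_refl)
    then have "q \<in> fat {y. conn E (V - S) x y}" using q edge(4) side_on_edge[OF ne] by (simp add: fat_def)
    then show ?thesis using component_of[OF x, of E] by blast
   qed
  next
   case (endpt om)
   have "side (end_comp V E S om) q = 1" unfolding endpt(2) by (rule end_side(1)[OF endpt(1) S]) simp
   then have "q \<in> fat (end_comp V E S om)" using q by (simp add: fat_def)
   then show ?thesis using end_comp_component[OF endpt(1) S] by blast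
  qed
 qed
 obtain r where r: "r \<in> V" using graph_connected_ne[OF V_connected] by blast
 define SS where "SS = (%n. ((%S. S Un nbrs S) ^^ n) {r})"
 have SSS: "SS (Suc n) = SS n Un nbrs (SS n)" for n by (simp add: SS_def)
 have nV: "nbrs S \<subseteq> V" for S using edgeD by (auto simp: nbrs_def)
 have SS0: "SS 0 = {r}" by (simp add: SS_def)
 have SS: "finite (SS n) & r \<in> SS n & SS n \<subseteq> V" for n
  by (induction n) (use r nV finite_nbrs_set in \<open>auto simp: SSS SS0\<close>)
 have SSm: "SS m \<subseteq> SS n" if "m \<le> n" for m n by (rule lift_Suc_mono_le[OF _ that]) (simp add: SSS)
 have SSV: "V \<subseteq> (\<Union>n. SS n)"
 proof (rule graph_connected_subset_side[OF V_connected _ r])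
  show "r \<in> (\<Union>n. SS n)" using SS[of 0] by blast
  fix a b assume "{a, b} \<in> E" "a \<in> (\<Union>n. SS n)"
  then obtain n where "a \<in> SS n" by blast
  then have "b \<in> SS (Suc n)" using \<open>{a, b} \<in> E\<close> by (auto simp: SSS nbrs_def)
  then show "b \<in> (\<Union>n. SS n)" by blast
 qed
 have ex: "\<exists>n. S \<subseteq> SS n" if "finite S" "S \<subseteq> V" for S
  using that
 proof (induction S rule: finite_induct)
  case (insert x F)
  then obtain n where n: "F \<subseteq> SS n" by auto
  obtain m where m: "x \<in> SS m" using SSV insert.prems by auto
  have "insert x F \<subseteq> SS (max m n)" using n m SSm[of n "max m n"] SSm[of m "max m n"] by auto
  then show ?case by blast
 qed simp
 show "\<exists>\<F>. finite \<F> & \<F> \<subseteq> \<U> & topspace FG \<subseteq> \<Union>\<F>"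
 proof (rule ccontr)
  assume "~ ?thesis"
  then have ncov: "~ cov (topspace FG)" by (simp add: cov_def)
  define P where "P = (%n C. C \<in> graph_components E (V - SS n) & ~ cov (fat C))"
  \<comment> \<open>Apart from finitely many edges, \<open>A\<close> consists of its intersections
    with finitely many parts; if all parts that it meets were finitely covered, so would be
    \<open>A\<close>.\<close>
  have pick: "\<exists>C'. P n C' & A Int fat C' ~= {}" if A: "A \<subseteq> topspace FG" "~ cov A" for n A
  proof (rule ccontr)
   assume neg: "~ ?thesis"
   let ?\<C> = "{C \<in> graph_components E (V - SS n). A Int fat C ~= {}}"
   let ?E = "\<Union>e\<in>{e\<in>E. e Int SS n ~= {}}. closed_edge e"
   have Sn: "finite (SS n)" "SS n ~= {}" "SS n \<subseteq> V" using SS[of n] by auto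
   have fin: "finite ?\<C>" using comps[OF Sn] by simp
   have "cov (fat C)" if C: "C \<in> ?\<C>" for C
   proof (rule ccontr)
    assume "~ cov (fat C)"
    then have "P n C & A Int fat C ~= {}" using C by (simp add: P_def)
    then have "\<exists>C'. P n C' & A Int fat C' ~= {}" by (rule exI)
    then show False by (rule notE[OF neg])
   qed
   then have "cov (\<Union>C\<in>?\<C>. fat C)" by (rule covU[OF fin])
   then have c: "cov (?E Un (\<Union>C\<in>?\<C>. fat C))" by (rule covUn[OF cove[OF Sn(1)]])
   have "A \<subseteq> ?E Un (\<Union>C\<in>?\<C>. fat C)"
   proof
    fix q assume q: "q \<in> A"
    then have "q \<in> ?E Un (\<Union>C\<in>graph_components E (V - SS n). fat C)" by (rule subsetD[OF decomp[OF Sn(1,3)] subsetD[OF A(1)]])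
    then show "q \<in> ?E Un (\<Union>C\<in>?\<C>. fat C)"
    proof (elim UnE)
     assume "q \<in> (\<Union>C\<in>graph_components E (V - SS n). fat C)"
     then obtain C where C: "C \<in> graph_components E (V - SS n)" "q \<in> fat C" by (rule UN_E)
     have "A Int fat C ~= {}" using IntI[OF q C(2)] by (rule ex_in_conv[THEN iffD1, OF exI])
     then have "C \<in> ?\<C>" using C(1) by simp
     then have "q \<in> (\<Union>C\<in>?\<C>. fat C)" using C(2) by (rule UN_I)
     then show ?thesis by (rule UnI2)
    qed (rule UnI1)
   qed
   then show False using covsub[OF c] A(2) by simp
  qed
  have st: "\<exists>C'. P (Suc n) C' & C' \<subseteq> C" if C: "P n C" for n C
  proof -
   have "fat C \<subseteq> topspace FG" "~ cov (fat C)" using C by (auto simp: fat_def P_def)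
   from pick[OF this, of "Suc n"] obtain C' where C': "P (Suc n) C'" "fat C Int fat C' ~= {}" by (elim exE conjE)
   then obtain q where q: "q \<in> topspace FG" "side C q = 1" "side C' q = 1" by (auto simp: fat_def)
   have cc: "C \<in> graph_components E (V - SS n)" "C' \<in> graph_components E (V - SS (Suc n))" using C C'(1) by (auto simp: P_def)
   have cut: "cutset C" "cutset C'" using cutset_component[OF _ cc(1)] cutset_component[OF _ cc(2)] SS by auto
   have "C Int C' ~= {}" using side_disjoint[OF q(1) _ cut q(2,3)] by blast
   moreover have "C' \<subseteq> V - SS n" using component_subset[OF cc(2)] SSm[of n "Suc n"] by auto
   ultimately have "C' \<subseteq> C" by (intro component_absorbs[OF cc(1) component_connected[OF cc(2)]])
   then show ?thesis using C'(1) by blast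
  qed
  have "\<exists>C. P 0 C" using pick[OF subset_refl ncov, of 0] by (elim exE conjE) (rule exI)
  then have "\<exists>C. \<forall>n. P n (C n) & C (Suc n) \<subseteq> C n" by (intro dependent_nat_choice) (use st in auto)
  then obtain C where C: "!!n. P n (C n)" "!!n. C (Suc n) \<subseteq> C n" by blast
  have Cm: "C n \<subseteq> C m" if "m \<le> n" for m n using that
  proof (induction n rule: dec_induct)
   case (step n) then show ?case using C(2)[of n] by blast
  qed simp
  have cc: "C n \<in> graph_components E (V - SS n)" for n using C(1)[of n] by (simp add: P_def)
  have "\<exists>v. v \<in> C n" for n using graph_connected_ne[OF component_connected[OF cc]] by blast
  then obtain v where v: "!!n. v n \<in> C n" by metis
  have vS: "v n \<in> V - SS n" for n using v component_subset[OF cc] by blast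
  have infU: "infinite (range v)"
  proof
   assume "finite (range v)"
   then obtain m where "range v \<subseteq> SS m" using ex[of "range v"] vS by blast
   then show False using vS[of m] by blast
  qed
  have UV: "range v \<subseteq> V" using vS by blast
  obtain R where R: "ray E R" and comb: "!!S. finite S ==> \<exists>n. (\<forall>m\<ge>n. R m \<notin> S) & infinite {u\<in>range v. conn E (V - S) (R n) u}"
  proof (rule star_comb[OF V_connected r _ UV infU])
   show "finite {y\<in>V. {x, y} \<in> E}" if "x \<in> V" for x
    by (rule finite_subset[OF _ finite_nbrs[OF that]]) auto
  qed auto
  obtain om where w: "om \<in> ends V E" "R \<in> om" using ray_end[OF R] .
  \<comment> \<open>The vertices \<open>v k\<close> with \<open>k \<ge> m\<close> lie in
    \<open>C m\<close>, and the component of the end contains infinitely many of the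
    \<open>v k\<close>.\<close>
  have eqC: "C m = end_comp V E (SS m) om" for m
  proof -
   have Sm: "finite (SS m)" "SS m \<subseteq> V" using SS by auto
   obtain n where n: "\<forall>k\<ge>n. R k \<notin> SS m" "infinite {u\<in>range v. conn E (V - SS m) (R n) u}" using comb[OF Sm(1)] by blast
   have "infinite ({u\<in>range v. conn E (V - SS m) (R n) u} - v ` {..<m})" using n(2) by simp
   then have "{u\<in>range v. conn E (V - SS m) (R n) u} - v ` {..<m} ~= {}" by (rule infinite_imp_nonempty)
   then obtain u where "u \<in> {u\<in>range v. conn E (V - SS m) (R n) u} - v ` {..<m}" by (meson ex_in_conv)
   then have u: "u \<in> range v" "conn E (V - SS m) (R n) u" "u \<notin> v ` {..<m}" by simp_all
   obtain k where k: "u = v k" using u(1) by (rule rangeE)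
   have "k \<ge> m" using u(3) k by (metis imageI lessThan_iff not_le)
   then have "u \<in> C m" using v[of k] Cm k by blast
   moreover have "u \<in> end_comp V E (SS m) om" by (rule end_compI[OF w(1) Sm w(2) _ u(2)]) (use n(1) in blast)
   ultimately show ?thesis using component_unique[OF cc end_comp_component[OF w(1) Sm]] by blast
  qed
  have "End_Pt om \<in> topspace FG" using w(1) by (auto simp: topspace_FG)
  then obtain U where U: "U \<in> \<U>" "End_Pt om \<in> U" using UU by blast
  obtain S where S: "finite S" "S \<subseteq> V" "{q \<in> topspace FG. side (end_comp V E S om) q = 1} \<subseteq> U"
   using end_base[OF _ w(1) U(2)] UU U(1) by metis
  obtain m where m: "S \<subseteq> SS m" using ex[OF S(1,2)] by blast
  have sub: "C m \<subseteq> end_comp V E S om" unfolding eqC using end_comp_mono[OF w(1) _ m] SS[of m] by simp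
  have "fat (C m) \<subseteq> U"
  proof
   fix q assume "q \<in> fat (C m)"
   then have q: "q \<in> topspace FG" "side (C m) q = 1" by (auto simp: fat_def)
   then have "side (end_comp V E S om) q = 1" using side_mono[OF q(1) sub] side_range(2)[OF q(1), of "end_comp V E S om"] by linarith
   then show "q \<in> U" using S(3) q(1) by blast
  qed
  then have "cov (fat (C m))" unfolding cov_def using U(1) by (intro exI[of _ "{U}"]) auto
  then show False using C(1)[of m] by (simp add: P_def)
 qed
qed simp

end

section \<open>Thin sums and the separation of closed sets by finite cuts\<close>

lemma vertex_pt_inject: "vertex_pt u = vertex_pt v \<longleftrightarrow> u = v"
proof
 assume eq: "vertex_pt u = vertex_pt v"
 have "side {u} (vertex_pt v) = 1" by (simp add: eq[symmetric] side_vertex)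
 then show "u = v" by (simp add: side_vertex split: if_splits)
qed simp

lemma vertex_not_inner: assumes "x ~= y" "0 < t" "t < 1" shows "vertex_pt v ~= on_edge x y t"
proof
 assume eq: "vertex_pt v = on_edge x y t"
 have "side {x} (vertex_pt v) = 1 - t" unfolding eq side_on_edge[OF assms(1)] using assms(1) by simp
 then show False using assms by (auto simp: side_vertex split: if_splits)
qed

text \<open>Count incidences between \<open>F\<close> and the finitely many members that meet
  \<open>F\<close>; thinness makes their number finite.\<close>

lemma thin_sum_even:
 assumes thin: "thin_family E I A" and F: "finite F" "F \<subseteq> E" and ev: "!!i. i \<in> I ==> even (card (A i Int F))"
 shows "even (card (thin_sum E I A Int F))"
proof -
 define J where "J = (\<Union>e\<in>F. {i\<in>I. e \<in> A i})"
 have J: "finite J" unfolding J_def by (rule finite_UN_I[OF F(1)]) (use thin F(2) in \<open>auto simp: thin_family_def\<close>)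
 have "(\<Sum>e\<in>F. card {i\<in>J. e \<in> A i}) = (\<Sum>i\<in>J. card {e\<in>F. e \<in> A i})"
  by (rule sum_multicount_gen[OF F(1) J]) simp
 moreover have "even (\<Sum>i\<in>J. card {e\<in>F. e \<in> A i})"
 proof (rule dvd_sum)
  fix i assume "i \<in> J"
  then have "i \<in> I" by (auto simp: J_def)
  moreover have "{e\<in>F. e \<in> A i} = A i Int F" by auto
  ultimately show "2 dvd card {e\<in>F. e \<in> A i}" using ev by simp
 qed
 ultimately have "even (\<Sum>e\<in>F. card {i\<in>J. e \<in> A i})" by simp
 then have 1: "even (card {e\<in>F. odd (card {i\<in>J. e \<in> A i})})" unfolding even_sum_iff[OF F(1)] .
 have "{i\<in>J. e \<in> A i} = {i\<in>I. e \<in> A i}" if "e \<in> F" for e using that by (auto simp: J_def)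
 then have "{e\<in>F. odd (card {i\<in>J. e \<in> A i})} = {e\<in>F. odd (card {i\<in>I. e \<in> A i})}" by auto
 also have "\<dots> = thin_sum E I A Int F" using F(2) by (auto simp: thin_sum_def)
 finally show ?thesis using 1 by simp
qed

context lfgraph
begin

text \<open>Every point of \<open>K1\<close> has a neighbourhood whose vertices lie in the side of a
  finite cut that contains no vertex of \<open>K2\<close>; for an end, this side is a component
  beyond a finite set. Finitely many neighbourhoods cover \<open>K1\<close>, and the union of their
  sides again has a finite cut.\<close>

lemma finite_cut_separation:
 assumes K1: "compactin FG K1" and K2: "closedin FG K2" and dis: "K1 Int K2 = {}"
 obtains Q where "cutset Q" "!!v. v \<in> V ==> vertex_pt v \<in> K1 ==> v \<in> Q" "!!v. v \<in> Q ==> vertex_pt v \<notin> K2"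
proof -
 have K1T: "K1 \<subseteq> topspace FG" by (rule compactin_subset_topspace[OF K1])
 have "\<exists>Ob Q. openin FG Ob & p \<in> Ob & cutset Q & (\<forall>v\<in>Q. vertex_pt v \<notin> K2) & (\<forall>v\<in>V. vertex_pt v \<in> Ob --> v \<in> Q)" if p: "p \<in> K1" for p
 proof -
  have pT: "p \<in> topspace FG" and pK: "p \<notin> K2" using p K1T dis by auto
  from pT show ?thesis
  proof (cases rule: FG_cases)
   case (vertex u)
   let ?O = "vertex_star E u (%_. 1)"
   have "openin FG ?O" by (rule open_star[OF vertex(1)]) simp
   moreover have "p \<in> ?O" using vertex by (simp add: vertex_star_def)
   moreover have "\<forall>v\<in>V. vertex_pt v \<in> ?O --> v \<in> {u}"
   proof (intro ballI impI)
    fix v assume "vertex_pt v \<in> ?O"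
    then show "v \<in> {u}"
    proof (cases rule: star_cases)
     case vertex then show ?thesis by (simp add: vertex_pt_inject)
    next
     case (edge y t) then show ?thesis using vertex_not_inner[of u y t v] edgeD[OF edge(2)] by simp
    qed
   qed
   ultimately show ?thesis using cutset_single[OF vertex(1)] pK vertex(2) by (intro exI[of _ ?O] exI[of _ "{u}"]) simp
  next
   case (edge x y t)
   let ?O = "open_edge_interval x y 0 1"
   have "openin FG ?O" by (rule open_interval[OF edge(1)]) simp_all
   moreover have "p \<in> ?O" using edge by (auto simp: open_edge_interval_def)
   moreover have "vertex_pt v \<notin> ?O" for v using vertex_not_inner[of x y] edgeD[OF edge(1)] unfolding open_edge_interval_def by auto
   moreover have "cutset {}" by (simp add: cutset_def bd_def)
   ultimately show ?thesis by (intro exI[of _ ?O] exI[of _ "{}"]) simp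
  next
   case (endpt om)
   have "openin FG (topspace FG - K2)" using K2 by blast
   moreover have "End_Pt om \<in> topspace FG - K2" using pT pK endpt by simp
   ultimately obtain S where S: "finite S" "S \<subseteq> V" "{q \<in> topspace FG. side (end_comp V E S om) q = 1} \<subseteq> topspace FG - K2"
    using end_base[OF _ endpt(1)] by metis
   let ?C = "end_comp V E S om" and ?O = "end_hat V E S om 1"
   have CV: "?C \<subseteq> V" using end_comp_subset[OF endpt(1) S(1,2)] by blast
   have "openin FG ?O" by (rule open_hat[OF S(2,1) endpt(1)]) simp_all
   moreover have "p \<in> ?O" using endpt by (auto simp: end_hat_def Let_def)
   moreover have "cutset ?C" by (rule cutset_component[OF S(1) end_comp_component[OF endpt(1) S(1,2)]])
   moreover have "\<forall>v\<in>?C. vertex_pt v \<notin> K2"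
   proof
    fix v assume v: "v \<in> ?C"
    have "vertex_pt v \<in> topspace FG" unfolding topspace_FG using v CV by blast
    then have "vertex_pt v \<in> topspace FG - K2" using S(3) v by (auto simp: side_vertex)
    then show "vertex_pt v \<notin> K2" by blast
   qed
   moreover have "\<forall>v\<in>V. vertex_pt v \<in> ?O --> v \<in> ?C"
   proof (intro ballI impI)
    fix v assume "vertex_pt v \<in> ?O"
    then show "v \<in> ?C" unfolding hat_eq[OF endpt(1) S(1,2) zero_less_one order_refl]
     by (auto simp: side_vertex split: if_splits)
   qed
   ultimately show ?thesis by (intro exI[of _ ?O] exI[of _ ?C]) simp
  qed
 qed
 then have "\<forall>p\<in>K1. \<exists>Z. openin FG (fst Z) & p \<in> fst Z & cutset (snd Z) & (\<forall>v\<in>snd Z. vertex_pt v \<notin> K2) & (\<forall>v\<in>V. vertex_pt v \<in> fst Z --> v \<in> snd Z)"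
  by (simp add: split_paired_Ex)
 from bchoice[OF this] obtain Z where Z: "\<forall>p\<in>K1. openin FG (fst (Z p)) & p \<in> fst (Z p) & cutset (snd (Z p)) & (\<forall>v\<in>snd (Z p). vertex_pt v \<notin> K2) & (\<forall>v\<in>V. vertex_pt v \<in> fst (Z p) --> v \<in> snd (Z p))"
  by (elim exE)
 define Ob Qf where "Ob = (%p. fst (Z p))" and "Qf = (%p. snd (Z p))"
 have O: "openin FG (Ob p)" "p \<in> Ob p" "cutset (Qf p)" "v \<in> Qf p ==> vertex_pt v \<notin> K2" "v \<in> V ==> vertex_pt v \<in> Ob p ==> v \<in> Qf p" if "p \<in> K1" for p v
  using bspec[OF Z that] by (simp_all add: Ob_def Qf_def)
 have "\<exists>\<F>. finite \<F> & \<F> \<subseteq> Ob ` K1 & K1 \<subseteq> \<Union>\<F>"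
 proof -
  have 1: "openin FG U" if "U \<in> Ob ` K1" for U using that by (rule imageE) (simp add: O(1))
  have 2: "K1 \<subseteq> \<Union>(Ob ` K1)"
  proof
   fix p assume p: "p \<in> K1"
   show "p \<in> \<Union>(Ob ` K1)" using imageI[OF p, of Ob] O(2)[OF p] by (rule UnionI)
  qed
  show ?thesis using K1 1 2 unfolding compactin_def by (elim conjE allE[of _ "Ob ` K1"]) simp
 qed
 then obtain \<F> where F: "finite \<F>" "\<F> \<subseteq> Ob ` K1" "K1 \<subseteq> \<Union>\<F>" by (elim exE conjE)
 obtain I where I: "I \<subseteq> K1" "finite I" "\<F> = Ob ` I" using finite_subset_image[OF F(1,2)] by (elim exE conjE)
 have I3: "K1 \<subseteq> (\<Union>p\<in>I. Ob p)" using F(3) unfolding I(3) .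
 have IK: "p \<in> K1" if "p \<in> I" for p by (rule subsetD[OF I(1) that])
 define Q where "Q = (\<Union>p\<in>I. Qf p)"
 have "bd (\<Union>p\<in>I. Qf p) \<subseteq> (\<Union>p\<in>I. bd (Qf p))" by (auto simp: bd_def)
 moreover have "finite (\<Union>p\<in>I. bd (Qf p))" by (rule finite_UN_I[OF I(2)]) (use O(3) IK in \<open>simp add: cutset_def\<close>)
 ultimately have "finite (bd Q)" unfolding Q_def by (rule finite_subset)
 moreover have "Q \<subseteq> V" unfolding Q_def by (rule UN_least) (use O(3) IK in \<open>simp add: cutset_def\<close>)
 ultimately have "cutset Q" by (simp add: cutset_def)
 moreover have "v \<in> Q" if v: "v \<in> V" "vertex_pt v \<in> K1" for v
 proof -
  obtain p where p: "p \<in> I" "vertex_pt v \<in> Ob p" using subsetD[OF I3 v(2)] by (rule UN_E)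
  show ?thesis unfolding Q_def using p(1) O(5)[OF IK[OF p(1)] v(1) p(2)] by (rule UN_I)
 qed
 moreover have "vertex_pt v \<notin> K2" if v: "v \<in> Q" for v
 proof -
  obtain p where p: "p \<in> I" "v \<in> Qf p" using v unfolding Q_def by (rule UN_E)
  show ?thesis by (rule O(4)[OF IK[OF p(1)] p(2)])
 qed
 ultimately show ?thesis by (rule that)
qed


section \<open>Edge sets that meet finite cuts evenly\<close>

definition cut_even :: "'v set set => bool" where
 "cut_even C \<longleftrightarrow> C \<subseteq> E & (\<forall>Q. cutset Q --> even (card (C Int bd Q)))"

definition cut_minimal :: "'v set set => bool" where
 "cut_minimal C \<longleftrightarrow> cut_even C & C ~= {} & (\<forall>B. cut_even B & B ~= {} & B \<subseteq> C --> B = C)"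

lemma cutset_empty: "cutset {}" by (simp add: cutset_def bd_def)

lemma cutset_compl: "cutset Q ==> cutset (V - Q)" by (simp add: cutset_def bd_compl)

lemma cutset_union: assumes "cutset Q" "cutset Q'" shows "cutset (Q Un Q')"
proof -
 have "finite (bd Q Un bd Q')" using assms by (simp add: cutset_def)
 then have "finite (bd (Q Un Q'))" by (rule finite_subset[OF bd_union])
 then show ?thesis using assms by (simp add: cutset_def)
qed

lemma cutset_inter: assumes "cutset Q" "cutset Q'" shows "cutset (Q Int Q')"
proof -
 have "Q Int Q' = V - ((V - Q) Un (V - Q'))" using assms by (auto simp: cutset_def)
 then show ?thesis using cutset_compl[OF cutset_union[OF cutset_compl[OF assms(1)] cutset_compl[OF assms(2)]]] by simp
qed

lemma cutset_diff: assumes "cutset Q" "cutset Q'" shows "cutset (Q - Q')"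
proof -
 have "Q - Q' = Q Int (V - Q')" using assms by (auto simp: cutset_def)
 then show ?thesis using cutset_inter[OF assms(1) cutset_compl[OF assms(2)]] by simp
qed

lemma cutset_sym_diff: "cutset Q ==> cutset Q' ==> cutset ((Q - Q') Un (Q' - Q))"
 by (intro cutset_union cutset_diff)

lemma cut_even_diff: assumes "cut_even C" "cut_even B" "B \<subseteq> C" shows "cut_even (C - B)"
 unfolding cut_even_def
proof (intro conjI allI impI)
 show "C - B \<subseteq> E" using assms(1) by (auto simp: cut_even_def)
 fix Q assume Q: "cutset Q"
 have "(C - B) Int bd Q = (C Int bd Q - B Int bd Q) Un (B Int bd Q - C Int bd Q)" using assms(3) by auto
 moreover have "finite (C Int bd Q)" "finite (B Int bd Q)" using Q by (auto simp: cutset_def)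
 ultimately show "even (card ((C - B) Int bd Q))"
  using assms(1,2) Q even_card_sym_diff[of "C Int bd Q" "B Int bd Q"] by (simp add: cut_even_def)
qed

text \<open>Zorn's lemma for the sets that can be removed while keeping \<open>e\<close>. A finite
  cut sees only finitely many edges of the union of a chain, and these already lie in one member of
  the chain.\<close>

lemma exists_cut_minimal:
 assumes A: "cut_even A" and e: "e \<in> A"
 obtains C where "cut_minimal C" "e \<in> C" "C \<subseteq> A"
proof -
 let ?D = "{D. D \<subseteq> A & e \<notin> D & cut_even (A - D)}"
 have "\<exists>M\<in>?D. \<forall>X\<in>?D. M \<subseteq> X --> X = M"
 proof (rule subset_Zorn_nonempty)
  have "{} \<in> ?D" using A by simp
  then show "?D ~= {}" by (rule ex_in_conv[THEN iffD1, OF exI])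
  fix \<C> assume ne: "\<C> ~= {}" and ch: "subset.chain ?D \<C>"
  have sub: "D \<subseteq> A & e \<notin> D & cut_even (A - D)" if "D \<in> \<C>" for D
  proof -
   have "\<C> \<subseteq> ?D" using ch by (simp add: subset_chain_def)
   then have "D \<in> ?D" using that by (rule subsetD)
   then show ?thesis by simp
  qed
  have "even (card ((A - \<Union>\<C>) Int bd Q))" if Q: "cutset Q" for Q
  proof -
   have fin: "finite (\<Union>\<C> Int bd Q)" using Q by (simp add: cutset_def)
   obtain D where D: "D \<in> \<C>" "\<Union>\<C> Int bd Q \<subseteq> D" by (rule finite_subset_Union_chain[OF fin Int_lower1 ne ch])
   have "D \<subseteq> \<Union>\<C>" by (rule Union_upper[OF D(1)])
   then have "(A - \<Union>\<C>) Int bd Q = (A - D) Int bd Q" using D(2) by (auto simp only: Int_iff Diff_iff subset_iff)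
   then show ?thesis using sub[OF D(1)] Q by (simp add: cut_even_def)
  qed
  moreover have "A - \<Union>\<C> \<subseteq> E" using A by (auto simp: cut_even_def)
  ultimately have "cut_even (A - \<Union>\<C>)" by (simp add: cut_even_def)
  moreover have "\<Union>\<C> \<subseteq> A" by (rule Union_least) (use sub in simp)
  moreover have "e \<notin> \<Union>\<C>" using sub by (simp only: Union_iff) blast
  ultimately show "\<Union>\<C> \<in> ?D" by simp
 qed
 then obtain M where M: "M \<in> ?D" "\<forall>X\<in>?D. M \<subseteq> X --> X = M" by (elim bexE)
 have max: "X = M" if "X \<subseteq> A" "e \<notin> X" "cut_even (A - X)" "M \<subseteq> X" for X
  using bspec[OF M(2), of X] that by simp
 define C where "C = A - M"
 have MA: "M \<subseteq> A" "e \<notin> M" and Ce: "cut_even C" "e \<in> C" using M(1) e by (auto simp: C_def)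
 have small: "B = C" if B: "cut_even B" "B \<subseteq> C" "e \<in> B" for B
 proof -
  have "A - (A - B) = B" using B(2) by (auto simp: C_def)
  then have "A - B = M" using B MA by (intro max) (auto simp: C_def)
  then show ?thesis using B(2) MA by (auto simp: C_def)
 qed
 have "B = C" if B: "cut_even B" "B ~= {}" "B \<subseteq> C" for B
 proof (cases "e \<in> B")
  case True then show ?thesis using small B by simp
 next
  case False
  \<comment> \<open>Maximality concerns only subsets containing \<open>e\<close>. If
    \<open>B\<close> does not contain \<open>e\<close>, then its complement in \<open>C\<close>
    does.\<close>
  have "C - B = C" by (rule small[OF cut_even_diff[OF Ce(1) B(1,3)]]) (use False Ce in auto)
  then show ?thesis using B by blast
 qed
 then have "cut_minimal C" using Ce by (auto simp: cut_minimal_def)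
 then show ?thesis using that Ce(2) by (simp add: C_def)
qed

text \<open>Otherwise extend the span of the traces of finite cuts on \<open>C\<close> and of \<open>{f}\<close> to a maximal
  subspace that does not contain \<open>{e}\<close>. It has codimension one, and the set of edges \<open>g\<close> with
  \<open>{g}\<close> outside of it is orthogonal to all finite cuts, contradicting the minimality of \<open>C\<close>.\<close>

lemma two_edge_cut:
 assumes C: "cut_minimal C" and e: "e \<in> C" and f: "f \<in> C" and ne: "e ~= f"
 shows "\<exists>Q. cutset Q & C Int bd Q = {e, f}"
proof (rule ccontr)
 assume neg: "~ (\<exists>Q. cutset Q & C Int bd Q = {e, f})"
 have ce: "cut_even C" using C by (simp add: cut_minimal_def)
 define sd :: "'v set set => 'v set set => 'v set set" where "sd = (%X Y. (X - Y) Un (Y - X))"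
 have q1: "sd a (sd b s) = sd (sd a b) s" for a b s by (auto simp: sd_def)
 have q2: "sd (sd a s) b = sd (sd a b) s" for a b s by (auto simp: sd_def)
 have q3: "sd (sd a s) (sd b s) = sd a b" for a b s by (auto simp: sd_def)
 have q4: "sd (sd a s) s = a" for a s by (auto simp: sd_def)
 have q5: "sd a a = {}" "sd {} a = a" "sd a {} = a" for a by (auto simp: sd_def)
 have q6: "sd a b = sd b a" for a b by (auto simp: sd_def)
 \<comment> \<open>The span of the traces of finite cuts and of \<open>{f}\<close>. Since cuts are
   closed under sums, it is described by two cases.\<close>
 define M0 where "M0 = {X. \<exists>Q. cutset Q & (X = C Int bd Q \<or> X = sd (C Int bd Q) {f})}"
 have M0I: "C Int bd Q \<in> M0" "sd (C Int bd Q) {f} \<in> M0" if "cutset Q" for Q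
  unfolding M0_def mem_Collect_eq by (rule exI[of _ Q], simp add: that)+
 have M0cl: "sd X Y \<in> M0" if X: "X \<in> M0" and Y: "Y \<in> M0" for X Y
 proof -
  obtain Q where Q: "cutset Q" "X = C Int bd Q \<or> X = sd (C Int bd Q) {f}" using X unfolding M0_def by (elim CollectE exE conjE)
  obtain Q' where Q': "cutset Q'" "Y = C Int bd Q' \<or> Y = sd (C Int bd Q') {f}" using Y unfolding M0_def by (elim CollectE exE conjE)
  let ?Q = "(Q - Q') Un (Q' - Q)"
  have eq: "sd (C Int bd Q) (C Int bd Q') = C Int bd ?Q" unfolding bd_sym_diff sd_def by auto
  have "sd X Y = sd (C Int bd Q) (C Int bd Q') \<or> sd X Y = sd (sd (C Int bd Q) (C Int bd Q')) {f}"
   using Q(2) Q'(2)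
   by (elim disjE) (simp_all only: q1[of "C Int bd Q" "C Int bd Q'" "{f}"] q2[of "C Int bd Q" "{f}" "C Int bd Q'"] q3[of "C Int bd Q" "{f}" "C Int bd Q'"] simp_thms)
  then show ?thesis unfolding eq using M0I[OF cutset_sym_diff[OF Q(1) Q'(1)]] by (elim disjE) simp_all
 qed
 \<comment> \<open>Traces have even size, and a trace equal to \<open>{e, f}\<close> is excluded by
   assumption.\<close>
 have M0e: "{e} \<notin> M0"
 proof
  assume "{e} \<in> M0"
  then obtain Q where Q: "cutset Q" "{e} = C Int bd Q \<or> {e} = sd (C Int bd Q) {f}" unfolding M0_def by (elim CollectE exE conjE)
  from Q(2) show False
  proof
   assume "{e} = C Int bd Q"
   then have "card (C Int bd Q) = 1" by (metis card.empty card_insert_disjoint empty_iff finite.emptyI One_nat_def)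
   then show False using ce Q(1) unfolding cut_even_def by (metis odd_one)
  next
   assume "{e} = sd (C Int bd Q) {f}"
   then have "C Int bd Q = sd {e} {f}" using q4[of "C Int bd Q" "{f}"] by simp
   also have "\<dots> = {e, f}" using ne by (auto simp: sd_def)
   finally show False using neg Q(1) by simp
  qed
 qed
 let ?F = "{M. M0 \<subseteq> M & {e} \<notin> M & (\<forall>X\<in>M. \<forall>Y\<in>M. sd X Y \<in> M)}"
 have "\<exists>M\<in>?F. \<forall>X\<in>?F. M \<subseteq> X --> X = M"
 proof (rule subset_Zorn_nonempty)
  have "M0 \<in> ?F" using M0cl M0e by simp
  then show "?F ~= {}" by (rule ex_in_conv[THEN iffD1, OF exI])
  fix \<C> assume ne: "\<C> ~= {}" and ch: "subset.chain ?F \<C>"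
  have lin: "A \<subseteq> B \<or> B \<subseteq> A" if "A \<in> \<C>" "B \<in> \<C>" for A B using ch that by (simp add: subset_chain_def)
  have sub: "M0 \<subseteq> D" "{e} \<notin> D" "!!X Y. X \<in> D ==> Y \<in> D ==> sd X Y \<in> D" if "D \<in> \<C>" for D
  proof -
   have "\<C> \<subseteq> ?F" using ch by (simp add: subset_chain_def)
   then have "D \<in> ?F" using that by (rule subsetD)
   then show "M0 \<subseteq> D" "{e} \<notin> D" "!!X Y. X \<in> D ==> Y \<in> D ==> sd X Y \<in> D" by simp_all
  qed
  obtain D0 where D0: "D0 \<in> \<C>" using ne by (meson ex_in_conv)
  have "M0 \<subseteq> \<Union>\<C>" by (rule subset_trans[OF sub(1)[OF D0] Union_upper[OF D0]])
  moreover have "{e} \<notin> \<Union>\<C>"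
  proof
   assume "{e} \<in> \<Union>\<C>"
   then obtain D where "D \<in> \<C>" "{e} \<in> D" by (rule UnionE)
   then show False using sub(2) by simp
  qed
  moreover have "sd X Y \<in> \<Union>\<C>" if X: "X \<in> \<Union>\<C>" and Y: "Y \<in> \<Union>\<C>" for X Y
  proof -
   obtain A where A: "A \<in> \<C>" "X \<in> A" using X by (rule UnionE)
   obtain B where B: "B \<in> \<C>" "Y \<in> B" using Y by (rule UnionE)
   from lin[OF A(1) B(1)] show ?thesis
   proof
    assume "A \<subseteq> B"
    then have "X \<in> B" using A(2) by (rule subsetD)
    then show ?thesis using sub(3)[OF B(1) _ B(2)] B(1) by (intro UnionI)
   next
    assume "B \<subseteq> A"
    then have "Y \<in> A" using B(2) by (rule subsetD)
    then show ?thesis using sub(3)[OF A(1,2)] A(1) by (intro UnionI)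
   qed
  qed
  ultimately show "\<Union>\<C> \<in> ?F" by simp
 qed
 then obtain M where "M \<in> ?F" and max0: "\<forall>X\<in>?F. M \<subseteq> X --> X = M" by (elim bexE)
 then have M: "M0 \<subseteq> M" "{e} \<notin> M" and Mcl: "!!X Y. X \<in> M ==> Y \<in> M ==> sd X Y \<in> M" by simp_all
 have max: "N = M" if "M \<subseteq> N" "{e} \<notin> N" "!!X Y. X \<in> N ==> Y \<in> N ==> sd X Y \<in> N" for N
 proof -
  have "N \<in> ?F" using that M(1) by simp
  then show ?thesis using max0 that(1) by simp
 qed
 have bd0: "C Int bd {} = {}" by (simp add: bd_def)
 have M_empty: "{} \<in> M" using subsetD[OF M(1) M0I(1)[OF cutset_empty]] by (simp only: bd0)
 have M_f: "{f} \<in> M" using subsetD[OF M(1) M0I(2)[OF cutset_empty]] by (simp only: bd0 q5)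
 \<comment> \<open>Otherwise \<open>M\<close> and \<open>{g}\<close> would span a larger subspace
   without \<open>{e}\<close>.\<close>
 have codim: "sd {e} {g} \<in> M" if g: "{g} \<notin> M" for g
 proof (rule ccontr)
  assume neg': "sd {e} {g} \<notin> M"
  define N where "N = {Z. Z \<in> M \<or> sd Z {g} \<in> M}"
  have "N = M"
  proof (rule max)
   show "M \<subseteq> N" by (auto simp: N_def)
   show "{e} \<notin> N" using neg' M(2) by (simp add: N_def)
   fix X Y assume "X \<in> N" "Y \<in> N"
   then have "X \<in> M \<or> sd X {g} \<in> M" "Y \<in> M \<or> sd Y {g} \<in> M" by (simp_all add: N_def)
   then have "sd X Y \<in> M \<or> sd (sd X Y) {g} \<in> M"
   proof (elim disjE)
    assume "X \<in> M" "Y \<in> M" then show ?thesis using Mcl by simp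
   next
    assume "X \<in> M" "sd Y {g} \<in> M" then have "sd X (sd Y {g}) \<in> M" by (rule Mcl)
    then show ?thesis unfolding q1 by (rule disjI2)
   next
    assume "sd X {g} \<in> M" "Y \<in> M" then have "sd (sd X {g}) Y \<in> M" by (rule Mcl)
    then show ?thesis unfolding q2[of X "{g}" Y] by (rule disjI2)
   next
    assume "sd X {g} \<in> M" "sd Y {g} \<in> M" then have "sd (sd X {g}) (sd Y {g}) \<in> M" by (rule Mcl)
    then show ?thesis unfolding q3 by (rule disjI1)
   qed
   then show "sd X Y \<in> N" by (simp add: N_def)
  qed
  moreover have "{g} \<in> N" using M_empty by (simp add: N_def q5)
  ultimately show False using g by simp
 qed
 define z where "z = {g\<in>C. {g} \<notin> M}"
 have ins: "insert g Y = sd Y {g}" if "g \<notin> Y" for g Y using that by (auto simp: sd_def)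
 \<comment> \<open>Modulo \<open>M\<close> each \<open>{g}\<close> with \<open>g\<close> in
   \<open>z\<close> equals \<open>{e}\<close>, so a finite part of \<open>z\<close> is congruent to
   zero or to \<open>{e}\<close> according to its parity.\<close>
 have zsum: "(even (card Y) --> Y \<in> M) & (odd (card Y) --> sd Y {e} \<in> M)" if "finite Y" "Y \<subseteq> z" for Y
  using that
 proof (induction Y rule: finite_induct)
  case empty then show ?case using M_empty by simp
 next
  case (insert g Y)
  have G: "sd {e} {g} \<in> M" using insert.prems codim by (simp add: z_def)
  have IH: "(even (card Y) --> Y \<in> M) & (odd (card Y) --> sd Y {e} \<in> M)" using insert by simp
  have ca: "card (insert g Y) = Suc (card Y)" using insert by simp
  show ?case
  proof (cases "even (card Y)")
   case True
   then have "sd Y (sd {e} {g}) \<in> M" using Mcl G IH by simp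
   moreover have "sd Y (sd {e} {g}) = sd (sd Y {g}) {e}" unfolding q6[of "{e}"] q1 ..
   ultimately show ?thesis using True ca ins[OF insert.hyps(2)] by simp
  next
   case False
   then have "sd (sd Y {e}) (sd {e} {g}) \<in> M" using Mcl G IH by simp
   moreover have "sd (sd Y {e}) (sd {e} {g}) = sd Y {g}" unfolding q6[of "{e}" "{g}"] q3 ..
   ultimately show ?thesis using False ca ins[OF insert.hyps(2)] by simp
  qed
 qed
 have nonz: "Y \<in> M" if "finite Y" "\<forall>g\<in>Y. {g} \<in> M" for Y
  using that
 proof (induction Y rule: finite_induct)
  case empty then show ?case using M_empty by simp
 next
  case (insert g Y)
  then have "sd Y {g} \<in> M" by (intro Mcl) simp_all
  then show ?case using ins[OF insert.hyps(2)] by simp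
 qed
 \<comment> \<open>An odd trace of \<open>z\<close> would be congruent to \<open>{e}\<close>. But
   the trace of the cut on \<open>C\<close> and its part outside \<open>z\<close> both lie in
   \<open>M\<close>, and so does their difference.\<close>
 have "even (card (z Int bd Q))" if Q: "cutset Q" for Q
 proof (rule ccontr)
  assume odd: "odd (card (z Int bd Q))"
  have fin: "finite (bd Q)" using Q by (simp add: cutset_def)
  have "C Int bd Q - z \<in> M" by (rule nonz) (use fin in \<open>auto simp: z_def\<close>)
  then have "sd (C Int bd Q) (C Int bd Q - z) \<in> M" by (rule Mcl[OF subsetD[OF M(1) M0I(1)[OF Q]]])
  moreover have "sd (C Int bd Q) (C Int bd Q - z) = z Int bd Q" by (auto simp: sd_def z_def)
  ultimately have 1: "z Int bd Q \<in> M" by simp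
  have "sd (z Int bd Q) {e} \<in> M" using zsum[of "z Int bd Q"] fin odd by simp
  then have "sd (sd (z Int bd Q) {e}) (z Int bd Q) \<in> M" using 1 by (rule Mcl)
  then have "{e} \<in> M" unfolding q2[of "z Int bd Q" "{e}" "z Int bd Q"] q5 .
  then show False using M(2) by simp
 qed
 moreover have "z \<subseteq> E" using ce by (auto simp: z_def cut_even_def)
 ultimately have "cut_even z" by (simp add: cut_even_def)
 moreover have "e \<in> z" using e M(2) by (simp add: z_def)
 moreover have "z \<subseteq> C" by (auto simp: z_def)
 ultimately have "z = C" using C unfolding cut_minimal_def by (metis empty_iff)
 then have "f \<in> z" using f by simp
 then show False using M_f by (simp add: z_def)
qed

text \<open>The edges of \<open>C\<close> inside \<open>Q\<close> meet \<open>bd Q'\<close> exactly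
  where \<open>C\<close> meets \<open>bd (Q Int Q')\<close>, hence evenly. By minimality they are
  none or all of \<open>C\<close>.\<close>

lemma no_cross_side:
 assumes C: "cut_minimal C" and Q: "cutset Q" "C Int bd Q = {}"
 shows "(\<forall>e\<in>C. e \<subseteq> Q) \<or> (\<forall>e\<in>C. e Int Q = {})"
proof -
 have ce: "cut_even C" using C by (simp add: cut_minimal_def)
 have CE: "C \<subseteq> E" using ce by (simp add: cut_even_def)
 have sep: "e \<subseteq> Q \<or> e Int Q = {}" if e: "e \<in> C" for e
 proof -
  have eE: "e \<in> E" using e CE by (rule subsetD[rotated])
  then obtain x y where xy: "e = {x, y}" by (rule edge_ex)
  have "e \<notin> bd Q" using Q(2) e by (simp add: disjoint_iff)
  then have "x \<in> Q \<longleftrightarrow> y \<in> Q" using bd_iff[of x y Q] eE xy by simp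
  then show ?thesis using xy by auto
 qed
 define B where "B = {e\<in>C. e \<subseteq> Q}"
 have "B Int bd Q' = C Int bd (Q Int Q')" for Q'
 proof (intro equalityI subsetI)
  fix e assume "e \<in> B Int bd Q'"
  then have e: "e \<in> C" "e \<subseteq> Q" "e \<in> bd Q'" by (auto simp: B_def)
  from e(3) obtain x y where xy: "e = {x, y}" "x \<in> Q'" "y \<in> V - Q'" "{x, y} \<in> E" by (rule bd_cases)
  then have "e \<in> bd (Q Int Q')" using bd_iff[OF xy(4), of "Q Int Q'"] e(2) by auto
  then show "e \<in> C Int bd (Q Int Q')" using e(1) by simp
 next
  fix e assume "e \<in> C Int bd (Q Int Q')"
  then have e: "e \<in> C" "e \<in> bd (Q Int Q')" by auto
  from e(2) obtain x y where xy: "e = {x, y}" "x \<in> Q Int Q'" "y \<in> V - Q Int Q'" "{x, y} \<in> E" by (rule bd_cases)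
  have "e \<subseteq> Q" using sep[OF e(1)] xy by auto
  moreover have "e \<in> bd Q'" using bd_iff[OF xy(4), of Q'] xy \<open>e \<subseteq> Q\<close> by auto
  ultimately show "e \<in> B Int bd Q'" using e(1) by (simp add: B_def)
 qed
 then have "cut_even B" using ce CE cutset_inter[OF Q(1)] unfolding cut_even_def by (auto simp: B_def)
 moreover have "B \<subseteq> C" by (auto simp: B_def)
 ultimately consider "B = {}" | "B = C" using C unfolding cut_minimal_def by metis
 then show ?thesis
 proof cases
  case 1 then have "\<forall>e\<in>C. e Int Q = {}" using sep by (auto simp: B_def)
  then show ?thesis ..
 next
  case 2 then have "\<forall>e\<in>C. e \<subseteq> Q" by (auto simp: B_def)
  then show ?thesis ..
 qed
qed

text \<open>Both tails lie in one end, so one side of a finite cut contains only finitely many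
  vertices of the double ray; evenness then follows from the degrees. Vertex stars are finite cuts,
  so an even subset has even degrees and is all or nothing.\<close>

lemma double_ray_cut_minimal:
 assumes d: "inj d" "double_ray_edges d \<subseteq> E" and eq: "((%n. d (int n)), (%n. d (- int n))) \<in> ray_equiv V E"
 shows "cut_minimal (double_ray_edges d)"
proof -
 have li: "locally_inj d" by (rule double_ray_seq(2)[OF d(1)])
 have CE: "seq_edges d \<subseteq> E" using d(2) by (simp add: double_ray_seq(1))
 have edge: "{d i, d (i + 1)} \<in> E" for i using CE by (auto simp: seq_edges_def)
 have dV: "d i \<in> V" for i using edgeD[OF edge[of i]] by blast
 have half: "even (card (seq_edges d Int bd Q))" if fin: "finite {i. d i \<in> Q}" for Q
 proof -
  let ?K = "d ` {i. d i \<in> Q}"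
  have mem: "d i \<in> ?K \<longleftrightarrow> d i \<in> Q" for i by auto
  have "{d i, d (i + 1)} \<in> bd Q \<longleftrightarrow> {d i, d (i + 1)} \<in> bd ?K" for i unfolding bd_iff[OF edge] mem ..
  then have "seq_edges d Int bd Q = seq_edges d Int bd ?K" unfolding seq_edges_def by auto
  moreover have "even (card (seq_edges d Int bd ?K))"
   by (rule even_cut_of_even_degrees[OF finite_imageI[OF fin] _ CE seq_edges_even(2)[OF li]]) (use dV in auto)
  ultimately show ?thesis by simp
 qed
 define R R' where "R = (%n. d (int n))" and "R' = (%n. d (- int n))"
 have RR: "(R, R') \<in> ray_equiv V E" using eq by (simp add: R_def R'_def)
 then have "ray E R" by (simp add: ray_equiv_def)
 then obtain om where w: "om \<in> ends V E" "R \<in> om" by (rule ray_end)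
 have w': "R' \<in> om" by (rule ends_closed[OF w RR])
 have fin: "finite {i. d i \<in> P}" if S: "finite S" "S \<subseteq> V" "end_comp V E S om Int P = {}" for S P
 proof -
  obtain n where n: "R ` {n..} \<subseteq> end_comp V E S om" using end_comp_tail[OF w(1) S(1,2) w(2)] by (elim exE)
  obtain n' where n': "R' ` {n'..} \<subseteq> end_comp V E S om" using end_comp_tail[OF w(1) S(1,2) w'] by (elim exE)
  have "{i. d i \<in> P} \<subseteq> {- int n'..int n}"
  proof
   fix i assume "i \<in> {i. d i \<in> P}"
   then have i: "d i \<in> P" by simp
   have "~ i > int n"
   proof
    assume "i > int n"
    then have "d i = R (nat i)" "nat i \<in> {n..}" by (auto simp: R_def)
    then have "d i \<in> end_comp V E S om" using n by (metis imageI subsetD)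
    then show False using i S(3) by blast
   qed
   moreover have "~ i < - int n'"
   proof
    assume "i < - int n'"
    then have "d i = R' (nat (- i))" "nat (- i) \<in> {n'..}" by (auto simp: R'_def)
    then have "d i \<in> end_comp V E S om" using n' by (metis imageI subsetD)
    then show False using i S(3) by blast
   qed
   ultimately show "i \<in> {- int n'..int n}" by simp
  qed
  then show ?thesis by (rule finite_subset) simp
 qed
 have "even (card (seq_edges d Int bd Q))" if Q: "cutset Q" for Q
 proof (rule end_dichotomy[OF w(1) Q])
  fix S assume S: "finite S" "S \<subseteq> V" "end_comp V E S om \<subseteq> Q"
  then have "end_comp V E S om Int (V - Q) = {}" by auto
  then have "even (card (seq_edges d Int bd (V - Q)))" by (rule half[OF fin[OF S(1,2)]])
  then show ?thesis by (simp add: bd_compl)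
 next
  fix S assume S: "finite S" "S \<subseteq> V" "end_comp V E S om Int Q = {}"
  then show ?thesis by (intro half fin)
 qed
 then have "cut_even (seq_edges d)" using CE by (simp add: cut_even_def)
 moreover have "seq_edges d ~= {}" by (auto simp: seq_edges_def)
 moreover have "B = seq_edges d" if B: "cut_even B" "B ~= {}" "B \<subseteq> seq_edges d" for B
 proof (rule seq_edges_minimal[OF li B(3,2)])
  fix i
  have "{e\<in>B. d i \<in> e} = B Int bd {d i}" using B(1) unfolding bd_star[OF dV] by (auto simp: cut_even_def)
  then show "even (card {e\<in>B. d i \<in> e})" using B(1) cutset_single[OF dV[of i]] by (simp add: cut_even_def)
 qed
 ultimately show ?thesis by (simp add: cut_minimal_def double_ray_seq(1))
qed

text \<open>Provides the enumeration of the edges for the weighted series \<open>s\<close> below.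
  The graph is a countable union of finite balls.\<close>

lemma countable_E: "countable E"
proof -
 obtain r where r: "r \<in> V" using graph_connected_ne[OF V_connected] by blast
 define SS where "SS = (%n. ((%S. S Un nbrs S) ^^ n) {r})"
 have SSS: "SS (Suc n) = SS n Un nbrs (SS n)" for n by (simp add: SS_def)
 have nV: "nbrs S \<subseteq> V" for S using edgeD by (auto simp: nbrs_def)
 have SS0: "SS 0 = {r}" by (simp add: SS_def)
 have SS: "finite (SS n) & SS n \<subseteq> V" for n
  by (induction n) (use r nV finite_nbrs_set in \<open>auto simp: SSS SS0\<close>)
 have "V \<subseteq> (\<Union>n. SS n)"
 proof (rule graph_connected_subset_side[OF V_connected _ r])
  show "r \<in> (\<Union>n. SS n)" using SS0 by blast
  fix a b assume "{a, b} \<in> E" "a \<in> (\<Union>n. SS n)"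
  then obtain n where "a \<in> SS n" by blast
  then have "b \<in> SS (Suc n)" using \<open>{a, b} \<in> E\<close> by (auto simp: SSS nbrs_def)
  then show "b \<in> (\<Union>n. SS n)" by blast
 qed
 moreover have "countable (\<Union>n. SS n)" by (rule countable_UN) (simp_all add: countable_finite SS)
 ultimately have "countable V" by (rule countable_subset)
 then have "countable {A. finite A & A \<subseteq> V}" by (rule countable_Collect_finite_subset)
 moreover have "E \<subseteq> {A. finite A & A \<subseteq> V}"
 proof
  fix e assume e: "e \<in> E"
  then obtain x y where xy: "e = {x, y}" by (rule edge_ex)
  then show "e \<in> {A. finite A & A \<subseteq> V}" using edgeD[of x y] e by simp
 qed
 ultimately show ?thesis by (rule countable_subset[rotated])
qed

lemma side_add:
 assumes p: "p \<in> topspace FG" and Q: "cutset Q" "cutset Q'" and dis: "Q Int Q' = {}"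
 shows "side (Q Un Q') p = side Q p + side Q' p"
 using p
proof (cases rule: FG_cases)
 case (vertex v) then show ?thesis using dis by (auto simp: side_vertex)
next
 case (edge x y t)
 have ne: "x ~= y" using edgeD[OF edge(1)] by blast
 show ?thesis using dis unfolding edge(4) side_on_edge[OF ne] by auto
next
 case (endpt om)
 have ex: "\<exists>S. finite S & S \<subseteq> V & (end_comp V E S om \<subseteq> P \<or> end_comp V E S om Int P = {})" if P: "cutset P" for P
  by (rule end_dichotomy[OF endpt(1) P]) (rule exI, intro conjI, assumption+, simp)+
 obtain S where S: "finite S" "S \<subseteq> V" "end_comp V E S om \<subseteq> Q \<or> end_comp V E S om Int Q = {}" using ex[OF Q(1)] by (elim exE conjE)
 obtain S' where S': "finite S'" "S' \<subseteq> V" "end_comp V E S' om \<subseteq> Q' \<or> end_comp V E S' om Int Q' = {}" using ex[OF Q(2)] by (elim exE conjE)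
 let ?D = "end_comp V E (S Un S') om"
 have SS: "finite (S Un S')" "S Un S' \<subseteq> V" using S S' by auto
 have D: "?D \<subseteq> end_comp V E S om" "?D \<subseteq> end_comp V E S' om" using end_comp_mono[OF endpt(1) SS(1) _ SS(2)] by simp_all
 have ne: "?D ~= {}" by (rule graph_connected_ne[OF component_connected[OF end_comp_component[OF endpt(1) SS]]])
 have 1: "?D \<subseteq> Q \<or> ?D Int Q = {}" using S(3) D(1) by auto
 have 2: "?D \<subseteq> Q' \<or> ?D Int Q' = {}" using S'(3) D(2) by auto
 note es = end_side[OF endpt(1) SS]
 consider "?D \<subseteq> Q" "?D Int Q' = {}" "?D \<subseteq> Q Un Q'" | "?D Int Q = {}" "?D \<subseteq> Q'" "?D \<subseteq> Q Un Q'" | "?D Int Q = {}" "?D Int Q' = {}" "?D Int (Q Un Q') = {}"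
  using 1 2 ne dis by auto
 then show ?thesis
 proof cases
  case 1 then show ?thesis using es(1)[of Q] es(2)[of Q'] es(1)[of "Q Un Q'"] endpt(2) by simp
 next
  case 2 then show ?thesis using es(2)[of Q] es(1)[of Q'] es(1)[of "Q Un Q'"] endpt(2) by simp
 next
  case 3 then show ?thesis using es(2)[of Q] es(2)[of Q'] es(2)[of "Q Un Q'"] endpt(2) by simp
 qed
qed

lemma side_compl: assumes p: "p \<in> topspace FG" and Q: "cutset Q" shows "side (V - Q) p = 1 - side Q p"
proof -
 have "side V p = 1" using p
 proof (cases rule: FG_cases)
  case (vertex v) then show ?thesis by (simp add: side_vertex)
 next
  case (edge x y t) then show ?thesis using edgeD[OF edge(1)] by (simp add: side_on_edge)
 next
  case (endpt om)
  have "end_comp V E {} om \<subseteq> V" using end_comp_subset[OF endpt(1), of "{}"] by simp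
  then show ?thesis using end_side(1)[OF endpt(1), of "{}"] endpt(2) by simp
 qed
 moreover have "Q Un (V - Q) = V" using Q by (auto simp: cutset_def)
 ultimately show ?thesis using side_add[OF p Q cutset_compl[OF Q]] by simp
qed

text \<open>\<open>c\<close> is the value on \<open>Q Int Q'\<close>, and the last bound comes from
  the union. Once one of the two values is \<open>0\<close> or \<open>1\<close>, these bounds
  determine \<open>c\<close>.\<close>

lemma side_sym_diff:
 assumes p: "p \<in> topspace FG" and Q: "cutset Q" "cutset Q'"
 obtains c where "side ((Q - Q') Un (Q' - Q)) p = side Q p + side Q' p - 2 * c" "0 \<le> c" "c \<le> side Q p" "c \<le> side Q' p" "side Q p + side Q' p - c \<le> 1"
proof -
 have c: "cutset (Q Int Q')" "cutset (Q - Q')" "cutset (Q' - Q)" using Q by (auto intro: cutset_inter cutset_diff)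
 have "(Q Int Q') Un (Q - Q') = Q" "(Q Int Q') Un (Q' - Q) = Q'" by auto
 then have a: "side Q p = side (Q Int Q') p + side (Q - Q') p" "side Q' p = side (Q Int Q') p + side (Q' - Q) p"
  using side_add[OF p c(1,2)] side_add[OF p c(1,3)] by auto
 have b: "side ((Q - Q') Un (Q' - Q)) p = side (Q - Q') p + side (Q' - Q) p" by (rule side_add[OF p c(2,3)]) auto
 have d: "side (Q Un (Q' - Q)) p = side Q p + side (Q' - Q) p" by (rule side_add[OF p Q(1) c(3)]) auto
 show ?thesis
  using a b d side_range[OF p, of "Q Int Q'"] side_range[OF p, of "Q - Q'"] side_range[OF p, of "Q' - Q"] side_range[OF p, of "Q Un (Q' - Q)"]
  by (intro that[of "side (Q Int Q') p"]) linarith+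
qed

lemma on_edge_eqD:
 assumes "x ~= y" "u ~= v" "on_edge x y t = on_edge u v s" "0 < s" "s < 1" shows "{x, y} = {u, v}"
proof -
 have "side {u} (on_edge u v s) = 1 - s" "side {v} (on_edge u v s) = s" using assms(2) by (simp_all add: side_on_edge)
 then have "side {u} (on_edge x y t) > 0" "side {v} (on_edge x y t) > 0" using assms by auto
 then have "u \<in> {x, y}" "v \<in> {x, y}" unfolding side_on_edge[OF assms(1)] by (auto split: if_splits)
 then show ?thesis using assms(1,2) by auto
qed

end

section \<open>From a minimal set to its circle\<close>

locale min_cut_even = lfgraph V E for V :: "'v set" and E :: "'v set set" +
 fixes C :: "'v set set"
 assumes minimal: "cut_minimal C"
begin

lemma CE: "e \<in> C ==> e \<in> E" using minimal by (auto simp: cut_minimal_def cut_even_def)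

lemma even_C: "cutset Q ==> even (card (C Int bd Q))" using minimal by (simp add: cut_minimal_def cut_even_def)

lemma no_single: assumes "cutset Q" "C Int bd Q \<subseteq> {e}" shows "C Int bd Q = {}"
proof (rule ccontr)
 assume "C Int bd Q ~= {}"
 then have "C Int bd Q = {e}" using assms(2) by blast
 then show False using even_C[OF assms(1)] by simp
qed

text \<open>The closure of the union of \<open>C\<close>: its ends are those that no finite cut separates from \<open>C\<close>.\<close>

definition circle :: "'v fpoint set" where
 "circle = {p \<in> topspace FG. \<forall>Q. cutset Q & Q Int \<Union>C = {} --> side Q p = 0}
  - \<Union>{open_edge_interval x y 0 1 | x y. {x, y} \<in> E - C}"

lemma circle_topspace: "p \<in> circle ==> p \<in> topspace FG" by (simp add: circle_def)

lemma circle_closed: "closedin FG circle"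
 unfolding circle_def
proof (rule closedin_diff)
 have "{p \<in> topspace FG. \<forall>Q. cutset Q & Q Int \<Union>C = {} --> side Q p = 0}
  = (\<Inter>Q\<in>{Q. cutset Q & Q Int \<Union>C = {}}. {p \<in> topspace FG. side Q p \<in> {0}})"
  using cutset_empty by (intro equalityI subsetI) (simp_all, metis inf_bot_left)
 moreover have "closedin FG (\<Inter>Q\<in>{Q. cutset Q & Q Int \<Union>C = {}}. {p \<in> topspace FG. side Q p \<in> {0}})"
 proof (rule closedin_INT)
  have "{} \<in> {Q. cutset Q & Q Int \<Union>C = {}}" using cutset_empty by simp
  then show "{Q. cutset Q & Q Int \<Union>C = {}} ~= {}" by (rule ex_in_conv[THEN iffD1, OF exI])
  fix Q assume "Q \<in> {Q. cutset Q & Q Int \<Union>C = {}}"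
  then show "closedin FG {p \<in> topspace FG. side Q p \<in> {0}}"
   by (intro closedin_continuous_map_preimage[OF side_continuous]) simp_all
 qed
 ultimately show "closedin FG {p \<in> topspace FG. \<forall>Q. cutset Q & Q Int \<Union>C = {} --> side Q p = 0}" by simp
 show "openin FG (\<Union>{open_edge_interval x y 0 1 | x y. {x, y} \<in> E - C})"
  by (rule openin_Union) (elim CollectE exE conjE, simp add: open_interval)
qed

lemma circle_cases:
 assumes p: "p \<in> circle"
 obtains (vertex) v where "v \<in> \<Union>C" "v \<in> V" "p = vertex_pt v" | (edge) x y t where "{x, y} \<in> C" "0 < t" "t < 1" "p = on_edge x y t"
 | (endpt) om where "om \<in> ends V E" "p = End_Pt om"
 using circle_topspace[OF p]
proof (cases rule: FG_cases)
 case (vertex v)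
 have "v \<in> \<Union>C"
 proof (rule ccontr)
  assume "v \<notin> \<Union>C"
  then have "{v} Int \<Union>C = {}" by simp
  then have "side {v} p = 0" using p cutset_single[OF vertex(1)] unfolding circle_def by (simp only: Diff_iff mem_Collect_eq)
  then show False using vertex(2) by (simp add: side_vertex)
 qed
 then show ?thesis using that(1) vertex by blast
next
 case (edge x y t)
 have "{x, y} \<in> C"
 proof (rule ccontr)
  assume "{x, y} \<notin> C"
  then have "{x, y} \<in> E - C" using edge(1) by simp
  then have I: "open_edge_interval x y 0 1 \<in> {open_edge_interval x y 0 1 | x y. {x, y} \<in> E - C}"
   by (intro CollectI exI[of _ x] exI[of _ y]) simp
  have "p \<in> open_edge_interval x y 0 1" unfolding open_edge_interval_def using edge by (intro CollectI exI[of _ t]) simp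
  then have "p \<in> \<Union>{open_edge_interval x y 0 1 | x y. {x, y} \<in> E - C}" by (rule UnionI[OF I])
  then show False using p unfolding circle_def by (simp only: Diff_iff simp_thms)
 qed
 then show ?thesis using that(2) edge by blast
next
 case (endpt om) then show ?thesis using that(3) by blast
qed

lemma circle_edge: assumes e: "e \<in> C" and p: "p \<in> closed_edge e" shows "p \<in> circle"
proof -
 obtain x y where xy: "e = {x, y}" using CE[OF e] by (rule edge_ex)
 have xyE: "{x, y} \<in> E" using CE[OF e] xy by simp
 have ne: "x ~= y" using edgeD[OF xyE] by blast
 obtain t where t: "0 \<le> t" "t \<le> 1" "p = on_edge x y t" using p unfolding xy closed_edge_image[OF ne] by auto
 have "side Q p = 0" if Q: "Q Int \<Union>C = {}" for Q
 proof -
  have "x \<notin> Q" "y \<notin> Q" using Q e xy by auto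
  then show ?thesis by (simp add: t(3) side_on_edge[OF ne])
 qed
 moreover have "p \<notin> \<Union>{open_edge_interval x y 0 1 | x y. {x, y} \<in> E - C}"
 proof
  assume "p \<in> \<Union>{open_edge_interval x y 0 1 | x y. {x, y} \<in> E - C}"
  then obtain u v where uv: "{u, v} \<in> E - C" "p \<in> open_edge_interval u v 0 1" by (elim UnionE CollectE exE conjE) simp
  then obtain s where s: "p = on_edge u v s" "0 < s" "s < 1" by (auto simp: open_edge_interval_def)
  have "{x, y} = {u, v}" by (rule on_edge_eqD[OF ne, of u v t s]) (use s t edgeD[of u v] uv in auto)
  then show False using uv(1) e xy by simp
 qed
 moreover have "p \<in> topspace FG" using closed_edge_props(3)[OF CE[OF e]] p by blast
 ultimately show ?thesis by (simp add: circle_def)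
qed

lemma circle_edges: "{e\<in>E. closed_edge e \<subseteq> circle} = C"
proof (intro equalityI subsetI)
 fix e assume "e \<in> {e\<in>E. closed_edge e \<subseteq> circle}"
 then have e: "e \<in> E" "closed_edge e \<subseteq> circle" by auto
 obtain x y where xy: "e = {x, y}" using e(1) by (rule edge_ex)
 have ne: "x ~= y" using edgeD[of x y] e(1) xy by blast
 have "on_edge x y (1/2) \<in> closed_edge e" unfolding xy closed_edge_image[OF ne] by simp
 then have "on_edge x y (1/2) \<in> circle" using e(2) by (rule subsetD[rotated])
 then show "e \<in> C"
 proof (cases rule: circle_cases)
  case (vertex v) then show ?thesis using vertex_not_inner[OF ne, of "1/2" v] by simp
 next
  case (edge u v t)
  have "{x, y} = {u, v}" by (rule on_edge_eqD[OF ne, of u v "1/2" t]) (use edge edgeD[OF CE[OF edge(1)]] in auto)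
  then show ?thesis using edge(1) xy by simp
 next
  case (endpt om) then show ?thesis by (simp add: on_edge_def)
 qed
next
 fix e assume "e \<in> C"
 then show "e \<in> {e\<in>E. closed_edge e \<subseteq> circle}" using circle_edge CE by blast
qed

lemma circle_vertex: assumes "{x, y} \<in> C" shows "vertex_pt x \<in> circle" "vertex_pt y \<in> circle"
proof -
 have ne: "x ~= y" using edgeD[OF CE[OF assms]] by blast
 show "vertex_pt x \<in> circle" "vertex_pt y \<in> circle" unfolding on_edge_0[OF ne, symmetric] on_edge_1[OF ne, symmetric]
  by (rule circle_edge[OF assms], unfold closed_edge_image[OF ne], simp)+
qed

text \<open>A finite cut that misses \<open>C\<close> has all of \<open>C\<close> on one side. Then
  \<open>Q\<close> or its complement misses every vertex of \<open>C\<close>, and the definition of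
  \<open>circle\<close> extends this to the closure.\<close>

lemma side_const:
 assumes Q: "cutset Q" "C Int bd Q = {}"
 shows "(\<forall>p\<in>circle. side Q p = 0) \<or> (\<forall>p\<in>circle. side Q p = 1)"
proof -
 have 0: "\<forall>p\<in>circle. side P p = 0" if P: "cutset P" "P Int \<Union>C = {}" for P
 proof
  fix p assume "p \<in> circle"
  then show "side P p = 0" using P unfolding circle_def by (simp only: Diff_iff mem_Collect_eq)
 qed
 from no_cross_side[OF minimal Q] show ?thesis
 proof
  assume "\<forall>e\<in>C. e \<subseteq> Q"
  then have "(V - Q) Int \<Union>C = {}" by auto
  then have z: "\<forall>p\<in>circle. side (V - Q) p = 0" by (rule 0[OF cutset_compl[OF Q(1)]])
  have "side Q p = 1" if p: "p \<in> circle" for p using bspec[OF z p] side_compl[OF circle_topspace[OF p] Q(1)] by simp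
  then show ?thesis by simp
 next
  assume "\<forall>e\<in>C. e Int Q = {}"
  then have "Q Int \<Union>C = {}" by auto
  then show ?thesis using 0[OF Q(1)] by simp
 qed
qed

lemma side_inner:
 assumes p: "p \<in> circle" and Q: "cutset Q" and s: "side Q p ~= 0" "side Q p ~= 1"
 obtains u v t where "{u, v} \<in> C" "{u, v} \<in> bd Q" "u \<notin> Q" "v \<in> Q" "0 < t" "t < 1" "p = on_edge u v t" "side Q p = t"
 using p
proof (cases rule: circle_cases)
 case (vertex v) then show ?thesis using s by (simp add: side_vertex split: if_splits)
next
 case (edge x y t)
 have xyE: "{x, y} \<in> E" by (rule CE[OF edge(1)])
 have ne: "x ~= y" using edgeD[OF xyE] by blast
 have sd: "side Q p = (if x \<in> Q then 1 - t else 0) + (if y \<in> Q then t else 0)" unfolding edge(4) by (rule side_on_edge[OF ne])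
 consider "x \<in> Q" "y \<notin> Q" | "x \<notin> Q" "y \<in> Q" using s sd by fastforce
 then show ?thesis
 proof cases
  case 1
  have "{x, y} \<in> bd Q" using bd_iff[OF xyE] 1 by simp
  moreover have "p = on_edge y x (1 - t)" unfolding edge(4) by (rule on_edge_swap[OF ne])
  ultimately show ?thesis using that[of y x "1 - t"] 1 edge sd by (simp add: insert_commute)
 next
  case 2
  have "{x, y} \<in> bd Q" using bd_iff[OF xyE] 2 by simp
  then show ?thesis using that[of x y t] 2 edge sd by simp
 qed
next
 case (endpt om)
 have "side Q p = 0 \<or> side Q p = 1" unfolding endpt(2) by (rule end_dichotomy[OF endpt(1) Q]) simp_all
 then show ?thesis using s by simp
qed

end

text \<open>The edges of \<open>C\<close> other than \<open>{x, y}\<close> are enumerated by \<open>c\<close>, and \<open>Y f\<close> is the side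
  containing \<open>y\<close> of a finite cut that meets \<open>C\<close> precisely in \<open>{x, y}\<close> and \<open>f\<close>.\<close>

locale cut_param = min_cut_even V E C for V :: "'v set" and E :: "'v set set" and C :: "'v set set" +
 fixes x y :: 'v and c :: "nat => 'v set" and Y :: "'v set => 'v set"
 assumes e0: "{x, y} \<in> C" and c: "range c = C - {{x, y}}"
  and Y: "!!f. f \<in> C ==> f ~= {x, y} ==> cutset (Y f) & C Int bd (Y f) = {{x, y}, f} & x \<notin> Y f & y \<in> Y f"
begin

lemma xy: "{x, y} \<in> E" "x ~= y" "x \<in> V" "y \<in> V"
 using CE[OF e0] edgeD[OF CE[OF e0]] by auto

definition H :: "nat => 'v set" where "H n = Y (c n)"

lemma cC: "c n \<in> C" "c n ~= {x, y}" using c by (metis Diff_iff rangeI, metis Diff_iff insertI1 rangeI)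

lemma H: "cutset (H n)" "C Int bd (H n) = {{x, y}, c n}" "x \<notin> H n" "y \<in> H n"
 using Y[OF cC[of n]] by (simp_all add: H_def)

lemma cross_H: assumes "{a, b} \<in> C" shows "(a \<in> H n \<longleftrightarrow> b \<notin> H n) \<longleftrightarrow> {a, b} = {x, y} \<or> {a, b} = c n"
proof -
 have "{a, b} \<in> bd (H n) \<longleftrightarrow> {a, b} \<in> C Int bd (H n)" using assms by simp
 then show ?thesis unfolding H(2) bd_iff[OF CE[OF assms]] by simp
qed

text \<open>Detects the inside of the edge \<open>{x, y}\<close>: the product is
  \<open>t * (1 - t)\<close> there and zero at every other point. \<open>J p = 0\<close> thus
  describes the rest of the circle by a continuous function.\<close>

definition J :: "'v fpoint => real" where "J p = side {x} p * side {y} p"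

lemma J_edge: "J (on_edge x y t) = t * (1 - t)" using xy(2) by (simp add: J_def side_on_edge)

lemma J_inner:
 assumes p: "p \<in> topspace FG" and J: "J p ~= 0"
 obtains t where "0 < t" "t < 1" "p = on_edge x y t"
proof -
 have pos: "side {x} p > 0" "side {y} p > 0" using J side_range(1)[OF p, of "{x}"] side_range(1)[OF p, of "{y}"] by (auto simp: J_def)
 from p pos(1) show ?thesis
 proof (cases rule: side_single_pos)
  case vertex then show ?thesis using pos(2) xy(2) by (simp add: side_vertex)
 next
  case (edge y' t)
  have ne: "x ~= y'" using edgeD[OF edge(1)] by blast
  have "y' = y" using pos(2) xy(2) unfolding edge(4) side_on_edge[OF ne] by (auto split: if_splits)
  then show ?thesis using that edge by simp
 qed
qed

lemma H_inner:
 assumes p: "p \<in> circle" "J p = 0" and s: "side (H n) p ~= 0" "side (H n) p ~= 1"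
 obtains u v t where "{u, v} = c n" "u \<notin> H n" "v \<in> H n" "0 < t" "t < 1" "p = on_edge u v t" "side (H n) p = t"
proof -
 obtain u v t where uv: "{u, v} \<in> C" "{u, v} \<in> bd (H n)" "u \<notin> H n" "v \<in> H n" "0 < t" "t < 1" "p = on_edge u v t" "side (H n) p = t"
  by (rule side_inner[OF p(1) H(1) s])
 have "{u, v} \<in> {{x, y}, c n}" using IntI[OF uv(1,2)] unfolding H(2) .
 moreover have "{u, v} ~= {x, y}"
 proof
  assume "{u, v} = {x, y}"
  then have "u = x" "v = y" using uv(3,4) H(3,4)[of n] by (auto simp: doubleton_eq_iff)
  then show False using p(2) uv(5,6,7) J_edge[of t] by simp
 qed
 ultimately show ?thesis using that uv by simp
qed

text \<open>\<open>H m - H n\<close> crosses \<open>C\<close> at most in \<open>c m\<close>, hence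
  nowhere, so \<open>side (H m)\<close> is at most \<open>side (H n)\<close> on the circle. A
  fractional value of \<open>side (H n)\<close> puts \<open>p\<close> inside the edge
  \<open>c n\<close>, whose ends lie outside \<open>H m\<close>, and there \<open>side (H m)\<close>
  vanishes.\<close>

lemma nested_aux:
 assumes ne: "c m ~= c n" and cr: "c n \<in> bd (H n - H m)" and p: "p \<in> circle" "J p = 0" "side (H m) p > 0"
 shows "side (H n) p = 1"
proof (rule ccontr)
 assume n1: "side (H n) p ~= 1"
 let ?Q = "H m - H n"
 have Q: "cutset ?Q" by (rule cutset_diff[OF H(1) H(1)])
 have out: "u \<notin> H m & v \<notin> H m" if uv: "{u, v} = c n" for u v
 proof -
  have cn: "{u, v} \<in> C" using cC[of n] uv by simp
  have "u \<in> H n - H m \<longleftrightarrow> v \<notin> H n - H m" using cr bd_iff[OF CE[OF cn]] uv by simp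
  moreover have "~ (u \<in> H m \<longleftrightarrow> v \<notin> H m)" using cross_H[OF cn, of m] uv ne cC(2)[of n] by simp
  ultimately show ?thesis by blast
 qed
 have "C Int bd ?Q \<subseteq> {c m}"
 proof
  fix e assume e: "e \<in> C Int bd ?Q"
  obtain a b where ab: "e = {a, b}" using CE e by (metis IntD1 edge_ex)
  have abC: "{a, b} \<in> C" using e ab by simp
  have cr': "a \<in> ?Q \<longleftrightarrow> b \<notin> ?Q" using e bd_iff[OF CE[OF abC]] ab by simp
  have "{a, b} ~= {x, y}"
  proof
   assume "{a, b} = {x, y}"
   then have "a \<notin> ?Q" "b \<notin> ?Q" using H(3)[of m] H(4)[of n] by (auto simp: doubleton_eq_iff)
   then show False using cr' by simp
  qed
  moreover have "{a, b} ~= c n" using out[of a b] cr' by auto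
  moreover have "(a \<in> H m \<longleftrightarrow> b \<notin> H m) \<or> (a \<in> H n \<longleftrightarrow> b \<notin> H n)" using cr' by blast
  ultimately show "e \<in> {c m}" using cross_H[OF abC, of m] cross_H[OF abC, of n] ab by simp
 qed
 then have "C Int bd ?Q = {}" by (rule no_single[OF Q])
 then have "(\<forall>p\<in>circle. side ?Q p = 0) \<or> (\<forall>p\<in>circle. side ?Q p = 1)" by (rule side_const[OF Q])
 moreover have "side ?Q (vertex_pt x) = 0" using H(3) by (simp add: side_vertex)
 ultimately have "side ?Q p = 0" using circle_vertex(1)[OF e0] p(1) by fastforce
 moreover have "(H m Int H n) Un ?Q = H m" by auto
 ultimately have "side (H m) p = side (H m Int H n) p"
  using side_add[OF circle_topspace[OF p(1)] cutset_inter[OF H(1) H(1)] Q, of m n] by auto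
 also have "\<dots> \<le> side (H n) p" by (rule side_mono[OF circle_topspace[OF p(1)]]) auto
 finally have "side (H n) p ~= 0" using p(3) by simp
 from H_inner[OF p(1,2) this n1] obtain u v t where uv: "{u, v} = c n" "p = on_edge u v t" by metis
 have "{u, v} \<in> E" using CE[OF cC(1)[of n]] uv(1) by simp
 then have "u ~= v" using edgeD by blast
 then have "side (H m) p = 0" using out[OF uv(1)] uv(2) by (simp add: side_on_edge)
 then show False using p(3) by simp
qed

text \<open>Along the rest of the circle the cuts switch sides one after another, so their side
  functions agree on the order of points. If \<open>c n\<close> lies outside \<open>H m\<close>,
  then \<open>side (H n)\<close> is already \<open>1\<close> where \<open>side (H m)\<close> is
  positive; if it lies inside, the roles are exchanged.\<close>

lemma nested:
 assumes p: "p \<in> circle" "J p = 0" and q: "q \<in> circle" "J q = 0" and lt: "side (H n) p < side (H n) q"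
 shows "side (H m) p \<le> side (H m) q"
proof (cases "c m = c n")
 case True then show ?thesis using lt by (simp add: H_def)
next
 case ne: False
 have r: "0 \<le> side Q p" "side Q p \<le> 1" "0 \<le> side Q q" "side Q q \<le> 1" for Q
  using side_range circle_topspace p(1) q(1) by auto
 obtain u v where uv: "c n = {u, v}" using CE[OF cC(1)[of n]] by (rule edge_ex)
 have uvC: "{u, v} \<in> C" using cC(1)[of n] uv by simp
 have 1: "u \<in> H n \<longleftrightarrow> v \<notin> H n" using cross_H[OF uvC, of n] uv by simp
 have 2: "u \<in> H m \<longleftrightarrow> v \<in> H m" using cross_H[OF uvC, of m] uv ne cC(2)[of n] by auto
 show ?thesis
 proof (cases "u \<in> H m")
  case False
  then have "c n \<in> bd (H n - H m)" unfolding uv bd_iff[OF CE[OF uvC]] using 1 2 by blast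
  from nested_aux[OF ne this p] show ?thesis using lt r(1)[of "H m"] r(3)[of "H m"] r(4)[of "H n"] by (cases "side (H m) p = 0") auto
 next
  case True
  let ?Q = "H m - H n"
  have Q: "cutset ?Q" by (rule cutset_diff[OF H(1) H(1)])
  have fQ: "c n \<in> bd ?Q" unfolding uv bd_iff[OF CE[OF uvC]] using 1 2 True by blast
  have "c m \<in> bd ?Q"
  proof (rule ccontr)
   assume no: "c m \<notin> bd ?Q"
   have "C Int bd ?Q \<subseteq> {c n}"
   proof
    fix e assume e: "e \<in> C Int bd ?Q"
    obtain a b where ab: "e = {a, b}" using CE e by (metis IntD1 edge_ex)
    have abC: "{a, b} \<in> C" using e ab by simp
    have cr': "a \<in> ?Q \<longleftrightarrow> b \<notin> ?Q" using e bd_iff[OF CE[OF abC]] ab by simp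
    have "{a, b} ~= {x, y}"
    proof
     assume "{a, b} = {x, y}"
     then have "a \<notin> ?Q" "b \<notin> ?Q" using H(3)[of m] H(4)[of n] by (auto simp: doubleton_eq_iff)
     then show False using cr' by simp
    qed
    moreover have "{a, b} ~= c m" using no e ab by auto
    moreover have "(a \<in> H m \<longleftrightarrow> b \<notin> H m) \<or> (a \<in> H n \<longleftrightarrow> b \<notin> H n)" using cr' by blast
    ultimately show "e \<in> {c n}" using cross_H[OF abC, of m] cross_H[OF abC, of n] ab by simp
   qed
   then have "C Int bd ?Q = {}" by (rule no_single[OF Q])
   then show False using fQ cC(1)[of n] by blast
  qed
  from nested_aux[OF ne[symmetric] this q] have "side (H m) q = 1" using lt r(1)[of "H n"] by simp
  then show ?thesis using r(2) by simp
 qed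
qed

text \<open>A fractional value places both points on the same edge at the same parameter. Otherwise
  every finite cut is reduced, by adding the cuts \<open>H n\<close> of its edges in
  \<open>C\<close>, to one that meets \<open>C\<close> in no edge but \<open>{x, y}\<close>; by
  parity it misses \<open>C\<close>, and its side function is constant on the circle.\<close>

lemma separated:
 assumes p: "p \<in> circle" "J p = 0" and q: "q \<in> circle" "J q = 0" and eq: "!!n. side (H n) p = side (H n) q"
 shows "p = q"
proof (cases "\<exists>n. side (H n) p ~= 0 & side (H n) p ~= 1")
 case True
 then obtain n where n: "side (H n) p ~= 0" "side (H n) p ~= 1" by (elim exE conjE)
 then have n': "side (H n) q ~= 0" "side (H n) q ~= 1" using eq by simp_all
 obtain u v t where uv: "{u, v} = c n" "u \<notin> H n" "v \<in> H n" "p = on_edge u v t" "side (H n) p = t" by (rule H_inner[OF p n])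
 obtain u' v' t' where uv': "{u', v'} = c n" "u' \<notin> H n" "v' \<in> H n" "q = on_edge u' v' t'" "side (H n) q = t'" by (rule H_inner[OF q n'])
 have "{u, v} = {u', v'}" using uv(1) uv'(1) by simp
 then have "u = u'" "v = v'" using uv(2,3) uv'(2,3) by (auto simp: doubleton_eq_iff)
 moreover have "t = t'" using uv(5) uv'(5) eq by simp
 ultimately show ?thesis using uv(4) uv'(4) by simp
next
 case False
 then have 01: "side (H n) p = 0 \<or> side (H n) p = 1" for n by blast
 have "side Q p = side Q q" if "cutset Q" for Q
  using that
 proof (induction "card (C Int bd Q - {{x, y}})" arbitrary: Q rule: less_induct)
  case less
  have fin: "finite (C Int bd Q - {{x, y}})" using less.prems by (simp add: cutset_def)
  show ?case
  proof (cases "C Int bd Q - {{x, y}} = {}")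
   case True
   then have "C Int bd Q \<subseteq> {{x, y}}" by blast
   then have "C Int bd Q = {}" by (rule no_single[OF less.prems])
   then have "(\<forall>p\<in>circle. side Q p = 0) \<or> (\<forall>p\<in>circle. side Q p = 1)" by (rule side_const[OF less.prems])
   then show ?thesis using p(1) q(1) by auto
  next
   case False
   then obtain f where f: "f \<in> C Int bd Q - {{x, y}}" by (meson ex_in_conv)
   then have "f \<in> range c" using c by simp
   then obtain n where n: "f = c n" by (rule rangeE)
   let ?Q = "(Q - H n) Un (H n - Q)"
   have cQ: "cutset ?Q" by (rule cutset_sym_diff[OF less.prems H(1)])
   have "C Int bd ?Q - {{x, y}} = (C Int bd Q - {{x, y}}) - {f}"
   proof -
    have "C Int bd ?Q = (C Int bd Q - C Int bd (H n)) Un (C Int bd (H n) - C Int bd Q)" unfolding bd_sym_diff by auto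
    also have "\<dots> = (C Int bd Q - {{x, y}, f}) Un ({{x, y}, f} - C Int bd Q)" unfolding H(2) n ..
    finally show ?thesis using f by auto
   qed
   then have "card (C Int bd ?Q - {{x, y}}) < card (C Int bd Q - {{x, y}})" using card_Diff1_less[OF fin f] by simp
   then have IH: "side ?Q p = side ?Q q" using cQ by (rule less.hyps)
   obtain a where a: "side ?Q p = side Q p + side (H n) p - 2 * a" "0 \<le> a" "a \<le> side Q p" "a \<le> side (H n) p" "side Q p + side (H n) p - a \<le> 1"
    by (rule side_sym_diff[OF circle_topspace[OF p(1)] less.prems H(1)])
   obtain b where b: "side ?Q q = side Q q + side (H n) q - 2 * b" "0 \<le> b" "b \<le> side Q q" "b \<le> side (H n) q" "side Q q + side (H n) q - b \<le> 1"
    by (rule side_sym_diff[OF circle_topspace[OF q(1)] less.prems H(1)])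
   \<comment> \<open>Once \<open>side (H n)\<close> is \<open>0\<close> or \<open>1\<close>, the
     bounds on \<open>a\<close> and \<open>b\<close> recover the values of \<open>side Q\<close>
     from those on the symmetric difference.\<close>
   from 01[of n] show ?thesis
   proof
    assume "side (H n) p = 0" then show ?thesis using a b IH eq[of n] by linarith
   next
    assume "side (H n) p = 1" then show ?thesis using a b IH eq[of n] by linarith
   qed
  qed
 qed
 then show ?thesis using side_separates[OF circle_topspace[OF p(1)] circle_topspace[OF q(1)]] by metis
qed

text \<open>The weights add up to \<open>1\<close>, so \<open>s\<close> runs from \<open>0\<close>
  at \<open>x\<close> to \<open>1\<close> at \<open>y\<close>, and on the edge \<open>{x, y}\<close>
  it is the edge parameter. An edge may be enumerated repeatedly, for instance when \<open>C\<close>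
  is finite.\<close>

definition s :: "'v fpoint => real" where "s p = (\<Sum>n. (1/2) ^ Suc n * side (H n) p)"

lemma s_summable: assumes "p \<in> topspace FG" shows "summable (%n. (1/2) ^ Suc n * side (H n) p)"
proof (rule summable_comparison_test'[of "%n. (1/2) ^ Suc n" 0])
 show "summable (%n. (1/2 :: real) ^ Suc n)" using power_half_series by (rule sums_summable)
 fix n show "norm ((1/2) ^ Suc n * side (H n) p) \<le> (1/2) ^ Suc n" using side_range[OF assms, of "H n"] by (simp add: abs_mult)
qed

lemma s_edge: "s (on_edge x y t) = t"
proof -
 have "side (H n) (on_edge x y t) = t" for n using H(3,4)[of n] by (simp add: side_on_edge[OF xy(2)])
 then have "(%n. (1/2) ^ Suc n * side (H n) (on_edge x y t)) sums (1 * t)" using sums_mult2[OF power_half_series, of t] by simp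
 then show ?thesis unfolding s_def by (simp add: sums_iff)
qed

lemma s_tail: assumes p: "p \<in> topspace FG" shows "(\<Sum>n<N. (1/2) ^ Suc n * side (H n) p) \<le> s p" "s p \<le> (\<Sum>n<N. (1/2) ^ Suc n * side (H n) p) + (1/2) ^ N"
proof -
 let ?f = "%n. (1/2) ^ Suc n * side (H n) p"
 have nn: "0 \<le> ?f n" "?f n \<le> (1/2) ^ Suc n" for n using side_range[OF p, of "H n"] by (simp_all add: mult_left_le)
 have sm: "summable ?f" by (rule s_summable[OF p])
 show "(\<Sum>n<N. ?f n) \<le> s p" unfolding s_def by (rule sum_le_suminf[OF sm]) (use nn in auto)
 have "(%n. (1/2) ^ N * (1/2 :: real) ^ Suc n) sums ((1/2) ^ N * 1)" by (rule sums_mult[OF power_half_series])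
 then have g: "(%n. (1/2 :: real) ^ Suc (n + N)) sums ((1/2) ^ N)" by (simp add: power_add ac_simps)
 have "(\<Sum>n. ?f (n + N)) \<le> (\<Sum>n. (1/2) ^ Suc (n + N))"
  by (rule suminf_le[OF nn(2) summable_ignore_initial_segment[OF sm] sums_summable[OF g]])
 then have "(\<Sum>n. ?f (n + N)) \<le> (1/2) ^ N" using sums_unique[OF g] by simp
 then show "s p \<le> (\<Sum>n<N. ?f n) + (1/2) ^ N" using suminf_minus_initial_segment[OF sm, of N] by (simp add: s_def)
qed

lemma s_range: assumes "p \<in> topspace FG" shows "0 \<le> s p" "s p \<le> 1" using s_tail[OF assms, of 0] by simp_all

text \<open>A uniform limit of continuous partial sums, with error at most \<open>(1/2) ^ N\<close>
  by \<open>s_tail\<close>.\<close>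

lemma s_continuous: "continuous_map FG euclideanreal s"
proof (rule continuous_map_realI)
 fix p and \<epsilon> :: real assume p: "p \<in> topspace FG" and e: "\<epsilon> > 0"
 obtain N where N: "(1/2 :: real) ^ N < \<epsilon> / 2" using real_arch_pow_inv[of "\<epsilon> / 2" "1/2"] e by auto
 define g where "g = (%q. \<Sum>n<N. (1/2) ^ Suc n * side (H n) q)"
 have "continuous_map FG euclideanreal g" unfolding g_def
  by (intro continuous_map_sum continuous_map_real_mult_left side_continuous H(1)) simp
 then have op: "openin FG {q \<in> topspace FG. g q \<in> ball (g p) (\<epsilon> / 2)}" by (rule openin_continuous_map_preimage) simp
 have "\<bar>s q - s p\<bar> < \<epsilon>" if "q \<in> {q \<in> topspace FG. g q \<in> ball (g p) (\<epsilon> / 2)}" for q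
 proof -
  have q: "q \<in> topspace FG" "\<bar>g p - g q\<bar> < \<epsilon> / 2" using that by (auto simp: dist_real_def)
  have "g q \<le> s q" "s q \<le> g q + (1/2) ^ N" "g p \<le> s p" "s p \<le> g p + (1/2) ^ N"
   unfolding g_def by (rule s_tail[OF q(1)] s_tail[OF p])+
  then show ?thesis using q(2) N by linarith
 qed
 moreover have "p \<in> {q \<in> topspace FG. g q \<in> ball (g p) (\<epsilon> / 2)}" using p e by simp
 ultimately show "\<exists>U. openin FG U & p \<in> U & (\<forall>q\<in>U. \<bar>s q - s p\<bar> < \<epsilon>)" using op by (intro exI[of _ "{q \<in> topspace FG. g q \<in> ball (g p) (\<epsilon> / 2)}"]) simp
qed

lemma J_continuous: "continuous_map FG euclideanreal J"
 unfolding J_def by (intro continuous_map_real_mult side_continuous cutset_single xy)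

text \<open>By \<open>nested\<close>, a strict difference in one summand is not compensated by any
  other.\<close>

lemma s_less:
 assumes p: "p \<in> circle" "J p = 0" and q: "q \<in> circle" "J q = 0" and lt: "side (H n) p < side (H n) q"
 shows "s p < s q"
proof -
 let ?f = "%p n. (1/2) ^ Suc n * side (H n) p"
 have "0 < (\<Sum>n. ?f q n - ?f p n)"
 proof (rule suminf_pos2[of _ n])
  show "summable (%n. ?f q n - ?f p n)" using p(1) q(1) by (intro summable_diff s_summable circle_topspace)
  show "0 \<le> ?f q m - ?f p m" for m using nested[OF p q lt, of m] by simp
  show "0 < ?f q n - ?f p n" using lt by simp
 qed
 also have "\<dots> = s q - s p" unfolding s_def using p(1) q(1) by (intro suminf_diff[symmetric] s_summable circle_topspace)
 finally show ?thesis by simp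
qed

lemma s_inj:
 assumes p: "p \<in> circle" "J p = 0" and q: "q \<in> circle" "J q = 0" and eq: "s p = s q"
 shows "p = q"
proof (rule separated[OF p q], rule ccontr)
 fix n assume "side (H n) p ~= side (H n) q"
 then consider "side (H n) p < side (H n) q" | "side (H n) q < side (H n) p" by linarith
 then show False using s_less[OF p q, of n] s_less[OF q p, of n] eq by cases auto
qed

lemma J_edge_zero: assumes f: "f \<in> C" "f ~= {x, y}" and p: "p \<in> closed_edge f" shows "J p = 0"
proof (rule ccontr)
 assume J: "J p ~= 0"
 have "p \<in> topspace FG" using circle_topspace[OF circle_edge[OF f(1) p]] .
 then obtain t where t: "0 < t" "t < 1" "p = on_edge x y t" using J by (rule J_inner)
 obtain u v where uv: "f = {u, v}" using CE[OF f(1)] by (rule edge_ex)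
 have ne: "u ~= v" using edgeD[of u v] CE[OF f(1)] uv by blast
 obtain t' where "p = on_edge u v t'" using p unfolding uv closed_edge_image[OF ne] by auto
 then have "{u, v} = {x, y}" using t by (intro on_edge_eqD[OF ne xy(2), of t' t]) auto
 then show False using f(2) uv by simp
qed

text \<open>Otherwise the part of the circle with \<open>s < r\<close> and the part with \<open>s > r\<close> are separated by a
  finite cut that meets \<open>C\<close> only in \<open>{x, y}\<close>.\<close>

lemma s_surj: assumes r: "0 < r" "r < 1" shows "\<exists>p\<in>circle. J p = 0 & s p = r"
proof (rule ccontr)
 assume neg: "~ (\<exists>p\<in>circle. J p = 0 & s p = r)"
 define K1 where "K1 = circle Int {p \<in> topspace FG. J p \<in> {0}} Int {p \<in> topspace FG. s p \<in> {..r}}"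
 define K2 where "K2 = circle Int {p \<in> topspace FG. J p \<in> {0}} Int {p \<in> topspace FG. s p \<in> {r..}}"
 have cl: "closedin FG K1" "closedin FG K2" unfolding K1_def K2_def
  by (intro closedin_Int circle_closed closedin_continuous_map_preimage[OF J_continuous] closedin_continuous_map_preimage[OF s_continuous]; simp)+
 have K1: "compactin FG K1" by (rule closedin_compact_space[OF FG_compact cl(1)])
 have dis: "K1 Int K2 = {}"
 proof (rule ccontr)
  assume "K1 Int K2 ~= {}"
  then obtain p where "p \<in> K1 Int K2" by (meson ex_in_conv)
  then have "p \<in> circle" "J p = 0" "s p = r" by (auto simp: K1_def K2_def)
  then show False using neg by blast
 qed
 obtain Q where Q: "cutset Q" "!!v. v \<in> V ==> vertex_pt v \<in> K1 ==> v \<in> Q" "!!v. v \<in> Q ==> vertex_pt v \<notin> K2"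
  using finite_cut_separation[OF K1 cl(2) dis] by metis
 \<comment> \<open>On any other crossing edge of \<open>C\<close>, \<open>s\<close> would pass from
   below \<open>r\<close> to above \<open>r\<close> and take the value \<open>r\<close> in
   between.\<close>
 have "C Int bd Q \<subseteq> {{x, y}}"
 proof (rule subsetI, rule ccontr)
  fix f assume "f \<in> C Int bd Q" "f \<notin> {{x, y}}"
  then have f: "f \<in> C" "f \<in> bd Q" "f ~= {x, y}" by auto
  from f(2) obtain u v where uv: "f = {u, v}" "u \<in> Q" "v \<in> V - Q" "{u, v} \<in> E" by (rule bd_cases)
  have ne: "u ~= v" and uV: "u \<in> V" using edgeD[OF uv(4)] by auto
  have X: "p \<in> circle" "J p = 0" if "p \<in> closed_edge f" for p using circle_edge[OF f(1) that] J_edge_zero[OF f(1,3) that] by auto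
  have ve: "vertex_pt u \<in> closed_edge f" "vertex_pt v \<in> closed_edge f"
   unfolding uv(1) on_edge_0[OF ne, symmetric] on_edge_1[OF ne, symmetric] closed_edge_image[OF ne] by auto
  have "vertex_pt u \<notin> K2" by (rule Q(3)[OF uv(2)])
  then have 1: "s (vertex_pt u) < r" using X[OF ve(1)] circle_topspace by (auto simp: K2_def)
  have "vertex_pt v \<notin> K1" using Q(2)[of v] uv(3) by blast
  then have 2: "s (vertex_pt v) > r" using X[OF ve(2)] circle_topspace by (auto simp: K1_def)
  have "connectedin euclideanreal (s ` closed_edge f)"
   by (rule connectedin_continuous_map_image[OF s_continuous closed_edge_props(2)[OF CE[OF f(1)]]])
  then have "connected (s ` closed_edge f)" by simp
  then have "r \<in> s ` closed_edge f" by (rule connectedD_interval[OF _ imageI[OF ve(1)] imageI[OF ve(2)]]) (use 1 2 in auto)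
  then obtain p where "p \<in> closed_edge f" "s p = r" by (metis imageE)
  then show False using X neg by blast
 qed
 then have "C Int bd Q = {}" by (rule no_single[OF Q(1)])
 moreover have "{x, y} \<in> bd Q"
 proof -
  have j: "J (vertex_pt x) = 0" "J (vertex_pt y) = 0" using xy(2) by (auto simp: J_def side_vertex)
  have s: "s (vertex_pt x) = 0" "s (vertex_pt y) = 1" using s_edge[of 0] s_edge[of 1] by (simp_all add: on_edge_0[OF xy(2)] on_edge_1[OF xy(2)])
  have "vertex_pt x \<in> K1" "vertex_pt y \<in> K2" using j s r circle_vertex[OF e0] circle_topspace by (auto simp: K1_def K2_def)
  then have "x \<in> Q" "y \<notin> Q" using Q xy by auto
  then show ?thesis using bd_iff[OF xy(1)] by simp
 qed
 ultimately show False using e0 by blast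
qed

text \<open>The real part \<open>2 * s - 1\<close> parametrises both arcs from \<open>x\<close> to
  \<open>y\<close>. On the edge \<open>{x, y}\<close> we have \<open>J = s * (1 - s)\<close>, so the
  imaginary part is the positive root; elsewhere \<open>J = 0\<close> leaves the negative
  one.\<close>

definition wrap :: "'v fpoint => complex" where
 "wrap p = complex_of_real (2 * s p - 1) + \<i> * complex_of_real (4 * sqrt (J p) - 2 * sqrt (s p * (1 - s p)))"

lemma wrap_components: "Re (wrap p) = 2 * s p - 1" "Im (wrap p) = 4 * sqrt (J p) - 2 * sqrt (s p * (1 - s p))"
 by (simp_all add: wrap_def)

lemma wrap_continuous: "continuous_map FG euclidean wrap"
proof -
 have 1: "continuous_map FG euclidean (%p. complex_of_real (f p))" if "continuous_map FG euclideanreal f" for f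
  using continuous_map_compose[OF that, of euclidean complex_of_real] by (simp add: o_def continuous_on_of_real continuous_on_id)
 have 2: "continuous_map FG euclidean (%p. \<i> * complex_of_real (f p))" if "continuous_map FG euclideanreal f" for f
  using continuous_map_compose[OF that, of euclidean "%r. \<i> * complex_of_real r"] by (simp add: o_def continuous_intros)
 show ?thesis unfolding wrap_def
  by (intro continuous_map_add 1 2 continuous_map_diff continuous_map_real_mult_left continuous_map_sqrt continuous_map_real_mult s_continuous J_continuous)
   (simp_all)
qed

text \<open>The real part determines \<open>s\<close>, and then the imaginary part determines
  \<open>J\<close>. For \<open>J\<close> zero, \<open>s\<close> is injective; otherwise both points
  lie on the edge \<open>{x, y}\<close>, where \<open>s\<close> is the parameter.\<close>

lemma wrap_inj: "inj_on wrap circle"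
proof (rule inj_onI)
 fix p q assume p: "p \<in> circle" and q: "q \<in> circle" and eq: "wrap p = wrap q"
 have s: "s p = s q" using arg_cong[OF eq, of Re] by (simp add: wrap_components)
 have "sqrt (J p) = sqrt (J q)" using arg_cong[OF eq, of Im] s by (simp add: wrap_components)
 then have J: "J p = J q" by simp
 show "p = q"
 proof (cases "J p = 0")
  case True then show ?thesis using s_inj[OF p _ q _ s] J by simp
 next
  case False
  obtain t where t: "p = on_edge x y t" using circle_topspace[OF p] False by (rule J_inner)
  have "J q ~= 0" using False J by simp
  then obtain t' where t': "q = on_edge x y t'" by (rule J_inner[OF circle_topspace[OF q]])
  show ?thesis using s t t' by (simp add: s_edge)
 qed
qed

lemma wrap_edge: assumes "0 \<le> t" "t \<le> 1" shows "Im (wrap (on_edge x y t)) = 2 * sqrt (t * (1 - t))"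
 by (simp add: wrap_components J_edge s_edge)

lemma circle_identity: fixes r :: real assumes "0 \<le> r" "r \<le> 1" shows "(2 * r - 1)\<^sup>2 + (2 * sqrt (r * (1 - r)))\<^sup>2 = 1"
proof -
 have "(sqrt (r * (1 - r)))\<^sup>2 = r * (1 - r)" using assms by simp
 then show ?thesis by (simp add: power_mult_distrib power2_eq_square algebra_simps)
qed

lemma wrap_image: "wrap ` circle = sphere 0 1"
proof (intro equalityI subsetI)
 fix z assume "z \<in> wrap ` circle"
 then obtain p where p: "p \<in> circle" "z = wrap p" by (metis imageE)
 have "\<bar>Im z\<bar> = 2 * sqrt (s p * (1 - s p))"
 proof (cases "J p = 0")
  case True
  have "0 \<le> s p * (1 - s p)" using s_range[OF circle_topspace[OF p(1)]] by simp
  then show ?thesis using True p(2) by (simp add: wrap_components)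
 next
  case False
  obtain t where t: "0 < t" "t < 1" "p = on_edge x y t" using circle_topspace[OF p(1)] False by (rule J_inner)
  then show ?thesis using p(2) wrap_edge[of t] s_edge[of t] by simp
 qed
 then have "(Im z)\<^sup>2 = (2 * sqrt (s p * (1 - s p)))\<^sup>2" by (metis power2_abs)
 then have "(Re z)\<^sup>2 + (Im z)\<^sup>2 = 1" using circle_identity[OF s_range[OF circle_topspace[OF p(1)]]] p(2) by (simp add: wrap_components)
 then show "z \<in> sphere 0 1" by (simp add: cmod_def)
next
 fix z :: complex assume "z \<in> sphere 0 1"
 then have z: "(Re z)\<^sup>2 + (Im z)\<^sup>2 = 1" by (simp add: cmod_def)
 define r where "r = (Re z + 1) / 2"
 have "(Re z)\<^sup>2 \<le> 1" using z zero_le_power2[of "Im z"] by linarith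
 then have "\<bar>Re z\<bar> \<le> 1" by (simp add: abs_square_le_1)
 then have r: "0 \<le> r" "r \<le> 1" "Re z = 2 * r - 1" by (auto simp: r_def field_simps)
 have "(Im z)\<^sup>2 = (2 * sqrt (r * (1 - r)))\<^sup>2" using z circle_identity[OF r(1,2)] r(3) by simp
 then have "\<bar>Im z\<bar> = \<bar>2 * sqrt (r * (1 - r))\<bar>" by (simp only: power2_eq_iff abs_eq_iff)
 then have im: "\<bar>Im z\<bar> = 2 * sqrt (r * (1 - r))" using r by simp
 have edge: "on_edge x y r \<in> circle" by (rule circle_edge[OF e0]) (use r in \<open>simp add: closed_edge_image[OF xy(2)]\<close>)
 have up: "z \<in> wrap ` circle" if "Im z \<ge> 0"
 proof (rule image_eqI[OF _ edge])
  show "z = wrap (on_edge x y r)" by (rule complex_eqI) (use that im r wrap_edge[OF r(1,2)] in \<open>simp_all add: wrap_components s_edge\<close>)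
 qed
 show "z \<in> wrap ` circle"
 proof (cases "Im z \<ge> 0")
  case False
  then have "r * (1 - r) ~= 0" using im by auto
  then have "0 < r" "r < 1" using r by (auto simp: less_le)
  then obtain p where p: "p \<in> circle" "J p = 0" "s p = r" using s_surj by metis
  show ?thesis
  proof (rule image_eqI[OF _ p(1)])
   show "z = wrap p" by (rule complex_eqI) (use False im r p in \<open>simp_all add: wrap_components\<close>)
  qed
 qed (rule up)
qed

text \<open>A continuous bijection from a compact space to a Hausdorff space is a
  homeomorphism.\<close>

lemma is_circle: "is_circle V E circle"
proof -
 have "homeomorphic_map (subtopology FG circle) (top_of_set (sphere 0 1)) wrap"
 proof (rule continuous_imp_homeomorphic_map)
  show "compact_space (subtopology FG circle)"
   by (rule compact_space_subtopology[OF closedin_compact_space[OF FG_compact circle_closed]])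
  show "Hausdorff_space (top_of_set (sphere 0 1 :: complex set))" by (simp add: Hausdorff_space_subtopology)
  have ts: "topspace (subtopology FG circle) = circle" using circle_topspace by auto
  show "continuous_map (subtopology FG circle) (top_of_set (sphere 0 1)) wrap"
   unfolding continuous_map_in_subtopology using continuous_map_from_subtopology[OF wrap_continuous] wrap_image ts by auto
  show "wrap ` topspace (subtopology FG circle) = topspace (top_of_set (sphere 0 1))" using wrap_image ts by simp
  show "inj_on wrap (topspace (subtopology FG circle))" using wrap_inj ts by simp
 qed
 then show ?thesis unfolding is_circle_def using circle_topspace homeomorphic_map_imp_homeomorphic_space by blast
qed

end

context lfgraph
begin

lemma cut_minimal_circuit: assumes C: "cut_minimal C" shows "C \<in> topological_circuits V E"
proof -
 interpret min_cut_even V E C by unfold_locales (rule C)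
 have "C ~= {}" using C by (simp add: cut_minimal_def)
 then obtain e where e: "e \<in> C" by (meson ex_in_conv)
 obtain x y where xy: "e = {x, y}" using CE[OF e] by (rule edge_ex)
 have xyC: "{x, y} \<in> C" and xyE: "{x, y} \<in> E" using e CE xy by auto
 have xyV: "x \<in> V" "x ~= y" using edgeD[OF xyE] by auto
 \<comment> \<open>If \<open>{x, y}\<close> were the only edge, the star of \<open>x\<close> would
   meet \<open>C\<close> in a single edge. A non-empty remainder is required for the
   enumeration.\<close>
 have ne: "C - {{x, y}} ~= {}"
 proof
  assume "C - {{x, y}} = {}"
  then have "C Int bd {x} \<subseteq> {{x, y}}" by blast
  then have "C Int bd {x} = {}" by (rule no_single[OF cutset_single[OF xyV(1)]])
  moreover have "{x, y} \<in> bd {x}" using bd_iff[OF xyE, of "{x}"] xyV by simp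
  ultimately show False using xyC by blast
 qed
 have "countable (C - {{x, y}})" by (rule countable_subset[OF _ countable_E]) (use CE in auto)
 then have c: "range (from_nat_into (C - {{x, y}})) = C - {{x, y}}" by (rule range_from_nat_into[OF ne])
 \<comment> \<open>The two-edge cut is oriented by passing to the complement if necessary, so that
   all sides contain \<open>y\<close>.\<close>
 have "\<exists>Q. cutset Q & C Int bd Q = {{x, y}, f} & x \<notin> Q & y \<in> Q" if f: "f \<in> C" "f ~= {x, y}" for f
 proof -
  obtain Q where Q: "cutset Q" "C Int bd Q = {{x, y}, f}" using two_edge_cut[OF C xyC f(1) f(2)[symmetric]] by (elim exE conjE)
  have "{x, y} \<in> bd Q" using Q(2) by blast
  then have cr: "x \<in> Q \<longleftrightarrow> y \<notin> Q" using bd_iff[OF xyE] by simp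
  show ?thesis
  proof (cases "x \<in> Q")
   case True then show ?thesis using Q cr cutset_compl[OF Q(1)] edgeD[OF xyE] by (intro exI[of _ "V - Q"]) (simp add: bd_compl)
  next
   case False then show ?thesis using Q cr by (intro exI[of _ Q]) simp
  qed
 qed
 then obtain Y where Y: "!!f. f \<in> C ==> f ~= {x, y} ==> cutset (Y f) & C Int bd (Y f) = {{x, y}, f} & x \<notin> Y f & y \<in> Y f" by metis
 interpret cut_param V E C x y "from_nat_into (C - {{x, y}})" Y
  by unfold_locales (rule xyC, rule c, rule Y)
 show ?thesis unfolding topological_circuits_def using is_circle circle_edges by (intro CollectI exI[of _ circle]) simp
qed

end

section \<open>From a circle to its edge set\<close>

lemma cis_Arg2pi: assumes "cmod w = 1" shows "cis (Arg2pi w) = w"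
 using Arg2pi_eq[of w] assms by (simp add: cis_conv_exp)

lemma Arg2pi_cis_eq: assumes "0 \<le> t" "t < 2 * pi" shows "Arg2pi (cis t) = t"
 by (rule Arg2pi_unique[of 1]) (use assms in \<open>simp_all add: cis_conv_exp\<close>)

text \<open>The set is the image of an open interval of angles, measured from
  \<open>a\<close>.\<close>

lemma connected_sphere_minus_point:
 fixes a :: complex assumes a: "a \<in> sphere 0 1" shows "connected (sphere 0 1 - {a})"
proof -
 have na: "cmod a = 1" "a ~= 0" using a by auto
 have "sphere 0 1 - {a} = (%t. a * cis t) ` {0<..<2 * pi}"
 proof (intro equalityI subsetI)
  fix z assume z: "z \<in> sphere 0 1 - {a}"
  define t where "t = Arg2pi (z / a)"
  have "cmod (z / a) = 1" using z na by (simp add: norm_divide)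
  then have eq: "z = a * cis t" using cis_Arg2pi na by (simp add: t_def)
  have "t ~= 0" using eq z by auto
  then have "t \<in> {0<..<2 * pi}" using Arg2pi_ge_0[of "z / a"] Arg2pi_lt_2pi[of "z / a"] by (simp add: t_def)
  then show "z \<in> (%t. a * cis t) ` {0<..<2 * pi}" unfolding eq by (rule imageI)
 next
  fix z assume "z \<in> (%t. a * cis t) ` {0<..<2 * pi}"
  then obtain t where t': "z = a * cis t" "t \<in> {0<..<2 * pi}" by (rule imageE)
  then have t: "z = a * cis t" "0 < t" "t < 2 * pi" by simp_all
  have "cis t ~= 1"
  proof
   assume "cis t = 1"
   then have "Arg2pi (cis t) = Arg2pi (cis 0)" by simp
   then show False using Arg2pi_cis_eq[of t] Arg2pi_cis_eq[of 0] t by simp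
  qed
  then show "z \<in> sphere 0 1 - {a}" using t na by (simp add: norm_mult)
 qed
 moreover have "connected ((%t. a * cis t) ` {0<..<2 * pi})"
  by (rule connected_continuous_image) (auto intro!: continuous_intros simp: cis_conv_exp)
 ultimately show ?thesis by simp
qed

text \<open>The angle measured from \<open>a\<close> is continuous away from \<open>a\<close>. On a
  connected set it would have to take the value that belongs to \<open>b\<close> alone.\<close>

lemma not_connected_sphere_minus_two:
 fixes a b :: complex assumes a: "a \<in> sphere 0 1" and b: "b \<in> sphere 0 1" and ne: "a ~= b"
 shows "~ connected (sphere 0 1 - {a, b})"
proof
 assume con: "connected (sphere 0 1 - {a, b})"
 have na: "cmod a = 1" "a ~= 0" "cmod b = 1" using a b by auto
 define f where "f = (%z. Arg2pi (z / a))"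
 have eqf: "z = a * cis (f z)" if "cmod z = 1" for z
  using cis_Arg2pi[of "z / a"] na that by (simp add: f_def norm_divide)
 have fcis: "f (a * cis t) = t" if "0 \<le> t" "t < 2 * pi" for t using Arg2pi_cis_eq[OF that] na by (simp add: f_def)
 have cont: "continuous_on (sphere 0 1 - {a, b}) f" unfolding f_def
 proof (rule continuous_on_compose2[of "- \<real>\<^sub>\<ge>\<^sub>0" Arg2pi])
  show "continuous_on (- \<real>\<^sub>\<ge>\<^sub>0) Arg2pi" by (rule continuous_at_imp_continuous_on) (simp add: continuous_at_Arg2pi)
  show "continuous_on (sphere 0 1 - {a, b}) (%z. z / a)" using na by (intro continuous_intros) auto
  show "(%z. z / a) ` (sphere 0 1 - {a, b}) \<subseteq> - \<real>\<^sub>\<ge>\<^sub>0"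
  proof (rule image_subsetI, rule ComplI)
   fix z assume z: "z \<in> sphere 0 1 - {a, b}" and "z / a \<in> \<real>\<^sub>\<ge>\<^sub>0"
   then obtain r where r: "z / a = complex_of_real r" "r \<ge> 0" by (auto elim: nonneg_Reals_cases)
   have "cmod (z / a) = 1" using z na by (simp add: norm_divide)
   then have "r = 1" using r by simp
   then show False using r z na by simp
  qed
 qed
 define \<beta> where "\<beta> = f b"
 have b0: "0 \<le> \<beta>" "\<beta> < 2 * pi" using Arg2pi_ge_0 Arg2pi_lt_2pi by (auto simp: \<beta>_def f_def)
 have bc: "b = a * cis \<beta>" using eqf[OF na(3)] by (simp add: \<beta>_def)
 have "\<beta> ~= 0" using bc ne by auto
 then have bpos: "0 < \<beta>" using b0 by simp
 have mem: "t \<in> f ` (sphere 0 1 - {a, b})" if t: "0 < t" "t < 2 * pi" "t ~= \<beta>" for t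
 proof (rule image_eqI)
  show "t = f (a * cis t)" using fcis t by simp
  have "a * cis t ~= a" using fcis[of t] fcis[of 0] t by auto
  moreover have "a * cis t ~= b" using fcis[of t] t by (auto simp: \<beta>_def)
  ultimately show "a * cis t \<in> sphere 0 1 - {a, b}" using na by (simp add: norm_mult)
 qed
 have "connected (f ` (sphere 0 1 - {a, b}))" by (rule connected_continuous_image[OF cont con])
 then have "\<beta> \<in> f ` (sphere 0 1 - {a, b})"
  by (rule connectedD_interval[OF _ mem[of "\<beta> / 2"] mem[of "\<beta> / 2 + pi"]]) (use b0 bpos in auto)
 then obtain z where z': "\<beta> = f z" "z \<in> sphere 0 1 - {a, b}" by (rule imageE)
 have z: "z \<in> sphere 0 1 - {a, b}" "f z = \<beta>" using z' by simp_all
 have "cmod z = 1" using z(1) by simp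
 then have "z = b" using eqf[of z] z(2) bc by simp
 then show False using z(1) by simp
qed

lemma connectedin_side:
 assumes "connectedin X S" "openin X A" "openin X B" "S \<subseteq> A Un B" "A Int B Int S = {}" "A Int S ~= {}"
 shows "B Int S = {}"
 using assms unfolding connectedin by blast

locale circle_graph = lfgraph V E for V :: "'v set" and E :: "'v set set" +
 fixes K :: "'v fpoint set"
 assumes circ: "is_circle V E K"
begin

definition CK :: "'v set set" where "CK = {e\<in>E. closed_edge e \<subseteq> K}"

lemma K_topspace: "K \<subseteq> topspace FG" using circ by (simp add: is_circle_def)

lemma circle_maps:
 "\<exists>h g. continuous_map (subtopology FG K) (top_of_set (sphere 0 1)) h & continuous_map (top_of_set (sphere 0 1)) (subtopology FG K) g
  & (\<forall>p\<in>K. h p \<in> sphere (0::complex) 1 & g (h p) = p) & (\<forall>z\<in>sphere 0 1. g z \<in> K & h (g z) = z)"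
proof -
 obtain h g where hg: "homeomorphic_maps (subtopology FG K) (top_of_set (sphere (0::complex) 1)) h g"
  using circ unfolding is_circle_def homeomorphic_space_def by (elim conjE exE)
 have ts: "topspace (subtopology FG K) = K" using K_topspace by auto
 have c: "continuous_map (subtopology FG K) (top_of_set (sphere (0::complex) 1)) h" "continuous_map (top_of_set (sphere (0::complex) 1)) (subtopology FG K) g"
  and i: "\<forall>p\<in>K. g (h p) = p" "\<forall>z\<in>sphere 0 1. h (g z) = z"
  using hg unfolding homeomorphic_maps_def ts by simp_all
 have 1: "\<forall>p\<in>K. h p \<in> sphere 0 1" using continuous_map_image_subset_topspace[OF c(1)] ts by auto
 have 2: "\<forall>z\<in>sphere 0 1. g z \<in> K" using continuous_map_image_subset_topspace[OF c(2)] ts by auto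
 show ?thesis by (intro exI[of _ h] exI[of _ g] conjI c) (use 1 2 i in simp_all)
qed

lemma two_points: obtains p q where "p \<in> K" "q \<in> K" "p ~= q"
proof -
 obtain h g where hg: "\<forall>z\<in>sphere (0::complex) 1. g z \<in> K & h (g z) = z" using circle_maps by (elim exE conjE)
 have "g 1 \<in> K" "g (- 1) \<in> K" "h (g 1) = 1" "h (g (- 1)) = - 1" using bspec[OF hg, of 1] bspec[OF hg, of "- 1"] by simp_all
 moreover from this have "g 1 ~= g (- 1)" by auto
 ultimately show ?thesis using that by simp
qed

lemma K_compact: "compactin FG K"
proof -
 have "compact_space (top_of_set (sphere (0::complex) 1))" by (simp add: compact_space_subtopology)
 then have "compact_space (subtopology FG K)" using homeomorphic_compact_space circ unfolding is_circle_def by blast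
 then show ?thesis using K_topspace by (simp add: compactin_subspace)
qed

lemma K_closed: "closedin FG K" by (rule compactin_imp_closedin[OF FG_Hausdorff K_compact])

lemma connected_image:
 assumes g: "continuous_map (top_of_set (sphere (0::complex) 1)) (subtopology FG K) g" and T: "T \<subseteq> sphere 0 1" "connected T"
 shows "connectedin FG (g ` T)"
proof -
 have "connectedin (top_of_set (sphere 0 1)) T" using T by (simp add: connectedin_subtopology)
 then have "connectedin (subtopology FG K) (g ` T)" by (rule connectedin_continuous_map_image[OF g])
 then show ?thesis by (simp add: connectedin_subtopology)
qed

text \<open>Transported from the unit circle along the homeomorphism. Deleting one point leaves the
  circle connected and deleting two does not; evenness and minimality of \<open>CK\<close> are both
  drawn from this.\<close>

lemma K_connected: "connectedin FG K" and K_minus_connected: "p \<in> K ==> connectedin FG (K - {p})"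
 and K_minus_two: "p \<in> K ==> q \<in> K ==> p ~= q ==> ~ connectedin FG (K - {p, q})"
proof -
 obtain h g where h: "continuous_map (subtopology FG K) (top_of_set (sphere 0 1)) h" and g: "continuous_map (top_of_set (sphere 0 1)) (subtopology FG K) g"
  and hg': "\<forall>p\<in>K. h p \<in> sphere (0::complex) 1 & g (h p) = p" "\<forall>z\<in>sphere 0 1. g z \<in> K & h (g z) = z"
  using circle_maps by (elim exE conjE)
 have hg: "!!p. p \<in> K ==> h p \<in> sphere (0::complex) 1" "!!p. p \<in> K ==> g (h p) = p" "!!z. z \<in> sphere 0 1 ==> g z \<in> K" "!!z. z \<in> sphere 0 1 ==> h (g z) = z"
  using bspec[OF hg'(1)] bspec[OF hg'(2)] by simp_all
 have im: "K - A = g ` (sphere 0 1 - h ` A)" if A: "A \<subseteq> K" for A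
 proof (intro equalityI subsetI)
  fix p assume p: "p \<in> K - A"
  have "h p \<notin> h ` A"
  proof
   assume "h p \<in> h ` A"
   then obtain q where q: "h p = h q" "q \<in> A" by (rule imageE)
   then have "g (h p) = g (h q)" by simp
   then have "p = q" using hg(2) p A q(2) by auto
   then show False using p q(2) by simp
  qed
  then show "p \<in> g ` (sphere 0 1 - h ` A)" using p hg(1,2)[of p] by (intro image_eqI[of _ _ "h p"]) auto
 next
  fix p assume "p \<in> g ` (sphere 0 1 - h ` A)"
  then obtain z where z: "p = g z" "z \<in> sphere 0 1 - h ` A" by (rule imageE)
  have "p \<notin> A" using z hg(4)[of z] imageI[of p A h] by auto
  then show "p \<in> K - A" using z hg(3) by simp
 qed
 have "connected (sphere (0::complex) 1)" by (rule connected_sphere) simp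
 then have "connectedin FG (g ` (sphere 0 1))" by (intro connected_image[OF g]) auto
 then show "connectedin FG K" using im[of "{}"] by simp
 show "connectedin FG (K - {p})" if p: "p \<in> K"
 proof -
  have "K - {p} = g ` (sphere 0 1 - {h p})" using im[of "{p}"] p by simp
  then show ?thesis using connected_image[OF g Diff_subset connected_sphere_minus_point[OF hg(1)[OF p]]] by simp
 qed
 show "~ connectedin FG (K - {p, q})" if pq: "p \<in> K" "q \<in> K" "p ~= q"
 proof
  assume "connectedin FG (K - {p, q})"
  then have "connectedin (subtopology FG K) (K - {p, q})" by (simp add: connectedin_subtopology)
  then have "connectedin (top_of_set (sphere 0 1)) (h ` (K - {p, q}))" by (rule connectedin_continuous_map_image[OF h])
  then have con: "connected (h ` (K - {p, q}))" by (simp add: connectedin_subtopology)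
  have ne: "h p ~= h q" using pq hg(2) by metis
  have "h ` (K - {p, q}) = sphere 0 1 - {h p, h q}"
  proof -
   have "K - {p, q} = g ` (sphere 0 1 - {h p, h q})" using im[of "{p, q}"] pq by simp
   then have "h ` (K - {p, q}) = (%z. h (g z)) ` (sphere 0 1 - {h p, h q})" by (simp add: image_image)
   also have "\<dots> = (%z. z) ` (sphere 0 1 - {h p, h q})" by (rule image_cong) (use hg(4) in auto)
   finally show ?thesis by simp
  qed
  then show False using con not_connected_sphere_minus_two[OF hg(1)[OF pq(1)] hg(1)[OF pq(2)] ne] by simp
 qed
qed

lemma side_crosses:
 assumes S: "connectedin FG S" and Q: "cutset Q" and pq: "p \<in> S" "q \<in> S" "side Q p \<le> r" "r \<le> side Q q"
 obtains z where "z \<in> S" "side Q z = r"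
proof -
 have "connectedin euclideanreal (side Q ` S)" by (rule connectedin_continuous_map_image[OF side_continuous[OF Q] S])
 then have "connected (side Q ` S)" by simp
 then have "r \<in> side Q ` S" by (rule connectedD_interval[OF _ imageI[OF pq(1)] imageI[OF pq(2)] pq(3,4)])
 then show ?thesis using that by (metis imageE)
qed

lemma on_edge_inject: assumes "{x, y} \<in> E" "on_edge x y s = on_edge x y t" shows "s = t"
proof -
 have ne: "x ~= y" using edgeD[OF assms(1)] by blast
 show ?thesis using arg_cong[OF assms(2), of "side {y}"] ne by (simp add: side_on_edge)
qed

text \<open>Two points of \<open>K\<close> on the edge before the missing point would confine
  \<open>K\<close> to a segment, which an inner point disconnects; a single one would be isolated in
  \<open>K\<close>.\<close>

lemma no_gap:
 assumes xy: "{x, y} \<in> E" and t0: "0 < t0" "t0 < t1" and t1: "t1 \<le> 1" and K: "on_edge x y t0 \<in> K" "on_edge x y t1 \<notin> K"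
 shows False
proof -
 define P where "P = on_edge x y"
 have inj: "P s = P t ==> s = t" for s t using on_edge_inject[OF xy] by (simp add: P_def)
 have xyV: "x ~= y" "x \<in> V" "y \<in> V" using edgeD[OF xy] by auto
 have sy: "side {y} (P t) = t" for t using xyV by (simp add: P_def side_on_edge)
 have int: "z \<in> open_edge_interval x y s t \<longleftrightarrow> (\<exists>r. z = P r & s < r & r < t)" for z s t by (auto simp: open_edge_interval_def P_def)
 have A: False if s: "0 < s" "s < r" "r < t1" "P s \<in> K" "P r \<in> K" for s r
 proof -
  let ?I = "open_edge_interval x y s t1" and ?F = "P ` {s..t1}"
  have I: "openin FG ?I" by (rule open_interval[OF xy]) (use s t1 in auto)
  have "compactin (top_of_set {0..1}) {s..t1}" using s t1 by (simp add: compactin_subtopology)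
  then have "compactin FG ?F" unfolding P_def by (rule image_compactin[OF _ on_edge_continuous[OF xy]])
  then have "closedin FG ?F" by (rule compactin_imp_closedin[OF FG_Hausdorff])
  then have E2: "openin FG (topspace FG - ?F)" by (rule openin_diff[OF openin_topspace])
  have cov: "K - {P s} \<subseteq> ?I Un (topspace FG - ?F)"
  proof
   fix z assume z: "z \<in> K - {P s}"
   show "z \<in> ?I Un (topspace FG - ?F)"
   proof (cases "z \<in> ?F")
    case True
    then obtain t where t: "z = P t" "s \<le> t" "t \<le> t1" by auto
    have "t ~= s" "t ~= t1" using t z K(2) by (auto simp: P_def)
    then show ?thesis using t int by auto
   next
    case False then show ?thesis using z K_topspace by auto
   qed
  qed
  have dis: "?I Int (topspace FG - ?F) Int (K - {P s}) = {}" using int by auto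
  have "P r \<in> ?I Int (K - {P s})" using s inj[of r s] int by auto
  then have "?I Int (K - {P s}) ~= {}" by (rule ex_in_conv[THEN iffD1, OF exI])
  then have "(topspace FG - ?F) Int (K - {P s}) = {}" by (rule connectedin_side[OF K_minus_connected[OF s(4)] I E2 cov dis])
  then have sub: "K \<subseteq> ?F" using K_topspace s(2,3) by auto
  \<comment> \<open>\<open>K\<close> lies on a segment of the edge here. By connectedness it
    contains \<open>P m\<close>, and it would remain connected without \<open>P m\<close>, although
    \<open>side {y}\<close> takes the value \<open>m\<close> nowhere else on the segment.\<close>
  define m where "m = (s + r) / 2"
  have m: "s < m" "m < r" using s by (auto simp: m_def)
  obtain z where z: "z \<in> K" "side {y} z = m"
   by (rule side_crosses[OF K_connected cutset_single[OF xyV(3)] s(4,5), of m]) (use m sy in auto)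
  have zP: "z = P m" using z sub sy by auto
  obtain z' where z': "z' \<in> K - {P m}" "side {y} z' = m"
   by (rule side_crosses[OF K_minus_connected[of "P m"] cutset_single[OF xyV(3)], of "P s" "P r" m])
    (use m sy s z zP inj[of s m] inj[of r m] in auto)
  then have "z' = P m" using sub sy by auto
  then show False using z'(1) by simp
 qed
 let ?I = "open_edge_interval x y 0 t1"
 have I: "openin FG ?I" by (rule open_interval[OF xy]) (use t0 t1 in auto)
 \<comment> \<open>By the first part, no two points of \<open>K\<close> lie inside this interval, so
   \<open>P t0\<close> is isolated in \<open>K\<close>.\<close>
 have only: "z = P t0" if z: "z \<in> ?I" "z \<in> K" for z
 proof -
  obtain r where r: "z = P r" "0 < r" "r < t1" using z(1) unfolding int by (elim exE conjE)
  have "~ r < t0" using A[of r t0] r z(2) t0 K(1) by (auto simp: P_def)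
  moreover have "~ t0 < r" using A[of t0 r] r z(2) t0 K(1) by (auto simp: P_def)
  ultimately show ?thesis using r(1) by simp
 qed
 have T0: "P t0 \<in> ?I" "P t0 \<in> K" using int t0 K(1) by (auto simp: P_def)
 have "closedin FG {P t0}" using T0(2) K_topspace closedin_Hausdorff_singleton[OF FG_Hausdorff] by blast
 then have E2: "openin FG (topspace FG - {P t0})" by (rule openin_diff[OF openin_topspace])
 have "P t0 \<in> ?I Int K" using T0 by simp
 then have ne: "?I Int K ~= {}" by (rule ex_in_conv[THEN iffD1, OF exI])
 have "(topspace FG - {P t0}) Int K = {}"
 proof (rule connectedin_side[OF K_connected I E2 _ _ ne])
  show "K \<subseteq> ?I Un (topspace FG - {P t0})"
  proof
   fix z assume z: "z \<in> K"
   then have "z \<in> topspace FG" using K_topspace by (rule subsetD[rotated])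
   then show "z \<in> ?I Un (topspace FG - {P t0})" using T0(1) by (cases "z = P t0") simp_all
  qed
  show "?I Int (topspace FG - {P t0}) Int K = {}"
  proof (rule equals0I)
   fix z assume "z \<in> ?I Int (topspace FG - {P t0}) Int K"
   then have "z \<in> ?I" "z \<in> K" "z ~= P t0" by simp_all
   then show False using only by metis
  qed
 qed
 then have "K \<subseteq> {P t0}" using K_topspace by auto
 moreover obtain a b where "a \<in> K" "b \<in> K" "a ~= b" by (rule two_points)
 ultimately show False by auto
qed

lemma edge_in_circle:
 assumes xy: "{x, y} \<in> E" and t: "0 < t" "t < 1" and K: "on_edge x y t \<in> K"
 shows "{x, y} \<in> CK"
proof -
 have ne: "x ~= y" using edgeD[OF xy] by blast
 have "on_edge x y r \<in> K" if r: "0 \<le> r" "r \<le> 1" for r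
 proof (rule ccontr)
  assume nr: "on_edge x y r \<notin> K"
  then have "r ~= t" using K by auto
  then consider "t < r" | "r < t" by linarith
  then show False
  proof cases
   case 1 then show ?thesis using no_gap[OF xy t(1) 1 r(2) K nr] by simp
  next
   case 2
   have yx: "{y, x} \<in> E" using xy by (simp add: insert_commute)
   show ?thesis by (rule no_gap[OF yx, of "1 - t" "1 - r"]) (use t r 2 K nr on_edge_swap[OF ne] in auto)
  qed
 qed
 then show ?thesis unfolding CK_def closed_edge_image[OF ne, symmetric] using xy closed_edge_image[OF ne] by auto
qed

lemma CK_E: "e \<in> CK ==> e \<in> E" by (simp add: CK_def)

lemma CK_vertex: assumes "{x, y} \<in> CK" shows "vertex_pt x \<in> K" "vertex_pt y \<in> K" "on_edge x y (1/2) \<in> K"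
proof -
 have ne: "x ~= y" using edgeD[OF CK_E[OF assms]] by blast
 have sub: "on_edge x y ` {0..1} \<subseteq> K" using assms by (simp add: CK_def closed_edge_image[OF ne])
 show "vertex_pt x \<in> K" "vertex_pt y \<in> K" "on_edge x y (1/2) \<in> K"
  using subsetD[OF sub imageI[of 0]] subsetD[OF sub imageI[of 1]] subsetD[OF sub imageI[of "1/2"]] by (simp_all add: on_edge_0[OF ne] on_edge_1[OF ne])
qed

lemma K_side_inner:
 assumes p: "p \<in> K" and Q: "cutset Q" and s: "side Q p ~= 0" "side Q p ~= 1"
 obtains u v t where "{u, v} \<in> CK" "{u, v} \<in> bd Q" "u \<notin> Q" "v \<in> Q" "p = on_edge u v t" "side Q p = t"
proof -
 have "p \<in> topspace FG" using p K_topspace by blast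
 then show ?thesis
 proof (cases rule: FG_cases)
  case (vertex v) then show ?thesis using s by (simp add: side_vertex split: if_splits)
 next
  case (edge x y t)
  have C: "{x, y} \<in> CK" by (rule edge_in_circle[OF edge(1,2,3)]) (use p edge(4) in simp)
  have ne: "x ~= y" using edgeD[OF edge(1)] by blast
  have sd: "side Q p = (if x \<in> Q then 1 - t else 0) + (if y \<in> Q then t else 0)" unfolding edge(4) by (rule side_on_edge[OF ne])
  consider "x \<in> Q" "y \<notin> Q" | "x \<notin> Q" "y \<in> Q" using s sd by fastforce
  then show ?thesis
  proof cases
   case 1
   have "{x, y} \<in> bd Q" using bd_iff[OF edge(1)] 1 by simp
   moreover have "p = on_edge y x (1 - t)" unfolding edge(4) by (rule on_edge_swap[OF ne])
   ultimately show ?thesis using that[of y x "1 - t"] 1 C sd by (simp add: insert_commute)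
  next
   case 2
   have "{x, y} \<in> bd Q" using bd_iff[OF edge(1)] 2 by simp
   then show ?thesis using that[of x y t] 2 C edge sd by simp
  qed
 next
  case (endpt om)
  have "side Q p = 0 \<or> side Q p = 1" unfolding endpt(2) by (rule end_dichotomy[OF endpt(1) Q]) simp_all
  then show ?thesis using s by simp
 qed
qed

text \<open>Without the midpoint of \<open>e\<close> the circle is still connected, so
  \<open>side Q\<close> takes the value \<open>1/2\<close> on it. It does so only inside an edge of
  \<open>CK\<close> that crosses the cut, which would have to be \<open>e\<close>, and there only at
  the deleted midpoint.\<close>

lemma CK_not_single: assumes Q: "cutset Q" "CK Int bd Q = {e}" shows False
proof -
 have "e \<in> CK" "e \<in> bd Q" using Q(2) by auto
 from this(2) obtain x y where xy: "e = {x, y}" "x \<in> Q" "y \<in> V - Q" "{x, y} \<in> E" by (rule bd_cases)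
 have C: "{x, y} \<in> CK" using \<open>e \<in> CK\<close> xy(1) by simp
 have ne: "x ~= y" using edgeD[OF xy(4)] by blast
 let ?m = "on_edge x y (1/2)"
 have v: "vertex_pt x \<in> K - {?m}" "vertex_pt y \<in> K - {?m}"
  using CK_vertex[OF C] vertex_not_inner[OF ne, of "1/2"] by auto
 obtain z where z: "z \<in> K - {?m}" "side Q z = 1/2"
  by (rule side_crosses[OF K_minus_connected[OF CK_vertex(3)[OF C]] Q(1) v(2,1), of "1/2"]) (use xy in \<open>auto simp: side_vertex\<close>)
 have zK: "z \<in> K" and zs: "side Q z ~= 0" "side Q z ~= 1" using z by auto
 obtain u v t where uv: "{u, v} \<in> CK" "{u, v} \<in> bd Q" "u \<notin> Q" "v \<in> Q" "z = on_edge u v t" "side Q z = t"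
  by (rule K_side_inner[OF zK Q(1) zs])
 have "{u, v} = {x, y}" using IntI[OF uv(1,2)] unfolding Q(2) xy(1) by simp
 then have "u = y" "v = x" using uv(3,4) xy by (auto simp: doubleton_eq_iff)
 then have "z = on_edge y x (1/2)" using uv(5,6) z(2) by metis
 moreover have "(1::real) - 1/2 = 1/2" by simp
 then have "?m = on_edge y x (1/2)" using on_edge_swap[OF ne, of "1/2"] by (simp only:)
 ultimately show False using z(1) by simp
qed

text \<open>Without edges, all side functions of finite cuts take only the values \<open>0\<close>
  and \<open>1\<close> on \<open>K\<close>. As \<open>K\<close> is connected, none of them could
  separate two of its points.\<close>

lemma CK_nonempty: "CK ~= {}"
proof
 assume emp: "CK = {}"
 obtain p q where pq: "p \<in> K" "q \<in> K" "p ~= q" by (rule two_points)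
 obtain Q where Q: "cutset Q" "side Q p ~= side Q q"
  by (rule side_separates[OF subsetD[OF K_topspace pq(1)] subsetD[OF K_topspace pq(2)] pq(3)])
 have 01: "side Q z = 0 \<or> side Q z = 1" if "z \<in> K" for z
  using K_side_inner[OF that Q(1)] emp by blast
 have "\<exists>a b. a \<in> K & b \<in> K & side Q a = 0 & side Q b = 1" using 01[OF pq(1)] 01[OF pq(2)] Q(2) pq(1,2) by auto
 then obtain a b where ab: "a \<in> K" "b \<in> K" "side Q a = 0" "side Q b = 1" by (elim exE conjE)
 obtain z where "z \<in> K" "side Q z = 1/2" by (rule side_crosses[OF K_connected Q(1) ab(1,2), of "1/2"]) (use ab in auto)
 then show False using 01[of z] by simp
qed

lemma inner_half_connected:
 assumes xy: "{x, y} \<in> E" and T: "T \<subseteq> {0..1}" "connected T" shows "connectedin FG (on_edge x y ` T)"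
proof -
 have "connectedin (top_of_set {0..1}) T" using T by (simp add: connectedin_subtopology)
 then show ?thesis by (rule connectedin_continuous_map_image[OF on_edge_continuous[OF xy]])
qed

text \<open>If both ends of the edge were in \<open>A\<close>, then both halves of the edge next to
  \<open>q\<close> would be on the side of \<open>A\<close>. Adding the open edge to
  \<open>A\<close> would split \<open>K - {p}\<close>, which is connected.\<close>

lemma arc_split:
 assumes AB: "openin FG A" "openin FG B" "K - {p, q} \<subseteq> A Un B" "A Int B Int K = {}" "p \<notin> B" "q \<notin> B"
  and ne: "B Int K ~= {}" and p: "p \<in> K" "p \<notin> closed_edge {a, b}" and ab: "{a, b} \<in> CK" and q: "q = on_edge a b (1/2)"
  and v: "vertex_pt a \<in> A" "vertex_pt b \<in> A"
 shows False
proof -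
 have abE: "{a, b} \<in> E" by (rule CK_E[OF ab])
 have nab: "a ~= b" using edgeD[OF abE] by blast
 let ?P = "on_edge a b"
 have sub: "?P t \<in> K" "?P t ~= p" if "0 \<le> t" "t \<le> 1" for t
 proof -
  have "?P ` {0..1} \<subseteq> K" using ab by (simp add: CK_def closed_edge_image[OF nab])
  then show "?P t \<in> K" using that by auto
  show "?P t ~= p" using p(2) that unfolding closed_edge_image[OF nab] by auto
 qed
 have half: "B Int ?P ` T = {}" if T: "T \<subseteq> {0..1}" "connected T" "1/2 \<notin> T" "\<exists>t\<in>T. ?P t \<in> A" for T
 proof (rule connectedin_side[OF inner_half_connected[OF abE T(1,2)] AB(1,2)])
  have "?P t ~= q" if t: "t \<in> T" for t
  proof
   assume "?P t = q"
   then have "t = 1/2" using on_edge_inject[OF abE, of t "1/2"] q by simp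
   then show False using T(3) t by metis
  qed
  moreover have "?P t \<in> K" "?P t ~= p" if t: "t \<in> T" for t using subsetD[OF T(1) t] by (intro sub; simp)+
  ultimately have s: "?P ` T \<subseteq> K - {p, q}" by (intro image_subsetI) simp
  then show "?P ` T \<subseteq> A Un B" using AB(3) by (rule subset_trans)
  show "A Int B Int ?P ` T = {}" using s AB(4) by auto
  show "A Int ?P ` T ~= {}" using T(4) by auto
 qed
 have h0: "B Int ?P ` {0..<1/2} = {}" by (rule half) (use v on_edge_0[OF nab] in \<open>auto intro!: bexI[of _ 0]\<close>)
 have h1: "B Int ?P ` {1/2<..1} = {}" by (rule half) (use v on_edge_1[OF nab] in \<open>auto intro!: bexI[of _ 1]\<close>)
 let ?I = "open_edge_interval a b 0 1"
 have I: "openin FG (A Un ?I)" by (rule openin_Un[OF AB(1) open_interval[OF abE]]) auto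
 have IB: "?I Int B = {}"
 proof (rule ccontr)
  assume "?I Int B ~= {}"
  then obtain z where z: "z \<in> ?I" "z \<in> B" by blast
  then obtain t where t: "z = ?P t" "0 < t" "t < 1" by (auto simp: open_edge_interval_def)
  consider "t < 1/2" | "t = 1/2" | "t > 1/2" by linarith
  then show False
  proof cases
   case 1 then have "?P t \<in> ?P ` {0..<1/2}" using t by (intro imageI) simp
   then show ?thesis using h0 z(2) t(1) by blast
  next
   case 2 then show ?thesis using z(2) t(1) q AB(6) by metis
  next
   case 3 then have "?P t \<in> ?P ` {1/2<..1}" using t by (intro imageI) simp
   then show ?thesis using h1 z(2) t(1) by blast
  qed
 qed
 have qI: "q \<in> ?I" unfolding q open_edge_interval_def by (intro CollectI exI[of _ "1/2"]) simp
 have va: "vertex_pt a \<in> K - {p}" using sub[of 0] on_edge_0[OF nab] by simp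
 have "B Int (K - {p}) = {}"
 proof (rule connectedin_side[OF K_minus_connected[OF p(1)] I AB(2)])
  show "K - {p} \<subseteq> A Un ?I Un B" using AB(3) qI by auto
  show "(A Un ?I) Int B Int (K - {p}) = {}" using IB AB(4) by auto
  have "vertex_pt a \<in> (A Un ?I) Int (K - {p})" using va v by simp
  then show "(A Un ?I) Int (K - {p}) ~= {}" by (rule ex_in_conv[THEN iffD1, OF exI])
 qed
 then show False using ne AB(5) by auto
qed

text \<open>Deleting the midpoints of \<open>e\<close> and \<open>f\<close> splits the circle, and
  by \<open>arc_split\<close> each of the two edges has its ends on different sides. A finite cut
  separates the vertices of the two sides; any other edge of the circle is connected and avoids the
  midpoints, so it lies on one side.\<close>

lemma CK_two_edge_cut:
 assumes e: "e \<in> CK" and f: "f \<in> CK" and ef: "e ~= f"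
 shows "\<exists>Q. cutset Q & CK Int bd Q = {e, f}"
proof -
 obtain x y where xy: "e = {x, y}" using CK_E[OF e] by (rule edge_ex)
 obtain u v where uv: "f = {u, v}" using CK_E[OF f] by (rule edge_ex)
 have C: "{x, y} \<in> CK" "{u, v} \<in> CK" using e f xy uv by auto
 have EE: "{x, y} \<in> E" "{u, v} \<in> E" using C CK_E by auto
 have ne: "x ~= y" "u ~= v" using edgeD[OF EE(1)] edgeD[OF EE(2)] by auto
 define p q where "p = on_edge x y (1/2)" and "q = on_edge u v (1/2)"
 have pqK: "p \<in> K" "q \<in> K" using CK_vertex(3)[OF C(1)] CK_vertex(3)[OF C(2)] by (auto simp: p_def q_def)
 have notin: "on_edge a b (1/2) \<notin> closed_edge g" if g: "g \<in> E" "{a, b} \<in> E" "g ~= {a, b}" for a b g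
 proof
  assume m: "on_edge a b (1/2) \<in> closed_edge g"
  obtain c d where cd: "g = {c, d}" using g(1) by (rule edge_ex)
  have n: "c ~= d" "a ~= b" using edgeD[of c d] edgeD[OF g(2)] g(1) cd by auto
  obtain t where "on_edge a b (1/2) = on_edge c d t" using m unfolding cd closed_edge_image[OF n(1)] by auto
  then have "{c, d} = {a, b}" by (intro on_edge_eqD[OF n, of t "1/2"]) auto
  then show False using g(3) cd by simp
 qed
 have pf: "p \<notin> closed_edge {u, v}" unfolding p_def by (rule notin[OF EE(2,1)]) (use ef xy uv in auto)
 have qe: "q \<notin> closed_edge {x, y}" unfolding q_def by (rule notin[OF EE(1,2)]) (use ef xy uv in auto)
 have "q \<in> closed_edge {u, v}" unfolding q_def closed_edge_image[OF ne(2)] by simp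
 then have pq: "p ~= q" using pf by auto
 have sub: "K - {p, q} \<subseteq> topspace FG" using K_topspace by auto
 have "\<exists>E1 E2. openin FG E1 & openin FG E2 & K - {p, q} \<subseteq> E1 Un E2 & E1 Int E2 Int (K - {p, q}) = {} & E1 Int (K - {p, q}) ~= {} & E2 Int (K - {p, q}) ~= {}"
 proof (rule ccontr)
  assume neg: "~ ?thesis"
  have "connectedin FG (K - {p, q})" unfolding connectedin by (rule conjI[OF sub neg])
  then show False using K_minus_two[OF pqK pq] by simp
 qed
 then obtain E1 E2 where E12: "openin FG E1" "openin FG E2" "K - {p, q} \<subseteq> E1 Un E2" "E1 Int E2 Int (K - {p, q}) = {}" "E1 Int (K - {p, q}) ~= {}" "E2 Int (K - {p, q}) ~= {}"
  by (elim exE conjE)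
 have clpq: "closedin FG {p, q}"
 proof -
  have "closedin FG ({p} Un {q})"
   by (intro closedin_Un closedin_Hausdorff_singleton[OF FG_Hausdorff] subsetD[OF K_topspace] pqK)
  then show ?thesis by (simp add: insert_commute)
 qed
 define A B where "A = E1 - {p, q}" and "B = E2 - {p, q}"
 have AB: "openin FG A" "openin FG B" "K - {p, q} \<subseteq> A Un B" "A Int B Int K = {}" "A Int K ~= {}" "B Int K ~= {}"
  and nAB: "p \<notin> A" "q \<notin> A" "p \<notin> B" "q \<notin> B"
  using E12 openin_diff[OF E12(1) clpq] openin_diff[OF E12(2) clpq] by (auto simp: A_def B_def)
 have BA: "K - {p, q} \<subseteq> B Un A" "B Int A Int K = {}" "K - {q, p} \<subseteq> A Un B" "K - {q, p} \<subseteq> B Un A" using AB(3,4) by auto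
 have vK: "vertex_pt x \<in> K - {p, q}" "vertex_pt y \<in> K - {p, q}" "vertex_pt u \<in> K - {p, q}" "vertex_pt v \<in> K - {p, q}"
  using CK_vertex[OF C(1)] CK_vertex[OF C(2)] vertex_not_inner[OF ne(1), of "1/2"] vertex_not_inner[OF ne(2), of "1/2"] by (auto simp: p_def q_def)
 have vAB: "vertex_pt w \<in> A \<longleftrightarrow> vertex_pt w \<notin> B" if "vertex_pt w \<in> K - {p, q}" for w using that AB(3,4) by auto
 have fx: "vertex_pt u \<in> A \<longleftrightarrow> vertex_pt v \<notin> A"
  using arc_split[OF AB(1,2,3,4) nAB(3,4) AB(6) pqK(1) pf C(2) q_def] arc_split[OF AB(2,1) BA(1,2) nAB(1,2) AB(5) pqK(1) pf C(2) q_def] vAB vK(3,4) by blast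
 have ex: "vertex_pt x \<in> A \<longleftrightarrow> vertex_pt y \<notin> A"
  using arc_split[OF AB(1,2) BA(3) AB(4) nAB(4,3) AB(6) pqK(2) qe C(1) p_def] arc_split[OF AB(2,1) BA(4,2) nAB(2,1) AB(5) pqK(2) qe C(1) p_def] vAB vK(1,2) by blast
 let ?I = "open_edge_interval x y 0 1 Un open_edge_interval u v 0 1"
 have I: "openin FG ?I" by (intro openin_Un open_interval EE) auto
 have pqI: "p \<in> ?I" "q \<in> ?I" unfolding p_def q_def open_edge_interval_def by (intro UnI1 UnI2 CollectI exI[of _ "1/2"]; simp)+
 \<comment> \<open>Without the two open edges the sides become closed and disjoint, and no vertex is
   lost.\<close>
 define K1 K2 where "K1 = K - (B Un ?I)" and "K2 = K - (A Un ?I)"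
 have cl: "closedin FG K1" "closedin FG K2" unfolding K1_def K2_def by (intro closedin_diff K_closed openin_Un AB(1,2) I)+
 have K1c: "compactin FG K1" by (rule closedin_compact_space[OF FG_compact cl(1)])
 have dis: "K1 Int K2 = {}" using AB(3) pqI by (auto simp: K1_def K2_def)
 obtain Q where Q: "cutset Q" "!!v. v \<in> V ==> vertex_pt v \<in> K1 ==> v \<in> Q" "!!v. v \<in> Q ==> vertex_pt v \<notin> K2"
  using finite_cut_separation[OF K1c cl(2) dis] by metis
 have vI: "vertex_pt w \<notin> ?I" for w
  using vertex_not_inner[OF ne(1)] vertex_not_inner[OF ne(2)] by (auto simp: open_edge_interval_def)
 have QA: "w \<in> Q \<longleftrightarrow> vertex_pt w \<in> A" if w: "w \<in> V" "vertex_pt w \<in> K - {p, q}" for w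
 proof
  assume "w \<in> Q"
  then have "vertex_pt w \<notin> K2" by (rule Q(3))
  then show "vertex_pt w \<in> A" using w vI[of w] by (auto simp: K2_def)
 next
  assume "vertex_pt w \<in> A"
  then have "vertex_pt w \<in> K1" using w vAB[OF w(2)] vI[of w] by (auto simp: K1_def)
  then show "w \<in> Q" by (rule Q(2)[OF w(1)])
 qed
 have V: "x \<in> V" "y \<in> V" "u \<in> V" "v \<in> V" using edgeD[OF EE(1)] edgeD[OF EE(2)] by auto
 have "e \<in> bd Q" unfolding xy bd_iff[OF EE(1)] using QA[OF V(1) vK(1)] QA[OF V(2) vK(2)] ex by simp
 moreover have "f \<in> bd Q" unfolding uv bd_iff[OF EE(2)] using QA[OF V(3) vK(3)] QA[OF V(4) vK(4)] fx by simp
 moreover have "g \<in> {e, f}" if g: "g \<in> CK" "g \<in> bd Q" for g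
 proof (rule ccontr)
  assume ng: "g \<notin> {e, f}"
  from g(2) obtain a b where ab: "g = {a, b}" "a \<in> Q" "b \<in> V - Q" "{a, b} \<in> E" by (rule bd_cases)
  have nab: "a ~= b" and aV: "a \<in> V" using edgeD[OF ab(4)] by auto
  have "p \<notin> closed_edge g" unfolding p_def by (rule notin[OF CK_E[OF g(1)] EE(1)]) (use ng xy in auto)
  moreover have "q \<notin> closed_edge g" unfolding q_def by (rule notin[OF CK_E[OF g(1)] EE(2)]) (use ng uv in auto)
  ultimately have sub: "closed_edge g \<subseteq> K - {p, q}" using g(1) by (auto simp: CK_def)
  have ve: "vertex_pt a \<in> closed_edge g" "vertex_pt b \<in> closed_edge g"
   unfolding ab(1) on_edge_0[OF nab, symmetric] on_edge_1[OF nab, symmetric] closed_edge_image[OF nab] by auto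
  have aA: "vertex_pt a \<in> A" using QA[OF aV subsetD[OF sub ve(1)]] ab(2) by simp
  have "vertex_pt b \<notin> A" using QA[OF _ subsetD[OF sub ve(2)]] ab(3) by simp
  then have bB: "vertex_pt b \<in> B" using vAB[OF subsetD[OF sub ve(2)]] by simp
  have "B Int closed_edge g = {}"
  proof (rule connectedin_side[OF closed_edge_props(2)[OF CK_E[OF g(1)]] AB(1,2)])
   show "closed_edge g \<subseteq> A Un B" using sub AB(3) by (rule subset_trans)
   show "A Int B Int closed_edge g = {}" using sub AB(4) by auto
   show "A Int closed_edge g ~= {}" using aA ve(1) by auto
  qed
  then show False using bB ve(2) by auto
 qed
 ultimately have "CK Int bd Q = {e, f}" using e f by auto
 then show ?thesis using Q(1) by (intro exI[of _ Q]) simp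
qed

text \<open>Adding two-edge cuts removes crossing edges in pairs, and a single remaining one is
  impossible by \<open>CK_not_single\<close>. A proper non-empty even subset would meet a two-edge
  cut through one edge inside and one outside of it in a single edge.\<close>

lemma CK_minimal: "cut_minimal CK"
proof -
 have CE: "CK \<subseteq> E" using CK_E by auto
 have ev: "even (card (CK Int bd Q))" if "cutset Q" for Q
  using that
 proof (induction "card (CK Int bd Q)" arbitrary: Q rule: less_induct)
  case less
  have fin: "finite (CK Int bd Q)" using less.prems by (simp add: cutset_def)
  show ?case
  proof (rule ccontr)
   assume odd: "odd (card (CK Int bd Q))"
   then have "CK Int bd Q ~= {}" by auto
   then obtain e where e: "e \<in> CK Int bd Q" by (meson ex_in_conv)
   have "CK Int bd Q ~= {e}" using CK_not_single[OF less.prems] by metis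
   then obtain f where f: "f \<in> CK Int bd Q" "f ~= e" using e by blast
   obtain P where P: "cutset P" "CK Int bd P = {e, f}" using CK_two_edge_cut[of e f] e f by auto
   let ?Q = "(Q - P) Un (P - Q)"
   have "CK Int bd ?Q = (CK Int bd Q - CK Int bd P) Un (CK Int bd P - CK Int bd Q)" unfolding bd_sym_diff by auto
   also have "\<dots> = CK Int bd Q - {e, f}" unfolding P(2) using e f(1) by auto
   finally have eq: "CK Int bd ?Q = CK Int bd Q - {e, f}" .
   have sub: "{e, f} \<subseteq> CK Int bd Q" using e f(1) by auto
   have c2: "card {e, f} = 2" using f(2) by auto
   have "card (CK Int bd ?Q) = card (CK Int bd Q) - 2" unfolding eq using card_Diff_subset[OF _ sub] c2 by simp
   moreover have "card (CK Int bd Q) \<ge> 2" using card_mono[OF fin sub] c2 by simp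
   ultimately have "card (CK Int bd ?Q) < card (CK Int bd Q)" "card (CK Int bd Q) = card (CK Int bd ?Q) + 2" by simp_all
   then show False using less.hyps[OF _ cutset_sym_diff[OF less.prems P(1)]] odd by simp
  qed
 qed
 have "B = CK" if B: "cut_even B" "B ~= {}" "B \<subseteq> CK" for B
 proof (rule ccontr)
  assume "B ~= CK"
  then obtain f where f: "f \<in> CK" "f \<notin> B" using B(3) by blast
  obtain e where e: "e \<in> B" using B(2) by (meson ex_in_conv)
  obtain Q where Q: "cutset Q" "CK Int bd Q = {e, f}" using CK_two_edge_cut[of e f] e f B(3) by auto
  have "B Int bd Q = B Int (CK Int bd Q)" using B(3) by auto
  also have "\<dots> = {e}" unfolding Q(2) using e f by auto
  finally have "card (B Int bd Q) = 1" by simp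
  then show False using B(1) Q(1) unfolding cut_even_def by (metis odd_one)
 qed
 then show ?thesis using CE ev CK_nonempty by (simp add: cut_minimal_def cut_even_def)
qed

end

section \<open>Minimal elements of the topological cycle space and the three statements\<close>

context lfgraph
begin

lemma circuit_cut_minimal: assumes "C \<in> topological_circuits V E" shows "cut_minimal C"
proof -
 obtain K where K: "C = {e\<in>E. closed_edge e \<subseteq> K}" "is_circle V E K" using assms unfolding topological_circuits_def by (elim CollectE exE conjE)
 interpret circle_graph V E K by unfold_locales (rule K(2))
 show ?thesis using CK_minimal unfolding K(1) CK_def .
qed

text \<open>Parity passes from circuits to thin sums, because a finite cut meets only finitely many
  members of a thin family.\<close>

lemma top_cycle_space_cut_even: assumes "B \<in> top_cycle_space V E" shows "cut_even B"
proof -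
 obtain I :: "('v set \<times> nat) set" and A where IA: "B = thin_sum E I A" "\<forall>i\<in>I. A i \<in> topological_circuits V E" "thin_family E I A"
  using assms unfolding top_cycle_space_def by (elim CollectE exE conjE)
 have "even (card (B Int bd Q))" if Q: "cutset Q" for Q
  unfolding IA(1)
 proof (rule thin_sum_even[OF IA(3) _ bd_subset])
  show "finite (bd Q)" using Q by (simp add: cutset_def)
  show "even (card (A i Int bd Q))" if "i \<in> I" for i
   using circuit_cut_minimal[of "A i"] IA(2) that Q by (simp add: cut_minimal_def cut_even_def)
 qed
 moreover have "B \<subseteq> E" unfolding IA(1) by (auto simp: thin_sum_def)
 ultimately show ?thesis by (simp add: cut_even_def)
qed

lemma circuit_in_top_cycle_space: assumes C: "C \<in> topological_circuits V E" shows "C \<in> top_cycle_space V E"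
proof -
 define I :: "('v set \<times> nat) set" where "I = {({}, 0)}"
 have "C \<subseteq> E" using circuit_cut_minimal[OF C] by (simp add: cut_minimal_def cut_even_def)
 moreover have "{i\<in>I. e \<in> C} = (if e \<in> C then I else {})" for e by auto
 ultimately have "C = thin_sum E I (%_. C)" by (auto simp: thin_sum_def I_def)
 moreover have "thin_family E I (%_. C)" by (simp add: thin_family_def I_def)
 ultimately show ?thesis unfolding top_cycle_space_def using C by (intro CollectI exI[of _ I] exI[of _ "%_. C"]) simp
qed

text \<open>An element of the space meets finite cuts evenly and so contains a minimal set of this
  kind, which is a circuit. Conversely, a circuit is minimal even among all sets that meet finite
  cuts evenly.\<close>

lemma minimal_top: "minimal_nonzero (top_cycle_space V E) = topological_circuits V E"
proof (intro equalityI subsetI)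
 fix A assume "A \<in> minimal_nonzero (top_cycle_space V E)"
 then have A: "A \<in> top_cycle_space V E" "A ~= {}" "\<forall>B\<in>top_cycle_space V E. B ~= {} & B \<subseteq> A --> B = A"
  by (simp_all add: minimal_nonzero_def)
 obtain e where "e \<in> A" using A(2) by (meson ex_in_conv)
 then obtain C where C: "cut_minimal C" "e \<in> C" "C \<subseteq> A" using exists_cut_minimal[OF top_cycle_space_cut_even[OF A(1)]] by metis
 have "C \<in> topological_circuits V E" by (rule cut_minimal_circuit[OF C(1)])
 moreover have "C = A" using bspec[OF A(3) circuit_in_top_cycle_space[OF calculation]] C(2,3) by auto
 ultimately show "A \<in> topological_circuits V E" by simp
next
 fix C assume C: "C \<in> topological_circuits V E"
 then have "cut_minimal C" by (rule circuit_cut_minimal)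
 then show "C \<in> minimal_nonzero (top_cycle_space V E)"
  using circuit_in_top_cycle_space[OF C] top_cycle_space_cut_even by (simp add: minimal_nonzero_def cut_minimal_def)
qed

text \<open>The double count of \<open>thin_sum_even\<close>, now over the finite set
  \<open>F\<close> instead of a finite cut.\<close>

lemma finite_orthogonal_top:
 assumes F: "finite F" "F \<subseteq> E" and orth: "!!C. C \<in> topological_circuits V E ==> edge_orthogonal F C"
 shows "F \<in> edge_perp E (top_cycle_space V E)"
proof -
 have "edge_orthogonal F B" if B: "B \<in> top_cycle_space V E" for B
 proof -
  obtain I :: "('v set \<times> nat) set" and A where IA: "B = thin_sum E I A" "\<forall>i\<in>I. A i \<in> topological_circuits V E" "thin_family E I A"
   using B unfolding top_cycle_space_def by (elim CollectE exE conjE)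
  have "even (card (B Int F))" unfolding IA(1)
  proof (rule thin_sum_even[OF IA(3) F])
   show "even (card (A i Int F))" if "i \<in> I" for i
    using orth[of "A i"] IA(2) that by (simp add: edge_orthogonal_def Int_commute)
  qed
  then show ?thesis using F(1) by (simp add: edge_orthogonal_def Int_commute)
 qed
 then show ?thesis using F(2) by (simp add: edge_perp_def)
qed

lemma orthogonal_top:
 assumes F: "F \<subseteq> E" and deg: "\<forall>om\<in>ends V E. end_vertex_degree om \<ge> 3"
  and orth: "!!C. C \<in> topological_circuits V E ==> edge_orthogonal F C"
 shows "F \<in> edge_perp E (top_cycle_space V E)"
proof (rule finite_orthogonal_top[OF _ F orth])
 show "finite F"
 proof (rule ccontr)
  assume inf: "infinite F"
  obtain d where d: "inj d" "double_ray_edges d \<subseteq> E" "infinite (F Int double_ray_edges d)" "((%n. d (int n)), (%n. d (- int n))) \<in> ray_equiv V E"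
   using infinite_set_double_ray[OF F inf] deg by metis
  have "double_ray_edges d \<in> topological_circuits V E" by (rule cut_minimal_circuit[OF double_ray_cut_minimal[OF d(1,2,4)]])
  then show False using orth d(3) by (simp add: edge_orthogonal_def)
 qed
qed

lemma orthogonal_alg:
 assumes F: "F \<subseteq> E" and deg: "\<forall>om\<in>ends V E. end_vertex_degree om \<ge> 3"
  and orth: "!!C. C \<in> finite_circuits E Un double_ray_edge_sets E ==> edge_orthogonal F C"
 shows "F \<in> edge_perp E (alg_cycle_space V E)"
proof -
 have "finite F"
 proof (rule ccontr)
  assume inf: "infinite F"
  obtain d where d: "inj d" "double_ray_edges d \<subseteq> E" "infinite (F Int double_ray_edges d)"
   using infinite_set_double_ray[OF F inf] deg by metis
  have "double_ray_edges d \<in> double_ray_edge_sets E" unfolding double_ray_edge_sets_def using d(1,2) by (intro CollectI exI[of _ d]) simp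
  then show False using orth[of "double_ray_edges d"] d(3) by (simp add: edge_orthogonal_def)
 qed
 then show ?thesis using finite_orthogonal_alg[OF _ orth] F by (simp add: edge_perp_def)
qed

lemma orthogonal_cuts:
 assumes D: "D \<subseteq> E" and pad: "k_padded_at_infinity V E 3" and orth: "!!B. B \<in> bonds V E ==> edge_orthogonal D B"
 shows "D \<in> edge_perp E (cut_space V E)"
proof -
 have un: "unseparable 3 om R" if "om \<in> ends V E" "R \<in> om" for om R
  using padded_unseparable[of 3 om R] pad that by (simp add: k_padded_at_infinity_def)
 show ?thesis using finite_even_orthogonal_cuts[OF orthogonal_bonds_finite[OF D un orth]] by blast
qed

end

theorem theorem1p4:
  fixes V :: "'v set" and E F D :: "'v set set"
  assumes "simple_graph V E" and "locally_finite_graph V E" and "k_connected 2 V E"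
    and "F \<subseteq> E" and "D \<subseteq> E"
  shows
    "(minimal_nonzero (top_cycle_space V E) = topological_circuits V E \<and>
      ((\<forall>\<omega>\<in>ends V E. end_vertex_degree \<omega> \<ge> 3) \<and>
       (\<forall>C\<in>minimal_nonzero (top_cycle_space V E). edge_orthogonal F C)
       \<longrightarrow> F \<in> edge_perp E (top_cycle_space V E)))
     \<and>
     (minimal_nonzero (alg_cycle_space V E) = finite_circuits E \<union> double_ray_edge_sets E \<and>
      ((\<forall>\<omega>\<in>ends V E. end_vertex_degree \<omega> \<ge> 3) \<and>
       (\<forall>C\<in>minimal_nonzero (alg_cycle_space V E). edge_orthogonal F C)
       \<longrightarrow> F \<in> edge_perp E (alg_cycle_space V E)))
     \<and>
     (minimal_nonzero (cut_space V E) = bonds V E \<and>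
      (k_padded_at_infinity V E 3 \<and>
       (\<forall>B\<in>minimal_nonzero (cut_space V E). edge_orthogonal D B)
       \<longrightarrow> D \<in> edge_perp E (cut_space V E)))"
proof -
  interpret lfgraph V E by unfold_locales (rule assms)+
  show ?thesis
    unfolding minimal_top minimal_alg minimal_cut
    using orthogonal_top[OF assms(4)] orthogonal_alg[OF assms(4)] orthogonal_cuts[OF assms(5)] by (intro conjI refl impI) auto
qed

end
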